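(* Let $V=\{\nu_1,\ldots,\nu_N\}$ be a finite set of divisorial valuations of $\mathbb{P}^2$ and set $Z:=X_V$. If $C$ is an integral curve of $\mathbb{P}^2$ that is not the tangent line of $\nu_i$ (whenever it exists) for all $i=1,\ldots,N$, then $$\frac{\tilde{C}^2}{\deg(C)^2}\geq -\sum_{i=1}^N\delta_0(\nu_i)-2N+1,$$ where $\tilde{C}$ denotes the strict transform of $C$ on $Z$.
   Context: Let $\Bbbk$ be an algebraically closed field of arbitrary characteristic and $\mathbb{P}^2$ the projective plane over $\Bbbk$. A divisorial valuation $\nu$ of $\mathbb{P}^2$ centered at a closed point $p$ is the valuation of the function field of $\mathbb{P}^2$ given by the order of vanishing along the last exceptional divisor $E_n$ ($n\ge 1$) of a finite simple sequence of point blowups $X_\nu=X_n\xrightarrow{\pi_n}X_{n-1}\to\cdots\to X_1\xrightarrow{\pi_1}X_0=\mathbb{P}^2$, where $\pi_i$ is the blowup at a closed point $p_i\in X_{i-1}$ with exceptional divisor $E_i$, $p_1=p$, and $p_{i+1}\in E_i$ for $1\le i\le n-1$. The set $\mathcal{C}_\nu=\{p_1,\ldots,p_n\}$ is the configuration of centers of $\nu$. Let $\mathfrak{m}$ be the maximal ideal of $\mathcal{O}_{\mathbb{P}^2,p}$; $\nu$ is the $\mathfrak{m}$-adic valuation exactly when $n=1$. Set $\overline{\beta}_0(\nu):=\nu(\mathfrak{m})=\min\{\nu(x)\mid x\in\mathfrak{m}\setminus\{0\}\}$. The volume is $\mathrm{vol}(\nu):=\limsup_{m\to\infty}\frac{2\,\mathrm{length}(\mathcal{O}_{\mathbb{P}^2,p}/\mathcal{P}_m)}{m^2}$,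 where $\mathcal{P}_m=\{h\in\mathcal{O}_{\mathbb{P}^2,p}\mid \nu(h)\ge m\}\cup\{0\}$ (it is known that $\mathrm{vol}(\nu)^{-1}=\sum_{i=1}^n v_i^2$, $v_i$ being the value under $\nu$ of the maximal ideal of $\mathcal{O}_{X_{i-1},p_i}$). For a curve $S$ of $\mathbb{P}^2$, $\varphi_S\in\mathcal{O}_{\mathbb{P}^2,p}$ denotes a local equation of $S$ at $p$. If $\nu$ is not the $\mathfrak{m}$-adic valuation, there is a unique line $H$ of $\mathbb{P}^2$, called the tangent line of $\nu$, with $\nu(\varphi_H)>\overline{\beta}_0(\nu)$; put $t(\nu):=\nu(\varphi_H)$. If $\nu$ is $\mathfrak{m}$-adic, there is no tangent line and $t(\nu):=1$. Put $\delta_0(\nu):=-1$ if $\nu$ is the $\mathfrak{m}$-adic valuation and, otherwise, $\delta_0(\nu):=\left\lceil\frac{\mathrm{vol}(\nu)^{-1}-2\overline{\beta}_0(\nu)t(\nu)}{t(\nu)^2}\right\rceil^+$, where $\lceil x\rceil^+$ is the ceiling of the rational number $x$ if $x\ge 0$, and $0$ otherwise. For a finite set $V=\{\nu_1,\ldots,\nu_N\}$ of divisorial valuations of $\mathbb{P}^2$ (possibly with different centers in $\mathbb{P}^2$), set $\mathcal{C}_V:=\bigcup_{i=1}^N\mathcal{C}_{\nu_i}$, where points of different configurations are identified when they are the same infinitely near point of $\mathbb{P}^2$ (equivalently, when their exceptional divisors define the same valuation). $X_V$ is the surface obtained from $\mathbb{P}^2$ by the composition of the blowups centered at the points of $\mathcal{C}_V$.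 *)

theory Defs
  imports
    "HOL-Computational_Algebra.Computational_Algebra"
    "HOL-Library.Extended_Real"
    "HOL-Algebra.Ideal_Product"
begin

text \<open>
  Surfaces birational to the projective plane are treated as models in the sense of Zariski: a
  point (closed or not) of such a surface is identified with its local ring, a subring of the
  function field of the plane. An infinitely near point is then literally the same object whatever
  sequence of blowups produced it, and a prime divisor is given by the discrete valuation ring at
  its generic point.
\<close>

section \<open>Subrings of a field\<close>

abbreviation ring_on :: "'f::field set \<Rightarrow> 'f ring" where
  "ring_on A \<equiv> \<lparr>carrier = A, mult = (*), one = 1, zero = 0, add = (+)\<rparr>"

text \<open>The set of non-units; it is the maximal ideal when \<open>R\<close> is a local ring.\<close>

definition max_ideal :: "'f::field set \<Rightarrow> 'f set" where
  "max_ideal R = R - Units (ring_on R)"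

definition localize :: "'f::field set \<Rightarrow> 'f set \<Rightarrow> 'f set" where
  "localize A P = {a / b | a b. a \<in> A \<and> b \<in> A - P}"

primrec ideal_pow :: "'f::field set \<Rightarrow> 'f set \<Rightarrow> nat \<Rightarrow> 'f set" where
  "ideal_pow R I 0 = R"
| "ideal_pow R I (Suc n) = ideal_prod (ring_on R) I (ideal_pow R I n)"

text \<open>
  The length of the \<open>R\<close>-module \<open>R/I\<close>; its submodules correspond to the ideals containing \<open>I\<close>.
\<close>

definition colength :: "'f::field set \<Rightarrow> 'f set \<Rightarrow> enat" where
  "colength R I = (SUP n \<in> {n. \<exists>J. (\<forall>i\<le>n. ideal (J i) (ring_on R) \<and> I \<subseteq> J i) \<and>
                                   (\<forall>i<n. J i \<subset> J (Suc i))}. enat n)"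

text \<open>
  The normalized valuation of a discrete valuation ring \<open>D\<close>. It is meaningful at nonzero elements
  of the fraction field of \<open>D\<close> only; all other arguments get the same unspecified value.
\<close>

definition dvr_ord :: "'f::field set \<Rightarrow> 'f \<Rightarrow> int" where
  "dvr_ord D f = (THE n. \<exists>t u. t \<in> D \<and> PIdl\<^bsub>ring_on D\<^esub> t = max_ideal D \<and>
                               u \<in> Units (ring_on D) \<and> f = u * t powi n)"


section \<open>The projective plane\<close>

text \<open>
  Polynomials in three variables are iterated univariate polynomials. The function field of the
  plane is the degree zero part of the fraction field of the homogeneous coordinate ring, so it
  and all local rings below are subsets of the latter field.
\<close>

type_synonym 'k hpoly = "'k poly poly poly"
type_synonym 'k hfrac = "'k poly poly poly fract"

definition homogeneous :: "nat \<Rightarrow> 'k::field hpoly \<Rightarrow> bool" where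
  "homogeneous d F \<longleftrightarrow>
     (\<forall>i j l. Polynomial.coeff (Polynomial.coeff (Polynomial.coeff F i) j) l \<noteq> 0 \<longrightarrow> i + j + l = d)"

definition heval :: "'k::field hpoly \<Rightarrow> 'k \<times> 'k \<times> 'k \<Rightarrow> 'k" where
  "heval F = (\<lambda>(a, b, c). poly (poly (poly F [:[:a:]:]) [:b:]) c)"

text \<open>The local ring at the point with homogeneous coordinates \<open>p \<noteq> (0, 0, 0)\<close>.\<close>

definition local_ring_P2 :: "'k::field \<times> 'k \<times> 'k \<Rightarrow> 'k hfrac set" where
  "local_ring_P2 p = {Fract F G | F G d. homogeneous d F \<and> homogeneous d G \<and> heval G p \<noteq> 0}"

definition closed_points_P2 :: "'k::field hfrac set set" where
  "closed_points_P2 = local_ring_P2 ` (UNIV - {(0, 0, 0)})"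

definition integral_plane_curve :: "nat \<Rightarrow> 'k::field hpoly \<Rightarrow> bool" where
  "integral_plane_curve d F \<longleftrightarrow> homogeneous d F \<and> irreducible F"

text \<open>
  The local ring of the plane at the generic point of the integral curve \<open>F = 0\<close>. Since blowups at
  closed points do not change it, it is also the local ring of any blown up surface at the generic
  point of the strict transform of that curve.
\<close>

definition generic_ring :: "'k::field hpoly \<Rightarrow> 'k hfrac set" where
  "generic_ring F = {Fract A B | A B d. homogeneous d A \<and> homogeneous d B \<and> \<not> F dvd B}"


section \<open>Blowups\<close>

text \<open>
  The blowup at a point with local ring \<open>(R, m)\<close> is, over that point, \<open>Proj\<close> of the Rees algebra of
  \<open>m\<close>. It is covered by the spectra of the rings \<open>R[m/x]\<close> for nonzero \<open>x \<in> m\<close>. The closed points on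
  the exceptional divisor are the maximal ideals containing \<open>x\<close> (equivalently, \<open>m R[m/x] = x R[m/x]\<close>).
\<close>

definition blowup_chart :: "'f::field set \<Rightarrow> 'f \<Rightarrow> 'f set" where
  "blowup_chart R x = {a / x ^ n | a n. a \<in> ideal_pow R (max_ideal R) n}"

definition exceptional_points :: "'f::field set \<Rightarrow> 'f set set" where
  "exceptional_points R =
     {localize (blowup_chart R x) P | x P.
        x \<in> max_ideal R - {0} \<and> maximalideal P (ring_on (blowup_chart R x)) \<and> x \<in> P}"

text \<open>
  The local ring of the blowup at the generic point of the exceptional divisor: the homogeneous
  localization of the Rees algebra at the prime ideal \<open>m \<oplus> m\<^sup>2 \<oplus> m\<^sup>3 \<oplus> \<dots>\<close> (the ideal of the
  exceptional divisor, whose degree \<open>n\<close> part is the \<open>(n + 1)\<close>-st power of \<open>m\<close>).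
\<close>

definition exceptional_ring :: "'f::field set \<Rightarrow> 'f set" where
  "exceptional_ring R =
     {a / b | a b n. a \<in> ideal_pow R (max_ideal R) n \<and>
                     b \<in> ideal_pow R (max_ideal R) n - ideal_pow R (max_ideal R) (Suc n)}"

text \<open>The local rings of the centers of a finite simple sequence of point blowups of the plane.\<close>

definition simple_blowup_sequence :: "'k::field hfrac set list \<Rightarrow> bool" where
  "simple_blowup_sequence Rs \<longleftrightarrow>
     Rs \<noteq> [] \<and> hd Rs \<in> closed_points_P2 \<and>
     (\<forall>i. Suc i < length Rs \<longrightarrow> Rs ! Suc i \<in> exceptional_points (Rs ! i))"

text \<open>
  The closed points of the surface obtained by blowing up the points of \<open>C\<close>: those points, proper
  or infinitely near, that are not blown up themselves and whose predecessors all are.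
\<close>

definition blown_up_surface :: "'k::field hfrac set set \<Rightarrow> 'k hfrac set set" where
  "blown_up_surface C =
     {last Rs | Rs. simple_blowup_sequence Rs \<and> set (butlast Rs) \<subseteq> C \<and> last Rs \<notin> C}"


section \<open>Curves on a surface\<close>

text \<open>
  In the following \<open>D\<close> is the local ring at the generic point of an integral curve, and \<open>R\<close> the
  local ring of a closed point of the surface. The curve passes through the point iff \<open>R \<subseteq> D\<close>.
\<close>

definition curve_ideal :: "'f::field set \<Rightarrow> 'f set \<Rightarrow> 'f set" where
  "curve_ideal D R = (if R \<subseteq> D then R \<inter> max_ideal D else R)"

definition local_equation :: "'f::field set \<Rightarrow> 'f set \<Rightarrow> 'f" where
  "local_equation D R = (SOME f. f \<in> R \<and> PIdl\<^bsub>ring_on R\<^esub> f = curve_ideal D R)"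

text \<open>
  The local intersection number at \<open>R\<close> of the curve with local equation \<open>f\<close> and the Cartier divisor
  with local equation \<open>\<psi> = a/b\<close>, which must not contain the curve: the length of \<open>R/(f,a)\<close> minus the
  length of \<open>R/(f,b)\<close>.
\<close>

definition local_intersection :: "'f::field set \<Rightarrow> 'f \<Rightarrow> 'f \<Rightarrow> int" where
  "local_intersection R f \<psi> =
     (THE n. \<exists>a b. a \<in> R - PIdl\<^bsub>ring_on R\<^esub> f \<and> b \<in> R - PIdl\<^bsub>ring_on R\<^esub> f \<and> \<psi> = a / b \<and>
             n = int (the_enat (colength R (Idl\<^bsub>ring_on R\<^esub> {f, a})))
               - int (the_enat (colength R (Idl\<^bsub>ring_on R\<^esub> {f, b}))))"

text \<open>
  The self-intersection of an integral curve \<open>C\<close> on the complete surface \<open>X\<close>, that is, the degree on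
  \<open>C\<close> of the invertible sheaf associated with \<open>C\<close>. It is the intersection number of \<open>C\<close> with the
  linearly equivalent divisor \<open>C - div \<phi>\<close>, where \<open>\<phi>\<close> is any rational function vanishing to order
  one along \<open>C\<close>, so that \<open>C\<close> is not a component of \<open>C - div \<phi>\<close>; the number does not depend on
  \<open>\<phi>\<close>. Only finitely many points contribute.
\<close>

definition self_intersection :: "'f::field set set \<Rightarrow> 'f set \<Rightarrow> int" where
  "self_intersection X D =
     (let \<phi> = (SOME \<phi>. \<phi> \<in> D \<and> PIdl\<^bsub>ring_on D\<^esub> \<phi> = max_ideal D);
          i = (\<lambda>R. local_intersection R (local_equation D R) (local_equation D R / \<phi>))
      in (\<Sum>R \<in> {R \<in> X. R \<subseteq> D \<and> i R \<noteq> 0}. i R))"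


section \<open>Divisorial valuations\<close>

definition divisorial_valuation :: "('k::field hfrac \<Rightarrow> int) \<Rightarrow> bool" where
  "divisorial_valuation \<nu> \<longleftrightarrow>
     (\<exists>Rs. simple_blowup_sequence Rs \<and> \<nu> = dvr_ord (exceptional_ring (last Rs)))"

text \<open>The sequence is uniquely determined by the valuation.\<close>

definition blowup_sequence :: "('k::field hfrac \<Rightarrow> int) \<Rightarrow> 'k hfrac set list" where
  "blowup_sequence \<nu> =
     (SOME Rs. simple_blowup_sequence Rs \<and> \<nu> = dvr_ord (exceptional_ring (last Rs)))"

definition centers :: "('k::field hfrac \<Rightarrow> int) \<Rightarrow> 'k hfrac set set" where
  "centers \<nu> = set (blowup_sequence \<nu>)"

definition center_ring :: "('k::field hfrac \<Rightarrow> int) \<Rightarrow> 'k hfrac set" where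
  "center_ring \<nu> = hd (blowup_sequence \<nu>)"

definition m_adic :: "('k::field hfrac \<Rightarrow> int) \<Rightarrow> bool" where
  "m_adic \<nu> \<longleftrightarrow> length (blowup_sequence \<nu>) = 1"

definition \<beta>0 :: "('k::field hfrac \<Rightarrow> int) \<Rightarrow> int" where
  "\<beta>0 \<nu> = (LEAST v. v \<in> \<nu> ` (max_ideal (center_ring \<nu>) - {0}))"

definition valuation_ideal :: "('k::field hfrac \<Rightarrow> int) \<Rightarrow> nat \<Rightarrow> 'k hfrac set" where
  "valuation_ideal \<nu> m = {h \<in> center_ring \<nu>. h = 0 \<or> \<nu> h \<ge> int m}"

definition vol :: "('k::field hfrac \<Rightarrow> int) \<Rightarrow> real" where
  "vol \<nu> = real_of_ereal (limsup (\<lambda>m.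
     2 * ereal_of_enat (colength (center_ring \<nu>) (valuation_ideal \<nu> m)) / ereal (real m ^ 2)))"

definition curve_value :: "('k::field hfrac \<Rightarrow> int) \<Rightarrow> 'k hpoly \<Rightarrow> int" where
  "curve_value \<nu> F = \<nu> (local_equation (generic_ring F) (center_ring \<nu>))"

text \<open>\<open>H = 0\<close> is the tangent line of \<open>\<nu>\<close>; the form \<open>H\<close> is unique up to a scalar.\<close>

definition tangent_line :: "('k::field hfrac \<Rightarrow> int) \<Rightarrow> 'k hpoly \<Rightarrow> bool" where
  "tangent_line \<nu> H \<longleftrightarrow> \<not> m_adic \<nu> \<and> homogeneous 1 H \<and> H \<noteq> 0 \<and> curve_value \<nu> H > \<beta>0 \<nu>"

definition tangent_value :: "('k::field hfrac \<Rightarrow> int) \<Rightarrow> int" where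
  "tangent_value \<nu> = (if m_adic \<nu> then 1 else curve_value \<nu> (SOME H. tangent_line \<nu> H))"

definition ceiling_plus :: "real \<Rightarrow> int" where
  "ceiling_plus x = (if x \<ge> 0 then \<lceil>x\<rceil> else 0)"

definition \<delta>0 :: "('k::field hfrac \<Rightarrow> int) \<Rightarrow> int" where
  "\<delta>0 \<nu> =
     (if m_adic \<nu> then - 1
      else ceiling_plus ((inverse (vol \<nu>) - 2 * real_of_int (\<beta>0 \<nu>) * real_of_int (tangent_value \<nu>))
                         / (real_of_int (tangent_value \<nu>))\<^sup>2))"

definition surface_of :: "('k::field hfrac \<Rightarrow> int) set \<Rightarrow> 'k hfrac set set" where
  "surface_of V = blown_up_surface (\<Union>\<nu>\<in>V. centers \<nu>)"

end

theory Submission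
 imports Defs "Berlekamp_Zassenhaus.Unique_Factorization_Poly" "HOL-Library.Liminf_Limsup"
  "HOL-Real_Asymp.Real_Asymp"
begin

text \<open>
 Points are local rings inside the function field. By Bezout's theorem and the change of intersection numbers
 under a point blowup, the self-intersection is \<open>d^2\<close> minus the sum of the squared multiplicities of \<open>C\<close> at the
 centers, so it suffices to bound the part \<open>\<Sum> m_i^2\<close> of one \<open>\<nu>\<close> by \<open>(2 + \<delta>0) d^2\<close>. Imposing multiplicity \<open>c v_i\<close>
 at the \<open>i\<close>-th center shows that \<open>\<Sum> v_i^2\<close> is at most the inverse volume, hence at most \<open>2 \<beta>0 t + \<delta>0 t^2\<close>.
 An inequality \<open>\<Sum> v_i^2 \<le> a \<nu>(X)^2 + b \<nu>(X) \<nu>(Y) + e \<nu>(Y)^2\<close> for local parameters \<open>X, Y\<close>, with natural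
 numbers \<open>a, b, e\<close>, turns into one of the same kind for \<open>Y, X / Y\<close> after a blowup. By induction it also holds
 with \<open>m_i\<close> for \<open>v_i\<close> and the intersection numbers of \<open>C\<close> with \<open>X, Y\<close> for their values; that of the
 tangent line is at most \<open>d\<close>.
\<close>

text \<open>Values and intersection numbers behave differently under a blowup: values satisfy v(X) =
  v(E) + v(X'), while for a curve one has at a single point only (C.X) >= m + (C'.X') and (C'.E) <=
  m, because the strict transform may meet E elsewhere too. Both inequalities point the right way
  since a quadratic form with natural coefficients is monotone. The coefficients stay natural
  because the form dominates v(E)^2 >= 1 and so cannot vanish identically. The starting form comes
  from the definition of \<delta>0; its mixed term v_1 t is not matched by a second curve but by the
  multiplicity of C at the first center, which is at most the intersection number with the tangent
  line. Modules over different local rings are made comparable by measuring every length as a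
  dimension over the constants of a quotient of two subspaces of one field. This requires residue
  fields equal to the constants, one of the places where algebraic closedness enters.\<close>

abbreviation mx :: "'f::field set => 'f set" where "mx \<equiv> max_ideal"
abbreviation exc :: "'f::field set => 'f set set" where "exc \<equiv> exceptional_points"
abbreviation PP2 :: "'k::field hfrac set set" where "PP2 \<equiv> closed_points_P2"
abbreviation loc_P2 ("\<O>") where "\<O> \<equiv> local_ring_P2"
abbreviation form :: "nat => 'k::field hpoly => bool" where "form \<equiv> homogeneous"
abbreviation sbs :: "'k::field hfrac set list => bool" where "sbs \<equiv> simple_blowup_sequence"
abbreviation chart :: "'f::field set => 'f => 'f set" where "chart \<equiv> blowup_chart"
abbreviation ering :: "'f::field set => 'f set" where "ering \<equiv> exceptional_ring"
abbreviation pcoeff :: "'a::zero poly => nat => 'a" where "pcoeff \<equiv> Polynomial.coeff"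

section \<open>Length of modules inside a field\<close>

definition ring_set :: "'f::field set => bool" where
 "ring_set R \<longleftrightarrow> 0 \<in> R \<and> 1 \<in> R \<and> (\<forall>a\<in>R. - a \<in> R) \<and> (\<forall>a\<in>R. \<forall>b\<in>R. a + b \<in> R \<and> a * b \<in> R)"

text \<open>\<open>A\<close> need not lie in \<open>S\<close>, so ideals, overrings and fractional
  modules are compared inside one field. Negatives do not appear in the definition: over a ring of
  scalars they arise by multiplying with -1.\<close>

definition submod :: "'f::field set => 'f set => bool" where
 "submod S A \<longleftrightarrow> 0 \<in> A \<and> (\<forall>a\<in>A. \<forall>b\<in>A. a + b \<in> A) \<and> (\<forall>s\<in>S. \<forall>a\<in>A. s * a \<in> A)"

definition set_add :: "'f::field set => 'f set => 'f set" (infixl "+++" 65) where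
 "A +++ B = {a + b | a b. a \<in> A \<and> b \<in> B}"

definition smul :: "'f::field => 'f set => 'f set" (infixr "*o" 70) where
 "a *o B = (\<lambda>b. a * b) ` B"

lemma ring_setD:
 assumes "ring_set R"
 shows "0 \<in> R" "1 \<in> R" "a \<in> R ==> - a \<in> R" "a \<in> R ==> b \<in> R ==> a + b \<in> R"
  "a \<in> R ==> b \<in> R ==> a * b \<in> R" "a \<in> R ==> b \<in> R ==> a - b \<in> R"
  "a \<in> R ==> a ^ n \<in> R"
proof -
 show m: "a \<in> R ==> b \<in> R ==> a * b \<in> R" for a b using assms unfolding ring_set_def by blast
 show "1 \<in> R" using assms unfolding ring_set_def by blast
 thus "a \<in> R ==> a ^ n \<in> R" using m by (induction n) auto
 show "a \<in> R ==> b \<in> R ==> a - b \<in> R"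
  using assms unfolding ring_set_def by (metis diff_conv_add_uminus)
qed (use assms in \<open>auto simp: ring_set_def\<close>)

lemma ring_set_sum: "ring_set R ==> (\<And>i. i \<in> I ==> g i \<in> R) ==> sum g I \<in> R"
 by (induction I rule: infinite_finite_induct) (auto simp: ring_setD)

lemma submodD:
 assumes "submod S A"
 shows "0 \<in> A" "a \<in> A ==> b \<in> A ==> a + b \<in> A" "s \<in> S ==> a \<in> A ==> s * a \<in> A"
  "s \<in> S ==> a \<in> A ==> a * s \<in> A"
 using assms unfolding submod_def by (auto simp: mult.commute)

lemma submod_uminus: "submod S A ==> ring_set S ==> a \<in> A ==> - a \<in> A"
 using submodD(3)[of S A "-1" a] by (simp add: ring_setD)

lemma submod_diff: "submod S A ==> ring_set S ==> a \<in> A ==> b \<in> A ==> a - b \<in> A"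
 using submodD(2)[of S A a "-b"] submod_uminus by force

lemma submod_sum: "submod S A ==> (\<And>i. i \<in> I ==> g i \<in> A) ==> sum g I \<in> A"
 by (induction I rule: infinite_finite_induct) (auto simp: submodD)

lemma submod_self: "ring_set R ==> submod R R"
 by (auto simp: submod_def ring_setD)

lemma submod_mono: "submod S A ==> S' \<subseteq> S ==> submod S' A"
 by (auto simp: submod_def)

lemma submod_subring: "ring_set R ==> S \<subseteq> R ==> submod S R"
 using submod_mono submod_self by blast

lemma submod_Int: "submod S A ==> submod S B ==> submod S (A \<inter> B)"
 by (auto simp: submod_def)

lemma set_addI: "a \<in> A ==> b \<in> B ==> a + b \<in> A +++ B" by (auto simp: set_add_def)
lemma set_addE: "c \<in> A +++ B ==> (\<And>a b. a \<in> A ==> b \<in> B ==> c = a + b ==> P) ==> P"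
 by (auto simp: set_add_def)

lemma smulI: "b \<in> B ==> a * b \<in> a *o B" by (auto simp: smul_def)
lemma smulI': "b \<in> B ==> b * a \<in> a *o B" by (auto simp: smul_def)
lemma smulE: "c \<in> a *o B ==> (\<And>b. b \<in> B ==> c = a * b ==> P) ==> P"
 by (auto simp: smul_def)

lemma smul_smul: "a *o b *o A = (a * b) *o A"
 by (auto simp: smul_def image_image mult.assoc)

lemma smul_mono: "A \<subseteq> B ==> c *o A \<subseteq> c *o B" by (auto simp: smul_def)
lemma set_add_mono: "A \<subseteq> A' ==> B \<subseteq> B' ==> A +++ B \<subseteq> A' +++ B'" unfolding set_add_def by blast

lemma set_add_commute: "A +++ B = B +++ A"
proof -
 have "A +++ B \<subseteq> B +++ A" for A B :: "'a set" by (auto elim!: set_addE) (metis add.commute set_addI)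
 thus ?thesis by blast
qed

lemma submod_add:
 assumes "submod S A" "submod S B" shows "submod S (A +++ B)"
 unfolding submod_def
proof (intro conjI ballI)
 show "0 \<in> A +++ B" using set_addI[of 0 A 0 B] assms submodD(1) by force
next
 fix x y assume "x \<in> A +++ B" "y \<in> A +++ B"
 then obtain a b c d where *: "a \<in> A" "b \<in> B" "c \<in> A" "d \<in> B" "x = a + b" "y = c + d"
  by (blast elim: set_addE)
 have "x + y = (a + c) + (b + d)" using * by simp
 thus "x + y \<in> A +++ B" using * set_addI submodD(2) assms by metis
next
 fix s x assume "s \<in> S" "x \<in> A +++ B"
 thus "s * x \<in> A +++ B" using assms by (auto elim!: set_addE simp: distrib_left intro!: set_addI dest: submodD(3))
qed

lemma submod_smul: "submod S A ==> submod S (c *o A)"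
 unfolding submod_def smul_def by (auto simp: image_iff distrib_left[symmetric] mult.left_commute)

lemma set_add_subset_iff:
 assumes "submod S A" "submod S B" "submod S C"
 shows "A +++ B \<subseteq> C \<longleftrightarrow> A \<subseteq> C \<and> B \<subseteq> C"
proof
 assume *: "A +++ B \<subseteq> C"
 have "a \<in> C" if "a \<in> A" for a using set_addI[OF that, of 0 B] submodD(1)[OF assms(2)] * by auto
 moreover have "a \<in> C" if "a \<in> B" for a using set_addI[OF _ that, of 0 A] submodD(1)[OF assms(1)] * by auto
 ultimately show "A \<subseteq> C \<and> B \<subseteq> C" by blast
qed (auto elim!: set_addE intro!: submodD(2)[OF assms(3)])

lemma set_add_ub1: "submod S B ==> A \<subseteq> A +++ B"
 using set_addI[of _ A 0 B] submodD(1) by fastforce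
lemma set_add_ub2: "submod S A ==> B \<subseteq> A +++ B"
 using set_addI[of 0 A _ B] submodD(1) by fastforce

lemma set_add_absorb: "submod S A ==> submod S B ==> B \<subseteq> A ==> A +++ B = A"
 using set_add_subset_iff[of S A B A] set_add_ub1[of S B A] by auto

lemma modular_law:
 assumes "ring_set S" "submod S A" "submod S B" "submod S C" "A \<subseteq> C"
 shows "C \<inter> (A +++ B) = A +++ (C \<inter> B)"
proof
 show "C \<inter> (A +++ B) \<subseteq> A +++ (C \<inter> B)"
 proof
  fix c assume c: "c \<in> C \<inter> (A +++ B)"
  then obtain a b where ab: "a \<in> A" "b \<in> B" "c = a + b" by (auto elim: set_addE)
  hence "b = c - a" by simp
  hence "b \<in> C" using c ab assms submod_diff by blast
  thus "c \<in> A +++ (C \<inter> B)" using ab by (auto intro: set_addI)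
 qed
 show "A +++ (C \<inter> B) \<subseteq> C \<inter> (A +++ B)"
  using assms submodD(2) by (fastforce elim!: set_addE intro: set_addI)
qed

section \<open>Strict chains of submodules and length\<close>

inductive chain_of :: "'f::field set => 'f set => 'f set => 'f set => nat => bool"
 for S A B where
 chain_base: "submod S X ==> B \<subseteq> X ==> X \<subseteq> A ==> chain_of S A B X 0"
| chain_step: "chain_of S A B X n ==> submod S Y ==> X \<subset> Y ==> Y \<subseteq> A ==> chain_of S A B Y (Suc n)"

text \<open>A chain may begin and end anywhere between \<open>B\<close> and \<open>A\<close>, and
  its index counts strict inclusions. Recording the top member in \<open>chain_of\<close> allows
  induction by adding one larger submodule.\<close>

definition len :: "'f::field set => 'f set => 'f set => enat" where
 "len S A B = (SUP n \<in> {n. \<exists>X. chain_of S A B X n}. enat n)"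

lemma chain_ofD: "chain_of S A B X n ==> submod S X \<and> B \<subseteq> X \<and> X \<subseteq> A"
 by (induction rule: chain_of.induct) auto

lemma chain_of_iff:
 "chain_of S A B X n \<longleftrightarrow> (\<exists>J. (\<forall>i\<le>n. submod S (J i) \<and> B \<subseteq> J i \<and> J i \<subseteq> A) \<and>
   (\<forall>i<n. J i \<subset> J (Suc i)) \<and> J n = X)"
proof
 show "chain_of S A B X n ==> \<exists>J. (\<forall>i\<le>n. submod S (J i) \<and> B \<subseteq> J i \<and> J i \<subseteq> A) \<and>
   (\<forall>i<n. J i \<subset> J (Suc i)) \<and> J n = X"
 proof (induction rule: chain_of.induct)
  case (chain_base X)
  thus ?case by (intro exI[of _ "\<lambda>_. X"]) auto
 next
  case (chain_step X n Y)
  then obtain J where J: "\<forall>i\<le>n. submod S (J i) \<and> B \<subseteq> J i \<and> J i \<subseteq> A"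
   "\<forall>i<n. J i \<subset> J (Suc i)" "J n = X" by blast
  have "B \<subseteq> Y" using chain_step.hyps(1,3) chain_ofD by blast
  thus ?case using J chain_step.hyps by (intro exI[of _ "J(Suc n := Y)"]) (auto simp: le_Suc_eq less_Suc_eq)
 qed
next
 show "\<exists>J. (\<forall>i\<le>n. submod S (J i) \<and> B \<subseteq> J i \<and> J i \<subseteq> A) \<and>
   (\<forall>i<n. J i \<subset> J (Suc i)) \<and> J n = X ==> chain_of S A B X n"
 proof (induction n arbitrary: X)
  case 0
  thus ?case by (auto intro: chain_base)
 next
  case (Suc n)
  then obtain J where J: "\<forall>i\<le>Suc n. submod S (J i) \<and> B \<subseteq> J i \<and> J i \<subseteq> A"
   "\<forall>i<Suc n. J i \<subset> J (Suc i)" "J (Suc n) = X" by blast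
  have "\<forall>i\<le>n. submod S (J i) \<and> B \<subseteq> J i \<and> J i \<subseteq> A" "\<forall>i<n. J i \<subset> J (Suc i)"
   using J(1,2) by (meson le_SucI less_SucI)+
  hence "chain_of S A B (J n) n" by (intro Suc.IH) blast
  hence "chain_of S A B (J (Suc n)) (Suc n)" by (rule chain_step) (use J(1,2) in \<open>simp_all\<close>)
  thus ?case using J(3) by simp
 qed
qed

lemma len_ge: "chain_of S A B X n ==> enat n \<le> len S A B"
 unfolding len_def by (rule SUP_upper) auto

lemma len_le: "(\<And>X n. chain_of S A B X n ==> enat n \<le> N) ==> len S A B \<le> N"
 unfolding len_def by (rule SUP_least) auto

text \<open>The set of chain lengths is closed downwards, because an initial segment of a chain is a
  chain. Hence every natural number not above the supremum occurs, even when the supremum is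
  infinite.\<close>

lemma len_obtain_chain:
 assumes "enat n \<le> len S A B" "submod S B" "B \<subseteq> A"
 obtains X where "chain_of S A B X n"
proof -
 have down: "\<exists>Y. chain_of S A B Y m" if "chain_of S A B X n" "m \<le> n" for X n m using that
 proof (induction rule: chain_of.induct)
  case (chain_step X n Y)
  thus ?case by (cases "m = Suc n") (auto intro: chain_of.chain_step)
 qed (auto intro: chain_base)
 have "\<exists>X. chain_of S A B X n"
 proof (rule ccontr)
  assume *: "\<not> ?thesis"
  have n0: "n \<noteq> 0" using * chain_base[OF assms(2) order_refl assms(3)] by metis
  have "len S A B \<le> enat (n - 1)"
  proof (rule len_le)
   fix X m assume "chain_of S A B X m"
   hence "\<not> n \<le> m" using down * by blast
   thus "enat m \<le> enat (n - 1)" by simp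
  qed
  hence "enat n \<le> enat (n - 1)" using assms(1) order_trans by blast
  thus False using n0 by simp
 qed
 thus ?thesis using that by blast
qed

lemma len_le_map:
 assumes "\<And>X. submod S X ==> B \<subseteq> X ==> X \<subseteq> A ==> submod S' (\<phi> X) \<and> B' \<subseteq> \<phi> X \<and> \<phi> X \<subseteq> A'"
  and "\<And>X Y. submod S X ==> submod S Y ==> B \<subseteq> X ==> X \<subset> Y ==> Y \<subseteq> A ==> \<phi> X \<subset> \<phi> Y"
 shows "len S A B \<le> len S' A' B'"
proof (rule len_le)
 fix X n assume "chain_of S A B X n"
 hence "chain_of S' A' B' (\<phi> X) n"
 proof (induction rule: chain_of.induct)
  case (chain_base X)
  thus ?case using assms(1)[of X] by (intro chain_of.chain_base) auto
 next
  case (chain_step X n Y)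
  have "B \<subseteq> X" "submod S X" using chain_step chain_ofD by blast+
  thus ?case using chain_step assms by (intro chain_of.chain_step[of _ _ _ "\<phi> X"]) auto
 qed
 thus "enat n \<le> len S' A' B'" by (rule len_ge)
qed

lemma len_self [simp]: "len S A A = 0"
proof -
 have "n = 0" if "chain_of S A A X n" for X n using that
 proof (cases rule: chain_of.cases)
  case (chain_step X' n')
  thus ?thesis using chain_ofD by blast
 qed auto
 hence "len S A A \<le> 0" by (intro len_le) (auto simp: zero_enat_def)
 thus ?thesis by simp
qed

lemma len_eq_0_iff:
 assumes "submod S A" "submod S B" "B \<subseteq> A"
 shows "len S A B = 0 \<longleftrightarrow> A = B"
proof
 assume *: "len S A B = 0"
 show "A = B"
 proof (rule ccontr)
  assume "A \<noteq> B"
  hence "chain_of S A B A (Suc 0)" using assms by (intro chain_step[of _ _ _ B] chain_base) auto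
  hence "enat 1 \<le> 0" using len_ge * by (metis One_nat_def)
  thus False by (simp add: zero_enat_def)
 qed
qed auto

text \<open>For the upper bound a chain \<open>X\<close> is split into \<open>X +++ B\<close> above
  \<open>B\<close> and \<open>X \<inter> B\<close> below \<open>B\<close>; the modular law forbids
  that both stand still while \<open>X\<close> grows. For the lower bound a chain above
  \<open>B\<close> is stacked on one below it.\<close>

theorem len_add:
 assumes S: "ring_set S" and A: "submod S A" and B: "submod S B" and C: "submod S C"
  and "C \<subseteq> B" "B \<subseteq> A"
 shows "len S A C = len S A B + len S B C"
proof (rule antisym)
 show "len S A C \<le> len S A B + len S B C"
 proof (rule len_le)
  fix X n assume "chain_of S A C X n"
  hence "\<exists>p q. n \<le> p + q \<and> chain_of S A B (X +++ B) p \<and> chain_of S B C (X \<inter> B) q"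
  proof (induction rule: chain_of.induct)
   case (chain_base X)
   have "chain_of S A B (X +++ B) 0" using chain_base assms set_add_subset_iff[of S X B A] set_add_ub2[of S X B]
    by (intro chain_of.chain_base submod_add) auto
   moreover have "chain_of S B C (X \<inter> B) 0" using chain_base assms by (intro chain_of.chain_base submod_Int) auto
   ultimately show ?case by blast
  next
   case (chain_step X n Y)
   have X: "submod S X" "C \<subseteq> X" using chain_step chain_ofD by blast+
   have Y: "submod S Y" "X \<subset> Y" "Y \<subseteq> A" using chain_step by auto
   obtain p q where pq: "n \<le> p + q" "chain_of S A B (X +++ B) p" "chain_of S B C (X \<inter> B) q"
    using chain_step by blast
   have sub: "X +++ B \<subseteq> Y +++ B" "X \<inter> B \<subseteq> Y \<inter> B" using Y set_add_mono by blast+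
   have "X +++ B \<noteq> Y +++ B \<or> X \<inter> B \<noteq> Y \<inter> B"
   proof (rule ccontr)
    assume "\<not> ?thesis"
    hence eq: "X +++ B = Y +++ B" "X \<inter> B = Y \<inter> B" by auto
    have "Y = Y \<inter> (X +++ B)" using eq set_add_ub1[OF B, of Y] by auto
    also have "\<dots> = X +++ (Y \<inter> B)" using modular_law[OF S X(1) B Y(1)] Y by auto
    also have "\<dots> = X" using eq set_add_absorb[OF X(1) submod_Int[OF X(1) B]] by auto
    finally show False using Y by auto
   qed
   thus ?case
   proof
    assume "X +++ B \<noteq> Y +++ B"
    hence "chain_of S A B (Y +++ B) (Suc p)"
     using pq sub Y A B set_add_subset_iff[of S Y B A] \<open>B \<subseteq> A\<close>
     by (intro chain_of.chain_step[OF pq(2)] submod_add) auto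
    moreover have "\<exists>r\<ge>q. chain_of S B C (Y \<inter> B) r"
    proof (cases "X \<inter> B = Y \<inter> B")
     case False
     hence "chain_of S B C (Y \<inter> B) (Suc q)"
      using pq sub Y B by (intro chain_of.chain_step[OF pq(3)] submod_Int) auto
     thus ?thesis using le_SucI by blast
    qed (use pq in auto)
    ultimately show ?thesis using pq
     by (metis add_Suc add_Suc_shift add_mono_thms_linordered_semiring(2) le_trans not_less_eq_eq)
   next
    assume "X \<inter> B \<noteq> Y \<inter> B"
    hence "chain_of S B C (Y \<inter> B) (Suc q)"
     using pq sub Y B by (intro chain_of.chain_step[OF pq(3)] submod_Int) auto
    moreover have "\<exists>r\<ge>p. chain_of S A B (Y +++ B) r"
    proof (cases "X +++ B = Y +++ B")
     case False
     hence "chain_of S A B (Y +++ B) (Suc p)"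
      using pq sub Y A B set_add_subset_iff[of S Y B A] \<open>B \<subseteq> A\<close>
      by (intro chain_of.chain_step[OF pq(2)] submod_add) auto
     thus ?thesis using le_SucI by blast
    qed (use pq in auto)
    ultimately show ?thesis using pq
     by (metis add_Suc_right add_mono_thms_linordered_semiring(3) le_trans not_less_eq_eq)
   qed
  qed
  then obtain p q where pq: "n \<le> p + q" "enat p \<le> len S A B" "enat q \<le> len S B C" using len_ge by blast
  have "enat n \<le> enat p + enat q" using pq by simp
  also have "\<dots> \<le> len S A B + len S B C" using pq add_mono by blast
  finally show "enat n \<le> len S A B + len S B C" .
 qed
next
 have cat: "chain_of S A C X (q + p)" if "chain_of S A B X p" "chain_of S B C Z q" for X Z p q using that
 proof (induction arbitrary: rule: chain_of.induct)
  case (chain_base X)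
  have up: "chain_of S A C Z q" using chain_base(4)
  proof (induction rule: chain_of.induct)
   case (chain_base X)
   thus ?case using \<open>B \<subseteq> A\<close> by (intro chain_of.chain_base) auto
  next
   case (chain_step X n Y)
   thus ?case using \<open>B \<subseteq> A\<close> by (intro chain_of.chain_step[of _ _ _ X]) auto
  qed
  have ZX: "Z \<subseteq> X" using chain_base chain_ofD by blast
  have "chain_of S A C X q" using up chain_base(1,3) ZX
  proof (cases rule: chain_of.cases)
   case chain_base
   thus ?thesis using \<open>submod S X\<close> ZX \<open>X \<subseteq> A\<close> by (auto intro: chain_of.chain_base)
  next
   case (chain_step X' n)
   thus ?thesis using \<open>submod S X\<close> ZX \<open>X \<subseteq> A\<close>
    by (auto intro!: chain_of.chain_step[of _ _ _ X'])
  qed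
  thus ?case by simp
 next
  case (chain_step X n Y)
  thus ?case using chain_of.chain_step[of S A C X "q + n" Y] by simp
 qed
 have key: "enat p + enat q \<le> len S A C" if "chain_of S A B X p" "chain_of S B C Z q" for X Z p q
  using len_ge[OF cat[OF that]] by (simp add: add.commute)
 show "len S A B + len S B C \<le> len S A C"
 proof (cases "len S A C")
  case (enat N)
  have ne: "{n. \<exists>X. chain_of S A B X n} \<noteq> {}" "{n. \<exists>X. chain_of S B C X n} \<noteq> {}"
   using chain_base[of S B B A] chain_base[of S C C B] assms by blast+
  \<comment> \<open>Stacking a chain on a trivial one bounds each summand, so both suprema are
    finite and attained.\<close>
  have fin1: "len S A B \<le> N"
  proof (rule len_le)
   fix X n assume "chain_of S A B X n"
   hence "enat n + enat 0 \<le> len S A C" using key chain_base[of S C C B] assms by blast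
   thus "enat n \<le> enat N" using enat by simp
  qed
  have fin2: "len S B C \<le> N"
  proof (rule len_le)
   fix X n assume "chain_of S B C X n"
   hence "enat 0 + enat n \<le> len S A C" using key chain_base[of S B B A] assms by blast
   thus "enat n \<le> enat N" using enat by simp
  qed
  obtain a b where ab: "len S A B = enat a" "len S B C = enat b" using fin1 fin2 by (metis enat_ile)
  obtain X Z where "chain_of S A B X a" "chain_of S B C Z b" using ab len_obtain_chain assms by (metis order_refl)
  thus ?thesis using key ab by simp
 qed auto
qed

text \<open>Intersecting with \<open>A\<close> and adding \<open>B\<close> are strictly monotone
  between the two intervals of submodules, because the modular law recovers \<open>X\<close> from
  its image.\<close>

lemma len_second_iso:
 assumes S: "ring_set S" and A: "submod S A" and B: "submod S B"
 shows "len S (A +++ B) B = len S A (A \<inter> B)"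
proof (rule antisym)
 have eq1: "B +++ (X \<inter> A) = X" if "submod S X" "B \<subseteq> X" "X \<subseteq> A +++ B" for X
  using modular_law[OF S B A that(1,2)] that set_add_commute[of A B] by auto
 show "len S (A +++ B) B \<le> len S A (A \<inter> B)"
 proof (rule len_le_map[where \<phi> = "\<lambda>X. X \<inter> A"])
  fix X Y assume *: "submod S X" "submod S Y" "B \<subseteq> X" "X \<subset> Y" "Y \<subseteq> A +++ B"
  have "B +++ (X \<inter> A) = X" "B +++ (Y \<inter> A) = Y" using * by (meson eq1 order_trans psubset_imp_subset)+
  hence "X \<inter> A \<noteq> Y \<inter> A" using * by (metis psubset_eq)
  thus "X \<inter> A \<subset> Y \<inter> A" using * by auto
 qed (use A submod_Int in auto)
 have eq2: "A \<inter> (X +++ B) = X" if "submod S X" "A \<inter> B \<subseteq> X" "X \<subseteq> A" for X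
  using modular_law[OF S that(1) B A that(3)] set_add_absorb[OF that(1) submod_Int[OF A B] that(2)] by auto
 show "len S A (A \<inter> B) \<le> len S (A +++ B) B"
 proof (rule len_le_map[where \<phi> = "\<lambda>X. X +++ B"])
  fix X Y assume *: "submod S X" "submod S Y" "A \<inter> B \<subseteq> X" "X \<subset> Y" "Y \<subseteq> A"
  have "A \<inter> (X +++ B) = X" "A \<inter> (Y +++ B) = Y" using * by (meson eq2 order_trans psubset_imp_subset)+
  hence "X +++ B \<noteq> Y +++ B" using * by (metis psubset_eq)
  thus "X +++ B \<subset> Y +++ B" using * set_add_mono[of X Y B B] by auto
 next
  fix X assume *: "submod S X" "A \<inter> B \<subseteq> X" "X \<subseteq> A"
  thus "submod S (X +++ B) \<and> B \<subseteq> X +++ B \<and> X +++ B \<subseteq> A +++ B"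
   using B submod_add[of S X B] set_add_mono[of X A B B] set_add_ub2[of S X B] by simp
 qed
qed

lemma len_smul:
 assumes "c \<noteq> 0"
 shows "len S (c *o A) (c *o B) = len S A B"
proof -
 have le: "len S A B \<le> len S (c *o A) (c *o B)" if "c \<noteq> 0" for c :: 'a and A B
 proof (rule len_le_map[where \<phi> = "\<lambda>X. c *o X"])
  have "inj (\<lambda>b. c * b)" using that by (auto simp: inj_def)
  thus "c *o X \<subset> c *o Y" if "X \<subset> Y" for X Y
   unfolding smul_def using that by (metis image_strict_mono inj_on_subset subset_UNIV)
 qed (auto intro: submod_smul dest: smul_mono)
 have "inverse c *o c *o X = X" for X using assms by (simp add: smul_smul) (simp add: smul_def)
 hence "len S (c *o A) (c *o B) \<le> len S A B" using le[of "inverse c" "c *o A" "c *o B"] assms by simp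
 thus ?thesis using le[OF assms] by (simp add: antisym)
qed

lemma len_scalars_mono: "S' \<subseteq> S ==> len S A B \<le> len S' A B"
 by (rule len_le_map[where \<phi> = id]) (auto intro: submod_mono)

lemma len_mono1:
 assumes "ring_set S" "submod S A" "submod S B" "submod S C" "C \<subseteq> B" "B \<subseteq> A"
 shows "len S B C \<le> len S A C" "len S A B \<le> len S A C"
 using len_add[OF assms] by (auto intro: add_increasing add_increasing2)

text \<open>Of the two paths from \<open>A\<close> down to \<open>C\<close>, one passes through
  \<open>B\<close> and one through \<open>B'\<close>; a finite piece common to both can be
  cancelled. This carries the colength of a multiplication from one module to another of finite
  index in it.\<close>

lemma len_eq_cancel:
 assumes "ring_set S" "submod S A" "submod S B" "submod S B'" "submod S C"
  "C \<subseteq> B" "B \<subseteq> A" "C \<subseteq> B'" "B' \<subseteq> A" "len S A B = len S B' C" "len S A B \<noteq> \<infinity>"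
 shows "len S A B' = len S B C"
proof -
 have "len S A B + len S B C = len S A B' + len S B' C"
  using len_add[OF assms(1,2,3,5,6,7)] len_add[OF assms(1,2,4,5,8,9)] by simp
 thus ?thesis using assms(10,11) by (cases "len S A B"; cases "len S B C"; cases "len S A B'") auto
qed

section \<open>Local rings\<close>

lemma cring_ring_on: "ring_set R ==> cring (ring_on R)"
proof -
 assume R: "ring_set R"
 have "abelian_group (ring_on R)"
  by (rule abelian_groupI) (auto simp: ring_setD[OF R] algebra_simps intro!: bexI[of _ "- _"])
 moreover have "comm_monoid (ring_on R)" by (rule comm_monoidI) (auto simp: ring_setD[OF R] algebra_simps)
 ultimately show ?thesis by (rule cringI) (auto simp: algebra_simps)
qed

lemma ideal_ring_on_iff:
 assumes R: "ring_set R"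
 shows "ideal I (ring_on R) \<longleftrightarrow> submod R I \<and> I \<subseteq> R"
proof
 interpret cring "ring_on R" by (rule cring_ring_on[OF R])
 show "submod R I \<and> I \<subseteq> R" if "ideal I (ring_on R)"
 proof -
  interpret I: ideal I "ring_on R" by (rule that)
  show ?thesis unfolding submod_def using I.zero_closed I.a_closed I.I_l_closed I.a_subset by auto
 qed
 show "ideal I (ring_on R)" if I: "submod R I \<and> I \<subseteq> R"
 proof (rule idealI)
  show "ring (ring_on R)" by (rule ring_axioms)
  have "\<exists>y\<in>I. y + x = 0" if "x \<in> I" for x
   using submod_uminus[of R I x] I R that by (intro bexI[of _ "- x"]) auto
  hence "inv\<^bsub>add_monoid (ring_on R)\<^esub> x \<in> I" if "x \<in> I" for x
  proof -
   have "- x \<in> I" using submod_uminus[of R I x] I R that by auto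
   moreover have "\<ominus>\<^bsub>ring_on R\<^esub> x = - x"
    using I that by (intro minus_equality) (auto simp: ring_setD[OF R] subset_iff)
   ultimately show ?thesis unfolding a_inv_def by simp
  qed
  thus "subgroup I (add_monoid (ring_on R))" using I unfolding subgroup_def submod_def by auto
 qed (use I in \<open>auto simp: submodD\<close>)
qed

lemma cgenideal_ring_on: "PIdl\<^bsub>ring_on R\<^esub> f = f *o R"
 unfolding cgenideal_def smul_def by (auto simp: mult.commute)

lemma genideal2_ring_on:
 assumes R: "ring_set R" and "f \<in> R" "g \<in> R"
 shows "Idl\<^bsub>ring_on R\<^esub> {f, g} = f *o R +++ g *o R"
proof
 interpret cring "ring_on R" by (rule cring_ring_on[OF R])
 have sub: "submod R (f *o R +++ g *o R)" by (intro submod_add submod_smul submod_self R)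
 have "f *o R +++ g *o R \<subseteq> R" using assms by (auto elim!: set_addE smulE simp: ring_setD)
 hence "ideal (f *o R +++ g *o R) (ring_on R)" using sub ideal_ring_on_iff[OF R] by blast
 moreover have "f = f * 1 + g * 0" "g = f * 0 + g * 1" by simp_all
 hence "{f, g} \<subseteq> f *o R +++ g *o R"
  using ring_setD(1,2)[OF R] by (metis empty_subsetI insert_subset set_addI smulI)
 ultimately show "Idl\<^bsub>ring_on R\<^esub> {f, g} \<subseteq> f *o R +++ g *o R" by (rule genideal_minimal)
 have sup: "{f, g} \<subseteq> Idl\<^bsub>ring_on R\<^esub> {f, g}" using assms by (intro genideal_self) auto
 have "ideal (Idl\<^bsub>ring_on R\<^esub> {f, g}) (ring_on R)" using assms by (intro genideal_ideal) auto
 hence "submod R (Idl\<^bsub>ring_on R\<^esub> {f, g})" using ideal_ring_on_iff[OF R] by blast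
 thus "f *o R +++ g *o R \<subseteq> Idl\<^bsub>ring_on R\<^esub> {f, g}"
  using sup by (auto elim!: set_addE smulE intro!: submodD(2) simp: submodD(4))
qed

lemma max_ideal_iff: "r \<in> mx R \<longleftrightarrow> r \<in> R \<and> (r = 0 \<or> inverse r \<notin> R)"
proof -
 have "(\<exists>x\<in>R. x * r = 1 \<and> r * x = 1) \<longleftrightarrow> r \<noteq> 0 \<and> inverse r \<in> R"
 proof
  assume "\<exists>x\<in>R. x * r = 1 \<and> r * x = 1"
  thus "r \<noteq> 0 \<and> inverse r \<in> R" using inverse_unique by fastforce
 qed (auto intro!: bexI[of _ "inverse r"])
 thus ?thesis unfolding max_ideal_def Units_def by auto
qed

lemma Units_ring_on: "u \<in> Units (ring_on R) \<longleftrightarrow> u \<in> R \<and> u \<notin> mx R"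
 unfolding max_ideal_def Units_def by auto

lemma colength_eq_len:
 assumes "ring_set R"
 shows "colength R I = len R R I"
proof -
 have "(\<exists>J. (\<forall>i\<le>n. ideal (J i) (ring_on R) \<and> I \<subseteq> J i) \<and> (\<forall>i<n. J i \<subset> J (Suc i))) \<longleftrightarrow>
  (\<exists>X. chain_of R R I X n)" for n unfolding chain_of_iff ideal_ring_on_iff[OF assms]
 proof -
  have "((submod R J \<and> J \<subseteq> R) \<and> I \<subseteq> J) = (submod R J \<and> I \<subseteq> J \<and> J \<subseteq> R)" for J by blast
  thus "(\<exists>J. (\<forall>i\<le>n. (submod R (J i) \<and> J i \<subseteq> R) \<and> I \<subseteq> J i) \<and> (\<forall>i<n. J i \<subset> J (Suc i))) \<longleftrightarrow>
   (\<exists>X J. (\<forall>i\<le>n. submod R (J i) \<and> I \<subseteq> J i \<and> J i \<subseteq> R) \<and> (\<forall>i<n. J i \<subset> J (Suc i)) \<and> J n = X)"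
   by simp
 qed
 thus ?thesis unfolding colength_def len_def by simp
qed

lemma enat_eq_one_plus_cancel:
 fixes a b :: enat
 assumes "a + b \<le> enat (Suc n)" "a \<ge> enat n" "b \<ge> 1"
 shows "a = enat n" "b = 1"
 using assms by (cases a; cases b; auto simp: one_enat_def)+

section \<open>Dimension over the field of constants\<close>

locale const_field =
 fixes K :: "'k::alg_closed_field => 'f::field"
 assumes K_add: "K (a + b) = K a + K b"
  and K_mult: "K (a * b) = K a * K b"
  and K_one [simp]: "K 1 = 1"
begin

lemma K_zero [simp]: "K 0 = 0" using K_add[of 0 0] by (metis add.right_neutral add_left_cancel)
lemma K_minus: "K (- a) = - K a" using K_add[of a "-a"] by (simp add: add_eq_0_iff)
lemma K_diff: "K (a - b) = K a - K b" using K_add[of a "-b"] K_minus by simp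
lemma K_eq_0_iff [simp]: "K a = 0 \<longleftrightarrow> a = 0"
 using K_mult[of a "inverse a"] by (cases "a = 0") auto
lemma K_inverse: "K (inverse a) = inverse (K a)"
 using K_mult[of a "inverse a"] by (cases "a = 0") (auto simp: inverse_unique)
lemma K_eq_iff [simp]: "K a = K b \<longleftrightarrow> a = b"
 using K_eq_0_iff[of "a - b"] by (simp add: K_diff)
abbreviation KK :: "'f set" where "KK \<equiv> range K"

lemma ring_set_KK: "ring_set KK"
 unfolding ring_set_def
proof (intro conjI ballI)
 show "0 \<in> KK" using K_zero by (metis rangeI)
 show "1 \<in> KK" using K_one by (metis rangeI)
next
 fix a b assume "a \<in> KK" "b \<in> KK"
 then obtain x y where "a = K x" "b = K y" by blast
 hence "a + b = K (x + y)" "a * b = K (x * y)" by (simp_all add: K_add K_mult)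
 thus "a + b \<in> KK" "a * b \<in> KK" by simp_all
next
 fix a assume "a \<in> KK"
 then obtain x where "a = K x" by blast
 hence "- a = K (- x)" by (simp add: K_minus)
 thus "- a \<in> KK" by simp
qed

abbreviation dim :: "'f set => 'f set => enat" where "dim \<equiv> len KK"

definition ev :: "'f => 'k poly => 'f" where
 "ev s p = poly (map_poly K p) s"

lemma ev_0 [simp]: "ev s 0 = 0" by (simp add: ev_def)
lemma ev_pCons [simp]: "ev s (pCons c p) = K c + s * ev s p"
 by (cases "pCons c p = 0") (auto simp: ev_def map_poly_pCons)
lemma ev_1 [simp]: "ev s 1 = 1" using ev_pCons[of s 1 0] by (simp add: pCons_one)
lemma ev_add: "ev s (p + q) = ev s p + ev s q"
 by (induction p q rule: poly_induct2) (auto simp: K_add algebra_simps)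
lemma ev_smult: "ev s (Polynomial.smult c p) = K c * ev s p"
 by (induction p) (auto simp: K_mult algebra_simps)
lemma ev_mult: "ev s (p * q) = ev s p * ev s q"
 by (induction p) (auto simp: ev_add ev_smult algebra_simps)
lemma ev_minus: "ev s (- p) = - ev s p" using ev_smult[of s "-1" p] by (simp add: K_minus)
lemma ev_diff: "ev s (p - q) = ev s p - ev s q" using ev_add[of s p "-q"] ev_minus[of s q] by simp
lemma ev_power: "ev s (p ^ n) = ev s p ^ n" by (induction n) (auto simp: ev_mult)
lemma ev_sum: "ev s (sum g I) = (\<Sum>i\<in>I. ev s (g i))"
 by (induction I rule: infinite_finite_induct) (auto simp: ev_add)
lemma ev_monom: "ev s (monom c n) = K c * s ^ n"
 by (induction n) (auto simp: monom_Suc monom_0 ev_pCons)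

lemma ev_altdef: "degree p \<le> n ==> ev s p = (\<Sum>i\<le>n. K (pcoeff p i) * s ^ i)"
 by (subst poly_as_sum_of_monoms'[symmetric, of p n]) (auto simp: ev_sum ev_monom)

definition line :: "'f => 'f set" where "line z = z *o KK"

lemma submod_line: "submod KK (line z)"
 unfolding line_def by (intro submod_smul submod_self ring_set_KK)

lemma lineI: "K c * z \<in> line z" unfolding line_def by (simp add: smulI')

lemma lineE: "y \<in> line z ==> (\<And>c. y = K c * z ==> P) ==> P"
 unfolding line_def by (auto elim!: smulE simp: mult.commute)

text \<open>Any strict step upwards inside the interval produces a vector c z + b with c nonzero,
  hence \<open>z\<close> itself, hence everything; so a second strict step is impossible.\<close>

lemma dim_line_le:
 assumes B: "submod KK B" shows "dim (line z +++ B) B \<le> 1"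
proof (rule len_le)
 fix X n assume "chain_of KK (line z +++ B) B X n"
 hence "n \<le> 1 \<and> (n = 1 --> X = line z +++ B)"
 proof (induction rule: chain_of.induct)
  case (chain_step X n Y)
  have X: "submod KK X" "B \<subseteq> X" using chain_step chain_ofD by blast+
  obtain y where y: "y \<in> Y" "y \<notin> X" using chain_step by blast
  hence "y \<in> line z +++ B" using chain_step by blast
  then obtain c b where yc: "y = K c * z + b" "b \<in> B" by (auto elim!: set_addE lineE)
  have "c \<noteq> 0" using y yc X by auto
  have "b \<in> Y" using yc X chain_step by auto
  hence "K c * z \<in> Y" using submod_diff[OF chain_step(2) ring_set_KK y(1), of b] yc(1) by simp
  hence "K (inverse c) * (K c * z) \<in> Y" using submodD(3)[OF chain_step(2)] by blast
  hence "z \<in> Y" using \<open>c \<noteq> 0\<close> by (simp add: K_inverse mult.assoc[symmetric])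
  hence "line z \<subseteq> Y" using submodD(3)[OF chain_step(2)] by (auto elim!: lineE)
  moreover have "B \<subseteq> Y" using X chain_step by blast
  ultimately have "line z +++ B \<subseteq> Y" using set_add_subset_iff[OF submod_line B chain_step(2)] by blast
  hence "Y = line z +++ B" using chain_step by blast
  moreover have "n \<noteq> 1" using chain_step calculation by auto
  ultimately show ?case using chain_step by simp
 qed auto
 thus "enat n \<le> 1" by (simp add: one_enat_def)
qed

lemma dim_line_eq:
 assumes B: "submod KK B" and "z \<notin> B" shows "dim (line z +++ B) B = 1"
proof (rule antisym[OF dim_line_le[OF B]])
 have "z \<in> line z +++ B" using set_addI[OF lineI[of 1 z], of 0 B] submodD(1)[OF B] by simp
 hence "line z +++ B \<noteq> B" using assms by blast
 hence "dim (line z +++ B) B \<noteq> 0"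
  using len_eq_0_iff[OF submod_add[OF submod_line B] B set_add_ub2[OF submod_line]] by blast
 thus "1 \<le> dim (line z +++ B) B" by (simp add: ileI1 one_eSuc)
qed

primrec span_over :: "'f set => (nat => 'f) => nat => 'f set" where
 "span_over B z 0 = B"
| "span_over B z (Suc n) = line (z n) +++ span_over B z n"

lemma submod_span_over: "submod KK B ==> submod KK (span_over B z n)"
 by (induction n) (auto intro: submod_add submod_line)

lemma span_over_ub: "submod KK B ==> m \<le> n ==> span_over B z m \<subseteq> span_over B z n"
proof (induction n)
 case (Suc n)
 thus ?case using set_add_ub2[OF submod_line, of "span_over B z n" "z n"] by (cases "m = Suc n") auto
qed auto

lemma span_over_iff:
 "submod KK B ==> v \<in> span_over B z n \<longleftrightarrow> (\<exists>c. v - (\<Sum>i<n. K (c i) * z i) \<in> B)"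
proof (induction n arbitrary: v)
 case (Suc n)
 show ?case
 proof
  assume "v \<in> span_over B z (Suc n)"
  then obtain c b where v: "v = K c * z n + b" "b \<in> span_over B z n" by (auto elim!: set_addE lineE)
  then obtain d where "b - (\<Sum>i<n. K (d i) * z i) \<in> B" using Suc by blast
  hence "v - (\<Sum>i<Suc n. K ((d(n := c)) i) * z i) \<in> B" using v by (simp add: algebra_simps)
  thus "\<exists>c. v - (\<Sum>i<Suc n. K (c i) * z i) \<in> B" by blast
 next
  assume "\<exists>c. v - (\<Sum>i<Suc n. K (c i) * z i) \<in> B"
  then obtain c where "v - (\<Sum>i<Suc n. K (c i) * z i) \<in> B" by blast
  hence "(v - K (c n) * z n) - (\<Sum>i<n. K (c i) * z i) \<in> B" by (simp add: algebra_simps)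
  hence "v - K (c n) * z n \<in> span_over B z n" using Suc by blast
  hence "K (c n) * z n + (v - K (c n) * z n) \<in> line (z n) +++ span_over B z n"
   by (rule set_addI[OF lineI])
  thus "v \<in> span_over B z (Suc n)" by simp
 qed
qed auto

lemma dim_span_over_Suc:
 assumes "submod KK B"
 shows "dim (span_over B z (Suc n)) B =
  dim (span_over B z (Suc n)) (span_over B z n) + dim (span_over B z n) B"
 using assms span_over_ub[OF assms, of n "Suc n" z] span_over_ub[OF assms, of 0 n z]
 by (intro len_add ring_set_KK submod_span_over) auto

lemma dim_span_over_le: "submod KK B ==> dim (span_over B z n) B \<le> enat n"
proof (induction n)
 case (Suc n)
 hence "dim (span_over B z (Suc n)) B \<le> 1 + enat n"
  by (subst dim_span_over_Suc) (auto intro!: add_mono dim_line_le submod_span_over)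
 thus ?case by (simp add: one_enat_def)
qed (simp add: zero_enat_def)

text \<open>The dimension grows with a new vector exactly when this vector is outside the span of
  the earlier ones, so full growth is linear independence modulo \<open>B\<close>.\<close>

lemma dim_span_over_eq_iff:
 assumes B: "submod KK B"
 shows "dim (span_over B z n) B = enat n \<longleftrightarrow>
  (\<forall>c. (\<Sum>i<n. K (c i) * z i) \<in> B --> (\<forall>i<n. c i = 0))"
proof (induction n)
 case 0
 thus ?case by (simp add: zero_enat_def)
next
 case (Suc n)
 note S = submod_span_over[OF B]
 have step: "dim (span_over B z (Suc n)) B = enat (Suc n) \<longleftrightarrow>
   dim (span_over B z n) B = enat n \<and> z n \<notin> span_over B z n"
 proof (cases "z n \<in> span_over B z n")
  case True
  have "line (z n) \<subseteq> span_over B z n" using True submodD(3)[OF S] by (auto elim!: lineE)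
  hence "span_over B z (Suc n) = span_over B z n"
   using set_add_absorb[OF S submod_line] set_add_commute[of "line (z n)"] by simp
  thus ?thesis using True dim_span_over_le[OF B, of z n] by auto
 next
  case False
  have "dim (span_over B z (Suc n)) B = 1 + dim (span_over B z n) B"
   using dim_span_over_Suc[OF B, of z n] dim_line_eq[OF S False] by simp
  thus ?thesis using False by (cases "dim (span_over B z n) B") (auto simp: one_enat_def)
 qed
 show ?case unfolding step Suc.IH
 proof (intro iffI allI impI)
  fix c i
  assume *: "(\<forall>c. (\<Sum>i<n. K (c i) * z i) \<in> B --> (\<forall>i<n. c i = 0)) \<and> z n \<notin> span_over B z n"
   and c: "(\<Sum>i<Suc n. K (c i) * z i) \<in> B" and i: "i < Suc n"
  have "c n = 0"
  proof (rule ccontr)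
   assume cn: "c n \<noteq> 0"
   have "K (inverse (c n)) * (\<Sum>i<Suc n. K (c i) * z i) \<in> B" using submodD(3)[OF B] c by blast
   also have "K (inverse (c n)) * (\<Sum>i<Suc n. K (c i) * z i) =
    z n - (\<Sum>i<n. K (- (inverse (c n) * c i)) * z i)"
    using cn by (simp add: distrib_left K_inverse K_mult K_minus sum_distrib_left mult.assoc
      sum_negf)
   finally have "z n \<in> span_over B z n" unfolding span_over_iff[OF B]
    by (intro exI[of _ "\<lambda>i. - (inverse (c n) * c i)"])
   thus False using * by blast
  qed
  thus "c i = 0" using * c i by (cases "i = n") auto
 next
  assume *: "\<forall>c. (\<Sum>i<Suc n. K (c i) * z i) \<in> B --> (\<forall>i<Suc n. c i = 0)"
  have "\<forall>i<n. c i = 0" if "(\<Sum>i<n. K (c i) * z i) \<in> B" for c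
  proof (intro allI impI)
   fix i assume "i < n"
   moreover have "(\<Sum>i<Suc n. K ((c(n := 0)) i) * z i) \<in> B" using that by simp
   ultimately have "(c(n := 0)) i = 0" using * less_SucI by blast
   thus "c i = 0" using \<open>i < n\<close> by simp
  qed
  moreover have "z n \<notin> span_over B z n"
  proof
   assume "z n \<in> span_over B z n"
   then obtain c where "z n - (\<Sum>i<n. K (c i) * z i) \<in> B" unfolding span_over_iff[OF B] by blast
   hence "(\<Sum>i<Suc n. K (((\<lambda>i. - c i)(n := 1)) i) * z i) \<in> B"
    by (simp add: K_minus sum_negf)
   thus False using *[rule_format, of "(\<lambda>i. - c i)(n := 1)" n] by simp
  qed
  ultimately show "(\<forall>c. (\<Sum>i<n. K (c i) * z i) \<in> B --> (\<forall>i<n. c i = 0)) \<and>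
   z n \<notin> span_over B z n" by blast
 qed
qed

text \<open>The last clause says that the residue field consists of constants. Simple modules are
  therefore lines over the constants, and length can be counted as dimension.\<close>

definition loc_ring :: "'f set => bool" where
 "loc_ring R \<longleftrightarrow> ring_set R \<and> KK \<subseteq> R \<and> submod R (mx R) \<and>
   (\<forall>r\<in>R. \<exists>c. r - K c \<in> mx R)"

lemma loc_ringD:
 assumes "loc_ring R"
 shows "ring_set R" "K c \<in> R" "KK \<subseteq> R" "submod R (mx R)" "mx R \<subseteq> R"
  "r \<in> R ==> \<exists>c. r - K c \<in> mx R"
 using assms unfolding loc_ring_def max_ideal_def by auto

lemma not_max_ideal_inverse:
 assumes "loc_ring R" "r \<in> R" "r \<notin> mx R" shows "r \<noteq> 0" "inverse r \<in> R"
 using assms max_ideal_iff by blast+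

lemma one_notin_max_ideal: "loc_ring R ==> 1 \<notin> mx R"
 using max_ideal_iff[of 1 R] loc_ringD(1) ring_setD(2) by auto

lemma K_notin_max_ideal: "loc_ring R ==> c \<noteq> 0 ==> K c \<notin> mx R"
 using max_ideal_iff[of "K c" R] loc_ringD(2) by (simp add: K_inverse[symmetric])

lemma add_notin_max_ideal:
 assumes "loc_ring R" "r \<notin> mx R" "s \<in> mx R" shows "r + s \<notin> mx R"
 using submod_diff[OF loc_ringD(4)[OF assms(1)] loc_ringD(1)[OF assms(1)], of "r + s" s] assms by auto

text \<open>Infinite length stays infinite with fewer scalars. For finite length the top composition
  factor of \<open>A\<close> over \<open>X'\<close> is simple, so it is annihilated by the maximal
  ideal and is a single line over the residue field; induction does the rest.\<close>

lemma len_loc_eq_dim: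
 assumes R: "loc_ring R" and A: "submod R A" and B: "submod R B" and "B \<subseteq> A"
 shows "len R A B = dim A B"
proof (cases "len R A B")
 case infinity
 thus ?thesis using len_scalars_mono[OF loc_ringD(3)[OF R], of A B] by simp
next
 case (enat n)
 have "len R A B = enat n ==> submod R A ==> B \<subseteq> A ==> dim A B = enat n" for n
 proof (induction n arbitrary: A)
  case 0
  thus ?case using len_eq_0_iff[of R A B] B by (simp add: zero_enat_def[symmetric])
 next
  case (Suc n)
  note Rr = loc_ringD(1)[OF R]
  obtain X where "chain_of R A B X (Suc n)" using len_obtain_chain[of "Suc n" R A B] Suc.prems B by auto
  then obtain X' where X': "chain_of R A B X' n" "X' \<subset> X" "X \<subseteq> A" by (cases rule: chain_of.cases) auto
  hence X'2: "submod R X'" "B \<subseteq> X'" "X' \<subseteq> A" using chain_ofD by blast+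
  have "chain_of R X' B X' n" using X'(1) unfolding chain_of_iff
  proof (elim exE conjE)
   fix J assume J: "\<forall>i\<le>n. submod R (J i) \<and> B \<subseteq> J i \<and> J i \<subseteq> A" "\<forall>i<n. J i \<subset> J (Suc i)" "J n = X'"
   have "J i \<subseteq> J n" if "i \<le> n" for i using that by (induction rule: inc_induct) (use J(2) in auto)
   thus "\<exists>J. (\<forall>i\<le>n. submod R (J i) \<and> B \<subseteq> J i \<and> J i \<subseteq> X') \<and> (\<forall>i<n. J i \<subset> J (Suc i)) \<and> J n = X'"
    using J by blast
  qed
  hence ge: "len R X' B \<ge> enat n" by (rule len_ge)
  have split: "len R A B = len R A X' + len R X' B" using len_add[OF Rr Suc.prems(2) X'2(1) B X'2(2,3)] .
  have "len R A X' \<noteq> 0" using len_eq_0_iff[OF Suc.prems(2) X'2(1,3)] X' by blast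
  hence "len R A X' \<ge> 1" by (simp add: ileI1 one_eSuc)
  hence l: "len R X' B = enat n" "len R A X' = 1"
   using enat_eq_one_plus_cancel[of "len R X' B" "len R A X'" n] ge split Suc.prems(1) by (auto simp: add.commute)
  have simple: "Y = X'" if "submod R Y" "X' \<subseteq> Y" "Y \<subset> A" for Y
  proof (rule ccontr)
   assume "Y \<noteq> X'"
   hence "chain_of R A X' A (Suc (Suc 0))"
    using that Suc.prems X'2 by (intro chain_step[of _ _ _ Y] chain_step[of _ _ _ X'] chain_base) auto
   hence "enat (Suc (Suc 0)) \<le> len R A X'" by (rule len_ge)
   thus False using l by (simp add: one_enat_def)
  qed
  obtain z where z: "z \<in> A" "z \<notin> X'" using X' by blast
  have mz: "z * r \<in> X'" if r: "r \<in> mx R" for r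
  proof -
   have rR: "r \<in> R" using r loc_ringD(5)[OF R] by blast
   define Y where "Y = (z * r) *o R +++ X'"
   have Y: "submod R Y" "X' \<subseteq> Y" unfolding Y_def
    using X'2 Rr by (auto intro!: submod_add submod_smul submod_self set_add_ub2)
   have zr: "z * r \<in> A" using submodD(4)[OF Suc.prems(2) rR z(1)] .
   have YA: "Y \<subseteq> A" unfolding Y_def using zr X'2 Suc.prems(2)
    by (auto elim!: set_addE smulE intro!: submodD(2) submodD(4)[of R])
   \<comment> \<open>If z r generated \<open>z\<close> modulo \<open>X'\<close>, the unit 1 - r s
     would put \<open>z\<close> into \<open>X'\<close>: Nakayama's argument for one
     generator.\<close>
   have "z \<notin> Y"
   proof
    assume "z \<in> Y"
    then obtain s y where s: "z = z * r * s + y" "s \<in> R" "y \<in> X'" unfolding Y_def by (metis set_addE smulE)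
    have rs: "r * s \<in> mx R" using submodD(4)[OF loc_ringD(4)[OF R] s(2) r] .
    have u: "1 - r * s \<in> R" "1 - r * s \<notin> mx R"
     using ring_setD(6)[OF Rr ring_setD(2)[OF Rr] ring_setD(5)[OF Rr rR s(2)]]
      add_notin_max_ideal[OF R one_notin_max_ideal[OF R] submod_uminus[OF loc_ringD(4)[OF R] Rr rs]] by simp_all
    have "y = (1 - r * s) * z" using s(1) by (simp add: algebra_simps)
    hence "inverse (1 - r * s) * y = z" using not_max_ideal_inverse(1)[OF R u] by simp
    thus False using submodD(3)[OF X'2(1) not_max_ideal_inverse(2)[OF R u] s(3)] z(2) by simp
   qed
   hence "Y = X'" using simple[OF Y] YA z(1) by blast
   moreover have "z * r * 1 + 0 \<in> Y" unfolding Y_def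
    using ring_setD(2)[OF Rr] submodD(1)[OF X'2(1)] by (intro set_addI smulI)
   ultimately show ?thesis by simp
  qed
  have "A = line z +++ X'"
  proof
   define Y where "Y = z *o R +++ X'"
   have Y: "submod R Y" "X' \<subseteq> Y" unfolding Y_def
    using X'2 Rr by (auto intro!: submod_add submod_smul submod_self set_add_ub2)
   have "Y \<subseteq> A" unfolding Y_def using z X'2 Suc.prems(2)
    by (auto elim!: set_addE smulE intro!: submodD(2) submodD(4)[of R])
   moreover have "z * 1 + 0 \<in> Y" unfolding Y_def
    using submodD(1)[OF X'2(1)] Rr by (intro set_addI smulI) (auto simp: ring_setD)
   ultimately have "Y = A" using simple Y z by auto
   show "A \<subseteq> line z +++ X'"
   proof
    fix a assume "a \<in> A"
    then obtain r x where rx: "a = z * r + x" "r \<in> R" "x \<in> X'"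
     using \<open>Y = A\<close> unfolding Y_def by (auto elim!: set_addE smulE)
    obtain c where c: "r - K c \<in> mx R" using loc_ringD(6)[OF R rx(2)] by blast
    have "a = K c * z + (z * (r - K c) + x)" using rx by (simp add: algebra_simps)
    moreover have "z * (r - K c) + x \<in> X'" using mz[OF c] rx submodD(2)[OF X'2(1)] by blast
    ultimately show "a \<in> line z +++ X'" using set_addI[OF lineI] by metis
   qed
   show "line z +++ X' \<subseteq> A" using z X'2 submodD(2,3)[OF Suc.prems(2)] loc_ringD(2)[OF R]
    by (auto elim!: set_addE lineE)
  qed
  hence "dim A X' = 1" using dim_line_eq[OF _ z(2)] submod_mono[OF X'2(1) loc_ringD(3)[OF R]] by simp
  moreover have "dim X' B = enat n" using Suc.IH[OF l(1) X'2(1,2)] .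
  ultimately have "dim A B = 1 + enat n"
   using len_add[of KK A X' B] ring_set_KK submod_mono[OF _ loc_ringD(3)[OF R]] Suc.prems B X'2 by auto
  thus ?case by (simp add: one_enat_def)
 qed
 thus ?thesis using enat assms by simp
qed

lemma colength_eq_dim:
 assumes "loc_ring R" "submod R I" "I \<subseteq> R" shows "colength R I = dim R I"
 using assms colength_eq_len len_loc_eq_dim loc_ringD(1) submod_self by metis

end

section \<open>Regular local rings of surfaces\<close>

abbreviation mpow :: "'f::field set => nat => 'f set" where
 "mpow R n \<equiv> ideal_pow R (mx R) n"

declare ideal_pow.simps(2) [simp del]

context const_field
begin

lemma submod_mpow:
 assumes R: "loc_ring R" shows "submod R (mpow R n)" "mpow R n \<subseteq> R"
proof -
 interpret cring "ring_on R" by (rule cring_ring_on[OF loc_ringD(1)[OF R]])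
 note I = ideal_ring_on_iff[OF loc_ringD(1)[OF R]]
 have "ideal (mpow R n) (ring_on R)"
 proof (induction n)
  case 0
  thus ?case using I submod_self loc_ringD(1)[OF R] by simp
 next
  case (Suc n)
  have "ideal (mx R) (ring_on R)" using I loc_ringD(4,5)[OF R] by blast
  thus ?case unfolding ideal_pow.simps(2) using Suc.IH by (rule ideal_prod_is_ideal)
 qed
 thus "submod R (mpow R n)" "mpow R n \<subseteq> R" using I by blast+
qed

lemma submod_KK: "loc_ring R ==> submod R A ==> submod KK A"
 using submod_mono loc_ringD(3) by blast

definition params :: "'f set => 'f => 'f => bool" where
 "params R x y \<longleftrightarrow> loc_ring R \<and> mx R = x *o R +++ y *o R"

lemma paramsD:
 assumes "params R x y"
 shows "loc_ring R" "ring_set R" "mx R = x *o R +++ y *o R" "x \<in> mx R" "y \<in> mx R"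
  "x \<in> R" "y \<in> R"
proof -
 show l: "loc_ring R" and m: "mx R = x *o R +++ y *o R" using assms by (auto simp: params_def)
 show r: "ring_set R" using loc_ringD(1)[OF l] .
 have "x * 1 + y * 0 \<in> mx R" "x * 0 + y * 1 \<in> mx R"
  unfolding m using r by (intro set_addI smulI; simp add: ring_setD)+
 thus "x \<in> mx R" "y \<in> mx R" by simp_all
 thus "x \<in> R" "y \<in> R" using loc_ringD(5)[OF l] by auto
qed

lemma params_commute: "params R x y ==> params R y x"
 unfolding params_def using set_add_commute by metis

lemma mpow_Suc:
 assumes "params R x y"
 shows "mpow R (Suc n) = x *o mpow R n +++ y *o mpow R n"
proof
 note p = paramsD[OF assms] and M = submod_mpow[OF paramsD(1)[OF assms], of n]
 have sub: "submod R (x *o mpow R n +++ y *o mpow R n)" by (intro submod_add submod_smul M)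
 show "mpow R (Suc n) \<subseteq> x *o mpow R n +++ y *o mpow R n"
 proof
  fix a assume "a \<in> mpow R (Suc n)"
  hence "a \<in> ideal_prod (ring_on R) (mx R) (mpow R n)" by (simp add: ideal_pow.simps(2))
  thus "a \<in> x *o mpow R n +++ y *o mpow R n"
  proof (induction rule: ideal_prod.induct)
   case (prod i j)
   then obtain r s where rs: "i = x * r + y * s" "r \<in> R" "s \<in> R" unfolding p(3) by (auto elim!: set_addE smulE)
   have "i * j = x * (r * j) + y * (s * j)" by (simp add: rs algebra_simps)
   thus ?case using rs prod submodD(3)[OF M(1)] by (auto intro!: set_addI smulI)
  next
   case (sum s1 s2)
   thus ?case using submodD(2)[OF sub] by simp
  qed
 qed
 show "x *o mpow R n +++ y *o mpow R n \<subseteq> mpow R (Suc n)"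
 proof
  fix a assume "a \<in> x *o mpow R n +++ y *o mpow R n"
  then obtain r s where rs: "a = x * r + y * s" "r \<in> mpow R n" "s \<in> mpow R n" by (auto elim!: set_addE smulE)
  hence "x * r \<in> mpow R (Suc n)" "y * s \<in> mpow R (Suc n)"
   using p(4,5) ideal_prod.prod[of _ "mx R" _ "mpow R n" "ring_on R"] by (auto simp: ideal_pow.simps(2))
  thus "a \<in> mpow R (Suc n)" using rs(1) submodD(2)[OF submod_mpow(1)[OF p(1), of "Suc n"]] by blast
 qed
qed

lemma mpow_mult:
 assumes "params R x y" "a \<in> mpow R i" "b \<in> mpow R j"
 shows "a * b \<in> mpow R (i + j)"
 using assms(2)
proof (induction i arbitrary: a)
 case 0
 thus ?case using submodD(3)[OF submod_mpow(1)[OF paramsD(1)[OF assms(1)]]] assms(3) by simp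
next
 case (Suc i)
 then obtain r s where rs: "a = x * r + y * s" "r \<in> mpow R i" "s \<in> mpow R i"
  unfolding mpow_Suc[OF assms(1)] by (auto elim!: set_addE smulE)
 have "a * b = x * (r * b) + y * (s * b)" by (simp add: rs algebra_simps)
 hence "a * b \<in> mpow R (Suc (i + j))"
  unfolding mpow_Suc[OF assms(1)] using Suc.IH rs by (auto intro!: set_addI smulI)
 thus ?case by simp
qed

lemma mpow_antimono_Suc:
 assumes "params R x y" shows "mpow R (Suc n) \<subseteq> mpow R n"
proof
 fix a assume "a \<in> mpow R (Suc n)"
 then obtain r s where rs: "a = x * r + y * s" "r \<in> mpow R n" "s \<in> mpow R n"
  unfolding mpow_Suc[OF assms] by (auto elim!: set_addE smulE)
 thus "a \<in> mpow R n" using submodD[OF submod_mpow(1)[OF paramsD(1)[OF assms], of n]] paramsD(6,7)[OF assms] by auto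
qed

lemma mpow_antimono:
 assumes "params R x y" "m \<le> n" shows "mpow R n \<subseteq> mpow R m"
 using assms(2) by (induction rule: dec_induct) (use mpow_antimono_Suc[OF assms(1)] in auto)

lemma mpow_1: assumes "params R x y" shows "mpow R (Suc 0) = mx R"
 using mpow_Suc[OF assms, of 0] paramsD(3)[OF assms] by simp

lemma mpow_power:
 assumes "params R x y" "a \<in> mx R" shows "a ^ n \<in> mpow R n"
proof (induction n)
 case 0
 thus ?case using ring_setD(2)[OF paramsD(2)[OF assms(1)]] by simp
next
 case (Suc n)
 thus ?case using mpow_mult[OF assms(1), of a 1 "a ^ n" n] assms(2) mpow_1[OF assms(1)] by simp
qed

lemma mpow_monomial:
 assumes "params R x y" "i \<le> n" shows "x ^ (n - i) * y ^ i \<in> mpow R n"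
 using mpow_mult[OF assms(1) mpow_power[OF assms(1)] mpow_power[OF assms(1)], of x y "n - i" i]
  paramsD[OF assms(1)] assms(2) by simp

lemma mpow_iff:
 assumes "params R x y"
 shows "a \<in> mpow R n \<longleftrightarrow> (\<exists>r. (\<forall>i. r i \<in> R) \<and> a = (\<Sum>i\<le>n. r i * (x ^ (n - i) * y ^ i)))"
proof
 note p = paramsD[OF assms]
 show "\<exists>r. (\<forall>i. r i \<in> R) \<and> a = (\<Sum>i\<le>n. r i * (x ^ (n - i) * y ^ i))" if "a \<in> mpow R n"
  using that
 proof (induction n arbitrary: a)
  case 0
  thus ?case by (intro exI[of _ "\<lambda>_. a"]) auto
 next
  case (Suc n)
  then obtain b c where bc: "a = x * b + y * c" "b \<in> mpow R n" "c \<in> mpow R n"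
   unfolding mpow_Suc[OF assms] by (auto elim!: set_addE smulE)
  obtain r s where rs: "\<forall>i. r i \<in> R" "b = (\<Sum>i\<le>n. r i * (x ^ (n - i) * y ^ i))"
   "\<forall>i. s i \<in> R" "c = (\<Sum>i\<le>n. s i * (x ^ (n - i) * y ^ i))"
   using Suc.IH[OF bc(2)] Suc.IH[OF bc(3)] by blast
  \<comment> \<open>Multiplication by \<open>y\<close> moves every coefficient one place up, so the
    two lists of coefficients are added with a shift and the missing ends count as 0.\<close>
  define t where "t i = (if i \<le> n then r i else 0) + (case i of 0 => 0 | Suc j => s j)" for i
  have "t i \<in> R" for i using rs ring_setD[OF p(2)] by (auto simp: t_def split: nat.split)
  moreover have "a = (\<Sum>i\<le>Suc n. t i * (x ^ (Suc n - i) * y ^ i))"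
  proof -
   have "x * b = (\<Sum>i\<le>Suc n. (if i \<le> n then r i else 0) * (x ^ (Suc n - i) * y ^ i))"
    by (simp add: rs sum_distrib_left Suc_diff_le mult_ac)
   moreover have "y * c = (\<Sum>i\<le>Suc n. (case i of 0 => 0 | Suc j => s j) * (x ^ (Suc n - i) * y ^ i))"
    by (subst sum.atMost_Suc_shift) (simp add: rs sum_distrib_left mult_ac)
   ultimately show ?thesis unfolding bc t_def by (simp only: distrib_right sum.distrib)
  qed
  ultimately show ?case by blast
 qed
 show "a \<in> mpow R n" if "\<exists>r. (\<forall>i. r i \<in> R) \<and> a = (\<Sum>i\<le>n. r i * (x ^ (n - i) * y ^ i))"
  using that mpow_monomial[OF assms] submodD(3)[OF submod_mpow(1)[OF p(1)]]
  by (auto intro!: submod_sum[OF submod_mpow(1)[OF p(1)]])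
qed

text \<open>Each coefficient of a form in \<open>x\<close>, \<open>y\<close> may be replaced by its
  residue, since the difference lies in the maximal ideal and raises the power by one.\<close>

lemma mpow_leading:
 assumes "params R x y" "a \<in> mpow R n"
 obtains c where "a - (\<Sum>i\<le>n. K (c i) * (x ^ (n - i) * y ^ i)) \<in> mpow R (Suc n)"
proof -
 note p = paramsD[OF assms(1)]
 obtain r where r: "\<forall>i. r i \<in> R" "a = (\<Sum>i\<le>n. r i * (x ^ (n - i) * y ^ i))"
  using mpow_iff[OF assms(1)] assms(2) by blast
 have "\<forall>i. \<exists>c. r i - K c \<in> mx R" using loc_ringD(6)[OF p(1)] r(1) by blast
 hence "\<exists>c. \<forall>i. r i - K (c i) \<in> mx R" by (rule choice)
 then obtain c where c: "\<And>i. r i - K (c i) \<in> mx R" by blast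
 have "a - (\<Sum>i\<le>n. K (c i) * (x ^ (n - i) * y ^ i)) =
  (\<Sum>i\<le>n. (r i - K (c i)) * (x ^ (n - i) * y ^ i))"
  unfolding r by (simp add: sum_subtractf left_diff_distrib)
 also have "\<dots> \<in> mpow R (Suc n)"
 proof (rule submod_sum[OF submod_mpow(1)[OF p(1)]])
  fix i assume "i \<in> {..n}"
  thus "(r i - K (c i)) * (x ^ (n - i) * y ^ i) \<in> mpow R (Suc n)"
   using mpow_mult[OF assms(1) _ mpow_monomial[OF assms(1)], of "r i - K (c i)" 1 i n] c
    mpow_1[OF assms(1)] by simp
 qed
 finally show ?thesis by (rule that)
qed

lemma mpow_eq_span_over:
 assumes "params R x y"
 shows "mpow R n = span_over (mpow R (Suc n)) (\<lambda>i. x ^ (n - i) * y ^ i) (Suc n)"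
proof -
 note p = paramsD[OF assms]
 note B = submod_KK[OF p(1) submod_mpow(1)[OF p(1)], of "Suc n"]
 note M = submod_mpow(1)[OF p(1), of n]
 show ?thesis unfolding set_eq_iff span_over_iff[OF B] lessThan_Suc_atMost
 proof (intro allI iffI)
  show "a \<in> mpow R n ==> \<exists>c. a - (\<Sum>i\<le>n. K (c i) * (x ^ (n - i) * y ^ i)) \<in> mpow R (Suc n)" for a
   by (rule mpow_leading[OF assms]) blast+
 next
  fix a assume "\<exists>c. a - (\<Sum>i\<le>n. K (c i) * (x ^ (n - i) * y ^ i)) \<in> mpow R (Suc n)"
  then obtain c where "a - (\<Sum>i\<le>n. K (c i) * (x ^ (n - i) * y ^ i)) \<in> mpow R n"
   using mpow_antimono_Suc[OF assms] by blast
  moreover have "(\<Sum>i\<le>n. K (c i) * (x ^ (n - i) * y ^ i)) \<in> mpow R n"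
   using submodD(3)[OF M] loc_ringD(2)[OF p(1)] mpow_monomial[OF assms] by (intro submod_sum[OF M]) auto
  ultimately show "a \<in> mpow R n" using submodD(2)[OF M] by fastforce
 qed
qed

text \<open>Regularity of a two-dimensional local ring in the form in which it is used: the
  associated graded ring has the Hilbert function of a polynomial ring in two variables, and no
  nonzero element lies in all powers of the maximal ideal.\<close>

definition reg :: "'f set => bool" where
 "reg R \<longleftrightarrow> (\<exists>x y. params R x y) \<and> (\<forall>n. dim (mpow R n) (mpow R (Suc n)) = enat (Suc n)) \<and>
   (\<forall>a\<in>R. a \<noteq> 0 --> (\<exists>n. a \<notin> mpow R n))"

lemma regD:
 assumes "reg R"
 shows "loc_ring R" "ring_set R" "\<exists>x y. params R x y"
  "dim (mpow R n) (mpow R (Suc n)) = enat (Suc n)" "a \<in> R ==> a \<noteq> 0 ==> \<exists>n. a \<notin> mpow R n"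
 using assms unfolding reg_def params_def loc_ring_def by auto

text \<open>The n + 1 monomials of degree n span a space of dimension n + 1 and so form a basis: the
  associated graded ring is a polynomial ring in \<open>x\<close> and \<open>y\<close>.\<close>

lemma reg_independent:
 assumes "reg R" "params R x y" "(\<Sum>i\<le>n. K (c i) * (x ^ (n - i) * y ^ i)) \<in> mpow R (Suc n)" "i \<le> n"
 shows "c i = 0"
proof -
 note B = submod_KK[OF regD(1) submod_mpow(1)[OF regD(1)], OF assms(1,1), of "Suc n"]
 have "dim (span_over (mpow R (Suc n)) (\<lambda>i. x ^ (n - i) * y ^ i) (Suc n)) (mpow R (Suc n)) = enat (Suc n)"
  using regD(4)[OF assms(1), of n] by (simp only: mpow_eq_span_over[OF assms(2), of n, symmetric])
 thus ?thesis using assms(3,4) unfolding dim_span_over_eq_iff[OF B] lessThan_Suc_atMost by auto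
qed

lemma params_nonzero:
 assumes "reg R" "params R x y" shows "x \<noteq> 0" "y \<noteq> 0" "x \<notin> mpow R 2" "y \<notin> mpow R 2"
proof -
 have *: "x \<notin> mpow R 2" if "params R x y" for x y
 proof
  assume "x \<in> mpow R 2"
  thus False using reg_independent[OF assms(1) that, of "\<lambda>i. if i = 0 then 1 else 0" 1 0]
   by (simp add: numeral_2_eq_2)
 qed
 show "x \<notin> mpow R 2" "y \<notin> mpow R 2" using * assms(2) params_commute by blast+
 moreover have "0 \<in> mpow R 2" using submodD(1)[OF submod_mpow(1)[OF regD(1)[OF assms(1)]]] .
 ultimately show "x \<noteq> 0" "y \<noteq> 0" by metis+
qed

text \<open>Initial forms of degree n are handled as polynomials of degree at most n in y / x, the
  coordinate that later lives on the exceptional divisor.\<close>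

lemma homogenize:
 assumes "x \<noteq> 0" "degree p \<le> n"
 shows "x ^ n * ev (y / x) p = (\<Sum>i\<le>n. K (pcoeff p i) * (x ^ (n - i) * y ^ i))"
 unfolding ev_altdef[OF assms(2)] sum_distrib_left
proof (rule sum.cong)
 fix i assume "i \<in> {..n}"
 hence "x ^ n = x ^ (n - i) * x ^ i" by (simp add: power_add[symmetric])
 thus "x ^ n * (K (pcoeff p i) * (y / x) ^ i) =
   K (pcoeff p i) * (x ^ (n - i) * y ^ i)" using assms(1) by (simp add: power_divide)
qed simp

lemma homogenize_mem:
 assumes "reg R" "params R x y" "degree p \<le> n"
 shows "x ^ n * ev (y / x) p \<in> mpow R n"
 unfolding homogenize[OF params_nonzero(1)[OF assms(1,2)] assms(3)]
 using submodD(3)[OF submod_mpow(1)] paramsD(1)[OF assms(2)] loc_ringD(2) mpow_monomial[OF assms(2)]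
 by (intro submod_sum[OF submod_mpow(1)]) auto

lemma homogenize_mem_Suc:
 assumes "reg R" "params R x y" "degree p \<le> n" "x ^ n * ev (y / x) p \<in> mpow R (Suc n)"
 shows "p = 0"
proof (rule poly_eqI)
 fix i
 show "pcoeff p i = pcoeff 0 i"
  using reg_independent[OF assms(1,2), of "pcoeff p" n i] assms(3,4)
   homogenize[OF params_nonzero(1)[OF assms(1,2)] assms(3), of y] by (cases "i \<le> n") (auto simp: coeff_eq_0)
qed

definition mord :: "'f set => 'f => nat" where
 "mord R a = (LEAST n. a \<notin> mpow R (Suc n))"

lemma mem_mpow_iff:
 assumes "reg R" "a \<in> R" "a \<noteq> 0"
 shows "a \<in> mpow R n \<longleftrightarrow> n \<le> mord R a"
proof -
 obtain x y where p: "params R x y" using regD(3)[OF assms(1)] by blast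
 obtain k where k: "a \<notin> mpow R k" using regD(5)[OF assms] by blast
 have "a \<notin> mpow R (Suc k)" using k mpow_antimono_Suc[OF p] by blast
 hence L: "a \<notin> mpow R (Suc (mord R a))" unfolding mord_def by (rule LeastI)
 have le: "a \<in> mpow R (mord R a)"
 proof (cases "mord R a")
  case (Suc m)
  thus ?thesis using not_less_Least[of m "\<lambda>n. a \<notin> mpow R (Suc n)"] unfolding mord_def by auto
 qed (use assms in simp)
 show ?thesis
 proof
  show "n \<le> mord R a" if "a \<in> mpow R n"
   using L that mpow_antimono[OF p, of "Suc (mord R a)" n] by (meson not_less_eq_eq subsetD)
  show "a \<in> mpow R n" if "n \<le> mord R a" using le mpow_antimono[OF p that] by blast
 qed
qed

lemma mord_eqI:
 assumes "reg R" "a \<in> mpow R n" "a \<notin> mpow R (Suc n)" shows "a \<in> R" "a \<noteq> 0" "mord R a = n"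
proof -
 show a: "a \<in> R" using submod_mpow(2)[OF regD(1)[OF assms(1)]] assms(2) by blast
 show "a \<noteq> 0" using submodD(1)[OF submod_mpow(1)[OF regD(1)[OF assms(1)]]] assms(3) by metis
 thus "mord R a = n" using mem_mpow_iff[OF assms(1) a] assms(2,3) by (meson le_antisym not_less_eq_eq)
qed

lemma leading_poly:
 assumes "reg R" "params R x y" "a \<in> mpow R n"
 obtains p where "degree p \<le> n" "a - x ^ n * ev (y / x) p \<in> mpow R (Suc n)"
  "p = 0 \<longleftrightarrow> a \<in> mpow R (Suc n)"
proof -
 note B = submod_mpow(1)[OF regD(1)[OF assms(1)], of "Suc n"]
 obtain c where c: "a - (\<Sum>i\<le>n. K (c i) * (x ^ (n - i) * y ^ i)) \<in> mpow R (Suc n)"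
  using mpow_leading[OF assms(2,3)] .
 define p where "p = (\<Sum>i\<le>n. monom (c i) i)"
 have cp: "pcoeff p i = (if i \<le> n then c i else 0)" for i
  unfolding p_def coeff_sum by (simp add: sum.delta)
 have deg: "degree p \<le> n" by (rule degree_le) (simp add: cp)
 have *: "a - x ^ n * ev (y / x) p \<in> mpow R (Suc n)"
  unfolding homogenize[OF params_nonzero(1)[OF assms(1,2)] deg] using c by (simp add: cp)
 moreover have "p = 0 \<longleftrightarrow> a \<in> mpow R (Suc n)"
 proof
  assume "a \<in> mpow R (Suc n)"
  hence "x ^ n * ev (y / x) p \<in> mpow R (Suc n)" using submod_diff[OF B regD(2)[OF assms(1)] _ *, of a] by simp
  thus "p = 0" using homogenize_mem_Suc[OF assms(1,2) deg] by blast
 qed (use * in auto)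
 ultimately show ?thesis using that deg by blast
qed

text \<open>Initial forms multiply like polynomials in one variable over a field, which have no zero
  divisors. This is what makes the order a valuation.\<close>

lemma mpow_mult_strict:
 assumes "reg R" "a \<in> mpow R i" "a \<notin> mpow R (Suc i)" "b \<in> mpow R j" "b \<notin> mpow R (Suc j)"
 shows "a * b \<notin> mpow R (Suc (i + j))"
proof
 assume ab: "a * b \<in> mpow R (Suc (i + j))"
 obtain x y where p: "params R x y" using regD(3)[OF assms(1)] by blast
 note B = submod_mpow(1)[OF regD(1)[OF assms(1)], of "Suc (i + j)"]
 obtain u where u: "degree u \<le> i" "a - x ^ i * ev (y / x) u \<in> mpow R (Suc i)" "u \<noteq> 0"
  using leading_poly[OF assms(1) p assms(2)] assms(3) by metis
 obtain v where v: "degree v \<le> j" "b - x ^ j * ev (y / x) v \<in> mpow R (Suc j)" "v \<noteq> 0"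
  using leading_poly[OF assms(1) p assms(4)] assms(5) by metis
 have d: "degree (u * v) \<le> i + j" using degree_mult_le[of u v] u v by linarith
 have "(a - x ^ i * ev (y / x) u) * b \<in> mpow R (Suc (i + j))" using mpow_mult[OF p u(2) assms(4)] by simp
 moreover have "x ^ i * ev (y / x) u * (b - x ^ j * ev (y / x) v) \<in> mpow R (Suc (i + j))"
  using mpow_mult[OF p homogenize_mem[OF assms(1) p u(1)] v(2)] by simp
 ultimately have "(a - x ^ i * ev (y / x) u) * b + x ^ i * ev (y / x) u * (b - x ^ j * ev (y / x) v)
   \<in> mpow R (Suc (i + j))" by (rule submodD(2)[OF B])
 hence "a * b - x ^ (i + j) * ev (y / x) (u * v) \<in> mpow R (Suc (i + j))"
  by (simp add: algebra_simps ev_mult power_add)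
 hence "a * b - (a * b - x ^ (i + j) * ev (y / x) (u * v)) \<in> mpow R (Suc (i + j))"
  using submod_diff[OF B regD(2)[OF assms(1)] ab] by blast
 hence "x ^ (i + j) * ev (y / x) (u * v) \<in> mpow R (Suc (i + j))" by simp
 hence "u * v = 0" using homogenize_mem_Suc[OF assms(1) p d] by blast
 thus False using u v by simp
qed

lemma mord_mult:
 assumes "reg R" "a \<in> R" "a \<noteq> 0" "b \<in> R" "b \<noteq> 0"
 shows "mord R (a * b) = mord R a + mord R b"
proof -
 obtain x y where p: "params R x y" using regD(3)[OF assms(1)] by blast
 have *: "a \<in> mpow R (mord R a)" "a \<notin> mpow R (Suc (mord R a))"
  "b \<in> mpow R (mord R b)" "b \<notin> mpow R (Suc (mord R b))" using mem_mpow_iff[OF assms(1)] assms by auto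
 show ?thesis using mord_eqI(3)[OF assms(1) mpow_mult[OF p *(1,3)] mpow_mult_strict[OF assms(1) *]] .
qed

lemma mord_add:
 assumes "reg R" "a \<in> R" "a \<noteq> 0" "b \<in> R" "b \<noteq> 0" "a + b \<noteq> 0"
 shows "mord R (a + b) \<ge> min (mord R a) (mord R b)"
proof -
 have "a + b \<in> mpow R (min (mord R a) (mord R b))"
  using mem_mpow_iff[OF assms(1)] assms submodD(2)[OF submod_mpow(1)[OF regD(1)[OF assms(1)]]] by auto
 moreover have "a + b \<in> R" using assms ring_setD(4)[OF regD(2)[OF assms(1)]] by blast
 ultimately show ?thesis using mem_mpow_iff[OF assms(1)] assms by blast
qed

lemma mord_eq_0_iff:
 assumes "reg R" "a \<in> R" "a \<noteq> 0" shows "mord R a = 0 \<longleftrightarrow> a \<notin> mx R"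
proof -
 obtain x y where p: "params R x y" using regD(3)[OF assms(1)] by blast
 show ?thesis using mem_mpow_iff[OF assms, of "Suc 0"] unfolding mpow_1[OF p] by auto
qed

text \<open>The initial form of a product is the product of initial forms.\<close>
lemma mpow_cancel:
 assumes "reg R" "f \<in> mpow R e" "f \<notin> mpow R (Suc e)" "a \<in> R" "f * a \<in> mpow R (e + n)"
 shows "a \<in> mpow R n"
proof (cases "a = 0")
 case True
 thus ?thesis using submodD(1)[OF submod_mpow(1)[OF regD(1)[OF assms(1)]]] by simp
next
 case False
 note f = mord_eqI[OF assms(1-3)]
 have "f * a \<in> R" "f * a \<noteq> 0" using f assms(4) False ring_setD(5)[OF regD(2)[OF assms(1)]] by auto
 hence "e + n \<le> mord R (f * a)" using mem_mpow_iff[OF assms(1)] assms(5) by blast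
 thus ?thesis using mord_mult[OF assms(1) f(1,2) assms(4) False] f(3)
   mem_mpow_iff[OF assms(1,4) False] by simp
qed

text \<open>A regular sequence is quasi-regular. Modulo \<open>x\<close> only the last term of the
  relation survives, so its coefficient is x q; dividing the relation by \<open>x\<close> lowers the
  degree.\<close>

lemma regular_sequence_relation:
 assumes R: "loc_ring R" and x: "x \<in> mx R" "x \<noteq> 0" and y: "y \<in> R"
  and rs: "\<And>a. a \<in> R ==> y * a \<in> x *o R ==> a \<in> x *o R"
  and r: "\<And>i. i \<le> n ==> r i \<in> R" and y': "y \<in> mx R"
  and rel: "(\<Sum>i\<le>n. r i * (x ^ (n - i) * y ^ i)) = 0" and i: "i \<le> n"
 shows "r i \<in> mx R"
 using r rel i
proof (induction n arbitrary: r i)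
 case 0
 thus ?case using submodD(1)[OF loc_ringD(4)[OF R]] by simp
next
 case (Suc n)
 note Rr = loc_ringD(1)[OF R]
 have xR: "x \<in> R" using x loc_ringD(5)[OF R] by blast
 have rs': "a \<in> x *o R" if "a \<in> R" "y ^ k * a \<in> x *o R" for a k using that(2)
 proof (induction k)
  case (Suc k)
  thus ?case using rs[of "y ^ k * a"] that(1) y Rr by (simp add: mult.assoc ring_setD)
 qed simp
 have split: "(\<Sum>i\<le>Suc n. r i * (x ^ (Suc n - i) * y ^ i)) =
  x * (\<Sum>i\<le>n. r i * (x ^ (n - i) * y ^ i)) + y ^ Suc n * r (Suc n)"
  by (simp add: sum_distrib_left Suc_diff_le mult_ac)
 hence "x * (\<Sum>i\<le>n. r i * (x ^ (n - i) * y ^ i)) + y ^ Suc n * r (Suc n) = 0" using Suc.prems(2) by (simp only:)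
 hence "y ^ Suc n * r (Suc n) = x * - (\<Sum>i\<le>n. r i * (x ^ (n - i) * y ^ i))"
  unfolding mult_minus_right by (metis add_eq_0_iff)
 moreover have "- (\<Sum>i\<le>n. r i * (x ^ (n - i) * y ^ i)) \<in> R"
 proof (intro ring_setD(3)[OF Rr] ring_set_sum[OF Rr])
  fix i assume "i \<in> {..n}"
  thus "r i * (x ^ (n - i) * y ^ i) \<in> R" using Suc.prems(1)[of i] xR y ring_setD(5,7)[OF Rr] by simp
 qed
 ultimately have "y ^ Suc n * r (Suc n) \<in> x *o R" by (simp only: smulI)
 hence "r (Suc n) \<in> x *o R" using rs'[OF Suc.prems(1)[OF order_refl]] by blast
 then obtain q where q: "r (Suc n) = x * q" "q \<in> R" by (auto elim: smulE)
 \<comment> \<open>The term x q y^(n + 1), divided by \<open>x\<close>, is absorbed as q y into the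
   coefficient of y^n.\<close>
 define t where "t i = (if i = n then r n + q * y else r i)" for i
 have "(\<Sum>i\<le>n. t i * (x ^ (n - i) * y ^ i)) = (\<Sum>i\<le>n. r i * (x ^ (n - i) * y ^ i)) + q * y * y ^ n"
  by (cases n) (auto simp: t_def algebra_simps)
 hence "x * (\<Sum>i\<le>n. t i * (x ^ (n - i) * y ^ i)) = 0" using Suc.prems(2) split q by (simp add: algebra_simps)
 hence "t i \<in> mx R" if "i \<le> n" for i
  using Suc.IH[of t] Suc.prems(1) q y Rr x that by (auto simp: t_def ring_setD)
 hence t: "t i \<in> mx R" if "i \<le> n" for i using that by blast
 show ?case
 proof (cases "i = Suc n")
  case True
  thus ?thesis using q x submodD(4)[OF loc_ringD(4)[OF R]] by simp
 next
  case False
  show ?thesis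
  proof (cases "i = n")
   case True
   have "q * y \<in> mx R" using q y' submodD(3)[OF loc_ringD(4)[OF R]] by blast
   thus ?thesis using t[of n] True submod_diff[OF loc_ringD(4)[OF R] Rr, of "r n + q * y" "q * y"] by (simp add: t_def)
  qed (use t[of i] False Suc.prems in \<open>auto simp: t_def\<close>)
 qed
qed

text \<open>Quasi-regularity of the sequence gives the Hilbert function, and separatedness is
  assumed. The criterion suits the local rings of the plane and of blowups, where the regular
  sequence is visible directly.\<close>

lemma regI:
 assumes p: "params R x y" and x: "x \<noteq> 0"
  and rs: "\<And>a. a \<in> R ==> y * a \<in> x *o R ==> a \<in> x *o R"
  and ord: "\<And>a. a \<in> R ==> a \<noteq> 0 ==> \<exists>n. a \<notin> mpow R n"
 shows "reg R"
 unfolding reg_def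
proof (intro conjI allI ballI impI)
 fix n
 note P = paramsD[OF p]
 note B = submod_KK[OF P(1) submod_mpow(1)[OF P(1)], of "Suc n"]
 have "c i = 0" if sum: "(\<Sum>i\<le>n. K (c i) * (x ^ (n - i) * y ^ i)) \<in> mpow R (Suc n)" and i: "i \<le> n" for c i
 proof -
  obtain r where r: "\<forall>i. r i \<in> R"
   "(\<Sum>i\<le>n. K (c i) * (x ^ (n - i) * y ^ i)) = (\<Sum>i\<le>Suc n. r i * (x ^ (Suc n - i) * y ^ i))"
   using sum mpow_iff[OF p] by blast
  \<comment> \<open>A form of degree n + 1 is rewritten as a form of degree n with coefficients in
    the maximal ideal; the monomial y^(n + 1) hands one factor \<open>y\<close> to the coefficient
    at n.\<close>
  define d where "d i = x * r i + (if i = n then y * r (Suc n) else 0)" for i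
  have d: "d i \<in> mx R" for i using r(1) submodD[OF loc_ringD(4)[OF P(1)]] P(4,5) by (auto simp: d_def)
  have "(\<Sum>i\<le>Suc n. r i * (x ^ (Suc n - i) * y ^ i)) =
   (\<Sum>i\<le>n. (x * r i) * (x ^ (n - i) * y ^ i)) + y * r (Suc n) * y ^ n" by (simp add: Suc_diff_le mult_ac)
  also have "\<dots> = (\<Sum>i\<le>n. d i * (x ^ (n - i) * y ^ i))"
   unfolding d_def by (cases n) (auto simp: algebra_simps)
  finally have "(\<Sum>i\<le>n. (K (c i) - d i) * (x ^ (n - i) * y ^ i)) = 0"
   using r(2) by (simp add: left_diff_distrib sum_subtractf)
  note rel = this
  have "K (c i) - d i \<in> mx R"
  proof (rule regular_sequence_relation[where r = "\<lambda>i. K (c i) - d i", OF P(1,4) x P(7) _ _ P(5) _ i])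
   show "K (c i) - d i \<in> R" for i
    using d[of i] loc_ringD(2)[OF P(1)] loc_ringD(5)[OF P(1)] ring_setD(6)[OF P(2)] by blast
  qed (use rs rel in blast)+
  hence "K (c i) \<in> mx R" using submodD(2)[OF loc_ringD(4)[OF P(1)] _ d[of i]] by fastforce
  thus ?thesis using K_notin_max_ideal[OF P(1)] by blast
 qed
 hence "dim (span_over (mpow R (Suc n)) (\<lambda>i. x ^ (n - i) * y ^ i) (Suc n)) (mpow R (Suc n)) = enat (Suc n)"
  unfolding dim_span_over_eq_iff[OF B] lessThan_Suc_atMost by auto
 thus "dim (mpow R n) (mpow R (Suc n)) = enat (Suc n)" by (simp only: mpow_eq_span_over[OF p, of n, symmetric])
qed (use p ord in auto)

lemma params_shear:
 assumes "params R x y" shows "params R (x - K l * y) y"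
proof -
 note p = paramsD[OF assms]
 have "x *o R +++ y *o R \<subseteq> (x - K l * y) *o R +++ y *o R"
 proof
  fix a assume "a \<in> x *o R +++ y *o R"
  then obtain r s where rs: "a = x * r + y * s" "r \<in> R" "s \<in> R" by (auto elim!: set_addE smulE)
  have "a = (x - K l * y) * r + y * (s + K l * r)" by (simp add: rs algebra_simps)
  thus "a \<in> (x - K l * y) *o R +++ y *o R"
   using rs loc_ringD(2)[OF p(1)] ring_setD[OF p(2)] by (metis set_addI smulI)
 qed
 moreover have "(x - K l * y) *o R +++ y *o R \<subseteq> x *o R +++ y *o R"
 proof
  fix a assume "a \<in> (x - K l * y) *o R +++ y *o R"
  then obtain r s where rs: "a = (x - K l * y) * r + y * s" "r \<in> R" "s \<in> R"
   by (auto elim!: set_addE smulE)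
  have "a = x * r + y * (s - K l * r)" by (simp add: rs algebra_simps)
  thus "a \<in> x *o R +++ y *o R" using rs loc_ringD(2)[OF p(1)] ring_setD[OF p(2)] by (metis set_addI smulI)
 qed
 ultimately show ?thesis using assms unfolding params_def by auto
qed

text \<open>In z = x (a + u) + y (b + v) the coefficient of \<open>y\<close> is a unit, so
  \<open>y\<close> can be expressed through \<open>z\<close> and \<open>x\<close>.\<close>

lemma params_extend_aux:
 assumes "reg R" "params R x y" "z - K a * x - K b * y \<in> mpow R 2" "b \<noteq> 0"
 shows "params R z x"
proof -
 note p = paramsD[OF assms(2)]
 note m = submodD[OF loc_ringD(4)[OF p(1)]]
 have "z - K a * x - K b * y \<in> x *o mx R +++ y *o mx R"
  using assms(3) mpow_Suc[OF assms(2), of "Suc 0"] mpow_1[OF assms(2)] by (simp add: numeral_2_eq_2)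
 then obtain u v where uv: "z - K a * x - K b * y = x * u + y * v" "u \<in> mx R" "v \<in> mx R"
  by (auto elim!: set_addE smulE)
 have uvR: "u \<in> R" "v \<in> R" using uv loc_ringD(5)[OF p(1)] by auto
 have zz: "z = x * (K a + u) + y * (K b + v)" using uv(1) by (simp add: algebra_simps)
 define w where "w = K b + v"
 have w: "w \<in> R" "w \<notin> mx R" using uvR loc_ringD(2)[OF p(1)] ring_setD(4)[OF p(2)]
   add_notin_max_ideal[OF p(1) K_notin_max_ideal[OF p(1) assms(4)] uv(3)] by (auto simp: w_def)
 note wi = not_max_ideal_inverse[OF p(1) w]
 have y: "y = z * inverse w + x * (- (K a + u) * inverse w)"
  using wi(1) zz unfolding w_def[symmetric] by (simp add: field_simps)
 have zR: "z \<in> R" unfolding zz using p uvR loc_ringD(2)[OF p(1)] ring_setD[OF p(2)] by auto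
 have "x *o R +++ y *o R = z *o R +++ x *o R"
 proof
  show "x *o R +++ y *o R \<subseteq> z *o R +++ x *o R"
  proof
   fix c assume "c \<in> x *o R +++ y *o R"
   then obtain r s where rs: "c = x * r + y * s" "r \<in> R" "s \<in> R" by (auto elim!: set_addE smulE)
   have "c = z * (inverse w * s) + x * (r + (- (K a + u) * inverse w) * s)"
    unfolding rs by (subst y) (simp add: algebra_simps)
   moreover have "inverse w * s \<in> R" "r + (- (K a + u) * inverse w) * s \<in> R"
    using rs wi(2) uvR loc_ringD(2)[OF p(1)] by (auto intro!: ring_setD[OF p(2)])
   ultimately show "c \<in> z *o R +++ x *o R" using set_addI smulI by metis
  qed
  show "z *o R +++ x *o R \<subseteq> x *o R +++ y *o R"
  proof
   fix c assume "c \<in> z *o R +++ x *o R"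
   then obtain r s where rs: "c = z * r + x * s" "r \<in> R" "s \<in> R" by (auto elim!: set_addE smulE)
   have "c = x * ((K a + u) * r + s) + y * (w * r)" unfolding rs by (subst zz) (simp add: algebra_simps w_def)
   moreover have "(K a + u) * r + s \<in> R" "w * r \<in> R"
    using rs w uvR loc_ringD(2)[OF p(1)] by (auto intro!: ring_setD[OF p(2)])
   ultimately show "c \<in> x *o R +++ y *o R" using set_addI smulI by metis
  qed
 qed
 thus ?thesis using assms(2) unfolding params_def by simp
qed

lemma params_extend:
 assumes "reg R" "z \<in> mx R" "z \<notin> mpow R 2"
 obtains w where "params R z w"
proof -
 obtain x y where p: "params R x y" using regD(3)[OF assms(1)] by blast
 have "z \<in> mpow R (Suc 0)" using assms(2) mpow_1[OF p] by simp
 then obtain c where "z - (\<Sum>i\<le>Suc 0. K (c i) * (x ^ (Suc 0 - i) * y ^ i)) \<in> mpow R (Suc (Suc 0))"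
  using mpow_leading[OF p] by blast
 hence c: "z - K (c 0) * x - K (c 1) * y \<in> mpow R 2" by (simp add: numeral_2_eq_2 algebra_simps)
 show ?thesis
 proof (cases "c 1 = 0")
  case False
  thus ?thesis using params_extend_aux[OF assms(1) p c] that by blast
 next
  case True
  hence "c 0 \<noteq> 0" using c assms(3) by auto
  moreover have "z - K (c 1) * y - K (c 0) * x \<in> mpow R 2" using c by (simp add: algebra_simps)
  ultimately show ?thesis using params_extend_aux[OF assms(1) params_commute[OF p]] that by blast
 qed
qed

end

section \<open>Localization and blowing up\<close>

definition prime_at :: "'f::field set => 'f set => bool" where
 "prime_at T P \<longleftrightarrow> ring_set T \<and> submod T P \<and> P \<subseteq> T \<and> 1 \<notin> P \<and>
   (\<forall>a\<in>T. \<forall>b\<in>T. a * b \<in> P --> a \<in> P \<or> b \<in> P)"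

lemma prime_atD:
 assumes "prime_at T P"
 shows "ring_set T" "submod T P" "P \<subseteq> T" "1 \<notin> P" "a \<in> T ==> b \<in> T ==> a \<notin> P ==> b \<notin> P ==> a * b \<notin> P"
  "0 \<in> P" using assms submodD(1) unfolding prime_at_def by blast+

lemma maximalideal_imp_prime_at:
 assumes T: "ring_set T" and "maximalideal P (ring_on T)"
 shows "prime_at T P"
proof -
 interpret P: maximalideal P "ring_on T" by fact
 have P: "submod T P" "P \<subseteq> T" using P.is_ideal ideal_ring_on_iff[OF T] by blast+
 have one: "1 \<notin> P"
 proof
  assume "1 \<in> P"
  hence "T \<subseteq> P" using submodD(3)[OF P(1), of _ 1] by fastforce
  thus False using P P.I_notcarr by auto
 qed
 have "b \<in> P" if ab: "a \<in> T" "b \<in> T" "a * b \<in> P" "a \<notin> P" for a b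
 proof -
  have J: "submod T (a *o T +++ P)" using P T by (intro submod_add submod_smul submod_self)
  have "a *o T +++ P \<subseteq> T" using P ab(1) ring_setD(4,5)[OF T] by (auto elim!: set_addE smulE)
  moreover have "P \<subseteq> a *o T +++ P" using T by (intro set_add_ub2[of T] submod_smul submod_self)
  ultimately have "a *o T +++ P = P \<or> a *o T +++ P = T"
   using P.I_maximal[of "a *o T +++ P"] J ideal_ring_on_iff[OF T] by simp
  moreover have "a * 1 + 0 \<in> a *o T +++ P" using T submodD(1)[OF P(1)] by (intro set_addI smulI) (auto simp: ring_setD)
  ultimately have "1 \<in> a *o T +++ P" using ab(4) ring_setD(2)[OF T] by auto
  then obtain t p where tp: "1 = a * t + p" "t \<in> T" "p \<in> P" by (auto elim!: set_addE smulE)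
  have "b = 1 * b" by simp
  also have "\<dots> = t * (a * b) + b * p" unfolding tp(1) by (simp add: algebra_simps)
  finally show ?thesis using tp ab submodD(2,3)[OF P(1)] by metis
 qed
 thus ?thesis unfolding prime_at_def using T P one by blast
qed

lemma localizeI: "a \<in> T ==> b \<in> T ==> b \<notin> P ==> a / b \<in> localize T P"
 unfolding localize_def by blast

lemma localizeE:
 assumes "prime_at T P" "c \<in> localize T P"
 obtains a b where "a \<in> T" "b \<in> T" "b \<notin> P" "b \<noteq> 0" "c = a / b"
 using assms prime_atD(6)[OF assms(1)] unfolding localize_def by blast

lemma ring_set_localize:
 assumes P: "prime_at T P" shows "ring_set (localize T P)" "T \<subseteq> localize T P"
proof -
 note p = prime_atD[OF P] and r = ring_setD[OF prime_atD(1)[OF P]]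
 show sub: "T \<subseteq> localize T P" using localizeI[of _ T 1 P] p r by fastforce
 show "ring_set (localize T P)" unfolding ring_set_def
 proof (intro conjI ballI)
  show "0 \<in> localize T P" "1 \<in> localize T P" using sub r by auto
 next
  fix c assume "c \<in> localize T P"
  then obtain a b where "a \<in> T" "b \<in> T" "b \<notin> P" "c = a / b" using localizeE[OF P] by metis
  thus "- c \<in> localize T P" using localizeI[of "- a" T b P] r by simp
 next
  fix c c' assume "c \<in> localize T P" "c' \<in> localize T P"
  then obtain a b a' b' where *: "a \<in> T" "b \<in> T" "b \<notin> P" "b \<noteq> 0" "c = a / b"
   "a' \<in> T" "b' \<in> T" "b' \<notin> P" "b' \<noteq> 0" "c' = a' / b'" using localizeE[OF P] by metis
  have "c + c' = (a * b' + a' * b) / (b * b')" "c * c' = (a * a') / (b * b')" using * by (simp_all add: field_simps)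
  moreover have "b * b' \<in> T" "b * b' \<notin> P" using * p r by auto
  ultimately show "c + c' \<in> localize T P" "c * c' \<in> localize T P" using * r by (auto intro!: localizeI)
 qed
qed

lemma max_ideal_localize:
 assumes P: "prime_at T P"
 shows "c \<in> mx (localize T P) \<longleftrightarrow> (\<exists>a b. a \<in> P \<and> b \<in> T \<and> b \<notin> P \<and> c = a / b)"
proof -
 note p = prime_atD[OF P] and r = ring_setD[OF prime_atD(1)[OF P]]
 note m = max_ideal_iff
 show ?thesis
 proof
  assume c: "c \<in> mx (localize T P)"
  then obtain a b where ab: "a \<in> T" "b \<in> T" "b \<notin> P" "b \<noteq> 0" "c = a / b" using m localizeE[OF P] by metis
  have "a \<in> P"
  proof (rule ccontr)
   assume "a \<notin> P"
   hence "b / a \<in> localize T P" "a \<noteq> 0" using ab localizeI p(6) by metis+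
   thus False using c m[of c] ab by auto
  qed
  thus "\<exists>a b. a \<in> P \<and> b \<in> T \<and> b \<notin> P \<and> c = a / b" using ab by blast
 next
  assume "\<exists>a b. a \<in> P \<and> b \<in> T \<and> b \<notin> P \<and> c = a / b"
  then obtain a b where ab: "a \<in> P" "b \<in> T" "b \<notin> P" "c = a / b" by blast
  hence b0: "b \<noteq> 0" using p(6) by metis
  have "c \<in> localize T P" using ab p by (auto intro: localizeI)
  moreover have "inverse c \<notin> localize T P" if "c \<noteq> 0"
  proof
   assume "inverse c \<in> localize T P"
   then obtain a' b' where *: "a' \<in> T" "b' \<in> T" "b' \<notin> P" "b' \<noteq> 0" "inverse c = a' / b'"
    using localizeE[OF P] by metis
   hence "b * b' = a * a'" using ab b0 that by (auto simp: field_simps)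
   moreover have "a * a' \<in> P" using submodD(4)[OF p(2)] * ab by blast
   moreover have "b * b' \<notin> P" using p * ab by auto
   ultimately show False by metis
  qed
  ultimately show "c \<in> mx (localize T P)" using m by blast
 qed
qed

lemma submod_max_ideal_localize:
 assumes P: "prime_at T P" shows "submod (localize T P) (mx (localize T P))"
proof -
 note p = prime_atD[OF P] and r = ring_setD[OF prime_atD(1)[OF P]]
 note m = max_ideal_localize[OF P]
 show ?thesis unfolding submod_def
 proof (intro conjI ballI)
  show "0 \<in> mx (localize T P)" unfolding m using p r by (intro exI[of _ 0] exI[of _ 1]) auto
 next
  fix c c' assume "c \<in> mx (localize T P)" "c' \<in> mx (localize T P)"
  then obtain a b a' b' where *: "a \<in> P" "b \<in> T" "b \<notin> P" "c = a / b"
   "a' \<in> P" "b' \<in> T" "b' \<notin> P" "c' = a' / b'" unfolding m by blast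
  hence "b \<noteq> 0" "b' \<noteq> 0" using p(6) by metis+
  hence "c + c' = (a * b' + a' * b) / (b * b')" using * by (simp add: field_simps)
  moreover have "b * b' \<in> T" "b * b' \<notin> P" "a * b' + a' * b \<in> P" using * p r submodD(2,4)[OF p(2)] by auto
  ultimately show "c + c' \<in> mx (localize T P)" unfolding m by blast
 next
  fix c' c assume c': "c' \<in> localize T P" and "c \<in> mx (localize T P)"
  then obtain a b where *: "a \<in> P" "b \<in> T" "b \<notin> P" "c = a / b" unfolding m by blast
  obtain a' b' where **: "a' \<in> T" "b' \<in> T" "b' \<notin> P" "c' = a' / b'" using c' localizeE[OF P] by metis
  have "c' * c = (a' * a) / (b' * b)" using * ** by simp
  moreover have "b' * b \<in> T" "b' * b \<notin> P" "a' * a \<in> P" using * ** p r submodD(3)[OF p(2)] by auto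
  ultimately show "c' * c \<in> mx (localize T P)" unfolding m by blast
 qed
qed

lemma max_ideal_localize_contract:
 assumes P: "prime_at T P" and t: "t \<in> T"
 shows "t \<in> mx (localize T P) \<longleftrightarrow> t \<in> P"
proof -
 note p = prime_atD[OF P]
 show ?thesis
 proof
  assume "t \<in> mx (localize T P)"
  then obtain a b where ab: "a \<in> P" "b \<in> T" "b \<notin> P" "t = a / b" using max_ideal_localize[OF P] by blast
  hence "t * b = a" using p(6) by auto
  thus "t \<in> P" using p(5)[OF t ab(2)] ab by metis
 next
  assume "t \<in> P"
  thus "t \<in> mx (localize T P)" unfolding max_ideal_localize[OF P]
   using p ring_setD(2)[OF p(1)] by (intro exI[of _ t] exI[of _ 1]) auto
 qed
qed

context const_field
begin

text \<open>A maximal ideal whose residue field is the field of constants, that is, a rational point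
  of the affine scheme of \<open>T\<close>.\<close>

definition resid :: "'f set => 'f set => bool" where
 "resid T P \<longleftrightarrow> ring_set T \<and> KK \<subseteq> T \<and> submod T P \<and> P \<subseteq> T \<and> 1 \<notin> P \<and> (\<forall>t\<in>T. \<exists>c. t - K c \<in> P)"

lemma residD:
 assumes "resid T P"
 shows "ring_set T" "KK \<subseteq> T" "K c \<in> T" "submod T P" "P \<subseteq> T" "1 \<notin> P" "t \<in> T ==> \<exists>c. t - K c \<in> P"
 using assms unfolding resid_def by auto

lemma resid_const:
 assumes "resid T P" "K c \<in> P" shows "c = 0"
proof (rule ccontr)
 assume "c \<noteq> 0"
 hence "K (inverse c) * K c = 1" by (simp add: K_mult[symmetric])
 thus False using submodD(3)[OF residD(4)[OF assms(1)] residD(3)[OF assms(1)] assms(2)]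
   residD(6)[OF assms(1)] by metis
qed

lemma resid_prime_at:
 assumes "resid T P" shows "prime_at T P"
proof -
 note d = residD[OF assms]
 have "a \<in> P" if ab: "a \<in> T" "b \<in> T" "a * b \<in> P" "b \<notin> P" for a b
 proof -
  obtain c where c: "b - K c \<in> P" using d(7)[OF ab(2)] by blast
  hence c0: "c \<noteq> 0" using ab(4) by auto
  have "a * (b - K c) \<in> P" using submodD(3)[OF d(4)] ab c by blast
  hence "a * b - a * (b - K c) \<in> P" using submod_diff[OF d(4,1)] ab by blast
  hence "K c * a \<in> P" by (simp add: algebra_simps)
  hence "K (inverse c) * (K c * a) \<in> P" using submodD(3)[OF d(4) d(3)] by blast
  thus ?thesis using c0 by (simp add: mult.assoc[symmetric] K_mult[symmetric])
 qed
 thus ?thesis unfolding prime_at_def using d by blast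
qed

lemma resid_maximalideal:
 assumes "resid T P" shows "maximalideal P (ring_on T)"
proof (rule maximalidealI)
 note d = residD[OF assms]
 show "ideal P (ring_on T)" using d ideal_ring_on_iff by blast
 show "carrier (ring_on T) \<noteq> P" using d ring_setD(2)[OF d(1)] by auto
 fix J assume "ideal J (ring_on T)" "P \<subseteq> J" "J \<subseteq> carrier (ring_on T)"
 hence J: "submod T J" "P \<subseteq> J" "J \<subseteq> T" using ideal_ring_on_iff[OF d(1)] by auto
 show "J = P \<or> J = carrier (ring_on T)"
 proof (cases "J = P")
  case False
  then obtain j where j: "j \<in> J" "j \<notin> P" using J by blast
  then obtain c where c: "j - K c \<in> P" using d(7) J by blast
  hence "c \<noteq> 0" using j by auto
  have "j - (j - K c) \<in> J" using j c J submod_diff[OF J(1) d(1)] by blast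
  hence "K (inverse c) * K c \<in> J" using submodD(3)[OF J(1) d(3)] by simp
  hence "1 \<in> J" using \<open>c \<noteq> 0\<close> by (simp add: K_mult[symmetric])
  hence "T \<subseteq> J" using submodD(3)[OF J(1), of _ 1] by fastforce
  thus ?thesis using J by auto
 qed simp
qed

lemma loc_ring_localize:
 assumes "resid T P" shows "loc_ring (localize T P)"
proof -
 note d = residD[OF assms] and P = resid_prime_at[OF assms]
 note p = prime_atD[OF P] and r = ring_setD[OF prime_atD(1)[OF P]]
 have "\<exists>k. c - K k \<in> mx (localize T P)" if "c \<in> localize T P" for c
 proof -
  obtain a b where ab: "a \<in> T" "b \<in> T" "b \<notin> P" "b \<noteq> 0" "c = a / b"
   using localizeE[OF P \<open>c \<in> localize T P\<close>] by metis
  obtain \<alpha> \<beta> where k: "a - K \<alpha> \<in> P" "b - K \<beta> \<in> P" using d(7) ab by metis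
  have b0: "\<beta> \<noteq> 0" using k ab by auto
  have "c - K (\<alpha> / \<beta>) = (K \<beta> * a - K \<alpha> * b) / (K \<beta> * b)"
  proof -
   have "K (\<alpha> / \<beta>) = K \<alpha> / K \<beta>" by (simp only: divide_inverse K_mult K_inverse)
   thus ?thesis using ab(4,5) b0 by (simp add: field_simps)
  qed
  moreover have "K \<beta> * a - K \<alpha> * b = K \<beta> * (a - K \<alpha>) - K \<alpha> * (b - K \<beta>)" by (simp add: algebra_simps)
  hence "K \<beta> * a - K \<alpha> * b \<in> P"
   using k submodD(3)[OF d(4) d(3)] submod_diff[OF d(4,1)] by simp
  moreover have "K \<beta> \<notin> P" using resid_const[OF assms] b0 by blast
  hence "K \<beta> * b \<notin> P" "K \<beta> * b \<in> T" using p ab d(3) r by auto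
  ultimately show ?thesis unfolding max_ideal_localize[OF P] by blast
 qed
 thus ?thesis unfolding loc_ring_def using ring_set_localize[OF P] submod_max_ideal_localize[OF P] d(2) by blast
qed

section \<open>The affine charts of a blowup\<close>

lemma chart_iff: "t \<in> chart R z \<longleftrightarrow> (\<exists>a n. a \<in> mpow R n \<and> t = a / z ^ n)"
 unfolding blowup_chart_def by blast

lemma ring_set_chart:
 assumes "params R x y" "z \<in> mx R" "z \<noteq> 0"
 shows "ring_set (chart R z)" "R \<subseteq> chart R z" "r \<in> mx R ==> r / z \<in> chart R z"
  "a \<in> mpow R n ==> a / z ^ n \<in> chart R z"
proof -
 note p = paramsD[OF assms(1)]
 show I: "a / z ^ n \<in> chart R z" if "a \<in> mpow R n" for a n using that chart_iff by blast
 show sub: "R \<subseteq> chart R z" using I[of _ 0] by auto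
 show "r / z \<in> chart R z" if "r \<in> mx R" for r
  using I[of r "Suc 0"] that mpow_1[OF assms(1)] by simp
 show "ring_set (chart R z)" unfolding ring_set_def
 proof (intro conjI ballI)
  show "0 \<in> chart R z" "1 \<in> chart R z" using sub ring_setD[OF p(2)] by auto
 next
  fix t assume "t \<in> chart R z"
  then obtain a n where "a \<in> mpow R n" "t = a / z ^ n" unfolding chart_iff by blast
  thus "- t \<in> chart R z" using I[of "- a" n] submod_uminus[OF submod_mpow(1)[OF p(1)] p(2)] by simp
 next
  fix t u assume "t \<in> chart R z" "u \<in> chart R z"
  then obtain a n b m where *: "a \<in> mpow R n" "t = a / z ^ n" "b \<in> mpow R m" "u = b / z ^ m"
   unfolding chart_iff by blast
  have "t * u = (a * b) / z ^ (n + m)" using * by (simp add: power_add)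
  thus "t * u \<in> chart R z" using I mpow_mult[OF assms(1) *(1,3)] by metis
  have "t + u = (z ^ m * a + z ^ n * b) / z ^ (n + m)"
   using assms(3) unfolding *(2,4) by (simp add: field_simps power_add)
  moreover have "z ^ m * a \<in> mpow R (n + m)" "z ^ n * b \<in> mpow R (n + m)"
   using mpow_mult[OF assms(1) mpow_power[OF assms(1,2)]] * by (metis add.commute)+
  ultimately show "t + u \<in> chart R z" using I submodD(2)[OF submod_mpow(1)[OF p(1)]] by metis
 qed
qed

text \<open>The point of the exceptional divisor at which the coordinate w / z vanishes. The other
  points in this chart arise by replacing \<open>w\<close> with w - c z.\<close>

definition chart_ideal :: "'f set => 'f => 'f => 'f set" where
 "chart_ideal R z w = z *o chart R z +++ (w / z) *o chart R z"

definition blow :: "'f set => 'f => 'f => 'f set" where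
 "blow R z w = localize (chart R z) (chart_ideal R z w)"

context
 fixes R z w T s
 assumes R: "reg R" and p: "params R z w"
  and T_def: "T = chart R z" and s_def: "s = w / z"
begin

lemma zw0: "z \<noteq> 0" "w \<noteq> 0" "z \<in> R" "w \<in> R" "z \<in> mx R" "w \<in> mx R"
 using params_nonzero[OF R p] paramsD[OF p] by auto

lemma ring_set_T: "ring_set T" "R \<subseteq> T" "s \<in> T" "z \<in> T" "KK \<subseteq> T" "K c \<in> T" "a \<in> mpow R n ==> a / z ^ n \<in> T"
proof -
 note c = ring_set_chart[OF p zw0(5,1), folded T_def]
 show "ring_set T" by (rule c)
 show RT: "R \<subseteq> T" by (rule c)
 show "s \<in> T" unfolding s_def by (intro c zw0)
 show "z \<in> T" using RT zw0 by blast
 show "KK \<subseteq> T" using RT loc_ringD(3)[OF regD(1)[OF R]] by blast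
 thus "K c \<in> T" by blast
 show "a \<in> mpow R n ==> a / z ^ n \<in> T" by (rule c)
qed

lemma ev_in_T: "ev s q \<in> T"
 by (induction q) (use ring_set_T in \<open>auto simp: ring_setD\<close>)

text \<open>The exceptional divisor is cut out by \<open>z\<close>, and modulo \<open>z\<close> the
  chart is the polynomial ring in \<open>s\<close>; the polynomial \<open>q\<close> is the initial
  form of \<open>a\<close> read on it.\<close>

lemma chart_leading:
 assumes "a \<in> mpow R n"
 obtains q t where "degree q \<le> n" "t \<in> T" "a / z ^ n = ev s q + z * t" "q = 0 \<longleftrightarrow> a \<in> mpow R (Suc n)"
proof -
 obtain q where q: "degree q \<le> n" "a - z ^ n * ev s q \<in> mpow R (Suc n)" "q = 0 \<longleftrightarrow> a \<in> mpow R (Suc n)"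
  using leading_poly[OF R p assms] unfolding s_def by metis
 have "(a - z ^ n * ev s q) / z ^ Suc n \<in> T" using q ring_set_T by blast
 moreover have "a / z ^ n = ev s q + z * ((a - z ^ n * ev s q) / z ^ Suc n)" using zw0 by (simp add: field_simps)
 ultimately show ?thesis using that q by blast
qed

lemma chart_resid:
 assumes "t \<in> T" obtains q u where "u \<in> T" "t = ev s q + z * u"
proof -
 obtain a n where "a \<in> mpow R n" "t = a / z ^ n" using assms unfolding T_def chart_iff by blast
 thus ?thesis using chart_leading that by metis
qed

text \<open>Clearing denominators turns divisibility by \<open>z\<close> into membership of a form
  in the next power of the maximal ideal, which only the zero form satisfies.\<close>

lemma chart_ev_zero:
 assumes "ev s q \<in> z *o T" shows "q = 0"
proof -
 obtain t where t: "t \<in> T" "ev s q = z * t" using assms by (auto elim: smulE)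
 then obtain a n where an: "a \<in> mpow R n" "t = a / z ^ n" unfolding T_def chart_iff by blast
 define N where "N = degree q + n"
 have "z ^ N * ev s q = z ^ Suc (degree q) * a" using t an zw0 by (simp add: N_def power_add)
 moreover have "z ^ Suc (degree q) * a \<in> mpow R (Suc (degree q) + n)"
  using mpow_mult[OF p mpow_power[OF p zw0(5)] an(1)] .
 ultimately have "z ^ N * ev s q \<in> mpow R (Suc N)" by (simp add: N_def)
 thus ?thesis using homogenize_mem_Suc[OF R p, of q N] by (simp add: N_def s_def)
qed

lemma chart_ideal_iff:
 "t \<in> chart_ideal R z w \<longleftrightarrow> (\<exists>q u. u \<in> T \<and> t = ev s q + z * u \<and> poly q 0 = 0)"
proof
 note r = ring_setD[OF ring_set_T(1)]
 assume "t \<in> chart_ideal R z w"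
 then obtain a b where ab: "a \<in> T" "b \<in> T" "t = z * a + s * b"
  unfolding chart_ideal_def T_def[symmetric] s_def[symmetric] by (auto elim!: set_addE smulE)
 obtain q u where q: "u \<in> T" "b = ev s q + z * u" using chart_resid[OF ab(2)] .
 have "t = ev s (pCons 0 q) + z * (a + s * u)" using ab q by (simp add: algebra_simps)
 moreover have "a + s * u \<in> T" using ab q ring_set_T r by auto
 ultimately show "\<exists>q u. u \<in> T \<and> t = ev s q + z * u \<and> poly q 0 = 0"
  by (intro exI[of _ "pCons 0 q"]) auto
next
 assume "\<exists>q u. u \<in> T \<and> t = ev s q + z * u \<and> poly q 0 = 0"
 then obtain q u where q: "u \<in> T" "t = ev s q + z * u" "poly q 0 = 0" by blast
 obtain c q' where "q = pCons c q'" by (cases q)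
 hence "t = z * u + s * ev s q'" using q by simp
 thus "t \<in> chart_ideal R z w" unfolding chart_ideal_def T_def[symmetric] s_def[symmetric]
  using q ev_in_T by (simp only: set_addI smulI)
qed

lemma resid_chart: "resid T (chart_ideal R z w)"
 unfolding resid_def
proof (intro conjI ballI)
 note r = ring_setD[OF ring_set_T(1)]
 show "ring_set T" "KK \<subseteq> T" by (rule ring_set_T)+
 show "submod T (chart_ideal R z w)" unfolding chart_ideal_def T_def[symmetric]
  by (intro submod_add submod_smul submod_self ring_set_T)
 show "chart_ideal R z w \<subseteq> T" using ev_in_T ring_set_T r by (auto simp: chart_ideal_iff)
 show "1 \<notin> chart_ideal R z w"
 proof
  assume "1 \<in> chart_ideal R z w"
  then obtain q u where q: "u \<in> T" "1 = ev s q + z * u" "poly q 0 = 0" unfolding chart_ideal_iff by blast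
  hence "ev s (1 - q) = z * u" unfolding ev_diff ev_1 by (metis add_diff_cancel_left')
  hence "1 - q = 0" using chart_ev_zero q smulI by metis
  thus False using q by auto
 qed
 fix t assume "t \<in> T"
 then obtain q u where q: "u \<in> T" "t = ev s q + z * u" by (rule chart_resid)
 have "t - K (poly q 0) = ev s (q - [:poly q 0:]) + z * u" using q by (simp add: ev_diff)
 thus "\<exists>c. t - K c \<in> chart_ideal R z w" unfolding chart_ideal_iff using q
  by (intro exI[of _ "poly q 0"] exI[of _ "q - [:poly q 0:]"] exI[of _ u]) auto
qed

text \<open>Modulo \<open>z\<close> the chart is a polynomial ring in one variable over an
  algebraically closed field, and there every maximal ideal is generated by some s - c.\<close>

lemma chart_prime_classify:
 assumes "prime_at T P" "maximalideal P (ring_on T)" "z \<in> P"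
 obtains c where "P = chart_ideal R z (w - K c * z)"
proof -
 note pr = prime_atD[OF assms(1)] and r = ring_setD[OF ring_set_T(1)]
 have zT: "z * t \<in> P" if "t \<in> T" for t using submodD(4)[OF pr(2)] assms(3) that by blast
 have root: "\<exists>c. ev s [:- c, 1:] \<in> P" if "q \<noteq> 0" "ev s q \<in> P" for q using that
 proof (induction "degree q" arbitrary: q rule: less_induct)
  case less
  show ?case
  proof (cases "degree q = 0")
   case True
   then obtain k where k: "q = [:k:]" "k \<noteq> 0" using less.prems by (metis degree_eq_zeroE pCons_0_0)
   hence "K (inverse k) * K k \<in> P" using less.prems ring_set_T submodD(3)[OF pr(2)] by auto
   hence "1 \<in> P" using k by (simp add: K_mult[symmetric])
   thus ?thesis using pr by blast
  next
   case False
   then obtain c where "poly q c = 0" using alg_closed_imp_poly_has_root by blast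
   then obtain q' where q': "q = [:- c, 1:] * q'" unfolding poly_eq_0_iff_dvd by (auto elim: dvdE)
   hence "ev s [:- c, 1:] * ev s q' \<in> P" using less.prems by (metis ev_mult)
   hence "ev s [:- c, 1:] \<in> P \<or> ev s q' \<in> P" using pr(5) ev_in_T by blast
   moreover have "q' \<noteq> 0" using q' less.prems by auto
   hence "degree q' < degree q" unfolding q' by (subst degree_mult_eq) auto
   ultimately show ?thesis using less.hyps \<open>q' \<noteq> 0\<close> by blast
  qed
 qed
 \<comment> \<open>Maximality applied to \<open>s\<close> gives 1 = s t + q with q in
   \<open>P\<close>; modulo \<open>z\<close> this places a polynomial 1 - s a, with constant term 1,
   in \<open>P\<close>.\<close>
 have "\<exists>q. q \<noteq> 0 \<and> ev s q \<in> P"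
 proof (cases "s \<in> P")
  case True
  thus ?thesis by (intro exI[of _ "[:0, 1:]"]) simp
 next
  case False
  interpret P: maximalideal P "ring_on T" by fact
  have J: "submod T (s *o T +++ P)" using pr by (intro submod_add submod_smul submod_self) auto
  have "s *o T +++ P \<subseteq> T" using pr(3) r(4,5) ring_set_T(3) by (auto elim!: set_addE smulE)
  moreover have "P \<subseteq> s *o T +++ P" using pr by (intro set_add_ub2[of T] submod_smul submod_self) auto
  ultimately have "s *o T +++ P = P \<or> s *o T +++ P = T"
   using P.I_maximal[of "s *o T +++ P"] J ideal_ring_on_iff[OF pr(1)] by simp
  moreover have "s * 1 + 0 \<in> s *o T +++ P" using r pr(6) by (intro set_addI smulI) auto
  ultimately have "1 \<in> s *o T +++ P" using False r by auto
  then obtain t q where tq: "1 = s * t + q" "t \<in> T" "q \<in> P" by (auto elim!: set_addE smulE)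
  obtain a u where u: "u \<in> T" "t = ev s a + z * u" using chart_resid[OF tq(2)] .
  have "ev s (1 - pCons 0 a) = q + z * (s * u)" using tq u by (simp add: ev_diff algebra_simps)
  moreover have "q + z * (s * u) \<in> P" using tq u ring_set_T r zT submodD(2)[OF pr(2)] by auto
  moreover have "1 - pCons 0 a \<noteq> 0"
  proof
   assume "1 - pCons 0 a = 0"
   hence "poly (1 - pCons 0 a) 0 = 0" by simp
   thus False by simp
  qed
  ultimately show ?thesis by metis
 qed
 then obtain c where c: "ev s [:- c, 1:] \<in> P" using root by blast
 have p': "params R z (w - K c * z)" using params_shear[OF params_commute[OF p]] params_commute by blast
 have s': "(w - K c * z) / z = ev s [:- c, 1:]" unfolding s_def using zw0 by (simp add: field_simps K_minus)
 have sub: "chart_ideal R z (w - K c * z) \<subseteq> P"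
  unfolding chart_ideal_def T_def[symmetric] s' using assms(3) c submodD(2,4)[OF pr(2)] by (auto elim!: set_addE smulE)
 have mx: "maximalideal (chart_ideal R z (w - K c * z)) (ring_on T)"
  unfolding T_def by (rule resid_maximalideal) (rule const_field.resid_chart[OF const_field_axioms R p' refl refl])
 have "P = chart_ideal R z (w - K c * z)"
  using maximalideal.I_maximal[OF mx, of P] sub pr(2,3,4) ideal_ring_on_iff[OF pr(1), of P]
   ring_setD(2)[OF pr(1)] by auto
 thus ?thesis by (rule that)
qed

lemmas blow_prime = resid_prime_at[OF resid_chart]

lemma loc_ring_blow: "loc_ring (blow R z w)"
 unfolding blow_def T_def[symmetric] by (rule loc_ring_localize[OF resid_chart])

lemma chart_subset_blow: "T \<subseteq> blow R z w"
 unfolding blow_def T_def[symmetric] by (rule ring_set_localize[OF blow_prime])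

lemma params_blow: "params (blow R z w) z s"
proof -
 define L where "L = blow R z w"
 have L: "loc_ring L" "T \<subseteq> L" unfolding L_def by (rule loc_ring_blow chart_subset_blow)+
 note m = max_ideal_localize[OF blow_prime]
 note rL = ring_setD[OF loc_ringD(1)[OF L(1)]]
 have "mx L = z *o L +++ s *o L"
 proof
  show "mx L \<subseteq> z *o L +++ s *o L"
  proof
   fix c assume "c \<in> mx L"
   then obtain a b where ab: "a \<in> chart_ideal R z w" "b \<in> T" "b \<notin> chart_ideal R z w" "c = a / b"
    unfolding L_def blow_def T_def[symmetric] m by blast
   then obtain t u where tu: "t \<in> T" "u \<in> T" "a = z * t + s * u"
    unfolding chart_ideal_def T_def[symmetric] s_def[symmetric] by (auto elim!: set_addE smulE)
   have "c = z * (t / b) + s * (u / b)" using ab tu by (simp add: add_divide_distrib)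
   moreover have "t / b \<in> L" "u / b \<in> L"
    unfolding L_def blow_def T_def[symmetric] using ab tu by (auto intro: localizeI)
   ultimately show "c \<in> z *o L +++ s *o L" by (simp only: set_addI smulI)
  qed
  have "ev s 0 + z * 1 \<in> chart_ideal R z w" unfolding chart_ideal_iff using ring_setD(1,2)[OF ring_set_T(1)]
   by (intro exI[of _ 0] exI[of _ 1]) simp
  moreover have "ev s [:0, 1:] + z * 0 \<in> chart_ideal R z w"
   unfolding chart_ideal_iff using ring_setD(1,2)[OF ring_set_T(1)] by (intro exI[of _ "[:0, 1:]"] exI[of _ 0]) simp
  ultimately
  have "z \<in> chart_ideal R z w" "s \<in> chart_ideal R z w" by simp_all
  hence "z \<in> mx L" "s \<in> mx L" unfolding L_def blow_def T_def[symmetric]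
   using max_ideal_localize_contract[OF blow_prime] ring_set_T by blast+
  thus "z *o L +++ s *o L \<subseteq> mx L"
   using submodD(2,4)[OF loc_ringD(4)[OF L(1)]] by (auto elim!: set_addE smulE)
 qed
 thus ?thesis unfolding params_def using L by (simp add: L_def)
qed

lemma blow_frac:
 assumes "a \<in> blow R z w"
 obtains t b where "t \<in> T" "b \<in> T" "b \<noteq> 0" "a = t / b" "b \<notin> chart_ideal R z w"
  "b \<in> blow R z w" "inverse b \<in> blow R z w"
proof -
 obtain t b where tb: "t \<in> T" "b \<in> T" "b \<notin> chart_ideal R z w" "b \<noteq> 0" "a = t / b"
  using localizeE[OF blow_prime] assms unfolding blow_def T_def[symmetric] by metis
 have "b \<in> blow R z w" using tb chart_subset_blow by blast
 moreover have "1 / b \<in> blow R z w" unfolding blow_def T_def[symmetric]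
  using tb ring_setD(2)[OF ring_set_T(1)] by (intro localizeI)
 ultimately show ?thesis using that tb by (simp add: divide_inverse)
qed

text \<open>Modulo \<open>z\<close> the relation reads s q q' = 0 in a polynomial ring, where q' is
  nonzero because it comes from a denominator outside the ideal of the point.\<close>

lemma blow_regular_sequence:
 assumes "a \<in> blow R z w" "s * a \<in> z *o blow R z w" shows "a \<in> z *o blow R z w"
proof -
 note r = ring_setD[OF ring_set_T(1)]
 obtain t b where tb: "t \<in> T" "b \<in> T" "b \<noteq> 0" "a = t / b" "b \<notin> chart_ideal R z w"
  "inverse b \<in> blow R z w" using blow_frac[OF assms(1)] by metis
 obtain c where c: "c \<in> blow R z w" "s * a = z * c" using assms(2) by (auto elim: smulE)
 obtain t' b' where tb': "t' \<in> T" "b' \<in> T" "b' \<noteq> 0" "c = t' / b'" "b' \<notin> chart_ideal R z w"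
  using blow_frac[OF c(1)] by metis
 have eq: "s * t * b' = z * (t' * b)" using c(2) tb tb' by (simp add: field_simps)
 obtain q u where q: "u \<in> T" "t = ev s q + z * u" using chart_resid[OF tb(1)] .
 obtain q' u' where q': "u' \<in> T" "b' = ev s q' + z * u'" using chart_resid[OF tb'(2)] .
 have "q' \<noteq> 0" using tb'(5) q' unfolding chart_ideal_iff by (metis poly_0)
 have "ev s ([:0, 1:] * q * q') = z * (t' * b - s * (u * b' + ev s q * u'))"
  using eq by (simp add: q q' ev_mult algebra_simps)
 moreover have "t' * b - s * (u * b' + ev s q * u') \<in> T" using tb tb' q q' ring_set_T ev_in_T r by auto
 ultimately have "[:0, 1:] * q * q' = 0" using chart_ev_zero smulI by metis
 hence "q = 0" using \<open>q' \<noteq> 0\<close> by auto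
 hence "a = z * (u * inverse b)" using q tb by (simp add: divide_inverse)
 moreover have "u * inverse b \<in> blow R z w"
  using q tb chart_subset_blow ring_setD(5)[OF loc_ringD(1)[OF loc_ring_blow]] by blast
 ultimately show ?thesis by (simp add: smulI)
qed

text \<open>Modulo \<open>z\<close> the strict transform is a nonzero polynomial in \<open>s\<close>
  of degree at most e, so it cannot vanish to order e + 1 at the origin; denominators do not vanish
  there at all.\<close>

lemma strict_transform_order_aux:
 assumes f: "f \<in> mpow R e" "f \<notin> mpow R (Suc e)"
 shows "f / z ^ e \<notin> z *o blow R z w +++ s ^ Suc e *o blow R z w"
proof
 note r = ring_setD[OF ring_set_T(1)]
 assume "f / z ^ e \<in> z *o blow R z w +++ s ^ Suc e *o blow R z w"
 then obtain g h where gh: "f / z ^ e = z * g + s ^ Suc e * h" "g \<in> blow R z w" "h \<in> blow R z w"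
  by (auto elim!: set_addE smulE)
 obtain t b where tb: "t \<in> T" "b \<in> T" "b \<noteq> 0" "g = t / b" "b \<notin> chart_ideal R z w"
  using blow_frac[OF gh(2)] by metis
 obtain t' b' where tb': "t' \<in> T" "b' \<in> T" "b' \<noteq> 0" "h = t' / b'" "b' \<notin> chart_ideal R z w"
  using blow_frac[OF gh(3)] by metis
 define B where "B = b * b'"
 have B: "B \<in> T" "B \<notin> chart_ideal R z w" unfolding B_def using prime_atD(5)[OF blow_prime] tb tb' r by auto
 obtain q u where q: "degree q \<le> e" "u \<in> T" "f / z ^ e = ev s q + z * u" "q = 0 \<longleftrightarrow> f \<in> mpow R (Suc e)"
  using chart_leading[OF f(1)] .
 have q0: "q \<noteq> 0" using q f by blast
 obtain qB uB where qB: "uB \<in> T" "B = ev s qB + z * uB" using chart_resid[OF B(1)] .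
 obtain q' u' where q': "u' \<in> T" "t' * b = ev s q' + z * u'" using chart_resid[OF r(5)[OF tb'(1) tb(2)]] .
 have nz: "poly qB 0 \<noteq> 0" using B(2) qB unfolding chart_ideal_iff by blast
 have "B * (ev s q + z * u) = z * (t * b') + s ^ Suc e * (t' * b)"
  unfolding q(3)[symmetric] gh(1) B_def tb(4) tb'(4) using tb(3) tb'(3) by (simp add: field_simps)
 hence "ev s (qB * q - [:0, 1:] ^ Suc e * q') =
   z * (t * b' + s ^ Suc e * u' - uB * (ev s q + z * u) - ev s qB * u)"
  by (simp only: qB q' ev_diff ev_mult ev_power) (simp add: algebra_simps)
 moreover have "t * b' + s ^ Suc e * u' - uB * (ev s q + z * u) - ev s qB * u \<in> T"
  using tb tb' q q' qB ring_set_T ev_in_T by (intro r) auto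
 ultimately have "qB * q - [:0, 1:] ^ Suc e * q' = 0" using chart_ev_zero smulI by metis
 hence "qB * q = [:0, 1:] ^ Suc e * q'" by (simp only: right_minus_eq)
 hence "[:- 0, 1:] ^ Suc e dvd qB * q" by (metis dvd_triv_left minus_zero)
 moreover have "qB * q \<noteq> 0" using q0 nz by auto
 ultimately have "Suc e \<le> Polynomial.order 0 (qB * q)" using order_divides by blast
 also have "\<dots> = Polynomial.order 0 q" using \<open>qB * q \<noteq> 0\<close> nz by (simp add: order_mult order_0I)
 also have "\<dots> \<le> e" using order_degree[OF q0] q(1) le_trans by blast
 finally show False by simp
qed

text \<open>Multiplicity does not grow under a blowup. Every monomial of degree e + 1 in
  \<open>z\<close>, \<open>s\<close> other than s^(e + 1) is divisible by \<open>z\<close>, which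
  reduces the claim to the computation modulo \<open>z\<close>.\<close>

lemma strict_transform_order:
 assumes f: "f \<in> mpow R e" "f \<notin> mpow R (Suc e)"
 shows "f / z ^ e \<notin> mpow (blow R z w) (Suc e)"
proof
 define L where "L = blow R z w"
 note PL = paramsD[OF params_blow, folded L_def] and rL = ring_setD[OF paramsD(2)[OF params_blow], folded L_def]
 assume "f / z ^ e \<in> mpow (blow R z w) (Suc e)"
 then obtain c where c: "\<forall>i. c i \<in> L" "f / z ^ e = (\<Sum>i\<le>Suc e. c i * (z ^ (Suc e - i) * s ^ i))"
  using mpow_iff[OF params_blow] unfolding L_def by blast
 define J where "J = z *o L +++ s ^ Suc e *o L"
 have J: "submod L J" unfolding J_def by (intro submod_add submod_smul submod_self PL(2))
 have "f / z ^ e \<in> J" unfolding c(2)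
 proof (rule submod_sum[OF J])
  fix i assume i: "i \<in> {..Suc e}"
  have "z * (c i * z ^ (e - i) * s ^ i) + s ^ Suc e * 0 \<in> J" "z * 0 + s ^ Suc e * c i \<in> J"
   unfolding J_def using c(1) PL(6,7) by (intro set_addI smulI rL; blast intro: rL)+
  moreover have "c i * (z ^ (Suc e - i) * s ^ i) = z * (c i * z ^ (e - i) * s ^ i)" if "i \<le> e"
   using that by (simp add: Suc_diff_le ac_simps)
  moreover have "c i * (z ^ (Suc e - i) * s ^ i) = s ^ Suc e * c i" if "\<not> i \<le> e"
  proof -
   have "i = Suc e" using that i by simp
   thus ?thesis by simp
  qed
  ultimately show "c i * (z ^ (Suc e - i) * s ^ i) \<in> J"
   by (cases "i \<le> e") (simp_all only: add_0_right add_0_left mult_zero_right simp_thms)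
 qed
 thus False using strict_transform_order_aux[OF f] unfolding J_def L_def by blast
qed

text \<open>The parameter \<open>z\<close> has order one and may be cancelled. The argument uses
  only that \<open>z\<close>, \<open>s\<close> is a regular sequence, since it is itself an
  ingredient of the proof of regularity.\<close>

lemma blow_cancel:
 assumes a: "a \<in> blow R z w" and za: "z * a \<in> mpow (blow R z w) (Suc n)"
 shows "a \<in> mpow (blow R z w) n"
proof -
 define L where "L = blow R z w"
 note p' = params_blow[folded L_def]
 note PL = paramsD[OF p'] and rL = ring_setD[OF paramsD(2)[OF p']]
 obtain c where c: "\<forall>i. c i \<in> L" "z * a = (\<Sum>i\<le>Suc n. c i * (z ^ (Suc n - i) * s ^ i))"
  using za mpow_iff[OF params_blow] unfolding L_def by blast
 define g where "g = (\<Sum>i\<le>n. c i * (z ^ (n - i) * s ^ i))"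
 have g: "g \<in> mpow L n" unfolding g_def mpow_iff[OF p'] using c(1) by blast
 have za: "z * a = z * g + s ^ Suc n * c (Suc n)"
  unfolding c(2) g_def by (simp add: sum_distrib_left Suc_diff_le ac_simps)
 have cancel: "y \<in> z *o L" if "y \<in> L" "s ^ k * y \<in> z *o L" for y k using that(2)
 proof (induction k)
  case (Suc k)
  thus ?case using blow_regular_sequence[of "s ^ k * y", folded L_def] that(1) PL(7) rL by (simp add: mult.assoc)
 qed simp
 have "s ^ Suc n * c (Suc n) = z * (a - g)" using za by (simp add: algebra_simps)
 moreover have "a - g \<in> L" using rL(6)[of a g] a g submod_mpow(2)[OF PL(1)] unfolding L_def by blast
 ultimately have "s ^ Suc n * c (Suc n) \<in> z *o L" by (simp only: smulI)
 then obtain d where d: "c (Suc n) = z * d" "d \<in> L" using cancel c(1) by (metis smulE)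
 have "z * a = z * (g + s ^ Suc n * d)" unfolding za d(1) by (simp add: algebra_simps)
 hence "a = g + s ^ Suc n * d" using zw0(1) by simp
 moreover have "s ^ Suc n \<in> mpow L n" using mpow_power[OF p' PL(5), of "Suc n"] mpow_antimono_Suc[OF p'] by blast
 hence "s ^ Suc n * d \<in> mpow L n" using submodD(4)[OF submod_mpow(1)[OF PL(1)] d(2)] by blast
 ultimately show ?thesis using submodD(2)[OF submod_mpow(1)[OF PL(1)] g] unfolding L_def by simp
qed

text \<open>Only separatedness takes work. Clearing denominators reduces it to an element f of
  \<open>R\<close> of order e, and in f = z^e (f / z^e) the second factor has order at most
  e.\<close>

theorem reg_blow: "reg (blow R z w)"
proof (rule regI[OF params_blow zw0(1)])
 show "a \<in> blow R z w ==> s * a \<in> z *o blow R z w ==> a \<in> z *o blow R z w" for a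
  by (rule blow_regular_sequence)
 fix a assume a: "a \<in> blow R z w" "a \<noteq> 0"
 define L where "L = blow R z w"
 note PL = paramsD[OF params_blow, folded L_def] and rL = ring_setD[OF paramsD(2)[OF params_blow], folded L_def]
 obtain t b where tb: "t \<in> T" "b \<in> L" "b \<noteq> 0" "a = t / b" unfolding L_def using blow_frac[OF a(1)] by metis
 obtain f n where f: "f \<in> mpow R n" "t = f / z ^ n" using tb(1) unfolding T_def chart_iff by blast
 have "f \<noteq> 0" using f tb a by auto
 have fR: "f \<in> R" using f(1) submod_mpow(2)[OF regD(1)[OF R]] by blast
 define e where "e = mord R f"
 have fe: "f \<in> mpow R e" "f \<notin> mpow R (Suc e)" using mem_mpow_iff[OF R fR \<open>f \<noteq> 0\<close>] by (auto simp: e_def)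
 have fL: "f / z ^ e \<in> L" using ring_set_T(7)[OF fe(1)] chart_subset_blow unfolding L_def by blast
 have red: "z ^ k * y \<in> mpow L (k + m) ==> y \<in> mpow L m" if "y \<in> L" for y k m
 proof (induction k)
  case (Suc k)
  have "z ^ k * y \<in> L" using rL(5)[OF rL(7)[OF PL(6)] that] .
  thus ?case using blow_cancel[of "z ^ k * y" "k + m", folded L_def] Suc by (simp add: mult.assoc)
 qed simp
 show "\<exists>n. a \<notin> mpow (blow R z w) n"
 proof (intro exI notI)
  \<comment> \<open>The exponent e + (e + 1) leaves e + 1 for f / z^e after \<open>z\<close> has
    been cancelled e times.\<close>
  assume "a \<in> mpow (blow R z w) (e + Suc e)"
  hence "b * z ^ n * a \<in> mpow L (e + Suc e)"
   using submodD(3)[OF submod_mpow(1)[OF PL(1)] rL(5)[OF tb(2) rL(7)[OF PL(6)]]] unfolding L_def by blast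
  moreover have "b * z ^ n * a = z ^ e * (f / z ^ e)" using tb f zw0 by simp
  ultimately have "z ^ e * (f / z ^ e) \<in> mpow L (e + Suc e)" by metis
  from red[OF fL this] show False using strict_transform_order[OF fe] unfolding L_def by blast
 qed
qed

end

lemmas zw1 = zw0[OF _ _ refl refl] and params_blow1 = params_blow[OF _ _ refl refl]

lemma blow_divide_power: "reg R ==> params R z w ==> a \<in> mpow R n ==> a / z ^ n \<in> blow R z w"
 using ring_set_T(7)[OF _ _ refl refl] chart_subset_blow[OF _ _ refl refl] by blast

lemma blow_divide: "reg R ==> params R z w ==> a \<in> mx R ==> a / z \<in> blow R z w"
 using blow_divide_power[of R z w a "Suc 0"] mpow_1 by simp

end

section \<open>Exceptional points and strict transforms\<close>

context const_field
begin

text \<open>If \<open>x\<close> were in the square of the maximal ideal, x / x^2 would lie in the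
  chart and an ideal containing \<open>x\<close> would contain 1. So \<open>x\<close> extends to a
  parameter pair, and the classification of the points of its chart applies.\<close>

lemma exceptional_pointsE:
 assumes R: "reg R" and "R' \<in> exc R"
 obtains z w where "params R z w" "R' = blow R z w"
proof -
 obtain x P where x: "x \<in> mx R" "x \<noteq> 0" "maximalideal P (ring_on (chart R x))" "x \<in> P"
  and R': "R' = localize (chart R x) P"
  using assms(2) unfolding exceptional_points_def by blast
 obtain x0 y0 where p0: "params R x0 y0" using regD(3)[OF R] by blast
 note c = ring_set_chart[OF p0 x(1,2)]
 note P = maximalideal_imp_prime_at[OF c(1) x(3)]
 have "x \<notin> mpow R 2"
 proof
  assume "x \<in> mpow R 2"
  hence "x / x ^ 2 \<in> chart R x" by (rule c(4))
  hence "x * (x / x ^ 2) \<in> P" using submodD(4)[OF prime_atD(2)[OF P]] x(4) by blast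
  thus False using x(2) prime_atD(4)[OF P] by (simp add: power2_eq_square)
 qed
 then obtain w where w: "params R x w" using params_extend[OF R x(1)] by blast
 obtain k where k: "P = chart_ideal R x (w - K k * x)" using chart_prime_classify[OF R w refl refl P x(3,4)] .
 have "params R x (w - K k * x)" using params_shear[OF params_commute[OF w]] params_commute by blast
 thus ?thesis using that R' k unfolding blow_def by blast
qed

lemma blow_exceptional_points:
 assumes R: "reg R" and p: "params R z w" shows "blow R z w \<in> exc R"
proof -
 note rs = resid_chart[OF R p refl refl]
 have "z * 1 + (w / z) * 0 \<in> chart_ideal R z w" unfolding chart_ideal_def
  using ring_setD(1,2)[OF residD(1)[OF rs]] by (intro set_addI smulI)
 thus ?thesis unfolding exceptional_points_def blow_def using resid_maximalideal[OF rs] zw1[OF R p] by auto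
qed

lemma reg_exceptional: "reg R ==> R' \<in> exc R ==> reg R'"
 using exceptional_pointsE reg_blow by metis

section \<open>Domination of local rings\<close>

definition dominates :: "'f set => 'f set => bool" where
 "dominates S R \<longleftrightarrow> R \<subseteq> S \<and> R \<inter> mx S = mx R"

lemma dominates_refl: "loc_ring R ==> dominates R R"
 unfolding dominates_def using loc_ringD(5) by blast

lemma dominates_trans: "dominates S R ==> dominates T S ==> dominates T R"
 unfolding dominates_def by blast

lemma blow_dominates:
 assumes R: "reg R" and p: "params R z w" shows "dominates (blow R z w) R"
proof -
 note zw = zw1[OF R p] and T = ring_set_T[OF R p refl refl]
 note PL = paramsD[OF params_blow1[OF R p]]
 have sub: "R \<subseteq> blow R z w" using T(2) chart_subset_blow[OF R p refl refl] by blast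
 have "r \<in> mx (blow R z w)" if r: "r \<in> mx R" for r
 proof -
  have "r / z \<in> blow R z w" using blow_divide[OF R p r] .
  hence "z * (r / z) \<in> mx (blow R z w)" using submodD(4)[OF loc_ringD(4)[OF PL(1)]] PL(4) by blast
  thus ?thesis using zw(1) by simp
 qed
 moreover have "r \<in> mx R" if r: "r \<in> R" "r \<in> mx (blow R z w)" for r
 proof (rule ccontr)
  assume "r \<notin> mx R"
  hence "r \<noteq> 0" "inverse r \<in> R" using not_max_ideal_inverse[OF regD(1)[OF R] r(1)] by auto
  thus False using r(2) sub unfolding max_ideal_iff by blast
 qed
 ultimately show ?thesis unfolding dominates_def using sub loc_ringD(5)[OF regD(1)[OF R]] by blast
qed

lemma exceptional_dominates: "reg R ==> R' \<in> exc R ==> dominates R' R"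
 using exceptional_pointsE blow_dominates by metis

text \<open>A ring dominating both points makes the ratio of the two chart parameters a unit, so
  both points lie in the overlap of the charts. This is the separatedness of the blowup over
  \<open>R\<close>.\<close>

lemma exceptional_unique_aux:
 assumes R: "reg R" and p: "params R z w" and p': "params R z' w'"
  and S: "ring_set S" "dominates S (blow R z w)" "dominates S (blow R z' w')"
 shows "blow R z' w' \<subseteq> blow R z w"
proof
 let ?L = "blow R z w" and ?L' = "blow R z' w'"
 note zw = zw1[OF R p] and zw' = zw1[OF R p']
 note PL = paramsD[OF params_blow1[OF R p]]
 note PL' = paramsD[OF params_blow1[OF R p']]
 have unit: "inverse b \<in> ?L" if b: "b \<in> ?L" "b \<noteq> 0" "inverse b \<in> S" for b
 proof (rule ccontr)
  assume "inverse b \<notin> ?L"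
  hence "b \<in> mx ?L" using b max_ideal_iff by blast
  hence "b \<in> mx S" using S(2) unfolding dominates_def by blast
  thus False using max_ideal_iff b by blast
 qed
 have "z' / z \<in> ?L" using blow_divide[OF R p zw'(5)] by blast
 moreover have "z / z' \<in> ?L'" using blow_divide[OF R p' zw(5)] by blast
 hence "inverse (z' / z) \<in> S" using S(3) unfolding dominates_def by auto
 moreover have "z' / z \<noteq> 0" using zw(1) zw'(1) by simp
 ultimately have "inverse (z' / z) \<in> ?L" using unit by blast
 hence zz: "z / z' \<in> ?L" by simp
 have T': "t \<in> ?L" if "t \<in> chart R z'" for t
 proof -
  obtain a n where an: "a \<in> mpow R n" "t = a / z' ^ n" using \<open>t \<in> chart R z'\<close>[unfolded chart_iff] by blast
  hence "t = (a / z ^ n) * (z / z') ^ n" using zw(1) by (simp add: power_divide)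
  moreover have "a / z ^ n \<in> ?L" using blow_divide_power[OF R p an(1)] by blast
  ultimately show ?thesis using ring_setD(5)[OF PL(2) _ ring_setD(7)[OF PL(2) zz]] by blast
 qed
 fix c assume "c \<in> ?L'"
 then obtain t b where tb: "t \<in> chart R z'" "b \<in> chart R z'" "b \<noteq> 0" "c = t / b"
  "inverse b \<in> ?L'" using blow_frac[OF R p' refl refl] by metis
 have "inverse b \<in> ?L" using unit[OF T'[OF tb(2)] tb(3)] tb(5) S(3) unfolding dominates_def by blast
 thus "c \<in> ?L" using tb T' ring_setD(5)[OF PL(2)] by (simp add: divide_inverse)
qed

lemma exceptional_unique:
 assumes "reg R" "R1 \<in> exc R" "R2 \<in> exc R" "ring_set S"
  "dominates S R1" "dominates S R2"
 shows "R1 = R2"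
 using assms exceptional_unique_aux by (metis (no_types, opaque_lifting) exceptional_pointsE subset_antisym)

lemma params_not_multiple:
 assumes R: "reg R" and p: "params R z w" shows "w \<notin> z *o R"
proof
 assume "w \<in> z *o R"
 then obtain r where r: "w = z * r" "r \<in> R" by (auto elim: smulE)
 obtain c where c: "r - K c \<in> mx R" using loc_ringD(6)[OF regD(1)[OF R] r(2)] by blast
 have "z * (r - K c) \<in> mpow R (Suc 0 + Suc 0)"
  using mpow_mult[OF p, of z "Suc 0" "r - K c" "Suc 0"] mpow_1[OF p] c zw1[OF R p] by simp
 hence "- (z * (r - K c)) \<in> mpow R (Suc (Suc 0))"
  using submod_uminus[OF submod_mpow(1)[OF regD(1)[OF R]] regD(2)[OF R]] by simp
 hence "(\<Sum>i\<le>Suc 0. K ((\<lambda>i. if i = 0 then c else - 1) i) * (z ^ (Suc 0 - i) * w ^ i)) \<in> mpow R (Suc (Suc 0))"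
  using r by (simp add: algebra_simps K_minus)
 hence "(if Suc 0 = 0 then c else - 1) = (0 :: 'k)" by (rule reg_independent[OF R p]) simp
 thus False by simp
qed

lemma exceptional_psubset:
 assumes R: "reg R" "R' \<in> exc R" shows "R \<subset> R'"
proof -
 obtain z w where p: "params R z w" "R' = blow R z w" using exceptional_pointsE[OF R] .
 have sub: "R \<subseteq> R'" using exceptional_dominates[OF R] unfolding dominates_def by blast
 have "w / z \<in> R'" using paramsD(7)[OF params_blow1[OF R(1) p(1)]] p by simp
 moreover have "w / z \<notin> R"
 proof
  assume "w / z \<in> R"
  hence "z * (w / z) \<in> z *o R" by (rule smulI)
  thus False using params_not_multiple[OF R(1) p(1)] zw1[OF R(1) p(1)] by simp
 qed
 ultimately show ?thesis using sub by blast
qed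

text \<open>Since y / x has residue 0 at \<open>L\<close>, the chart of \<open>x\<close> lies in
  \<open>L\<close> and its elements outside the ideal of the origin are units of \<open>L\<close>.
  Hence \<open>L\<close> dominates the origin, and two points dominated by one ring
  coincide.\<close>

lemma blow_eqI:
 assumes R: "reg R" and L: "L \<in> exc R" and p: "params R x y" and yx: "y / x \<in> mx L"
 shows "L = blow R x y"
proof -
 obtain z w where zw: "params R z w" "L = blow R z w" using exceptional_pointsE[OF R L] .
 note z = zw1[OF R zw(1)] and x = zw1[OF R p]
 note PL = paramsD[OF params_blow1[OF R zw(1)], folded zw(2)]
 note rL = ring_setD[OF PL(2)] and mL = submodD[OF loc_ringD(4)[OF PL(1)]]
 note rs = resid_chart[OF R p refl refl]
 note pP = resid_prime_at[OF rs]
 have RL: "R \<subseteq> L" "mx R \<subseteq> mx L"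
  using exceptional_dominates[OF R L] unfolding dominates_def by blast+
 obtain a b where ab: "z = x * a + y * b" "a \<in> R" "b \<in> R" using z(5) paramsD(3)[OF p] by (metis set_addE smulE)
 have "z / x = a + (y / x) * b" using ab(1) x(1) by (simp add: add_divide_distrib)
 moreover have "a + (y / x) * b \<in> L" using rL(4)[OF _ rL(5)] ab(2,3) RL(1) yx loc_ringD(5)[OF PL(1)] by blast
 ultimately have zx: "z / x \<in> L" by simp
 have TL: "chart R x \<subseteq> L"
 proof
  fix t assume "t \<in> chart R x"
  then obtain c n where c: "c \<in> mpow R n" "t = c / x ^ n" unfolding chart_iff by blast
  hence "t = (c / z ^ n) * (z / x) ^ n" using z(1) by (simp add: power_divide)
  moreover have "c / z ^ n \<in> L" using blow_divide_power[OF R zw(1) c(1)] zw(2) by blast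
  ultimately show "t \<in> L" using rL(5)[OF _ rL(7)[OF zx]] by blast
 qed
 have Pm: "chart_ideal R x y \<subseteq> mx L"
 proof
  fix t assume "t \<in> chart_ideal R x y"
  then obtain u v where uv: "u \<in> chart R x" "v \<in> chart R x" "t = x * u + (y / x) * v"
   unfolding chart_ideal_def by (metis set_addE smulE)
  thus "t \<in> mx L" using mL(2)[OF mL(4)[OF _ subsetD[OF RL(2) x(5)]] mL(4)[OF _ yx]] TL by blast
 qed
 have notP: "b \<notin> mx L" if b: "b \<in> chart R x" "b \<notin> chart_ideal R x y" for b
 proof -
  obtain c where c: "b - K c \<in> chart_ideal R x y" using residD(7)[OF rs b(1)] by blast
  hence "c \<noteq> 0" using b(2) by auto
  hence "K c + (b - K c) \<notin> mx L"
   using add_notin_max_ideal[OF PL(1) K_notin_max_ideal[OF PL(1)]] c Pm by blast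
  thus ?thesis by simp
 qed
 let ?M = "blow R x y"
 have sub: "?M \<subseteq> L"
 proof
  fix c assume "c \<in> ?M"
  then obtain t b where tb: "t \<in> chart R x" "b \<in> chart R x" "c = t / b" "b \<notin> chart_ideal R x y"
   using blow_frac[OF R p refl refl] by metis
  hence "inverse b \<in> L" using not_max_ideal_inverse(2)[OF PL(1)] notP TL by blast
  thus "c \<in> L" using rL(5) tb TL by (auto simp: divide_inverse)
 qed
 note PM = paramsD[OF params_blow1[OF R p]]
 have "c \<in> mx L" if c: "c \<in> mx ?M" for c
 proof -
  obtain u v where "u \<in> ?M" "v \<in> ?M" "c = x * u + (y / x) * v" using c unfolding PM(3) by (metis set_addE smulE)
  thus ?thesis using mL(2)[OF mL(4)[OF _ subsetD[OF RL(2) x(5)]] mL(4)[OF _ yx]] sub by blast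
 qed
 hence "dominates L ?M" unfolding dominates_def using sub max_ideal_iff[of _ ?M] max_ideal_iff[of _ L] by blast
 thus ?thesis using exceptional_unique[OF R L blow_exceptional_points[OF R p] PL(2) dominates_refl[OF PL(1)]] by blast
qed

text \<open>A direction is tangent to y = 0, to x = 0, or to neither. In the last case
  \<open>x\<close> and \<open>y\<close> are both local equations of the exceptional divisor at
  \<open>L\<close>.\<close>

lemma exceptional_direction:
 assumes R: "reg R" and L: "L \<in> exc R" and p: "params R x y"
 shows "L = blow R x y \<or> L = blow R y x \<or>
  (\<exists>z w. params R z w \<and> L = blow R z w \<and> x / z \<in> L \<and> x / z \<notin> mx L \<and> y / z \<in> L \<and> y / z \<notin> mx L)"
proof -
 obtain z w where zw: "params R z w" "L = blow R z w" using exceptional_pointsE[OF R L] .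
 note z = zw1[OF R zw(1)] and x = zw1[OF R p]
 note PL = paramsD[OF params_blow1[OF R zw(1)], folded zw(2)]
 note mL = submodD[OF loc_ringD(4)[OF PL(1)]]
 have RL: "R \<subseteq> L" using exceptional_dominates[OF R L] unfolding dominates_def by blast
 have inL: "a / z \<in> L" if "a \<in> mx R" for a using blow_divide[OF R zw(1) that] zw(2) by blast
 obtain a b where ab: "z = x * a + y * b" "a \<in> R" "b \<in> R" using z(5) paramsD(3)[OF p] by (metis set_addE smulE)
 have "x / z \<notin> mx L \<or> y / z \<notin> mx L"
 proof (rule ccontr)
  assume "\<not> ?thesis"
  hence "(x / z) * a + (y / z) * b \<in> mx L" using mL(2,4) ab(2,3) RL by blast
  moreover have "(x / z) * a + (y / z) * b = (x * a + y * b) / z" by (simp add: add_divide_distrib)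
  hence "(x / z) * a + (y / z) * b = 1" using z(1) ab(1)[symmetric] by simp
  ultimately show False using one_notin_max_ideal[OF PL(1)] by simp
 qed
 moreover have "L = blow R y x" if "x / z \<in> mx L" "y / z \<notin> mx L"
 proof (rule blow_eqI[OF R L params_commute[OF p]])
  have "inverse (y / z) \<in> L" using not_max_ideal_inverse(2)[OF PL(1) inL[OF x(6)] that(2)] .
  hence "x / z * inverse (y / z) \<in> mx L" using mL(4) that(1) by blast
  thus "x / y \<in> mx L" using z(1) by simp
 qed
 moreover have "L = blow R x y" if "y / z \<in> mx L" "x / z \<notin> mx L"
 proof (rule blow_eqI[OF R L p])
  have "inverse (x / z) \<in> L" using not_max_ideal_inverse(2)[OF PL(1) inL[OF x(5)] that(2)] .
  hence "y / z * inverse (x / z) \<in> mx L" using mL(4) that(1) by blast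
  thus "y / x \<in> mx L" using z(1) by simp
 qed
 ultimately show ?thesis using zw inL x(5,6) by blast
qed

section \<open>Curves and their strict transforms\<close>

definition local_dom :: "'f set => bool" where
 "local_dom D \<longleftrightarrow> ring_set D \<and> submod D (mx D)"

lemma local_domD:
 assumes "local_dom D"
 shows "ring_set D" "submod D (mx D)" "mx D \<subseteq> D"
  "d \<in> D ==> d \<notin> mx D ==> d \<noteq> 0 \<and> inverse d \<in> D"
  "d \<in> D ==> inverse d \<in> D ==> d \<noteq> 0 ==> d \<notin> mx D"
  "a \<in> D ==> b \<in> D ==> a \<notin> mx D ==> b \<notin> mx D ==> a * b \<notin> mx D"
proof -
 show r: "ring_set D" and s: "submod D (mx D)" using assms by (auto simp: local_dom_def)
 show "mx D \<subseteq> D" unfolding max_ideal_def by blast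
 show i: "d \<in> D ==> d \<notin> mx D ==> d \<noteq> 0 \<and> inverse d \<in> D" for d using max_ideal_iff by blast
 show "d \<in> D ==> inverse d \<in> D ==> d \<noteq> 0 ==> d \<notin> mx D" using max_ideal_iff by blast
 assume ab: "a \<in> D" "b \<in> D" "a \<notin> mx D" "b \<notin> mx D"
 show "a * b \<notin> mx D"
 proof
  assume "a * b \<in> mx D"
  hence "inverse a * (a * b) \<in> mx D" using i[OF ab(1,3)] submodD(3)[OF s] by blast
  thus False using ab i[OF ab(1,3)] by (simp add: mult.assoc[symmetric])
 qed
qed

definition curve_at :: "'f set => 'f set => 'f => bool" where
 "curve_at D R f \<longleftrightarrow> local_dom D \<and> R \<subseteq> D \<and> f \<in> R \<and> f \<noteq> 0 \<and> R \<inter> mx D = f *o R"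

lemma curve_atD:
 assumes "curve_at D R f"
 shows "local_dom D" "R \<subseteq> D" "f \<in> R" "f \<noteq> 0" "a \<in> R ==> a \<in> f *o R \<longleftrightarrow> a \<in> mx D"
  "R \<inter> mx D = f *o R" using assms unfolding curve_at_def by blast+

lemma curve_at_mem:
 assumes "loc_ring R" "curve_at D R f" shows "f \<in> mx D" "f \<in> mx R"
proof -
 note r = loc_ringD(1)[OF assms(1)] and c = curve_atD[OF assms(2)]
 have "f * 1 \<in> f *o R" using ring_setD(2)[OF r] by (rule smulI)
 thus *: "f \<in> mx D" using c(3,5) by simp
 show "f \<in> mx R"
 proof (rule ccontr)
  assume "f \<notin> mx R"
  hence "inverse f \<in> D" using not_max_ideal_inverse[OF assms(1) c(3)] c(2) by blast
  thus False using local_domD(5)[OF c(1)] c * by blast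
 qed
qed

text \<open>The multiplicity is read off the ideal of the curve, so no local equation has to be
  chosen; a point off the curve gets 0.\<close>

definition mult_at :: "'f set => 'f set => nat" where
 "mult_at D R = (if R \<subseteq> D then (LEAST e. \<not> R \<inter> mx D \<subseteq> mpow R (Suc e)) else 0)"

lemma mult_at_eq_mord:
 assumes "reg R" "curve_at D R f" shows "mult_at D R = mord R f"
proof -
 note c = curve_atD[OF assms(2)] and M = submod_mpow(1)[OF regD(1)[OF assms(1)]]
 have "f *o R \<subseteq> mpow R n \<longleftrightarrow> f \<in> mpow R n" for n
 proof
  assume "f *o R \<subseteq> mpow R n"
  moreover have "f * 1 \<in> f *o R" using ring_setD(2)[OF regD(2)[OF assms(1)]] by (rule smulI)
  ultimately show "f \<in> mpow R n" by auto
 qed (use submodD(4)[OF M] in \<open>auto elim!: smulE\<close>)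
 thus ?thesis unfolding mult_at_def mord_def c(6) using c(2) by simp
qed

context
 fixes R z w T s L D f e
 assumes R: "reg R" and p: "params R z w" and T_def: "T = chart R z" and s_def: "s = w / z"
  and L_def: "L = blow R z w" and C: "curve_at D R f" and e_def: "e = mord R f"
begin

lemma strict_transform_mem: "f \<in> mpow R e" "f \<notin> mpow R (Suc e)" "f / z ^ e \<in> T" "f / z ^ e \<in> L" "e \<ge> 1"
proof -
 note c = curve_atD[OF C]
 show fe: "f \<in> mpow R e" "f \<notin> mpow R (Suc e)" unfolding e_def using mem_mpow_iff[OF R c(3,4)] by auto
 show "f / z ^ e \<in> T" using ring_set_T(7)[OF R p T_def s_def fe(1)] .
 thus "f / z ^ e \<in> L" using chart_subset_blow[OF R p T_def s_def] unfolding L_def by blast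
 show "e \<ge> 1" using mord_eq_0_iff[OF R c(3,4)] curve_at_mem(2)[OF regD(1)[OF R] C] unfolding e_def by auto
qed

text \<open>Otherwise both parameters would vanish on the curve and be multiples of
  \<open>f\<close>. As \<open>z\<close> has order one its cofactor is a unit, and then
  \<open>w\<close> would be a multiple of \<open>z\<close>.\<close>

lemma exceptional_not_in_curve:
 assumes "L \<subseteq> D" shows "z \<notin> mx D"
proof
 note c = curve_atD[OF C] and zw = zw1[OF R p]
 note PL = paramsD[OF params_blow[OF R p refl s_def], folded L_def]
 assume z: "z \<in> mx D"
 have "z * s \<in> mx D" using submodD(4)[OF local_domD(2)[OF c(1)] _ z] PL(7) assms by blast
 hence "w \<in> mx D" using zw unfolding s_def by simp
 then obtain a b where ab: "z = f * a" "a \<in> R" "w = f * b" "b \<in> R" using z c(5) zw by (metis smulE)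
 have nz: "a \<noteq> 0" "b \<noteq> 0" using ab zw by auto
 have "a \<notin> mx R"
 proof
  assume "a \<in> mx R"
  hence "mord R a \<noteq> 0" using mord_eq_0_iff[OF R ab(2) nz(1)] by blast
  hence "2 \<le> mord R z"
   using mord_mult[OF R c(3,4) ab(2) nz(1)] strict_transform_mem(5) unfolding ab(1) e_def by simp
  thus False using mem_mpow_iff[OF R zw(3,1)] params_nonzero[OF R p] by blast
 qed
 hence "inverse a \<in> R" using not_max_ideal_inverse[OF regD(1)[OF R] ab(2)] by blast
 hence "z * (inverse a * b) \<in> z *o R" using ab(4) ring_setD(5)[OF regD(2)[OF R]] by (intro smulI)
 moreover have "z * (inverse a * b) = w" using ab(1,3) nz by simp
 ultimately have "w \<in> z *o R" by simp
 thus False using params_not_multiple[OF R p] by blast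
qed

text \<open>A function g / z^n on the chart that vanishes on the curve has g = f a, and
  multiplicativity of initial forms shows that \<open>a\<close> has order at least n - e. So it is a
  multiple of f / z^e.\<close>

lemma chart_curve:
 assumes z: "z \<notin> mx D"
 shows "T \<subseteq> D" "f / z ^ e \<in> mx D" "T \<inter> mx D = (f / z ^ e) *o T"
proof -
 note c = curve_atD[OF C] and zw = zw1[OF R p] and D = local_domD[OF curve_atD(1)[OF C]]
 have zD: "inverse z \<in> D" "z \<in> D" using D(4) z c(2) zw(3) by blast+
 have MR: "mpow R n \<subseteq> R" for n using submod_mpow(2)[OF regD(1)[OF R]] .
 have inD: "a / z ^ n \<in> D" if "a \<in> R" for a n
  using ring_setD(5)[OF D(1) subsetD[OF c(2) that] ring_setD(7)[OF D(1) zD(1), of n]]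
  by (simp add: divide_inverse power_inverse)
 show TD: "T \<subseteq> D"
 proof
  fix t assume "t \<in> T"
  then obtain a n where "a \<in> mpow R n" "t = a / z ^ n" unfolding T_def chart_iff by blast
  thus "t \<in> D" using inD MR[of n] by blast
 qed
 have inm: "a / z ^ n \<in> mx D" if "a \<in> mx D" for a n
  using submodD(4)[OF D(2) ring_setD(7)[OF D(1) zD(1), of n] that] by (simp add: divide_inverse power_inverse)
 show f': "f / z ^ e \<in> mx D" using inm curve_at_mem(1)[OF regD(1)[OF R] C] by blast
 show "T \<inter> mx D = (f / z ^ e) *o T"
 proof
  show "(f / z ^ e) *o T \<subseteq> T \<inter> mx D"
  proof
   fix a assume "a \<in> (f / z ^ e) *o T"
   then obtain b where b: "b \<in> T" "a = (f / z ^ e) * b" by (rule smulE)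
   thus "a \<in> T \<inter> mx D"
    using submodD(4)[OF D(2) _ f'] ring_setD(5)[OF ring_set_T(1)[OF R p T_def s_def] strict_transform_mem(3)]
     TD by blast
  qed
  show "T \<inter> mx D \<subseteq> (f / z ^ e) *o T"
  proof
   fix t assume t: "t \<in> T \<inter> mx D"
   then obtain g n where g: "g \<in> mpow R n" "t = g / z ^ n" unfolding T_def Int_iff chart_iff by blast
   have "t * z ^ n \<in> mx D" using submodD(4)[OF D(2) ring_setD(7)[OF D(1) zD(2)]] t by blast
   hence "g \<in> mx D" using g zw by simp
   then obtain a where a: "g = f * a" "a \<in> R" using c(5) g MR by (metis smulE subsetD)
   show "t \<in> (f / z ^ e) *o T"
   proof (cases "n \<ge> e")
    case True
    hence "a \<in> mpow R (n - e)" using mpow_cancel[OF R strict_transform_mem(1,2) a(2), of "n - e"] g a by simp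
    hence "a / z ^ (n - e) \<in> T" using ring_set_T(7)[OF R p T_def s_def] by blast
    moreover have "t = (f / z ^ e) * (a / z ^ (n - e))" using g a True zw by (simp add: power_add[symmetric])
    ultimately show ?thesis by (simp only: smulI)
   next
    case False
    have "z ^ (e - n) * a \<in> T" using ring_set_T(1,2,4)[OF R p T_def s_def] a(2) ring_setD(5,7) by blast
    moreover have "z ^ e = z ^ n * z ^ (e - n)" using False by (simp add: power_add[symmetric])
    hence "t = (f / z ^ e) * (z ^ (e - n) * a)" using g a zw by simp
    ultimately show ?thesis by (simp only: smulI)
   qed
  qed
 qed
qed

lemma strict_transform_curve_at:
 assumes "L \<subseteq> D" shows "curve_at D L (f / z ^ e)"
proof -
 note c = curve_atD[OF C] and zw = zw1[OF R p] and D = local_domD[OF curve_atD(1)[OF C]]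
 note z = exceptional_not_in_curve[OF assms]
 note rL = ring_setD[OF paramsD(2)[OF params_blow[OF R p T_def s_def]], folded L_def]
 have TL: "T \<subseteq> L" unfolding L_def by (rule chart_subset_blow[OF R p T_def s_def])
 have "L \<inter> mx D = (f / z ^ e) *o L"
 proof
  show "(f / z ^ e) *o L \<subseteq> L \<inter> mx D"
  proof
   fix a assume "a \<in> (f / z ^ e) *o L"
   then obtain b where b: "b \<in> L" "a = (f / z ^ e) * b" by (rule smulE)
   thus "a \<in> L \<inter> mx D"
    using submodD(4)[OF D(2) _ chart_curve(2)[OF z]] rL(5)[OF strict_transform_mem(4)] assms by blast
  qed
  show "L \<inter> mx D \<subseteq> (f / z ^ e) *o L"
  proof
   fix a assume a: "a \<in> L \<inter> mx D"
   then obtain t b where tb: "t \<in> T" "b \<noteq> 0" "a = t / b" "b \<in> L" "inverse b \<in> L"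
    using blow_frac[OF R p T_def s_def, folded L_def] by blast
   have "a * b \<in> mx D" using submodD(4)[OF D(2), of b a] tb(4) assms a by blast
   hence "t \<in> T \<inter> mx D" using tb by simp
   then obtain u where "t = (f / z ^ e) * u" "u \<in> T" unfolding chart_curve(3)[OF z] by (metis smulE)
   hence "a = (f / z ^ e) * (u * inverse b)" "u * inverse b \<in> L" using tb TL rL(5) by (auto simp: divide_inverse)
   thus "a \<in> (f / z ^ e) *o L" by (simp only: smulI)
  qed
 qed
 moreover have "f / z ^ e \<noteq> 0" using c(4) zw(1) by simp
 ultimately show ?thesis unfolding curve_at_def using c(1) assms strict_transform_mem(4) by blast
qed

lemma strict_transform_through_iff: "L \<subseteq> D \<longleftrightarrow> f / z ^ e \<in> mx L"
proof
 note c = curve_atD[OF C] and zw = zw1[OF R p] and D = local_domD[OF curve_atD(1)[OF C]]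
 note lL = loc_ring_blow[OF R p T_def s_def, folded L_def]
 show "f / z ^ e \<in> mx L" if "L \<subseteq> D"
  using curve_at_mem(2)[OF lL strict_transform_curve_at[OF that]] .
 assume f': "f / z ^ e \<in> mx L"
 have TL: "T \<subseteq> L" unfolding L_def by (rule chart_subset_blow[OF R p T_def s_def])
 \<comment> \<open>If \<open>z\<close> vanished on the curve, it would be \<open>f\<close> times a
   unit of \<open>R\<close>, and f / z^e would be a unit at \<open>L\<close>.\<close>
 have z: "z \<notin> mx D"
 proof
  assume "z \<in> mx D"
  then obtain a where a: "z = f * a" "a \<in> R" using c(5) zw by (metis smulE)
  hence "a \<noteq> 0" using zw by auto
  have "mord R z = 1" using params_nonzero[OF R p] mem_mpow_iff[OF R zw(3,1)] zw(5) mpow_1[OF p]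
   by (metis One_nat_def Suc_1 le_antisym not_less_eq_eq)
  hence "e + mord R a = 1" using mord_mult[OF R c(3,4) a(2) \<open>a \<noteq> 0\<close>] a unfolding e_def by simp
  hence e1: "e = 1" "mord R a = 0" using strict_transform_mem(5) by auto
  have "a \<in> L" using a(2) ring_set_T(2)[OF R p T_def s_def] TL by blast
  moreover have "(f / z ^ e) * a = 1" using a zw e1 by simp
  ultimately have "1 \<in> mx L" using submodD(4)[OF loc_ringD(4)[OF lL] _ f'] by metis
  thus False using one_notin_max_ideal[OF lL] by blast
 qed
 show "L \<subseteq> D"
 proof
  fix a assume "a \<in> L"
  then obtain t b where tb: "t \<in> T" "b \<in> T" "b \<noteq> 0" "a = t / b" "b \<in> L" "inverse b \<in> L"
   using blow_frac[OF R p T_def s_def, folded L_def] by metis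
  have TD: "T \<subseteq> D" by (rule chart_curve(1)[OF z])
  have "b \<notin> mx D"
  proof
   assume "b \<in> mx D"
   then obtain u where "b = (f / z ^ e) * u" "u \<in> T" using tb(2) chart_curve(3)[OF z] by (metis IntI smulE)
   hence "b \<in> mx L" using submodD(4)[OF loc_ringD(4)[OF lL] _ f'] TL by blast
   thus False using max_ideal_iff tb by blast
  qed
  hence "inverse b \<in> D" using D(4) tb(2) TD by blast
  thus "a \<in> D" using tb TD ring_setD(5)[OF D(1)] by (simp add: divide_inverse subset_iff)
 qed
qed

end

lemma exceptional_not_subset:
 assumes "reg R" "R' \<in> exc R" "\<not> R \<subseteq> D" shows "\<not> R' \<subseteq> D"
 using exceptional_psubset assms by blast

end

section \<open>The projection formula for a point blowup\<close>

definition ext_ideal :: "'f::field set => 'f set => 'f set => 'f set" where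
 "ext_ideal T P J = {j / b | j b. j \<in> J \<and> b \<in> T \<and> b \<notin> P}"

lemma ext_idealE:
 assumes "prime_at T P" "c \<in> ext_ideal T P J"
 obtains j b where "j \<in> J" "b \<in> T" "b \<notin> P" "b \<noteq> 0" "c = j / b"
 using assms prime_atD(6)[OF assms(1)] unfolding ext_ideal_def by blast

lemma ext_idealI: "j \<in> J ==> b \<in> T ==> b \<notin> P ==> j / b \<in> ext_ideal T P J"
 unfolding ext_ideal_def by blast

lemma submod_ext_ideal:
 assumes P: "prime_at T P" and J: "submod T J"
 shows "submod T (ext_ideal T P J)" "J \<subseteq> ext_ideal T P J" "J \<subseteq> T ==> ext_ideal T P J \<subseteq> localize T P"
proof -
 note p = prime_atD[OF P] and r = ring_setD[OF prime_atD(1)[OF P]]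
 show sub: "J \<subseteq> ext_ideal T P J" using ext_idealI[of _ J 1 T P] p(4) r(2) by fastforce
 show "ext_ideal T P J \<subseteq> localize T P" if "J \<subseteq> T"
  using that unfolding ext_ideal_def localize_def by blast
 show "submod T (ext_ideal T P J)" unfolding submod_def
 proof (intro conjI ballI)
  show "0 \<in> ext_ideal T P J" using sub submodD(1)[OF J] by blast
 next
  fix c c' assume "c \<in> ext_ideal T P J" "c' \<in> ext_ideal T P J"
  then obtain a b a' b' where *: "a \<in> J" "b \<in> T" "b \<notin> P" "b \<noteq> 0" "c = a / b"
   "a' \<in> J" "b' \<in> T" "b' \<notin> P" "b' \<noteq> 0" "c' = a' / b'" using ext_idealE[OF P] by metis
  have "c + c' = (b' * a + b * a') / (b * b')" using * by (simp add: field_simps)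
  moreover have "b' * a + b * a' \<in> J" using * submodD(2,3)[OF J] by blast
  ultimately show "c + c' \<in> ext_ideal T P J" using * p(5) r(5) by (simp only: ext_idealI not_False_eq_True)
 next
  fix t c assume t: "t \<in> T" and "c \<in> ext_ideal T P J"
  then obtain a b where *: "a \<in> J" "b \<in> T" "b \<notin> P" "c = a / b" using ext_idealE[OF P] by metis
  have "t * c = (t * a) / b" using * by simp
  thus "t * c \<in> ext_ideal T P J" using * t submodD(3)[OF J] by (simp only: ext_idealI not_False_eq_True)
 qed
qed

lemma ext_ideal_whole:
 assumes P: "prime_at T P" and J: "submod T J" "J \<subseteq> T" "\<not> J \<subseteq> P"
 shows "ext_ideal T P J = localize T P"
proof
 show "ext_ideal T P J \<subseteq> localize T P" by (rule submod_ext_ideal(3)[OF P J(1,2)])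
 obtain j where j: "j \<in> J" "j \<notin> P" using J by blast
 have j0: "j \<noteq> 0" using j prime_atD(6)[OF P] by metis
 show "localize T P \<subseteq> ext_ideal T P J"
 proof
  fix c assume "c \<in> localize T P"
  then obtain a b where ab: "a \<in> T" "b \<in> T" "b \<notin> P" "b \<noteq> 0" "c = a / b" using localizeE[OF P] by metis
  have "c = (a * j) / (b * j)" using ab j0 by simp
  moreover have "a * j \<in> J" "b * j \<in> T" "b * j \<notin> P"
   using ab j submodD(3)[OF J(1)] prime_atD(5)[OF P] J(2) by blast+
  ultimately show "c \<in> ext_ideal T P J" by (simp only: ext_idealI not_False_eq_True)
 qed
qed

lemma ext_ideal_add_principal:
 assumes P: "prime_at T P"
 shows "ext_ideal T P (g *o T +++ h *o T) = g *o localize T P +++ h *o localize T P"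
proof
 note p = prime_atD[OF P] and r = ring_setD[OF prime_atD(1)[OF P]]
 show "ext_ideal T P (g *o T +++ h *o T) \<subseteq> g *o localize T P +++ h *o localize T P"
 proof
  fix c assume "c \<in> ext_ideal T P (g *o T +++ h *o T)"
  then obtain j b where jb: "j \<in> g *o T +++ h *o T" "b \<in> T" "b \<notin> P" "c = j / b" using ext_idealE[OF P] by metis
  then obtain t u where tu: "t \<in> T" "u \<in> T" "j = g * t + h * u" by (auto elim!: set_addE smulE)
  have "c = g * (t / b) + h * (u / b)" using jb tu by (simp add: add_divide_distrib)
  thus "c \<in> g *o localize T P +++ h *o localize T P"
   using tu jb by (simp only: set_addI smulI localizeI not_False_eq_True)
 qed
 show "g *o localize T P +++ h *o localize T P \<subseteq> ext_ideal T P (g *o T +++ h *o T)"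
 proof
  fix c assume "c \<in> g *o localize T P +++ h *o localize T P"
  then obtain t u where tu: "t \<in> localize T P" "u \<in> localize T P" "c = g * t + h * u"
   by (auto elim!: set_addE smulE)
  obtain a b a' b' where *: "a \<in> T" "b \<in> T" "b \<notin> P" "b \<noteq> 0" "t = a / b"
   "a' \<in> T" "b' \<in> T" "b' \<notin> P" "b' \<noteq> 0" "u = a' / b'" using localizeE[OF P] tu(1,2) by metis
  have "c = (g * (a * b') + h * (a' * b)) / (b * b')" unfolding tu(3) *(5) *(10) using *(4,9) by (simp add: field_simps)
  moreover have "g * (a * b') + h * (a' * b) \<in> g *o T +++ h *o T"
   using * r(5) by (simp only: set_addI smulI not_False_eq_True)
  ultimately show "c \<in> ext_ideal T P (g *o T +++ h *o T)" using * p(5) r(5) by (simp only: ext_idealI not_False_eq_True)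
 qed
qed

context const_field
begin

text \<open>A submodule minimal above \<open>J\<close> has a simple quotient by \<open>J\<close>,
  and the annihilator of a generator of a simple module is a maximal ideal: an associated prime of T
  / J.\<close>

lemma maximal_annihilator:
 assumes T: "ring_set T" "KK \<subseteq> T" and J: "submod T J" "J \<subseteq> T" "J \<noteq> T" and fin: "dim T J \<noteq> \<infinity>"
 obtains z P where "z \<in> T" "z \<notin> J" "maximalideal P (ring_on T)" "J \<subseteq> P"
  "\<And>t. t \<in> T ==> t \<in> P \<longleftrightarrow> t * z \<in> J"
proof -
 define Q where "Q J' \<longleftrightarrow> submod T J' \<and> J \<subset> J' \<and> J' \<subseteq> T" for J'
 have K: "submod T A ==> submod KK A" for A using submod_mono[OF _ T(2)] .
 have fin': "dim J' J \<noteq> \<infinity>" if "Q J'" for J'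
  using len_mono1(1)[OF ring_set_KK, of T J' J] that K submod_self[OF T(1)] J fin
  unfolding Q_def by (metis enat_ord_simps(5) psubset_imp_subset)
 have "Q T" unfolding Q_def using submod_self T J by blast
 then obtain J' where J': "Q J'" "\<And>J''. Q J'' ==> the_enat (dim J' J) \<le> the_enat (dim J'' J)"
  using ex_has_least_nat[of Q T "\<lambda>X. the_enat (dim X J)"] by metis
 have min: "J'' = J'" if "submod T J''" "J \<subset> J''" "J'' \<subseteq> J'" for J''
 proof (rule ccontr)
  assume ne: "J'' \<noteq> J'"
  have Q: "Q J''" using that J'(1) unfolding Q_def by blast
  have "dim J' J = dim J' J'' + dim J'' J" using that J'(1) J by (intro len_add ring_set_KK K) (auto simp: Q_def)
  moreover have "dim J' J'' \<noteq> 0" using len_eq_0_iff[of KK J' J''] that J'(1) ne K unfolding Q_def by blast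
  ultimately have "the_enat (dim J'' J) < the_enat (dim J' J)"
   using fin'[OF J'(1)] fin'[OF Q] by (cases "dim J'' J"; cases "dim J' J''") (auto simp: zero_enat_def)
  thus False using J'(2)[OF Q] by simp
 qed
 obtain z where z: "z \<in> J'" "z \<notin> J" using J'(1) unfolding Q_def by blast
 have zT: "z \<in> T" using z J'(1) unfolding Q_def by blast
 define P where "P = {t \<in> T. t * z \<in> J}"
 note r = ring_setD[OF T(1)] and j = submodD[OF J(1)]
 have Pid: "ideal P (ring_on T)" unfolding ideal_ring_on_iff[OF T(1)] submod_def P_def using r(1,4,5) j(1,2,3)
  by (auto simp: distrib_right mult.assoc)
 have mx: "maximalideal P (ring_on T)"
 proof (rule maximalidealI[OF Pid])
  show "carrier (ring_on T) \<noteq> P"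
  proof
   assume "carrier (ring_on T) = P"
   hence "1 \<in> P" using r(2) by simp
   thus False using z(2) by (simp add: P_def)
  qed
  fix I assume "ideal I (ring_on T)" "P \<subseteq> I" "I \<subseteq> carrier (ring_on T)"
  hence I: "submod T I" "P \<subseteq> I" "I \<subseteq> T" using ideal_ring_on_iff[OF T(1)] by auto
  show "I = P \<or> I = carrier (ring_on T)"
  proof (cases "I = P")
   case False
   then obtain q where q: "q \<in> I" "q \<notin> P" "q \<in> T" using I by blast
   have qz: "q * z \<notin> J" using q by (simp add: P_def)
   have sub: "submod T ((q * z) *o T +++ J)" by (intro submod_add submod_smul submod_self T(1) J(1))
   have "q * z * 1 + 0 \<in> (q * z) *o T +++ J" using r(2) j(1) by (intro set_addI smulI)
   hence "J \<subset> (q * z) *o T +++ J"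
    using qz set_add_ub2[OF submod_smul[OF submod_self[OF T(1)]], of J "q * z"] by auto
   moreover have "(q * z) *o T +++ J \<subseteq> J'"
   proof -
    have J'm: "submod T J'" "J \<subseteq> J'" using J'(1) unfolding Q_def by auto
    have "q * z * t \<in> J'" if "t \<in> T" for t
     using submodD(3)[OF J'm(1) r(5)[OF q(3) that] z(1)] by (simp add: ac_simps)
    thus ?thesis using J'm submodD(2)[OF J'm(1)] by (auto elim!: set_addE smulE)
   qed
   ultimately have "(q * z) *o T +++ J = J'" using min[OF sub] by blast
   then obtain t u where tu: "z = q * z * t + u" "t \<in> T" "u \<in> J" using z(1) by (metis set_addE smulE)
   have "(1 - q * t) * z = u" using tu(1) by (simp add: algebra_simps)
   moreover have "1 - q * t \<in> T" using r(2,5,6) q tu by blast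
   ultimately have "1 - q * t \<in> P" using tu by (simp add: P_def)
   hence "(1 - q * t) + q * t \<in> I" using I submodD(2,4)[OF I(1)] q tu by blast
   hence "1 \<in> I" by simp
   hence "T \<subseteq> I" using submodD(3)[OF I(1), of _ 1] by fastforce
   thus ?thesis using I by auto
  qed simp
 qed
 show ?thesis
 proof (rule that[OF zT z(2) mx])
  show "J \<subseteq> P" using J(2) j(4) zT by (auto simp: P_def)
  show "\<And>t. t \<in> T ==> t \<in> P \<longleftrightarrow> t * z \<in> J" by (simp add: P_def)
 qed
qed

lemma maximalideal_eqI:
 assumes "ring_set T" "maximalideal P (ring_on T)" "maximalideal Q (ring_on T)" "P \<subseteq> Q"
 shows "P = Q"
proof -
 interpret P: maximalideal P "ring_on T" by fact
 interpret Q: maximalideal Q "ring_on T" by fact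
 show ?thesis using P.I_maximal[OF Q.is_ideal assms(4)] Q.I_notcarr Q.a_subset by auto
qed

text \<open>A finite-dimensional quotient is the product of its localizations. Induction removes one
  simple layer spanned by \<open>z\<close>; this lowers the dimension by one globally and at the
  maximal ideal \<open>P\<close> annihilating the layer, and changes nothing at the other maximal
  ideals.\<close>

theorem dim_local_global:
 assumes T: "ring_set T" "KK \<subseteq> T" and J: "submod T J" "J \<subseteq> T" and fin: "dim T J \<noteq> \<infinity>"
  and res: "\<And>P. maximalideal P (ring_on T) ==> J \<subseteq> P ==> resid T P"
 shows "finite {P. maximalideal P (ring_on T) \<and> J \<subseteq> P} \<and>
  dim T J = (\<Sum>P | maximalideal P (ring_on T) \<and> J \<subseteq> P. dim (localize T P) (ext_ideal T P J))"
proof -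
 have K: "submod T A ==> submod KK A" for A using submod_mono[OF _ T(2)] .
 obtain n where "dim T J = enat n" using fin by auto
 thus ?thesis using J res
 proof (induction n arbitrary: J)
  case 0
  hence JT: "J = T" using len_eq_0_iff[of KK T J] K submod_self[OF T(1)] by (auto simp: zero_enat_def)
  have "\<not> T \<subseteq> P" if "maximalideal P (ring_on T)" for P
   using prime_atD(4)[OF maximalideal_imp_prime_at[OF T(1) that]] ring_setD(2)[OF T(1)] by blast
  hence "{P. maximalideal P (ring_on T) \<and> J \<subseteq> P} = {}" unfolding JT by blast
  thus ?case using 0 by (simp only: sum.empty finite.emptyI zero_enat_def)
 next
  case (Suc n)
  have "J \<noteq> T" using Suc.prems(1) by (auto simp: zero_enat_def)
  then obtain z P where z: "z \<in> T" "z \<notin> J" and P: "maximalideal P (ring_on T)" "J \<subseteq> P"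
   and ann: "\<And>t. t \<in> T ==> t \<in> P \<longleftrightarrow> t * z \<in> J"
   using maximal_annihilator[OF T Suc.prems(2,3)] Suc.prems(1) by (metis enat.distinct(1))
  note rP = Suc.prems(4)[OF P] note dP = residD[OF rP] and j = submodD[OF Suc.prems(2)] and r = ring_setD[OF T(1)]
  define J' where "J' = line z +++ J"
  have J'eq: "J' = z *o T +++ J"
  proof
   show "J' \<subseteq> z *o T +++ J" unfolding J'_def line_def using T(2) by (intro set_add_mono smul_mono) auto
   show "z *o T +++ J \<subseteq> J'"
   proof
    fix a assume "a \<in> z *o T +++ J"
    then obtain t u where tu: "a = z * t + u" "t \<in> T" "u \<in> J" by (metis set_addE smulE)
    obtain c where c: "t - K c \<in> P" using dP(7)[OF tu(2)] by blast
    hence "(t - K c) * z + u \<in> J" using ann tu(3) j(2) dP(5) by blast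
    moreover have "a = K c * z + ((t - K c) * z + u)" by (simp add: tu algebra_simps)
    ultimately show "a \<in> J'" unfolding J'_def by (metis set_addI lineI)
   qed
  qed
  have J': "submod T J'" unfolding J'eq by (intro submod_add submod_smul submod_self T(1) Suc.prems(2))
  have JJ': "J \<subseteq> J'" unfolding J'_def by (rule set_add_ub2[OF submod_line])
  have J'T: "J' \<subseteq> T" unfolding J'eq using z(1) Suc.prems(3) r(4,5) by (auto elim!: set_addE smulE)
  have d1: "dim J' J = 1" unfolding J'_def by (rule dim_line_eq[OF K[OF Suc.prems(2)] z(2)])
  have "dim T J = dim T J' + dim J' J" by (intro len_add ring_set_KK K submod_self T J' Suc.prems(2) JJ' J'T)
  hence dn: "dim T J' = enat n" using d1 Suc.prems(1) by (cases "dim T J'") (auto simp: one_enat_def)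
  have res': "resid T Q" if "maximalideal Q (ring_on T)" "J' \<subseteq> Q" for Q
   using Suc.prems(4)[OF that(1)] that(2) JJ' by blast
  define S where "S = {Q. maximalideal Q (ring_on T) \<and> J \<subseteq> Q}"
  define S' where "S' = {Q. maximalideal Q (ring_on T) \<and> J' \<subseteq> Q}"
  have IH: "finite S'" "dim T J' = (\<Sum>Q\<in>S'. dim (localize T Q) (ext_ideal T Q J'))"
   using Suc.IH[OF dn J' J'T res'] unfolding S'_def by auto
  have SS': "S = insert P S'"
  proof
   show "insert P S' \<subseteq> S" using P JJ' unfolding S_def S'_def by blast
   show "S \<subseteq> insert P S'"
   proof
    fix Q assume Q: "Q \<in> S"
    show "Q \<in> insert P S'"
    proof (cases "Q = P")
     case False
     have rQ: "resid T Q" using Suc.prems(4) Q unfolding S_def by blast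
     have "\<not> P \<subseteq> Q" using maximalideal_eqI[OF T(1) P(1)] Q False unfolding S_def by blast
     then obtain p where p: "p \<in> P" "p \<notin> Q" by blast
     hence "p * z \<in> Q" using ann Q dP(5) unfolding S_def by blast
     hence "z \<in> Q" using prime_atD(5)[OF resid_prime_at[OF rQ]] p z(1) dP(5) by blast
     hence "J' \<subseteq> Q" unfolding J'eq
      using Q submodD(2,4)[OF residD(4)[OF rQ]] unfolding S_def by (auto elim!: set_addE smulE)
     thus ?thesis using Q unfolding S_def S'_def by blast
    qed simp
   qed
  qed
  \<comment> \<open>Some p in \<open>P\<close> is invertible at \<open>Q\<close> and kills the
    layer, so the layer disappears at \<open>Q\<close>.\<close>
  have same: "ext_ideal T Q J' = ext_ideal T Q J" if Q: "Q \<in> S" "Q \<noteq> P" for Q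
  proof
   have rQ: "resid T Q" using Suc.prems(4) Q unfolding S_def by blast
   note pQ = resid_prime_at[OF rQ]
   show "ext_ideal T Q J \<subseteq> ext_ideal T Q J'" using JJ' unfolding ext_ideal_def by blast
   have "\<not> P \<subseteq> Q" using maximalideal_eqI[OF T(1) P(1)] Q unfolding S_def by blast
   then obtain p where p: "p \<in> P" "p \<notin> Q" "p \<in> T" using dP(5) by blast
   have p0: "p \<noteq> 0" using p prime_atD(6)[OF pQ] by metis
   show "ext_ideal T Q J' \<subseteq> ext_ideal T Q J"
   proof
    fix c assume "c \<in> ext_ideal T Q J'"
    then obtain a b where ab: "a \<in> J'" "b \<in> T" "b \<notin> Q" "c = a / b" using ext_idealE[OF pQ] by metis
    then obtain t u where tu: "a = z * t + u" "t \<in> T" "u \<in> J" unfolding J'eq by (metis set_addE smulE)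
    have "p * a = t * (p * z) + p * u" using tu by (simp add: algebra_simps)
    moreover have "t * (p * z) + p * u \<in> J"
     using j(2)[OF j(3)[OF tu(2)] j(3)[OF p(3) tu(3)]] ann[OF p(3)] p(1) by blast
    moreover have "c = (p * a) / (p * b)" using ab p0 by simp
    ultimately show "c \<in> ext_ideal T Q J"
     using ext_idealI[of "p * a" J "p * b" T Q] r(5)[OF p(3) ab(2)] prime_atD(5)[OF pQ p(3) ab(2) p(2) ab(3)] by simp
   qed
  qed
  note pP = resid_prime_at[OF rP]
  have lineP: "ext_ideal T P J' = line z +++ ext_ideal T P J"
  proof
   show "ext_ideal T P J' \<subseteq> line z +++ ext_ideal T P J"
   proof
    fix c assume "c \<in> ext_ideal T P J'"
    then obtain a b where ab: "a \<in> J'" "b \<in> T" "b \<notin> P" "b \<noteq> 0" "c = a / b" using ext_idealE[OF pP] by metis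
    then obtain k u where ku: "a = K k * z + u" "u \<in> J" unfolding J'_def by (metis set_addE lineE)
    obtain c' where c': "b - K c' \<in> P" using dP(7)[OF ab(2)] by blast
    hence c'0: "K c' \<noteq> 0" using ab by auto
    \<comment> \<open>The denominator \<open>b\<close> is replaced by its residue \<open>c'\<close>;
      the error stays in \<open>J\<close> because b - c' annihilates \<open>z\<close> modulo
      \<open>J\<close>.\<close>
    have "c = K (k / c') * z + (K c' * u - (K k * ((b - K c') * z))) / (K c' * b)"
    proof -
     have "K (k / c') = K k / K c'" by (simp only: divide_inverse K_mult K_inverse)
     thus ?thesis unfolding ab(5) ku(1) using ab(4) c'0 by (simp add: field_simps)
    qed
    moreover have "K c' * u - (K k * ((b - K c') * z)) \<in> J"
     using submod_diff[OF Suc.prems(2) T(1) j(3)[OF dP(3) ku(2)] j(3)[OF dP(3)]] ann c' dP(5) by blast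
    moreover have "K c' \<notin> P" using resid_const[OF rP] c'0 by auto
    hence "K c' * b \<in> T" "K c' * b \<notin> P" using r(5) dP(3) ab prime_atD(5)[OF pP] by blast+
    ultimately show "c \<in> line z +++ ext_ideal T P J" by (simp only: set_addI lineI ext_idealI not_False_eq_True)
   qed
   have "ext_ideal T P J \<subseteq> ext_ideal T P J'" using JJ' unfolding ext_ideal_def by blast
   moreover have "line z \<subseteq> ext_ideal T P J'"
   proof -
    have "line z \<subseteq> J'" unfolding J'_def by (rule set_add_ub1[OF K[OF Suc.prems(2)]])
    thus ?thesis using submod_ext_ideal(2)[OF pP J'] by blast
   qed
   ultimately show "line z +++ ext_ideal T P J \<subseteq> ext_ideal T P J'"
    using submodD(2)[OF submod_ext_ideal(1)[OF pP J']] by (auto elim!: set_addE)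
  qed
  have znot: "z \<notin> ext_ideal T P J"
  proof
   assume "z \<in> ext_ideal T P J"
   then obtain a b where ab: "a \<in> J" "b \<in> T" "b \<notin> P" "b \<noteq> 0" "z = a / b" using ext_idealE[OF pP] by metis
   hence "b * z \<in> J" by simp
   thus False using ann ab by blast
  qed
  have dP': "dim (localize T P) (ext_ideal T P J) = dim (localize T P) (ext_ideal T P J') + 1"
  proof -
   have "dim (localize T P) (ext_ideal T P J) =
    dim (localize T P) (ext_ideal T P J') + dim (ext_ideal T P J') (ext_ideal T P J)"
    using submod_ext_ideal[OF pP J'] submod_ext_ideal[OF pP Suc.prems(2)] J'T ring_set_localize[OF pP]
     submod_subring[OF ring_set_localize(1)[OF pP]] T(2) lineP set_add_ub2[OF submod_line]
    by (intro len_add ring_set_KK K) auto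
   thus ?thesis using dim_line_eq[OF K[OF submod_ext_ideal(1)[OF pP Suc.prems(2)]] znot] lineP by simp
  qed
  have zero: "dim (localize T P) (ext_ideal T P J') = 0" if "P \<notin> S'"
   using that P(1) ext_ideal_whole[OF pP J' J'T] unfolding S'_def by simp
  have "dim T J = dim T J' + 1" using \<open>dim T J = dim T J' + dim J' J\<close> d1 by simp
  also have "dim T J' = (\<Sum>Q\<in>S. dim (localize T Q) (ext_ideal T Q J'))"
   using IH zero unfolding SS' by (cases "P \<in> S'") (auto simp: insert_absorb)
  also have "\<dots> + 1 = (\<Sum>Q\<in>S. dim (localize T Q) (ext_ideal T Q J))"
  proof -
   have "finite S" "P \<in> S" unfolding SS' using IH by auto
   thus ?thesis using same dP' by (simp add: sum.remove[of S P] ac_simps)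
  qed
  finally show ?case using IH(1) SS' unfolding S_def by simp
 qed
qed

end

context const_field
begin

section \<open>Local intersection numbers\<close>

definition inum :: "'f set => 'f => 'f => enat" where
 "inum R f g = dim R (f *o R +++ g *o R)"

definition finite_inum :: "'f set => 'f => bool" where
 "finite_inum R f \<longleftrightarrow> (\<forall>g\<in>R. g \<notin> f *o R --> inum R f g \<noteq> \<infinity>)"

lemma submod_two: "ring_set R ==> submod R (f *o R +++ g *o R)"
 by (intro submod_add submod_smul submod_self)

lemma two_subset: "ring_set R ==> f \<in> R ==> g \<in> R ==> f *o R +++ g *o R \<subseteq> R"
 using ring_setD(4,5) by (blast elim: set_addE smulE)

lemma mem_two:
 assumes "ring_set R" shows "f \<in> f *o R +++ g *o R" "g \<in> f *o R +++ g *o R"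
  "a \<in> R ==> f * a \<in> f *o R +++ g *o R" "a \<in> R ==> g * a \<in> f *o R +++ g *o R"
proof -
 note r = ring_setD[OF assms]
 show f: "f * a \<in> f *o R +++ g *o R" if "a \<in> R" for a
  using set_addI[OF smulI[OF that] smulI[OF r(1)], of f g] by simp
 show g: "g * a \<in> f *o R +++ g *o R" if "a \<in> R" for a
  using set_addI[OF smulI[OF r(1)] smulI[OF that], of f g] by simp
 show "f \<in> f *o R +++ g *o R" "g \<in> f *o R +++ g *o R" using f[OF r(2)] g[OF r(2)] by simp_all
qed

lemma inum_commute: "inum R f g = inum R g f"
 unfolding inum_def by (simp add: set_add_commute)

lemma inum_subset:
 assumes R: "loc_ring R" and "g \<in> R" "f \<in> R" "g' \<in> R" "g' \<in> f *o R +++ g *o R"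
 shows "inum R f g \<le> inum R f g'"
proof -
 note r = loc_ringD(1)[OF R]
 have "f *o R +++ g' *o R \<subseteq> f *o R +++ g *o R"
  using set_add_subset_iff[of R "f *o R" "g' *o R" "f *o R +++ g *o R"] submod_two[OF r]
   submod_smul[OF submod_self[OF r]] set_add_ub1[OF submod_smul[OF submod_self[OF r]], of "f *o R" g]
   submodD(4)[OF submod_two[OF r] _ assms(5)] by (auto elim!: smulE)
 thus ?thesis unfolding inum_def using two_subset[OF r] assms submod_two[OF r] submod_KK[OF R] submod_self[OF r]
  by (intro len_mono1(2)[OF ring_set_KK]) auto
qed

lemma inum_unit:
 assumes R: "loc_ring R" and "f \<in> R" "g \<in> R" "g \<notin> mx R" shows "inum R f g = 0"
proof -
 note r = loc_ringD(1)[OF R]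
 have i: "g \<noteq> 0" "inverse g \<in> R" using not_max_ideal_inverse[OF R] assms by auto
 have "f *o R +++ g *o R = R"
 proof
  show "f *o R +++ g *o R \<subseteq> R" using two_subset[OF r] assms by blast
  show "R \<subseteq> f *o R +++ g *o R"
  proof
   fix a assume "a \<in> R"
   hence "g * (inverse g * a) \<in> f *o R +++ g *o R" using mem_two(4)[OF r] ring_setD(5)[OF r i(2)] by blast
   thus "a \<in> f *o R +++ g *o R" using i by (simp add: mult.assoc[symmetric])
  qed
 qed
 thus ?thesis by (simp add: inum_def)
qed

text \<open>Multiplication by \<open>a\<close> embeds R / (f, b) into R / (f, a b) with cokernel R /
  (f, a), because \<open>a\<close> is no zero divisor modulo \<open>f\<close>.\<close>

lemma inum_mult_gen:
 assumes R: "loc_ring R" and "f \<in> R" "a \<in> R" "b \<in> R" "a \<noteq> 0"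
  and cancel: "\<And>u. u \<in> R ==> a * u \<in> f *o R ==> u \<in> f *o R"
 shows "inum R f (a * b) = inum R f a + inum R f b"
proof -
 note r = loc_ringD(1)[OF R] and rr = ring_setD[OF loc_ringD(1)[OF R]]
 have K: "submod R A ==> submod KK A" for A using submod_KK[OF R] .
 note self = submod_self[OF r] and two = submod_two[OF r]
 let ?A = "f *o R +++ a *o R" and ?C = "f *o R +++ (a * b) *o R"
 have CA: "?C \<subseteq> ?A"
 proof (rule set_add_mono[OF order_refl], rule subsetI)
  fix c assume "c \<in> (a * b) *o R"
  then obtain u where u: "u \<in> R" "c = a * b * u" by (rule smulE)
  hence "c = a * (b * u)" by (simp only: mult.assoc)
  thus "c \<in> a *o R" using rr(5)[OF assms(4) u(1)] by (simp only: smulI)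
 qed
 have 1: "inum R f (a * b) = inum R f a + dim ?A ?C"
  unfolding inum_def using two_subset[OF r] assms rr(5) CA K self two by (intro len_add ring_set_KK) auto
 have "?A = a *o R +++ ?C"
 proof
  show "?A \<subseteq> a *o R +++ ?C"
   using set_add_mono[OF set_add_ub1[OF submod_smul[OF self], of "f *o R" "a * b"] order_refl, of "a *o R"]
   by (simp add: set_add_commute)
  show "a *o R +++ ?C \<subseteq> ?A" using set_add_subset_iff[OF submod_smul[OF self] two two, of a f "a * b" f a] CA
    set_add_ub2[OF submod_smul[OF self], of "a *o R" f] by blast
 qed
 hence "dim ?A ?C = dim (a *o R) ((a *o R) \<inter> ?C)"
  using len_second_iso[OF ring_set_KK K[OF submod_smul[OF self]] K[OF two]] by metis
 also have "(a *o R) \<inter> ?C = a *o (f *o R +++ b *o R)"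
 proof
  show "(a *o R) \<inter> ?C \<subseteq> a *o (f *o R +++ b *o R)"
  proof
   fix c assume c: "c \<in> (a *o R) \<inter> ?C"
   then obtain u where u: "u \<in> R" "c = a * u" by (metis IntD1 smulE)
   obtain v w where vw: "v \<in> R" "w \<in> R" "c = f * v + a * b * w" using c by (metis IntD2 set_addE smulE)
   have "a * (u - b * w) = f * v" using u vw by (simp add: algebra_simps)
   hence "a * (u - b * w) \<in> f *o R" using vw by (simp only: smulI)
   hence "u - b * w \<in> f *o R" by (rule cancel[OF rr(6)[OF u(1) rr(5)[OF assms(4) vw(2)]]])
   hence "(u - b * w) + b * w \<in> f *o R +++ b *o R" using vw by (intro set_addI smulI)
   thus "c \<in> a *o (f *o R +++ b *o R)" using u by (simp add: smulI)
  qed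
  show "a *o (f *o R +++ b *o R) \<subseteq> (a *o R) \<inter> ?C"
  proof
   fix c assume "c \<in> a *o (f *o R +++ b *o R)"
   then obtain v w where vw: "v \<in> R" "w \<in> R" "c = a * (f * v + b * w)" by (metis set_addE smulE)
   have "c \<in> a *o R" unfolding vw(3) using vw assms rr(4,5) by (intro smulI) blast
   moreover have "c = f * (a * v) + a * b * w" using vw by (simp add: algebra_simps)
   hence "c \<in> ?C" using vw assms rr(5) by (simp only: set_addI smulI)
   ultimately show "c \<in> (a *o R) \<inter> ?C" by blast
  qed
 qed
 also have "dim (a *o R) (a *o (f *o R +++ b *o R)) = inum R f b" unfolding inum_def by (rule len_smul[OF assms(5)])
 finally show ?thesis using 1 by simp
qed

lemma curve_prime:
 assumes "curve_at D R f" "a \<in> R" "b \<in> R" "a \<notin> f *o R" "b \<notin> f *o R"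
 shows "a * b \<notin> mx D" "a * b \<in> R ==> a * b \<notin> f *o R"
proof -
 note c = curve_atD[OF assms(1)]
 show "a * b \<notin> mx D" using local_domD(6)[OF c(1)] c(2,5) assms by blast
 thus "a * b \<in> R ==> a * b \<notin> f *o R" using c(5) by blast
qed

lemma inum_mult:
 assumes R: "loc_ring R" and C: "curve_at D R f" and ab: "a \<in> R" "b \<in> R" "a \<notin> f *o R"
 shows "inum R f (a * b) = inum R f a + inum R f b"
proof (rule inum_mult_gen[OF R curve_atD(3)[OF C] ab(1,2)])
 note r = ring_setD[OF loc_ringD(1)[OF R]]
 have "0 \<in> f *o R" using smulI[OF r(1), of f] by simp
 thus "a \<noteq> 0" using ab by blast
 fix u assume u: "u \<in> R" "a * u \<in> f *o R"
 thus "u \<in> f *o R" using curve_prime(2)[OF C ab(1) u(1) ab(3)] r(5)[OF ab(1) u(1)] by blast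
qed

text \<open>The powers of \<open>x\<close> are linearly dependent modulo an ideal of finite
  codimension. Factoring the lowest power out of a dependence leaves a unit of the local ring, so
  that power of \<open>x\<close> lies in the ideal.\<close>

lemma power_in_finite_ideal:
 assumes R: "loc_ring R" and I: "submod R I" "I \<subseteq> R" "dim R I \<noteq> \<infinity>" and x: "x \<in> mx R"
 shows "\<exists>n. x ^ n \<in> I"
proof -
 note r = loc_ringD(1)[OF R] and rr = ring_setD[OF loc_ringD(1)[OF R]] and m = loc_ringD(4)[OF R]
 have xR: "x \<in> R" using x loc_ringD(5)[OF R] by blast
 have K: "submod R A ==> submod KK A" for A using submod_KK[OF R] .
 have main: "x ^ n * (\<Sum>i<k. K (c i) * x ^ i) \<in> I ==> \<exists>i<k. c i \<noteq> 0 ==> \<exists>n. x ^ n \<in> I" for n k c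
 proof (induction k arbitrary: n c)
  case (Suc k)
  define v where "v = (\<Sum>i<k. K (c (Suc i)) * x ^ i)"
  have vR: "v \<in> R" unfolding v_def by (intro ring_set_sum[OF r] rr(5) rr(7) xR loc_ringD(2)[OF R])
  have s: "(\<Sum>i<Suc k. K (c i) * x ^ i) = K (c 0) + x * v"
   unfolding v_def sum.lessThan_Suc_shift sum_distrib_left by (simp add: ac_simps)
  show ?case
  proof (cases "c 0 = 0")
   case True
   hence "x ^ Suc n * v \<in> I" using Suc.prems(1) unfolding s by (simp add: ac_simps)
   moreover have "\<exists>i<k. c (Suc i) \<noteq> 0" using Suc.prems(2) True by (metis less_Suc_eq_0_disj)
   ultimately show ?thesis unfolding v_def by (rule Suc.IH)
  next
   case False
   have "x * v \<in> mx R" using submodD(4)[OF m vR x] .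
   hence u: "K (c 0) + x * v \<in> R" "K (c 0) + x * v \<notin> mx R"
    using add_notin_max_ideal[OF R K_notin_max_ideal[OF R False]] rr(4)[OF loc_ringD(2)[OF R] rr(5)[OF xR vR]]
    by blast+
   have "inverse (K (c 0) + x * v) * (x ^ n * (K (c 0) + x * v)) \<in> I"
    using submodD(3)[OF I(1) not_max_ideal_inverse(2)[OF R u]] Suc.prems(1) unfolding s .
   moreover have "inverse w * (x ^ n * w) = x ^ n" if "w \<noteq> 0" for w using that by simp
   ultimately show ?thesis using not_max_ideal_inverse(1)[OF R u] by metis
  qed
 qed simp
 obtain N where N: "dim R I = enat N" using I(3) by auto
 have sub: "span_over I (\<lambda>i. x ^ i) n \<subseteq> R" for n
 proof (induction n)
  case (Suc n)
  have "c * x ^ n \<in> R" if "c \<in> KK" for c using that rr(5) rr(7)[OF xR] loc_ringD(3)[OF R] by blast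
  hence "line (x ^ n) \<subseteq> R" unfolding line_def by (auto elim!: smulE simp: mult.commute)
  thus ?case using Suc rr(4) by (auto elim!: set_addE)
 qed (use I in simp)
 have "dim (span_over I (\<lambda>i. x ^ i) (Suc N)) I \<le> enat N"
  using len_mono1(1)[OF ring_set_KK K[OF submod_self[OF r]] submod_span_over[OF K[OF I(1)]] K[OF I(1)] _ sub]
   span_over_ub[OF K[OF I(1)], of 0] unfolding N[symmetric] by (simp del: span_over.simps(2))
 hence "dim (span_over I (\<lambda>i. x ^ i) (Suc N)) I \<noteq> enat (Suc N)" by auto
 then obtain c where "(\<Sum>i<Suc N. K (c i) * x ^ i) \<in> I" "\<exists>i<Suc N. c i \<noteq> 0"
  unfolding dim_span_over_eq_iff[OF K[OF I(1)]] by blast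
 thus ?thesis using main[of 0 c "Suc N"] by (simp del: sum.lessThan_Suc)
qed

text \<open>The parameter \<open>x\<close> is transversal to the curve \<open>f = 0\<close>, whose strict transform therefore lies
 in the chart with ring \<open>T\<close>. There the strict transform is finite over \<open>R/f\<close>.\<close>
context
 fixes R x y T s D f e f'
 assumes R: "reg R" and p: "params R x y" and T_def: "T = chart R x" and s_def: "s = y / x"
  and C: "curve_at D R f" and e_def: "e = mord R f" and f'_def: "f' = f / x ^ e"
  and fin: "finite_inum R f" and trans: "f \<notin> x *o R +++ mpow R (Suc e)"
begin

text \<open>Transversality says that y^e occurs in the initial form of \<open>f\<close>, so its
  coefficient is a unit. This makes the equation of the strict transform monic in \<open>s\<close>
  up to a unit.\<close>

lemma transversal_expansion:
 obtains r where "\<And>i. r i \<in> R" "f = (\<Sum>i\<le>e. r i * (x ^ (e - i) * y ^ i))" "r e \<notin> mx R"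
proof -
 note st = strict_transform_mem[OF R p T_def s_def refl C e_def] and P = paramsD[OF p]
 note rr = ring_setD[OF P(2)]
 obtain r where r: "\<forall>i. r i \<in> R" "f = (\<Sum>i\<le>e. r i * (x ^ (e - i) * y ^ i))"
  using mpow_iff[OF p] st(1) by blast
 have "r e \<notin> mx R"
 proof
  assume re: "r e \<in> mx R"
  obtain e' where e': "e = Suc e'" using st(5) by (cases e) auto
  have 1: "r e * y ^ e \<in> mpow R (Suc e)"
   using mpow_mult[OF p, of "r e" "Suc 0" "y ^ e" e] mpow_power[OF p P(5)] re mpow_1[OF p] by simp
  have 2: "f = x * (\<Sum>i\<le>e'. r i * (x ^ (e' - i) * y ^ i)) + r e * y ^ e"
   unfolding r(2) e' by (simp add: sum_distrib_left Suc_diff_le ac_simps)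
  have "(\<Sum>i\<le>e'. r i * (x ^ (e' - i) * y ^ i)) \<in> R"
   using r(1) P(6,7) by (intro ring_set_sum[OF P(2)] rr(5) rr(7)) auto
  hence "f \<in> x *o R +++ mpow R (Suc e)" by (subst 2) (intro set_addI smulI 1)
  thus False using trans by blast
 qed
 thus ?thesis using that r by blast
qed

lemma x_not_in_curve: "x \<notin> mx D"
proof
 note c = curve_atD[OF C] and zw = zw1[OF R p] and st = strict_transform_mem[OF R p T_def s_def refl C e_def]
 assume "x \<in> mx D"
 then obtain a where a: "x = f * a" "a \<in> R" using c(5) zw by (metis smulE)
 hence a0: "a \<noteq> 0" using zw by auto
 have "mord R x = 1" using params_nonzero[OF R p] mem_mpow_iff[OF R zw(3,1)] zw(5) mpow_1[OF p]
  by (metis One_nat_def Suc_1 le_antisym not_less_eq_eq)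
 hence "mord R a = 0" using mord_mult[OF R c(3,4) a(2) a0] a st(5) unfolding e_def by simp
 hence "inverse a \<in> R" using mord_eq_0_iff[OF R a(2) a0] not_max_ideal_inverse[OF regD(1)[OF R] a(2)] by blast
 hence "x * inverse a + 0 \<in> x *o R +++ mpow R (Suc e)"
  using submodD(1)[OF submod_mpow(1)[OF regD(1)[OF R]]] by (intro set_addI smulI)
 moreover have "x * inverse a + 0 = f" using a a0 by simp
 ultimately show False using trans by simp
qed

lemmas transversal_chart = chart_curve[OF R p T_def s_def refl C e_def x_not_in_curve, folded f'_def]
lemmas chartT = ring_set_T[OF R p T_def s_def]

lemma f'_mem: "f' \<in> T" using strict_transform_mem(3)[OF R p T_def s_def refl C e_def] f'_def by simp

lemma f'_expansion:
 obtains r where "\<And>i. r i \<in> R" "f' = (\<Sum>i\<le>e. r i * s ^ i)" "r e \<notin> mx R"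
proof -
 obtain r where r: "\<And>i. r i \<in> R" "f = (\<Sum>i\<le>e. r i * (x ^ (e - i) * y ^ i))" "r e \<notin> mx R"
  by (rule transversal_expansion) blast
 have x0: "x \<noteq> 0" using zw1[OF R p] by blast
 have "f' = (\<Sum>i\<le>e. r i * s ^ i)" unfolding f'_def r(2) sum_divide_distrib
 proof (rule sum.cong)
  fix i assume "i \<in> {..e}"
  hence "x ^ e = x ^ (e - i) * x ^ i" by (simp add: power_add[symmetric])
  thus "r i * (x ^ (e - i) * y ^ i) / x ^ e = r i * s ^ i" using x0 by (simp add: s_def power_divide)
 qed simp
 thus ?thesis using that r by blast
qed

text \<open>The R-module generated by 1, ..., s^(i - 1) and the ideal of the strict transform.
  Modulo that ideal \<open>filt 1\<close> is the image of \<open>R\<close>, and at i = e all of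
  \<open>T\<close> is reached.\<close>

primrec filt :: "nat => 'f set" where
 "filt 0 = f' *o T"
| "filt (Suc i) = s ^ i *o R +++ filt i"

lemma submod_filt: "submod R (filt i)"
proof (induction i)
 case 0
 thus ?case using submod_mono[OF submod_smul[OF submod_self[OF chartT(1)]] chartT(2)] by simp
qed (auto intro: submod_add submod_smul submod_self regD(2)[OF R])

lemma filt_mono: "i \<le> j ==> filt i \<subseteq> filt j"
proof (induction j)
 case (Suc j)
 thus ?case using set_add_ub2[OF submod_smul[OF submod_self[OF regD(2)[OF R]]], of "filt j" "s ^ j"]
  by (cases "i = Suc j") auto
qed simp

lemma filt_subset: "filt i \<subseteq> T"
proof (induction i)
 case 0
 thus ?case using f'_mem ring_setD(5)[OF chartT(1)] by (auto elim!: smulE)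
next
 case (Suc i)
 have "s ^ i * r \<in> T" if "r \<in> R" for r
  using ring_setD(5)[OF chartT(1) ring_setD(7)[OF chartT(1,3)]] that chartT(2) by blast
 thus ?case using Suc ring_setD(4)[OF chartT(1)] by (auto elim!: set_addE smulE)
qed

text \<open>An equation of degree e in \<open>s\<close> with unit leading coefficient expresses s^n
  through lower powers, as in a division with remainder.\<close>

lemma filt_power: "r \<in> R ==> s ^ n * r \<in> filt e"
proof (induction n arbitrary: r rule: less_induct)
 case (less n)
 note rR = ring_setD[OF regD(2)[OF R]] and m = submodD[OF submod_filt]
 show ?case
 proof (cases "n < e")
  case True
  have "s ^ n * r + 0 \<in> filt (Suc n)" unfolding filt.simps using less.prems m(1) by (intro set_addI smulI)
  thus ?thesis using filt_mono[of "Suc n" e] True by auto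
 next
  case False
  obtain c where c: "\<And>i. c i \<in> R" "f' = (\<Sum>i\<le>e. c i * s ^ i)" "c e \<notin> mx R"
   by (rule f'_expansion) blast
  note ci = not_max_ideal_inverse[OF regD(1)[OF R] c(1) c(3)]
  have f'2: "f' = (\<Sum>i<e. c i * s ^ i) + c e * s ^ e" unfolding c(2) by (simp add: lessThan_Suc_atMost[symmetric])
  have "s ^ e = inverse (c e) * (f' - (\<Sum>i<e. c i * s ^ i))" using ci(1) f'2 by simp
  moreover have "s ^ n = s ^ (n - e) * s ^ e" using False by (simp add: power_add[symmetric])
  ultimately have "s ^ n * r = s ^ (n - e) * (inverse (c e) * (f' - (\<Sum>i<e. c i * s ^ i))) * r" by (simp only:)
  also have "\<dots> = f' * (s ^ (n - e) * (inverse (c e) * r)) -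
    (\<Sum>i<e. c i * s ^ i) * (s ^ (n - e) * (inverse (c e) * r))" by (simp add: algebra_simps)
  also have "\<dots> = f' * (s ^ (n - e) * (inverse (c e) * r)) +
    (\<Sum>i<e. s ^ (n - e + i) * (- (c i * (inverse (c e) * r))))"
   unfolding sum_distrib_right by (simp add: sum_negf power_add ac_simps)
  finally have eq: "s ^ n * r = f' * (s ^ (n - e) * (inverse (c e) * r)) +
    (\<Sum>i<e. s ^ (n - e + i) * (- (c i * (inverse (c e) * r))))" .
  have "f' * (s ^ (n - e) * (inverse (c e) * r)) \<in> filt e"
  proof -
   have "inverse (c e) * r \<in> T" using rR(5)[OF ci(2) less.prems] chartT(2) by blast
   hence "s ^ (n - e) * (inverse (c e) * r) \<in> T"
    using ring_setD(5)[OF chartT(1) ring_setD(7)[OF chartT(1,3)]] by blast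
   hence "f' * (s ^ (n - e) * (inverse (c e) * r)) \<in> filt 0" unfolding filt.simps by (rule smulI)
   thus ?thesis using filt_mono[of 0 e] by blast
  qed
  moreover have "(\<Sum>i<e. s ^ (n - e + i) * (- (c i * (inverse (c e) * r)))) \<in> filt e"
  proof (rule submod_sum[OF submod_filt])
   fix i assume "i \<in> {..<e}"
   hence "n - e + i < n" using False by auto
   moreover have "- (c i * (inverse (c e) * r)) \<in> R" using rR(3)[OF rR(5)[OF c(1) rR(5)[OF ci(2) less.prems]]] .
   ultimately show "s ^ (n - e + i) * (- (c i * (inverse (c e) * r))) \<in> filt e" by (rule less.IH)
  qed
  ultimately show ?thesis unfolding eq by (rule m(2))
 qed
qed

lemma filt_whole: "filt e = T"
proof
 show "T \<subseteq> filt e"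
 proof
  fix t assume "t \<in> T"
  then obtain a n where an: "a \<in> mpow R n" "t = a / x ^ n" unfolding T_def chart_iff by blast
  then obtain r where r: "\<forall>i. r i \<in> R" "a = (\<Sum>i\<le>n. r i * (x ^ (n - i) * y ^ i))"
   using mpow_iff[OF p] by blast
  have x0: "x \<noteq> 0" using zw1[OF R p] by blast
  have "t = (\<Sum>i\<le>n. s ^ i * r i)" unfolding an(2) r(2) sum_divide_distrib
  proof (rule sum.cong)
   fix i assume "i \<in> {..n}"
   hence "x ^ n = x ^ (n - i) * x ^ i" by (simp add: power_add[symmetric])
   thus "r i * (x ^ (n - i) * y ^ i) / x ^ n = s ^ i * r i" using x0 by (simp add: s_def power_divide)
  qed simp
  also have "\<dots> \<in> filt e" using r(1) by (intro submod_sum[OF submod_filt] filt_power) blast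
  finally show "t \<in> filt e" .
 qed
qed (rule filt_subset)

lemma K_filt: "submod R A ==> submod KK A" using submod_KK[OF regD(1)[OF R]] .

text \<open>The new layer s^i R is killed by \<open>f\<close>, since s^i f is a multiple of the
  strict transform, and by x^i, since s^i x^i = y^i lies in \<open>R\<close>. So it is a quotient of
  the finite R / (f, x^i). The bound i \<ge> 1 is what places \<open>R\<close> in
  \<open>filt i\<close>.\<close>

lemma filt_step_finite:
 assumes "i \<ge> 1" shows "dim (filt (Suc i)) (filt i) \<noteq> \<infinity>"
proof -
 note rR = ring_setD[OF regD(2)[OF R]] and self = submod_self[OF regD(2)[OF R]]
 note zw = zw1[OF R p] and c = curve_atD[OF C]
 let ?I = "f *o R +++ x ^ i *o R"
 have xi: "x ^ i \<in> R" using rR(7) zw(3) by blast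
 have "x ^ i \<notin> mx D"
 proof (induction i)
  case 0
  thus ?case using local_domD(5)[OF c(1), of 1] ring_setD(2)[OF local_domD(1)[OF c(1)]] by simp
 next
  case (Suc i)
  have "x \<in> D" "x ^ i \<in> D" using c(2) zw(3) rR(7) by blast+
  thus ?case using local_domD(6)[OF c(1) _ _ x_not_in_curve Suc] by simp
 qed
 hence fI: "dim R ?I \<noteq> \<infinity>" using fin xi c(5) unfolding finite_inum_def inum_def by blast
 have "dim (filt (Suc i)) (filt i) = dim (s ^ i *o R) ((s ^ i *o R) \<inter> filt i)"
  unfolding filt.simps using len_second_iso[OF ring_set_KK K_filt[OF submod_smul[OF self]] K_filt[OF submod_filt]] .
 also have "\<dots> \<le> dim (s ^ i *o R) (s ^ i *o ?I)"
 proof (intro len_mono1(2)[OF ring_set_KK] K_filt submod_smul submod_Int submod_filt self submod_two regD(2)[OF R])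
  have IR: "?I \<subseteq> R" using two_subset[OF regD(2)[OF R] c(3) xi] .
  show "(s ^ i *o R) \<inter> filt i \<subseteq> s ^ i *o R" by blast
  show "s ^ i *o ?I \<subseteq> (s ^ i *o R) \<inter> filt i"
  proof
   fix a assume "a \<in> s ^ i *o ?I"
   then obtain u v where uv: "u \<in> R" "v \<in> R" "a = s ^ i * (f * u + x ^ i * v)" by (metis set_addE smulE)
   have "f = f' * x ^ e" using zw unfolding f'_def by simp
   hence "s ^ i * (f * u) = f' * (s ^ i * (x ^ e * u))" by (simp add: ac_simps)
   moreover have "x ^ e * u \<in> T" using rR(5)[OF rR(7)[OF zw(3)] uv(1)] chartT(2) by blast
   hence "s ^ i * (x ^ e * u) \<in> T"
    using ring_setD(5)[OF chartT(1) ring_setD(7)[OF chartT(1,3)]] by blast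
   hence "f' * (s ^ i * (x ^ e * u)) \<in> filt 0" unfolding filt.simps by (rule smulI)
   ultimately have "s ^ i * (f * u) \<in> filt 0" by (simp only:)
   hence 1: "s ^ i * (f * u) \<in> filt i" using filt_mono[of 0 i] by blast
   have "s ^ i * (x ^ i * v) = s ^ 0 * (y ^ i * v) + 0" using zw unfolding s_def by (simp add: power_divide)
   also have "\<dots> \<in> filt (Suc 0)" unfolding filt.simps(2)
    using rR(5)[OF rR(7)[OF zw(4)] uv(2)] submodD(1)[OF submod_filt] by (intro set_addI smulI)
   finally have 2: "s ^ i * (x ^ i * v) \<in> filt i" using filt_mono[of "Suc 0" i] assms by auto
   have "a = s ^ i * (f * u) + s ^ i * (x ^ i * v)" unfolding uv(3) by (rule distrib_left)
   hence "a \<in> filt i" using submodD(2)[OF submod_filt 1 2] by simp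
   moreover have "f * u + x ^ i * v \<in> R" using rR(4,5) c(3) uv xi by blast
   hence "a \<in> s ^ i *o R" unfolding uv(3) by (rule smulI)
   ultimately show "a \<in> (s ^ i *o R) \<inter> filt i" by blast
  qed
 qed
 also have "\<dots> = dim R ?I" using zw unfolding s_def by (intro len_smul) simp
 finally show ?thesis using fI by (metis enat_ord_simps(5))
qed

lemma chart_over_image_finite: "dim T (filt 1) \<noteq> \<infinity>"
proof -
 have "dim (filt i) (filt 1) \<noteq> \<infinity>" if "i \<ge> 1" for i using that
 proof (induction i rule: dec_induct)
  case (step i)
  have "dim (filt (Suc i)) (filt 1) = dim (filt (Suc i)) (filt i) + dim (filt i) (filt 1)"
   using step by (intro len_add ring_set_KK K_filt submod_filt filt_mono) auto
  thus ?case using step filt_step_finite[of i] by auto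
 qed simp
 from this[of e] show ?thesis using strict_transform_mem(5)[OF R p T_def s_def refl C e_def] filt_whole by simp
qed

text \<open>R / f sits in T / f' with finite codimension. Multiplication by \<open>g\<close> is
  injective on both, so its two cokernels have the same dimension: the projection formula in one
  chart.\<close>

lemma chart_intersection:
 assumes g: "g \<in> R" "g \<notin> f *o R"
 shows "dim T (f' *o T +++ g *o T) = inum R f g"
proof -
 note rR = ring_setD[OF regD(2)[OF R]] and self = submod_self[OF regD(2)[OF R]]
 note rT = ring_setD[OF chartT(1)] and selfT = submod_self[OF chartT(1)]
 note c = curve_atD[OF C] and zw = zw1[OF R p] and D = local_domD[OF curve_atD(1)[OF C]]
 have KT: "submod T A ==> submod KK A" for A using submod_mono chartT(5) by blast
 have f1: "filt 1 = R +++ f' *o T" by (simp add: smul_def)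
 define J where "J = g *o R +++ f' *o T"
 have sT: "submod R (f' *o T)" using submod_filt[of 0] by simp
 have J: "submod R J" unfolding J_def by (intro submod_add submod_smul self sT)
 have gD: "g \<notin> mx D" using g c(5) by blast
 have g0: "g \<noteq> 0" using g smulI[OF rR(1), of f] by auto
 have gT: "g \<in> T" using g chartT(2) by blast
 have prime: "t \<in> f' *o T" if "t \<in> T" "g * t \<in> f' *o T" for t
 proof -
  have "g * t \<in> mx D" using that(2) transversal_chart(3) by blast
  hence "t \<in> mx D" using D(6)[of g t] gD gT that(1) transversal_chart(1) by blast
  thus ?thesis using that(1) transversal_chart(3) by blast
 qed
 have f'T: "f' *o T \<subseteq> T" using filt_subset[of 0] by simp
 have gTB: "g *o T +++ J = f' *o T +++ g *o T"
 proof
  have "g *o R \<subseteq> g *o T" using smul_mono chartT(2) by blast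
  thus "g *o T +++ J \<subseteq> f' *o T +++ g *o T" using set_add_subset_iff[of R "g *o T" J "f' *o T +++ g *o T"]
    set_add_subset_iff[of R "g *o R" "f' *o T" "f' *o T +++ g *o T"]
    set_add_ub1[of T "g *o T" "f' *o T"] set_add_ub2[of T "f' *o T" "g *o T"]
    submod_smul[OF selfT] submod_smul[OF self] J sT submod_mono[OF submod_smul[OF selfT] chartT(2)]
    submod_add unfolding J_def by blast
  have "f' *o T \<subseteq> J" unfolding J_def by (rule set_add_ub2[OF submod_smul[OF self]])
  thus "f' *o T +++ g *o T \<subseteq> g *o T +++ J" by (subst set_add_commute) (rule set_add_mono[OF order_refl])
 qed
 have gint: "(g *o T) \<inter> J = g *o filt 1"
 proof
  show "(g *o T) \<inter> J \<subseteq> g *o filt 1"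
  proof
   fix a assume a: "a \<in> (g *o T) \<inter> J"
   then obtain t where t: "t \<in> T" "a = g * t" by (metis IntD1 smulE)
   obtain r u where ru: "r \<in> R" "u \<in> T" "a = g * r + f' * u" using a unfolding J_def by (metis IntD2 set_addE smulE)
   have "g * (t - r) = f' * u" using t ru by (simp add: algebra_simps)
   hence "g * (t - r) \<in> f' *o T" using ru by (simp only: smulI)
   hence "t - r \<in> f' *o T" using prime rT(6) t(1) ru(1) chartT(2) by blast
   hence "r + (t - r) \<in> R +++ f' *o T" by (rule set_addI[OF ru(1)])
   thus "a \<in> g *o filt 1" unfolding f1 using t by (simp add: smulI)
  qed
  show "g *o filt 1 \<subseteq> (g *o T) \<inter> J"
  proof
   fix a assume "a \<in> g *o filt 1"
   then obtain r u where ru: "r \<in> R" "u \<in> T" "a = g * (r + f' * u)" unfolding f1 by (metis set_addE smulE)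
   have "r + f' * u \<in> T" using rT(4,5) ru f'_mem chartT(2) by blast
   hence "a \<in> g *o T" unfolding ru(3) by (rule smulI)
   moreover have "a = g * r + f' * (g * u)" using ru by (simp add: algebra_simps)
   hence "a \<in> J" unfolding J_def using ru rT(5)[OF gT] by (simp only: set_addI smulI)
   ultimately show "a \<in> (g *o T) \<inter> J" by blast
  qed
 qed
 have d1: "dim (f' *o T +++ g *o T) J = dim T (filt 1)"
  using len_second_iso[OF ring_set_KK KT[OF submod_smul[OF selfT]] K_filt[OF J], of g]
  unfolding gTB gint len_smul[OF g0] .
 have RJ: "R +++ J = filt 1"
 proof
  have "g *o R \<subseteq> R" using g(1) rR(5) by (auto elim!: smulE)
  hence "J \<subseteq> filt 1" unfolding J_def f1 by (intro set_add_mono order_refl)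
  moreover have "R \<subseteq> filt 1" unfolding f1 by (rule set_add_ub1[OF sT])
  ultimately show "R +++ J \<subseteq> filt 1" using set_add_subset_iff[OF self J submod_filt] by blast
  show "filt 1 \<subseteq> R +++ J" unfolding f1 J_def
   by (intro set_add_mono order_refl set_add_ub2[OF submod_smul[OF self]])
 qed
 have RJint: "R \<inter> J = f *o R +++ g *o R"
 proof
  show "R \<inter> J \<subseteq> f *o R +++ g *o R"
  proof
   fix a assume a: "a \<in> R \<inter> J"
   then obtain r u where ru: "r \<in> R" "u \<in> T" "a = g * r + f' * u" unfolding J_def by (metis IntD2 set_addE smulE)
   have "f' * u = a - g * r" using ru by simp
   hence "f' * u \<in> R" using rR(5,6) a ru(1) g(1) by auto
   moreover have "f' * u \<in> mx D" using transversal_chart(3) smulI[OF ru(2), of f'] by blast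
   ultimately have "f' * u \<in> f *o R" using c(5) by blast
   thus "a \<in> f *o R +++ g *o R" unfolding ru(3) using ru(1) by (subst add.commute) (intro set_addI smulI)
  qed
  have "f *o R \<subseteq> f' *o T"
  proof
   fix a assume "a \<in> f *o R"
   then obtain r where r: "r \<in> R" "a = f * r" by (rule smulE)
   have "a = f' * (x ^ e * r)" using r zw unfolding f'_def by simp
   moreover have "x ^ e * r \<in> T" using rR(5)[OF rR(7)[OF zw(3)] r(1)] chartT(2) by blast
   ultimately show "a \<in> f' *o T" by (simp only: smulI)
  qed
  hence "f *o R +++ g *o R \<subseteq> J" unfolding J_def by (subst set_add_commute) (intro set_add_mono order_refl)
  thus "f *o R +++ g *o R \<subseteq> R \<inter> J" using two_subset[OF regD(2)[OF R] c(3) g(1)] by blast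
 qed
 have d2: "dim (filt 1) J = inum R f g"
  using len_second_iso[OF ring_set_KK K_filt[OF self] K_filt[OF J]] unfolding RJ RJint inum_def .
 \<comment> \<open>The four modules form a diamond between \<open>T\<close> and \<open>J\<close>.
   The two sides of equal finite length are \<open>T\<close> over the image of \<open>R\<close> and
   its copy multiplied by \<open>g\<close>.\<close>
 have "dim T (f' *o T +++ g *o T) = dim (filt 1) J"
 proof (rule len_eq_cancel[OF ring_set_KK KT[OF selfT] K_filt[OF submod_filt] KT[OF submod_two[OF chartT(1)]] K_filt[OF J]])
  show "J \<subseteq> filt 1" unfolding RJ[symmetric] by (rule set_add_ub2[OF self])
  show "filt 1 \<subseteq> T" by (rule filt_subset)
  show "J \<subseteq> f' *o T +++ g *o T" unfolding gTB[symmetric] by (rule set_add_ub2[OF submod_smul[OF selfT]])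
  show "f' *o T +++ g *o T \<subseteq> T" by (rule two_subset[OF chartT(1) f'_mem gT])
 qed (use d1 chart_over_image_finite in auto)
 thus ?thesis using d2 by simp
qed

text \<open>Modulo \<open>x\<close> the strict transform becomes the dehomogenized initial form
  \<open>q\<close>, whose degree is exactly e by transversality; the quotient is a polynomial ring
  in \<open>s\<close> modulo \<open>q\<close>.\<close>

lemma chart_exceptional_intersection: "dim T (f' *o T +++ x *o T) = enat e"
proof -
 note rT = ring_setD[OF chartT(1)] and selfT = submod_self[OF chartT(1)]
 note st = strict_transform_mem[OF R p T_def s_def refl C e_def] and P = paramsD[OF p] and rr = ring_setD[OF paramsD(2)[OF p]]
 have x0: "x \<noteq> 0" using zw1[OF R p] by blast
 let ?J = "f' *o T +++ x *o T"
 have J: "submod T ?J" by (rule submod_two[OF chartT(1)])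
 have KJ: "submod KK ?J" using submod_mono[OF J chartT(5)] .
 obtain q where q: "degree q \<le> e" "f - x ^ e * ev s q \<in> mpow R (Suc e)"
  using leading_poly[OF R p st(1)] unfolding s_def by metis
 have "(f - x ^ e * ev s q) / x ^ Suc e \<in> T" using chartT(7)[OF q(2)] .
 moreover have "f' = ev s q + x * ((f - x ^ e * ev s q) / x ^ Suc e)"
  unfolding f'_def using x0 by (simp add: field_simps)
 ultimately obtain t where t: "t \<in> T" "f' = ev s q + x * t" by blast
 have qe: "pcoeff q e \<noteq> 0"
 proof
  assume qe: "pcoeff q e = 0"
  obtain e' where e': "e = Suc e'" using st(5) by (cases e) auto
  have dq: "degree q \<le> e'"
  proof (rule degree_le, intro allI impI)
   fix i assume "e' < i"
   hence "i = e \<or> degree q < i" using q(1) e' by linarith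
   thus "pcoeff q i = 0" using qe by (auto simp: coeff_eq_0)
  qed
  have "x ^ e' * ev s q \<in> R" using homogenize_mem[OF R p dq] submod_mpow(2)[OF P(1)] unfolding s_def by blast
  hence "x * (x ^ e' * ev s q) + (f - x ^ e * ev s q) \<in> x *o R +++ mpow R (Suc e)"
   using q(2) by (intro set_addI smulI)
  thus False using trans e' by (simp add: mult.assoc)
 qed
 hence degq: "degree q = e" using q(1) le_degree le_antisym by blast
 have q0: "q \<noteq> 0" using qe by auto
 have evq: "ev s (q * d) \<in> ?J" for d
 proof -
  have dT: "ev s d \<in> T" by (rule ev_in_T[OF R p T_def s_def])
  have "ev s (q * d) = f' * ev s d + x * (- (t * ev s d))" using t(2) by (simp add: ev_mult algebra_simps)
  thus ?thesis using dT rT(3)[OF rT(5)[OF t(1) dT]] by (simp only: set_addI smulI)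
 qed
 have "T = span_over ?J (\<lambda>i. s ^ i) e"
 proof
  show "T \<subseteq> span_over ?J (\<lambda>i. s ^ i) e"
  proof
   fix a assume "a \<in> T"
   then obtain b u where b: "u \<in> T" "a = ev s b + x * u" using chart_resid[OF R p T_def s_def] by metis
   have deg: "b mod q = 0 \<or> degree (b mod q) < e" using degree_mod_less[OF q0, of b] degq by simp
   have "ev s b = ev s (q * (b div q)) + ev s (b mod q)" unfolding ev_add[symmetric] by simp
   moreover have "ev s (b mod q) = (\<Sum>i<e. K (pcoeff (b mod q) i) * s ^ i)"
   proof (cases "b mod q = 0")
    case False
    obtain e' where e': "e = Suc e'" using st(5) by (cases e) auto
    thus ?thesis using deg False ev_altdef[of "b mod q" e' s] by (simp add: lessThan_Suc_atMost)
   qed simp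
   ultimately have "a - (\<Sum>i<e. K (pcoeff (b mod q) i) * s ^ i) = ev s (q * (b div q)) + x * u"
    using b(2) by simp
   moreover have "x * u \<in> ?J" using mem_two(4)[OF chartT(1) b(1)] .
   ultimately show "a \<in> span_over ?J (\<lambda>i. s ^ i) e"
    unfolding span_over_iff[OF KJ] using submodD(2)[OF J evq] by metis
  qed
  show "span_over ?J (\<lambda>i. s ^ i) e \<subseteq> T"
  proof
   fix a assume "a \<in> span_over ?J (\<lambda>i. s ^ i) e"
   then obtain c where c: "a - (\<Sum>i<e. K (c i) * s ^ i) \<in> ?J" unfolding span_over_iff[OF KJ] by blast
   moreover have "x \<in> T" using chartT(4) .
   ultimately have "a - (\<Sum>i<e. K (c i) * s ^ i) \<in> T" using two_subset[OF chartT(1) f'_mem] by blast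
   moreover have "(\<Sum>i<e. K (c i) * s ^ i) \<in> T"
    by (intro ring_set_sum[OF chartT(1)] rT(5) rT(7) chartT(3,6))
   ultimately show "a \<in> T" using rT(4) by fastforce
  qed
 qed
 moreover have "dim (span_over ?J (\<lambda>i. s ^ i) e) ?J = enat e" unfolding dim_span_over_eq_iff[OF KJ]
 proof (intro allI impI)
  fix c i assume c: "(\<Sum>i<e. K (c i) * s ^ i) \<in> ?J" and i: "i < e"
  define b where "b = (\<Sum>i<e. monom (c i) i)"
  have cb: "pcoeff b i = (if i < e then c i else 0)" for i unfolding b_def coeff_sum by (simp add: sum.delta)
  have evb: "ev s b = (\<Sum>i<e. K (c i) * s ^ i)" unfolding b_def by (simp add: ev_sum ev_monom)
  have "ev s b \<in> ?J" using c unfolding evb .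
  then obtain u v where uv: "u \<in> T" "v \<in> T" "ev s b = f' * u + x * v" by (metis set_addE smulE)
  obtain d w where w: "w \<in> T" "u = ev s d + x * w" using chart_resid[OF R p T_def s_def uv(1)] by metis
  have "ev s (b - q * d) = x * (t * u + ev s q * w + v)"
   using uv(3) t(2) w(2) by (simp add: ev_diff ev_mult algebra_simps)
  moreover have "t * u + ev s q * w + v \<in> T"
   using rT(4)[OF rT(4)[OF rT(5)[OF t(1) uv(1)] rT(5)[OF ev_in_T[OF R p T_def s_def] w(1)]] uv(2)] .
  ultimately have "b - q * d = 0" using chart_ev_zero[OF R p T_def s_def] smulI by metis
  hence bq: "b = q * d" by simp
  have "b = 0"
  proof (rule ccontr)
   assume b0: "b \<noteq> 0"
   hence "degree b \<ge> e" using bq degq by (auto simp: degree_mult_eq)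
   moreover have "degree b < e" using b0 cb by (metis leading_coeff_0_iff)
   ultimately show False by simp
  qed
  thus "c i = 0" using cb[of i] i by simp
 qed
 ultimately show ?thesis by metis
qed

text \<open>The points at which the strict transform meets the exceptional divisor.\<close>

definition chart_primes :: "'f set set" where
 "chart_primes = {P. maximalideal P (ring_on T) \<and> x \<in> P \<and> f' \<in> P}"

lemma chart_primesE:
 assumes "P \<in> chart_primes"
 obtains c where "P = chart_ideal R x (y - K c * x)" "params R x (y - K c * x)" "resid T P"
  "localize T P = blow R x (y - K c * x)"
proof -
 have P: "maximalideal P (ring_on T)" "x \<in> P" using assms unfolding chart_primes_def by auto
 obtain c where c: "P = chart_ideal R x (y - K c * x)"
  using chart_prime_classify[OF R p T_def s_def maximalideal_imp_prime_at[OF chartT(1) P(1)] P] .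
 have p': "params R x (y - K c * x)" using params_shear[OF params_commute[OF p]] params_commute by blast
 have "resid T P" unfolding c by (rule resid_chart[OF R p' T_def refl])
 thus ?thesis using that c p' unfolding blow_def T_def by blast
qed

text \<open>The only direction outside the chart of \<open>x\<close> is the one where x / y
  vanishes. There f / y^e has the same residue as the unit \<open>r e\<close>, so the strict
  transform avoids it.\<close>

lemma exceptional_through_chart:
 assumes L: "L \<in> exc R" "L \<subseteq> D"
 shows "\<exists>P\<in>chart_primes. L = localize T P"
proof -
 note p' = params_commute[OF p]
 have lL: "loc_ring L" using regD(1)[OF reg_exceptional[OF R L(1)]] .
 note rL = ring_setD[OF loc_ringD(1)[OF lL]]
 have "y / x \<in> L" using exceptional_direction[OF R L(1) p]
 proof (elim disjE exE conjE)
  assume "L = blow R x y"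
  thus "y / x \<in> L" using paramsD(7)[OF params_blow1[OF R p]] by simp
 next
  assume Ly: "L = blow R y x"
  note PL = paramsD[OF params_blow1[OF R p'], folded Ly]
  obtain r where r: "\<And>i. r i \<in> R" "f = (\<Sum>i\<le>e. r i * (x ^ (e - i) * y ^ i))" "r e \<notin> mx R"
   by (rule transversal_expansion) blast
  obtain e' where e': "e = Suc e'" using strict_transform_mem(5)[OF R p T_def s_def refl C e_def] by (cases e) auto
  define h where "h = (\<Sum>i\<le>e'. r i * (x ^ (e' - i) * y ^ i))"
  have "h \<in> mpow R e'" unfolding h_def
   using submod_sum[OF submod_mpow(1)[OF regD(1)[OF R]]] submodD(3)[OF submod_mpow(1)[OF regD(1)[OF R]] r(1)]
    mpow_monomial[OF p] by (metis (no_types, lifting) atMost_iff)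
  hence "h / y ^ e' \<in> L" using blow_divide_power[OF R p'] Ly by blast
  hence h: "(x / y) * (h / y ^ e') \<in> mx L" using submodD(4)[OF loc_ringD(4)[OF lL]] PL(6) PL(5) by blast
  have "f = x * h + r e * y ^ e" unfolding r(2) e' h_def by (simp add: sum_distrib_left Suc_diff_le ac_simps)
  hence fy: "f / y ^ e = r e + (x / y) * (h / y ^ e')" using zw1(1)[OF R p'] e' by (simp add: field_simps)
  have "r e \<notin> mx L" using r(1,3) exceptional_dominates[OF R L(1)] unfolding dominates_def by blast
  hence "f / y ^ e \<notin> mx L" unfolding fy using add_notin_max_ideal[OF lL] h by blast
  thus "y / x \<in> L" using strict_transform_through_iff[OF R p' refl refl Ly C e_def] L(2) by blast
 next
  fix z w assume zw: "params R z w" "x / z \<in> L" "x / z \<notin> mx L" "y / z \<in> L"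
  have "(y / z) * inverse (x / z) \<in> L" using rL(5)[OF zw(4) not_max_ideal_inverse(2)[OF lL zw(2,3)]] .
  thus "y / x \<in> L" using zw1(1)[OF R zw(1)] by simp
 qed
 then obtain c where c: "y / x - K c \<in> mx L" using loc_ringD(6)[OF lL] by blast
 define y' where "y' = y - K c * x"
 have q: "params R x y'" unfolding y'_def using params_shear[OF p'] params_commute by blast
 have "y' / x \<in> mx L" using c zw1(1)[OF R p] unfolding y'_def by (simp add: diff_divide_distrib)
 hence Lx: "L = blow R x y'" by (rule blow_eqI[OF R L(1) q])
 define P where "P = chart_ideal R x y'"
 have rP: "resid T P" unfolding P_def by (rule resid_chart[OF R q T_def refl])
 have LP: "L = localize T P" unfolding Lx blow_def P_def T_def ..
 note m = max_ideal_localize_contract[OF resid_prime_at[OF rP], folded LP]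
 have "x \<in> P" using m chartT(4) paramsD(4)[OF params_blow1[OF R q], folded Lx] by blast
 moreover have "f' \<in> P"
  using m f'_mem strict_transform_through_iff[OF R q refl refl Lx C e_def] L(2) unfolding f'_def by blast
 ultimately show ?thesis using LP resid_maximalideal[OF rP] unfolding chart_primes_def by blast
qed

lemma chart_primes_bij: "bij_betw (localize T) chart_primes {L \<in> exc R. L \<subseteq> D}"
proof (rule bij_betw_imageI)
 have "T \<inter> mx (localize T P) = P" if P: "P \<in> chart_primes" for P
 proof -
  have "resid T P" using chart_primesE[OF P] by metis
  thus ?thesis using max_ideal_localize_contract[OF resid_prime_at] residD(5) by blast
 qed
 thus "inj_on (localize T) chart_primes" by (metis inj_onI)
 have "localize T P \<in> {L \<in> exc R. L \<subseteq> D}" if P: "P \<in> chart_primes" for P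
 proof -
  obtain c where c: "params R x (y - K c * x)" "resid T P" "localize T P = blow R x (y - K c * x)"
   using P chart_primesE by metis
  have "f' \<in> mx (localize T P)"
   using max_ideal_localize_contract[OF resid_prime_at[OF c(2)] f'_mem] P unfolding chart_primes_def by blast
  hence "localize T P \<subseteq> D"
   using strict_transform_through_iff[OF R c(1) refl refl c(3) C e_def] unfolding f'_def by blast
  thus ?thesis using blow_exceptional_points[OF R c(1)] c(3) by simp
 qed
 thus "localize T ` chart_primes = {L \<in> exc R. L \<subseteq> D}"
  using exceptional_through_chart by blast
qed

text \<open>The maximal ideals that carry the quotient contain \<open>f'\<close> and
  \<open>g\<close>; \<open>pr\<close> puts them on the exceptional divisor, and the remaining points
  of the strict transform there contribute 0.\<close>

lemma chart_sum:
 assumes g: "g \<in> T" and fin: "dim T (f' *o T +++ g *o T) \<noteq> \<infinity>"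
  and pr: "\<And>P. maximalideal P (ring_on T) ==> f' \<in> P ==> g \<in> P ==> x \<in> P" and "finite chart_primes"
 shows "dim T (f' *o T +++ g *o T) = (\<Sum>L | L \<in> exc R \<and> L \<subseteq> D. inum L f' g)"
proof -
 let ?J = "f' *o T +++ g *o T"
 note T = chartT(1)
 have J: "submod T ?J" "?J \<subseteq> T" using submod_two[OF T] two_subset[OF T f'_mem g] by auto
 have sub_iff: "?J \<subseteq> P \<longleftrightarrow> f' \<in> P \<and> g \<in> P" if "maximalideal P (ring_on T)" for P
 proof
  note m = submodD[OF prime_atD(2)[OF maximalideal_imp_prime_at[OF T that]]]
  show "?J \<subseteq> P ==> f' \<in> P \<and> g \<in> P" using mem_two(1,2)[OF T] by blast
  show "?J \<subseteq> P" if "f' \<in> P \<and> g \<in> P"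
  proof
   fix a assume "a \<in> ?J"
   then obtain u v where "u \<in> T" "v \<in> T" "a = f' * u + g * v" by (metis set_addE smulE)
   thus "a \<in> P" using m(2)[OF m(4) m(4)] \<open>f' \<in> P \<and> g \<in> P\<close> by blast
  qed
 qed
 have inQ: "P \<in> chart_primes" if "maximalideal P (ring_on T)" "?J \<subseteq> P" for P
  using that pr sub_iff unfolding chart_primes_def by blast
 have "resid T P" if "maximalideal P (ring_on T)" "?J \<subseteq> P" for P using chart_primesE[OF inQ[OF that]] by metis
 hence "dim T ?J = (\<Sum>P | maximalideal P (ring_on T) \<and> ?J \<subseteq> P. dim (localize T P) (ext_ideal T P ?J))"
  using dim_local_global[OF T chartT(5) J fin] by blast
 also have "\<dots> = (\<Sum>P\<in>chart_primes. dim (localize T P) (ext_ideal T P ?J))"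
 proof (rule sum.mono_neutral_left[OF assms(4)])
  show "\<forall>P\<in>chart_primes - {P. maximalideal P (ring_on T) \<and> ?J \<subseteq> P}. dim (localize T P) (ext_ideal T P ?J) = 0"
  proof
   fix P assume P: "P \<in> chart_primes - {P. maximalideal P (ring_on T) \<and> ?J \<subseteq> P}"
   hence "maximalideal P (ring_on T)" "\<not> ?J \<subseteq> P" unfolding chart_primes_def by auto
   thus "dim (localize T P) (ext_ideal T P ?J) = 0" using ext_ideal_whole[OF maximalideal_imp_prime_at[OF T] J] by simp
  qed
 qed (use inQ in blast)
 also have "\<dots> = (\<Sum>P\<in>chart_primes. inum (localize T P) f' g)"
 proof (rule sum.cong[OF refl])
  fix P assume "P \<in> chart_primes"
  hence "maximalideal P (ring_on T)" unfolding chart_primes_def by blast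
  thus "dim (localize T P) (ext_ideal T P ?J) = inum (localize T P) f' g"
   using ext_ideal_add_principal[OF maximalideal_imp_prime_at[OF T]] unfolding inum_def by simp
 qed
 also have "\<dots> = (\<Sum>L | L \<in> exc R \<and> L \<subseteq> D. inum L f' g)"
  using sum.reindex_bij_betw[OF chart_primes_bij, of "\<lambda>L. inum L f' g"] by simp
 finally show ?thesis .
qed

lemma finite_chart_primes: "finite chart_primes"
proof -
 note T = chartT(1)
 let ?J = "f' *o T +++ x *o T"
 have J: "submod T ?J" "?J \<subseteq> T" using submod_two[OF T] two_subset[OF T f'_mem chartT(4)] by auto
 have "P \<in> chart_primes" if "maximalideal P (ring_on T)" "?J \<subseteq> P" for P
  using that mem_two(1,2)[OF T] unfolding chart_primes_def by blast
 hence "resid T P" if "maximalideal P (ring_on T)" "?J \<subseteq> P" for P using chart_primesE that by metis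
 hence "finite {P. maximalideal P (ring_on T) \<and> ?J \<subseteq> P}"
  using dim_local_global[OF T chartT(5) J] chart_exceptional_intersection by auto
 moreover have "chart_primes \<subseteq> {P. maximalideal P (ring_on T) \<and> ?J \<subseteq> P}"
 proof
  fix P assume P: "P \<in> chart_primes"
  hence "maximalideal P (ring_on T)" "f' \<in> P" "x \<in> P" unfolding chart_primes_def by auto
  thus "P \<in> {P. maximalideal P (ring_on T) \<and> ?J \<subseteq> P}"
   using prime_atD(2)[OF maximalideal_imp_prime_at[OF T]] submodD(2,4) by (blast elim: set_addE smulE)
 qed
 ultimately show ?thesis by (rule finite_subset[rotated])
qed

lemma transversal_sums:
 "finite {L. L \<in> exc R \<and> L \<subseteq> D}"
 "(\<Sum>L | L \<in> exc R \<and> L \<subseteq> D. inum L f' x) = enat e"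
 "g \<in> R ==> g \<notin> f *o R ==> (\<Sum>L | L \<in> exc R \<and> L \<subseteq> D. inum L f' g) = inum R f g"
 "L \<in> exc R ==> L \<subseteq> D ==> \<exists>w. params R x w \<and> L = blow R x w"
proof -
 note T = chartT(1)
 show "finite {L. L \<in> exc R \<and> L \<subseteq> D}"
  using bij_betw_finite[OF chart_primes_bij] finite_chart_primes by simp
 show "(\<Sum>L | L \<in> exc R \<and> L \<subseteq> D. inum L f' x) = enat e"
  using chart_sum[OF chartT(4) _ _ finite_chart_primes] chart_exceptional_intersection by auto
 show "(\<Sum>L | L \<in> exc R \<and> L \<subseteq> D. inum L f' g) = inum R f g" if g: "g \<in> R" "g \<notin> f *o R"
 proof -
  note d = chart_intersection[OF g]
  have fi: "inum R f g \<noteq> \<infinity>" using fin g unfolding finite_inum_def by blast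
  \<comment> \<open>R / (f, g) is finite, so a power of \<open>x\<close> lies in (f, g): the two
    pulled back equations have no common zero off the exceptional divisor.\<close>
  have "x \<in> P" if P: "maximalideal P (ring_on T)" "f' \<in> P" "g \<in> P" for P
  proof -
   note pP = maximalideal_imp_prime_at[OF T P(1)]
   have "x \<in> mx R" using paramsD(4)[OF p] .
   then obtain n where n: "x ^ n \<in> f *o R +++ g *o R"
    using power_in_finite_ideal[OF regD(1)[OF R] submod_two[OF regD(2)[OF R]] two_subset[OF regD(2)[OF R] curve_atD(3)[OF C] g(1)]] fi
    unfolding inum_def by blast
   then obtain u v where uv: "u \<in> R" "v \<in> R" "x ^ n = f * u + g * v" by (metis set_addE smulE)
   have x0: "x \<noteq> 0" using zw1[OF R p] by blast
   have "f = x ^ e * f'" unfolding f'_def using x0 by simp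
   hence "f \<in> P" using submodD(3)[OF prime_atD(2)[OF pP] _ P(2)] ring_setD(7)[OF T chartT(4)] by simp
   hence "x ^ n \<in> P" unfolding uv(3)
    using submodD(2)[OF prime_atD(2)[OF pP]] submodD(4)[OF prime_atD(2)[OF pP]] P(3) uv chartT(2) by blast
   moreover have "x ^ n \<notin> P" if "x \<notin> P"
    using that prime_atD(4,5)[OF pP] chartT(4) ring_setD(7)[OF T] by (induction n) auto
   ultimately show ?thesis by blast
  qed
  thus ?thesis using chart_sum[OF _ _ _ finite_chart_primes, of g] d fi g(1) chartT(2) by auto
 qed
 show "\<exists>w. params R x w \<and> L = blow R x w" if "L \<in> exc R" "L \<subseteq> D"
  using exceptional_through_chart[OF that] chart_primesE by metis
qed

end

end

section \<open>Intersection numbers with a curve\<close>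

text \<open>A root of p - 1 is a point where \<open>p\<close> takes the value 1; no count of field
  elements is involved.\<close>

lemma (in const_field) poly_nonroot: "(p :: 'k poly) \<noteq> 0 ==> \<exists>c. poly p c \<noteq> 0"
proof (cases "degree p = 0")
 case True
 moreover assume "p \<noteq> 0"
 ultimately obtain a where "p = [:a:]" "a \<noteq> 0" by (metis degree_eq_zeroE pCons_0_0)
 thus ?thesis by simp
next
 case False
 hence "degree (p - 1) > 0" using degree_add_eq_left[of "-1" p] by simp
 then obtain c where "poly (p - 1) c = 0" using alg_closed_imp_poly_has_root by blast
 thus ?thesis by (intro exI[of _ c]) auto
qed

context const_field
begin

text \<open>The initial form of \<open>f\<close>, as a polynomial in x0 / y, has a non-root l. The
  germ x0 - l y is then not tangent to the curve.\<close>

lemma transversal_exists: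
 assumes R: "reg R" and f: "f \<in> mpow R e" "f \<notin> mpow R (Suc e)"
 obtains x y where "params R x y" "f \<notin> x *o R +++ mpow R (Suc e)"
proof -
 obtain x0 y where p0: "params R x0 y" using regD(3)[OF R] by blast
 define T where "T = chart R y"
 note p0' = params_commute[OF p0]
 obtain q t where q: "t \<in> T" "f / y ^ e = ev (x0 / y) q + y * t" "q \<noteq> 0"
  using chart_leading[OF R p0' T_def refl f(1)] f(2) by metis
 then obtain l where l: "poly q l \<noteq> 0" using poly_nonroot by blast
 define x where "x = x0 - K l * y"
 have p: "params R x y" unfolding x_def by (rule params_shear[OF p0])
 note p' = params_commute[OF p]
 define L where "L = blow R y x"
 note P = paramsD[OF p] and y0 = zw1(1)[OF R p']
 note PL = paramsD[OF params_blow1[OF R p'], folded L_def]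
 note mL = submodD[OF loc_ringD(4)[OF PL(1)]] and tL = ring_set_T[OF R p' T_def refl]
 have TL: "T \<subseteq> L" unfolding L_def by (rule chart_subset_blow[OF R p' T_def refl])
 have x0y: "x0 / y = x / y + K l" using y0 by (simp add: x_def diff_divide_distrib)
 have "ev (x0 / y) q' - K (poly q' l) \<in> mx L" for q'
 proof (induction q')
  case (pCons a q')
  have "ev (x0 / y) q' \<in> L" using ev_in_T[OF R p0' T_def refl] TL by blast
  hence "K l * (ev (x0 / y) q' - K (poly q' l)) + ev (x0 / y) q' * (x / y) \<in> mx L"
   using mL(2,3) loc_ringD(2)[OF PL(1)] pCons PL(5) by blast
  thus ?case unfolding x0y by (simp add: K_add K_mult algebra_simps)
 qed (simp add: mL(1))
 moreover have "y * t \<in> mx L" using mL(4)[OF subsetD[OF TL q(1)] PL(4)] .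
 ultimately have "(ev (x0 / y) q - K (poly q l)) + y * t \<in> mx L" using mL(2) by blast
 \<comment> \<open>At the point of the exceptional divisor where x / y vanishes, f / y^e has the
   nonzero residue q(l).\<close>
 hence fL: "f / y ^ e \<notin> mx L"
  using add_notin_max_ideal[OF PL(1) K_notin_max_ideal[OF PL(1) l]] unfolding q(2) by fastforce
 have "f \<notin> x *o R +++ mpow R (Suc e)"
 proof
  assume "f \<in> x *o R +++ mpow R (Suc e)"
  then obtain u v where uv: "u \<in> R" "v \<in> mpow R (Suc e)" "f = x * u + v" by (metis set_addE smulE)
  have "v / y ^ Suc e \<in> L" using tL(7)[OF uv(2)] TL by blast
  hence v: "y * (v / y ^ Suc e) \<in> mx L" using mL(4) PL(4) by blast
  have "f - v \<in> mpow R e"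
   using submod_diff[OF submod_mpow(1)[OF P(1)] P(2) f(1)] mpow_antimono_Suc[OF p] uv(2) by blast
  hence xu: "x * u \<in> mpow R e" using uv(3) by simp
  show False
  proof (cases e)
   case 0
   hence "f \<in> mx R"
    unfolding uv(3) using uv(2) mpow_1[OF p] submodD(2)[OF loc_ringD(4)[OF P(1)] submodD(4)[OF loc_ringD(4)[OF P(1)] uv(1) P(4)]]
    by simp
   thus False using f(2) 0 mpow_1[OF p] by simp
  next
   case (Suc k)
   have "x \<in> mpow R (Suc 0)" "x \<notin> mpow R (Suc (Suc 0))"
    using P(4) mpow_1[OF p] params_nonzero[OF R p] by (simp_all add: numeral_2_eq_2)
   hence "u \<in> mpow R k" using mpow_cancel[OF R _ _ uv(1)] xu Suc by simp
   hence "u / y ^ k \<in> L" using tL(7) TL by blast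
   hence "(u / y ^ k) * (x / y) + y * (v / y ^ Suc e) \<in> mx L" using mL(2,3) PL(5) v by blast
   moreover have "f / y ^ e = (u / y ^ k) * (x / y) + y * (v / y ^ Suc e)"
    using y0 unfolding uv(3) Suc by (simp add: field_simps)
   ultimately show False using fL by simp
  qed
 qed
 thus ?thesis using that p by blast
qed

text \<open>Unlike \<open>inum\<close> this refers to the ideal of the curve and not to an equation,
  so it can be followed through a sequence of blowups.\<close>

definition cnum :: "'f set => 'f set => 'f => enat" where
 "cnum D R g = dim R ((R \<inter> mx D) +++ g *o R)"

lemma cnum_eq_inum: "curve_at D R f ==> cnum D R g = inum R f g"
 unfolding cnum_def inum_def using curve_atD(6) by metis

definition good :: "'f set => 'f set => bool" where
 "good D R \<longleftrightarrow> reg R \<and> (\<exists>f. curve_at D R f) \<and> (\<forall>g\<in>R. g \<notin> mx D --> cnum D R g \<noteq> \<infinity>)"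

lemma goodD:
 assumes "good D R"
 shows "reg R" "\<exists>f. curve_at D R f" "g \<in> R ==> g \<notin> mx D ==> cnum D R g \<noteq> \<infinity>" "loc_ring R"
  "ring_set R" "local_dom D" "R \<subseteq> D" using assms regD(1,2) curve_atD(1,2) unfolding good_def by blast+

lemma good_finite_inum: "good D R ==> curve_at D R f ==> finite_inum R f"
 unfolding finite_inum_def using goodD(3) cnum_eq_inum curve_atD(5) by metis

lemma cnum_mult:
 assumes "good D R" "a \<in> R" "b \<in> R" "a \<notin> mx D"
 shows "cnum D R (a * b) = cnum D R a + cnum D R b"
proof -
 obtain f where C: "curve_at D R f" using goodD(2)[OF assms(1)] by blast
 show ?thesis unfolding cnum_eq_inum[OF C]
  using inum_mult[OF goodD(4)[OF assms(1)] C assms(2,3)] assms(2,4) curve_atD(5)[OF C] by blast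
qed

lemma cnum_unit:
 assumes "good D R" "u \<in> R" "u \<notin> mx R" shows "cnum D R u = 0"
proof -
 obtain f where C: "curve_at D R f" using goodD(2)[OF assms(1)] by blast
 show ?thesis unfolding cnum_eq_inum[OF C] by (rule inum_unit[OF goodD(4)[OF assms(1)] curve_atD(3)[OF C] assms(2,3)])
qed

lemma unit_not_in_curve:
 assumes "good D R" "u \<in> R" "u \<notin> mx R" shows "u \<notin> mx D"
 using not_max_ideal_inverse[OF goodD(4)[OF assms(1)] assms(2,3)] local_domD(5)[OF goodD(6)[OF assms(1)], of u]
  goodD(7)[OF assms(1)] assms(2) by blast

lemma cnum_unit_mult:
 assumes "good D R" "u \<in> R" "u \<notin> mx R" "g \<in> R" shows "cnum D R (u * g) = cnum D R g"
 using cnum_mult[OF assms(1,2,4) unit_not_in_curve[OF assms(1-3)]] cnum_unit[OF assms(1-3)] by simp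

definition exc_on :: "'f set => 'f set => 'f set set" where
 "exc_on D R = {L \<in> exc R. L \<subseteq> D}"

text \<open>Both \<open>x\<close> and \<open>z\<close> are equations of the exceptional divisor at
  the same point, so each divides the other.\<close>

lemma chart_unit:
 assumes R: "reg R" and p: "params R x y" "params R z w" and eq: "blow R x y = blow R z w"
 shows "x / z \<in> blow R x y" "x / z \<notin> mx (blow R x y)"
proof -
 note x = zw1[OF R p(1)] and z = zw1[OF R p(2)]
 note PL = paramsD[OF params_blow1[OF R p(1)]]
 show 1: "x / z \<in> blow R x y" using blow_divide[OF R p(2) x(5)] eq by blast
 have "inverse (x / z) \<in> blow R x y" using blow_divide[OF R p(1) z(5)] by auto
 thus "x / z \<notin> mx (blow R x y)" using x(1) z(1) by (simp add: max_ideal_iff)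
qed

text \<open>The transversal parameter serves the computation; the result is stated through
  \<open>cnum\<close> and \<open>mult_at\<close>, with one \<open>x\<close> that is an equation of
  the exceptional divisor at every point of the strict transform over \<open>R\<close>.\<close>

theorem blowup_intersection:
 assumes G: "good D R"
 obtains x where "x \<in> mx R" "x \<notin> mx D" "x \<noteq> 0"
  "\<And>L. L \<in> exc_on D R ==> \<exists>w. params R x w \<and> L = blow R x w"
  "finite (exc_on D R)" "\<And>L. L \<in> exc_on D R ==> good D L"
  "(\<Sum>L\<in>exc_on D R. cnum D L x) = enat (mult_at D R)"
  "\<And>g. g \<in> R ==> g \<notin> mx D ==> (\<Sum>L\<in>exc_on D R. cnum D L g) = cnum D R g"
  "\<And>L f. L \<in> exc_on D R ==> curve_at D R f ==> curve_at D L (f / x ^ mult_at D R)"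
proof -
 note R = goodD(1)[OF G]
 obtain f where C: "curve_at D R f" using goodD(2)[OF G] by blast
 define e where "e = mord R f"
 have fe: "f \<in> mpow R e" "f \<notin> mpow R (Suc e)"
  unfolding e_def using mem_mpow_iff[OF R curve_atD(3,4)[OF C]] by auto
 obtain x y where p: "params R x y" and tr: "f \<notin> x *o R +++ mpow R (Suc e)" using transversal_exists[OF R fe] .
 note S = transversal_sums[OF R p refl refl C e_def refl good_finite_inum[OF G C] tr, folded exc_on_def]
 define f' where "f' = f / x ^ e"
 have mem: "L \<in> exc R \<and> L \<subseteq> D \<longleftrightarrow> L \<in> exc_on D R" for L unfolding exc_on_def by blast
 have fin: "finite (exc_on D R)" using S(1) unfolding exc_on_def by simp
 have setC: "{L. L \<in> exc R \<and> L \<subseteq> D} = exc_on D R" unfolding exc_on_def by blast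
 have curve': "curve_at D L (g / x ^ mult_at D R)" if L: "L \<in> exc_on D R" and Cg: "curve_at D R g" for L g
 proof -
  obtain w where w: "params R x w" "L = blow R x w" using S(4) L mem by blast
  have "L \<subseteq> D" using L mem by blast
  thus ?thesis using strict_transform_curve_at[OF R w(1) refl refl w(2) Cg refl] mult_at_eq_mord[OF R Cg] by simp
 qed
 have e_mult: "e = mult_at D R" unfolding e_def using mult_at_eq_mord[OF R C] by simp
 have C': "curve_at D L f'" if "L \<in> exc_on D R" for L using curve'[OF that C] unfolding f'_def e_mult .
 have sums: "(\<Sum>L\<in>exc_on D R. cnum D L g) = (\<Sum>L\<in>exc_on D R. inum L f' g)" for g
  by (rule sum.cong[OF refl]) (rule cnum_eq_inum[OF C'])
 have proj: "(\<Sum>L\<in>exc_on D R. cnum D L g) = cnum D R g" if g: "g \<in> R" "g \<notin> mx D" for g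
  unfolding sums cnum_eq_inum[OF C] using S(3)[OF g(1)] g curve_atD(5)[OF C] unfolding f'_def setC by blast
 have xD: "x \<notin> mx D" by (rule x_not_in_curve[OF R p refl refl C e_def refl good_finite_inum[OF G C] tr])
 have x0: "x \<noteq> 0" using zw1[OF R p] by blast
 have "good D L" if L: "L \<in> exc_on D R" for L
 proof -
  obtain w where w: "params R x w" "L = blow R x w" using S(4) L mem by blast
  have rL: "reg L" unfolding w(2) by (rule reg_blow[OF R w(1) refl refl])
  note PL = paramsD[OF params_blow1[OF R w(1)], folded w(2)]
  have RL: "R \<subseteq> L" using exceptional_dominates[OF R, of L] L mem unfolding dominates_def by blast
  \<comment> \<open>Multiplying \<open>g\<close> by a unit and a power of \<open>x\<close> gives an
    element of \<open>R\<close>, for which the projection formula yields finiteness; a divisor of it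
    has an intersection number that is no larger.\<close>
  have "cnum D L g \<noteq> \<infinity>" if g: "g \<in> L" "g \<notin> mx D" for g
  proof -
   obtain t b where tb: "t \<in> chart R x" "b \<in> L" "b \<noteq> 0" "g = t / b" "inverse b \<in> L"
    using blow_frac[OF R w(1) refl refl, folded w(2)] g(1) by metis
   obtain a n where an: "a \<in> mpow R n" "t = a / x ^ n" using tb(1) unfolding chart_iff by blast
   have aR: "a \<in> R" using an(1) submod_mpow(2)[OF regD(1)[OF R]] by blast
   have ag: "a = g * (b * x ^ n)" using tb an x0 by simp
   have xn: "b * x ^ n \<in> L" using ring_setD(5,7)[OF PL(2)] tb(2) PL(6) by blast
   have LD: "L \<subseteq> D" using L mem by blast
   note D = local_domD[OF goodD(6)[OF G]]
   have xD': "inverse x \<in> D" using D(4) xD curve_atD(2)[OF C] zw1(3)[OF R p] by blast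
   have "a \<notin> mx D"
   proof
    assume "a \<in> mx D"
    hence "inverse b * (inverse x ^ n * a) \<in> mx D"
     using submodD(3)[OF D(2)] xD' ring_setD(7)[OF D(1) xD'] tb(5) LD by blast
    moreover have "inverse b * (inverse x ^ n * a) = g" using tb(3,4) an(2) by (simp add: divide_inverse power_inverse)
    ultimately show False using g(2) by simp
   qed
   hence "(\<Sum>L\<in>exc_on D R. cnum D L a) \<noteq> \<infinity>" using proj[OF aR] goodD(3)[OF G aR] by simp
   hence "cnum D L a \<noteq> \<infinity>"
    using member_le_sum[OF L _ fin, of "\<lambda>L. cnum D L a"] by (metis enat_ord_simps(5) zero_le)
   moreover have "cnum D L g \<le> cnum D L a" unfolding cnum_eq_inum[OF C'[OF L]]
    using inum_subset[OF PL(1) g(1) curve_atD(3)[OF C'[OF L]], of a] mem_two(4)[OF PL(2) xn, of g f'] ag aR RL by auto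
   ultimately show ?thesis by (metis enat_ord_simps(5))
  qed
  thus ?thesis unfolding good_def using rL C'[OF L] by blast
 qed
 moreover have "(\<Sum>L\<in>exc_on D R. cnum D L x) = enat (mult_at D R)"
  unfolding sums using S(2) unfolding f'_def setC e_mult by simp
 ultimately show ?thesis using that[of x] paramsD(4)[OF p] xD x0 S(4) mem fin proj curve' by blast
qed

lemma exc_onE:
 assumes "good D R" "L \<in> exc_on D R"
 obtains "L \<in> exc R" "L \<subseteq> D" "good D L" "finite (exc_on D R)"
 using assms(2) blowup_intersection[OF assms(1)] assms unfolding exc_on_def by (metis (no_types, lifting) mem_Collect_eq)

text \<open>The sums over all points of the exceptional divisor are restricted to the single point
  \<open>L\<close>. As all terms are nonnegative, the equalities turn into these
  inequalities.\<close>

lemma cnum_exceptional_le: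
 assumes G: "good D R" and L: "L \<in> exc_on D R" and p: "params R z w" "L = blow R z w"
 shows "z \<notin> mx D" "cnum D L z \<le> enat (mult_at D R)"
  "g \<in> mx R ==> g \<notin> mx D ==> g / z \<in> L \<and> g / z \<notin> mx D \<and>
    cnum D R g \<ge> enat (mult_at D R) + cnum D L (g / z)"
proof -
 note R = goodD(1)[OF G]
 obtain f where C: "curve_at D R f" using goodD(2)[OF G] by blast
 have LD: "L \<subseteq> D" and L': "L \<in> exc R" using L unfolding exc_on_def by auto
 note D = local_domD[OF goodD(6)[OF G]]
 show zD: "z \<notin> mx D" by (rule exceptional_not_in_curve[OF R p(1) refl refl p(2) C refl LD])
 obtain x where x: "x \<in> mx R" "x \<notin> mx D" "x \<noteq> 0"
  "\<And>L. L \<in> exc_on D R ==> \<exists>w. params R x w \<and> L = blow R x w"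
  "finite (exc_on D R)" "\<And>L. L \<in> exc_on D R ==> good D L"
  "(\<Sum>L\<in>exc_on D R. cnum D L x) = enat (mult_at D R)"
  "\<And>g. g \<in> R ==> g \<notin> mx D ==> (\<Sum>L\<in>exc_on D R. cnum D L g) = cnum D R g"
  using blowup_intersection[OF G] by metis
 obtain w' where w': "params R x w'" "L = blow R x w'" using x(4)[OF L] by blast
 have GL: "good D L" using x(6)[OF L] .
 have z0: "z \<noteq> 0" using zw1[OF R p(1)] by blast
 have u: "x / z \<in> L" "x / z \<notin> mx L" using chart_unit[OF R w'(1) p(1)] w'(2) p(2) by auto
 have zL: "z \<in> L" using paramsD(6)[OF params_blow1[OF R p(1)]] p(2) by simp
 have "cnum D L x = cnum D L z" using cnum_unit_mult[OF GL u zL] z0 by simp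
 thus "cnum D L z \<le> enat (mult_at D R)" using member_le_sum[OF L _ x(5), of "\<lambda>L. cnum D L x"] x(7) by auto
 assume g: "g \<in> mx R" "g \<notin> mx D"
 have gR: "g \<in> R" using g loc_ringD(5)[OF regD(1)[OF R]] by blast
 have div: "g / x \<in> M \<and> g / x \<notin> mx D \<and> x \<in> M" if M: "M \<in> exc_on D R" for M
 proof -
  obtain v where v: "params R x v" "M = blow R x v" using x(4)[OF M] by blast
  have "g / x \<in> M" using blow_divide[OF R v(1) g(1)] v(2) by blast
  moreover have xM: "x \<in> M" using paramsD(6)[OF params_blow1[OF R v(1)]] v(2) by simp
  moreover have "M \<subseteq> D" using M unfolding exc_on_def by blast
  moreover have "x * (g / x) = g" using x(3) by simp
  ultimately show ?thesis using submodD(3)[OF D(2), of x "g / x"] g(2) by (metis subsetD)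
 qed
 have "cnum D R g = (\<Sum>M\<in>exc_on D R. cnum D M x + cnum D M (g / x))" unfolding x(8)[OF gR g(2), symmetric]
 proof (rule sum.cong[OF refl])
  fix M assume M: "M \<in> exc_on D R"
  show "cnum D M g = cnum D M x + cnum D M (g / x)"
   using cnum_mult[OF x(6)[OF M], of x "g / x"] div[OF M] x(2,3) by simp
 qed
 also have "\<dots> = enat (mult_at D R) + (\<Sum>M\<in>exc_on D R. cnum D M (g / x))" by (simp add: sum.distrib x(7))
 finally have eq: "cnum D R g = enat (mult_at D R) + (\<Sum>M\<in>exc_on D R. cnum D M (g / x))" .
 have "cnum D L (g / x) \<le> (\<Sum>M\<in>exc_on D R. cnum D M (g / x))" using member_le_sum[OF L _ x(5), of "\<lambda>M. cnum D M (g / x)"] by simp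
 moreover have gz: "g / z = (x / z) * (g / x)" using x(3) by simp
 hence "cnum D L (g / z) = cnum D L (g / x)" using cnum_unit_mult[OF GL u, of "g / x"] div[OF L] by (simp only:)
 ultimately have "cnum D R g \<ge> enat (mult_at D R) + cnum D L (g / z)" unfolding eq by (simp add: add_left_mono)
 moreover have "g / z \<in> L" unfolding gz using ring_setD(5)[OF goodD(5)[OF GL] u(1)] div[OF L] by blast
 moreover have "g / z \<notin> mx D" using submodD(3)[OF D(2), of z "g / z"] zL LD g(2) z0 by auto
 ultimately show "g / z \<in> L \<and> g / z \<notin> mx D \<and> cnum D R g \<ge> enat (mult_at D R) + cnum D L (g / z)" by blast
qed

lemma cnum_ge_mult:
 assumes G: "good D R" and g: "g \<in> mx R" "g \<notin> mx D"
 shows "cnum D R g \<ge> enat (mult_at D R)" "exc_on D R \<noteq> {}" "mult_at D R \<ge> 1"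
proof -
 obtain f where C: "curve_at D R f" using goodD(2)[OF G] by blast
 show m: "mult_at D R \<ge> 1"
  using strict_transform_mem(5)[OF goodD(1)[OF G] _ refl refl refl C refl] regD(3)[OF goodD(1)[OF G]]
   mult_at_eq_mord[OF goodD(1)[OF G] C] by metis
 have "(\<Sum>L\<in>exc_on D R. cnum D L x) = enat (mult_at D R) ==> exc_on D R \<noteq> {}" for x
  using m by (auto simp: zero_enat_def)
 thus ne: "exc_on D R \<noteq> {}" using blowup_intersection[OF G] by metis
 then obtain L where L: "L \<in> exc_on D R" by blast
 obtain z w where p: "params R z w" "L = blow R z w"
  using exceptional_pointsE[OF goodD(1)[OF G]] L unfolding exc_on_def by blast
 show "cnum D R g \<ge> enat (mult_at D R)"
  using cnum_exceptional_le(3)[OF G L p g] by (metis add.right_neutral add_left_mono order_trans zero_le)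
qed

end

section \<open>Chains of infinitely near points\<close>

context const_field
begin

fun inf_near :: "'f set => 'f set list => bool" where
 "inf_near R [] \<longleftrightarrow> True"
| "inf_near R (L # Ls) \<longleftrightarrow> L \<in> exc R \<and> inf_near L Ls"

lemma inf_near_last:
 "reg R ==> inf_near R Ls ==> reg (last (R # Ls)) \<and> dominates (last (R # Ls)) R"
proof (induction Ls arbitrary: R)
 case Nil
 thus ?case using dominates_refl regD(1) by simp
next
 case (Cons L Ls)
 hence "reg (last (L # Ls))" "dominates (last (L # Ls)) L" "dominates L R"
  using reg_exceptional exceptional_dominates by auto
 thus ?case using dominates_trans[of L R "last (L # Ls)"] by simp
qed

text \<open>With \<open>S\<close> the last center of a divisorial valuation and \<open>R\<close>
  running over its centers, these are the numbers v_i.\<close>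

definition vmin :: "'f set => 'f set => nat" where
 "vmin S R = (LEAST n. n \<in> mord S ` (mx R - {0}))"

lemma mord_params:
 assumes "reg R" "params R x y" shows "mord R x = 1" "mord R y = 1"
proof -
 have "mord R x = 1" if "params R x y" for x y
  using params_nonzero[OF assms(1) that] mem_mpow_iff[OF assms(1)] paramsD(4,6)[OF that] mpow_1[OF that]
  by (metis One_nat_def Suc_1 le_antisym not_less_eq_eq)
 thus "mord R x = 1" "mord R y = 1" using assms(2) params_commute by blast+
qed

lemma mord_dominates:
 assumes S: "reg S" and R: "loc_ring R" and d: "dominates S R" and a: "a \<in> R" "a \<noteq> 0"
 shows "mord S a = 0 \<longleftrightarrow> a \<notin> mx R"
 using mord_eq_0_iff[OF S, of a] a d unfolding dominates_def by blast

lemma vmin_self: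
 assumes "reg S" shows "vmin S S = 1"
proof -
 obtain x y where p: "params S x y" using regD(3)[OF assms] by blast
 show ?thesis unfolding vmin_def
 proof (rule Least_equality)
  show "1 \<in> mord S ` (mx S - {0})"
   using mord_params(1)[OF assms p] paramsD(4)[OF p] params_nonzero(1)[OF assms p] by force
  fix n assume "n \<in> mord S ` (mx S - {0})"
  then obtain a where "a \<in> mx S" "a \<noteq> 0" "n = mord S a" by blast
  thus "1 \<le> n" using mord_eq_0_iff[OF assms, of a] loc_ringD(5)[OF regD(1)[OF assms]] by (metis One_nat_def Suc_leI neq0_conv subsetD)
 qed
qed

text \<open>Every element of the maximal ideal of \<open>R\<close> becomes divisible by
  \<open>z\<close> after the blowup, so \<open>z\<close> has the least order at
  \<open>S\<close>.\<close>

lemma vmin_blow: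
 assumes R: "reg R" and p: "params R z w" and S: "reg S" "dominates S (blow R z w)"
 shows "vmin S R = mord S z" "a \<in> mx R ==> a \<noteq> 0 ==> mord S a = mord S z + mord S (a / z)" "mord S z \<ge> 1"
  "z \<in> S" "a \<in> mx R ==> a / z \<in> S"
proof -
 note z = zw1[OF R p] and PL = paramsD[OF params_blow1[OF R p]]
 show zS: "z \<in> S" using PL(6) S(2) unfolding dominates_def by blast
 show aS: "a / z \<in> S" if "a \<in> mx R" for a
  using blow_divide[OF R p that] S(2) unfolding dominates_def by blast
 show m: "mord S a = mord S z + mord S (a / z)" if "a \<in> mx R" "a \<noteq> 0" for a
  using mord_mult[OF S(1) zS z(1) aS[OF that(1)]] that(2) z(1) by simp
 show "mord S z \<ge> 1" using mord_dominates[OF S(1) PL(1) S(2) PL(6) z(1)] PL(4) by auto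
 show "vmin S R = mord S z" unfolding vmin_def
 proof (rule Least_equality)
  show "mord S z \<in> mord S ` (mx R - {0})" using z by blast
  show "mord S z \<le> n" if "n \<in> mord S ` (mx R - {0})" for n using that m by auto
 qed
qed

lemma mult_at_zero: "\<not> R \<subseteq> D ==> mult_at D R = 0"
 unfolding mult_at_def by simp

lemma inf_near_mult_zero:
 "reg R ==> inf_near R Ls ==> \<not> R \<subseteq> D ==> (\<Sum>L\<leftarrow>R # Ls. (mult_at D L)^2) = 0"
proof (induction Ls arbitrary: R)
 case (Cons L Ls)
 hence "reg L" "\<not> L \<subseteq> D" "inf_near L Ls" using reg_exceptional exceptional_not_subset by auto
 thus ?case using Cons.IH[of L] Cons.prems(3) by (simp add: mult_at_zero)
qed (simp add: mult_at_zero)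

text \<open>One germ passes through the blown up point with larger contact: the pair of germs \<open>(X, Y)\<close> is
 replaced by \<open>(Y, X/Y)\<close>, that is, by the exceptional divisor and the strict transform of \<open>X\<close>.\<close>
lemma quadratic_step:
 fixes e E X' p p' q \<epsilon> tv tm a b d :: nat
 assumes v: "E^2 + tv \<le> a * (E + X')^2 + b * ((E + X') * E) + d * E^2" and abd: "1 \<le> a + b + d"
  and IH: "tv \<le> (a + b + d - 1) * E^2 + (2 * a + b) * (E * X') + a * X'^2 ==>
   tm \<le> (a + b + d - 1) * \<epsilon>^2 + (2 * a + b) * (\<epsilon> * p') + a * p'^2"
  and le: "\<epsilon> \<le> e" "e + p' \<le> p" "e \<le> q"
 shows "e^2 + tm \<le> a * p^2 + b * (p * q) + d * q^2"
proof -
 obtain k where k: "a + b + d = Suc k" using abd by (cases "a + b + d") auto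
 \<comment> \<open>Substituting X = x + y and Y = x, with x for the exceptional divisor, and
   removing x^2 gives the new coefficients; by \<open>abd\<close> the natural subtraction in a + b +
   d - 1 is exact.\<close>
 have id: "x^2 + (k * x^2 + (2 * a + b) * (x * y) + a * y^2) = a * (x + y)^2 + b * ((x + y) * x) + d * x^2" for x y
 proof -
  have "x^2 + (k * x^2 + (2 * a + b) * (x * y) + a * y^2) = (Suc k) * x^2 + (2 * a + b) * (x * y) + a * y^2" by simp
  also have "\<dots> = a * (x + y)^2 + b * ((x + y) * x) + d * x^2"
   unfolding k[symmetric] by (simp add: power2_eq_square algebra_simps)
  finally show ?thesis .
 qed
 have "tv \<le> k * E^2 + (2 * a + b) * (E * X') + a * X'^2" using v id[of E X'] by linarith
 hence "tm \<le> k * \<epsilon>^2 + (2 * a + b) * (\<epsilon> * p') + a * p'^2" using IH k by simp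
 also have "\<dots> \<le> k * e^2 + (2 * a + b) * (e * p') + a * p'^2"
  using le(1) by (intro add_mono mult_mono power_mono) auto
 finally have "e^2 + tm \<le> a * (e + p')^2 + b * ((e + p') * e) + d * e^2" using id[of e p'] by linarith
 also have "\<dots> \<le> a * p^2 + b * (p * q) + d * q^2"
  using le by (intro add_mono mult_mono power_mono) auto
 finally show ?thesis .
qed

text \<open>The parameter pair and the coefficients are arbitrary, since both change in every step.
  Once the curve leaves the sequence of centers, all further multiplicities are 0 and the trivial
  estimate by the first one is enough.\<close>

lemma chain_bound:
 fixes a b d pX pY :: nat
 assumes "good D R" "inf_near R Ls" "params R X Y" "X \<notin> mx D" "Y \<notin> mx D"
  and "cnum D R X = enat pX" "cnum D R Y = enat pY" "S = last (R # Ls)"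
  and "(\<Sum>L\<leftarrow>R # Ls. (vmin S L)^2) \<le> a * (mord S X)^2 + b * (mord S X * mord S Y) + d * (mord S Y)^2"
 shows "(\<Sum>L\<leftarrow>R # Ls. (mult_at D L)^2) \<le> a * pX^2 + b * (pX * pY) + d * pY^2"
 using assms(1-7,9) unfolding assms(8)
proof (induction Ls arbitrary: R X Y a b d pX pY)
 case Nil
 note G = Nil.prems(1) and R = goodD(1)[OF Nil.prems(1)] and P = paramsD[OF Nil.prems(3)]
 have "1 \<le> a + b + d" using Nil.prems(8) vmin_self[OF R] mord_params[OF R Nil.prems(3)] by simp
 have e: "mult_at D R \<le> pX" "mult_at D R \<le> pY"
  using cnum_ge_mult(1)[OF G P(4) Nil.prems(4)] cnum_ge_mult(1)[OF G P(5) Nil.prems(5)] Nil.prems(6,7) by auto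
 have "(mult_at D R)^2 \<le> (a + b + d) * (mult_at D R)^2" using \<open>1 \<le> a + b + d\<close> by simp
 also have "\<dots> = a * (mult_at D R)^2 + b * (mult_at D R * mult_at D R) + d * (mult_at D R)^2"
  by (simp add: power2_eq_square algebra_simps)
 also have "\<dots> \<le> a * pX^2 + b * (pX * pY) + d * pY^2" using e by (intro add_mono mult_mono power_mono) auto
 finally show ?case by simp
next
 case (Cons L Ls)
 note G = Cons.prems(1) and R = goodD(1)[OF Cons.prems(1)] and P = paramsD[OF Cons.prems(3)]
 have L: "L \<in> exc R" and near: "inf_near L Ls" using Cons.prems(2) by auto
 note rL = reg_exceptional[OF R L]
 define S where "S = last (L # Ls)"
 have SS: "last (R # L # Ls) = S" by (simp add: S_def)
 have S: "reg S" "dominates S L" using inf_near_last[OF rL near] unfolding S_def by auto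
 define e where "e = mult_at D R"
 have epXY: "e \<le> pX" "e \<le> pY"
  using cnum_ge_mult(1)[OF G P(4) Cons.prems(4)] cnum_ge_mult(1)[OF G P(5) Cons.prems(5)] Cons.prems(6,7)
  unfolding e_def by auto
 have "vmin S R \<ge> 1" using exceptional_pointsE[OF R L] vmin_blow(1,3)[OF R _ S(1)] S(2) by metis
 hence "1 \<le> (vmin S R)^2" by (rule one_le_power)
 also have "\<dots> \<le> (\<Sum>L\<leftarrow>R # L # Ls. (vmin S L)^2)" by simp
 also have "\<dots> \<le> a * (mord S X)^2 + b * (mord S X * mord S Y) + d * (mord S Y)^2"
  using Cons.prems(8) unfolding SS .
 finally have "1 \<le> a * (mord S X)^2 + b * (mord S X * mord S Y) + d * (mord S Y)^2" .
 \<comment> \<open>The form dominates the square of a positive value, so some coefficient is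
   nonzero.\<close>
 hence abd: "1 \<le> a + b + d" by (cases "a = 0 \<and> b = 0 \<and> d = 0") auto
 show ?case
 proof (cases "L \<subseteq> D")
  case False
  have "(mult_at D R)^2 \<le> (a + b + d) * e^2" using abd by (simp add: e_def)
  also have "\<dots> = a * e^2 + b * (e * e) + d * e^2" by (simp add: power2_eq_square algebra_simps)
  also have "\<dots> \<le> a * pX^2 + b * (pX * pY) + d * pY^2" using epXY by (intro add_mono mult_mono power_mono) auto
  finally show ?thesis using inf_near_mult_zero[OF rL near False] by (simp only: list.map sum_list.Cons add_0_right)
 next
  case True
  hence LE: "L \<in> exc_on D R" unfolding exc_on_def using L by blast
  have GL: "good D L" using exc_onE[OF G LE] by blast
  define tv where "tv = (\<Sum>M\<leftarrow>L # Ls. (vmin S M)^2)"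
  define tm where "tm = (\<Sum>M\<leftarrow>L # Ls. (mult_at D M)^2)"
  have fin: "\<exists>n. cnum D L g = enat n" if "g \<in> L" "g \<notin> mx D" for g
   using goodD(3)[OF GL that] by auto
  \<comment> \<open>Here \<open>L\<close> lies on the strict transform of \<open>X\<close>. The
    other coordinate direction is the same argument with the two germs and the coefficients
    \<open>a\<close> and \<open>d\<close> exchanged.\<close>
  have caseA: "e^2 + tm \<le> a * pX^2 + b * (pX * pY) + d * pY^2"
   if p: "params R X Y" and D: "X \<notin> mx D" "Y \<notin> mx D" and n: "cnum D R X = enat pX" "cnum D R Y = enat pY"
    and le: "(vmin S R)^2 + tv \<le> a * (mord S X)^2 + b * (mord S X * mord S Y) + d * (mord S Y)^2"
    and abd: "1 \<le> a + b + d" and LYX: "L = blow R Y X" and eY: "e \<le> pY"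
   for X Y a b d pX pY
  proof -
   note p' = params_commute[OF p]
   note pL = params_blow1[OF R p', folded LYX]
   note Pm = paramsD[OF p]
   note vb = vmin_blow[OF R p' S(1) S(2)[unfolded LYX]]
   note ce = cnum_exceptional_le[OF G LE p' LYX]
   have X0: "X \<noteq> 0" using zw1[OF R p] by blast
   note cX = ce(3)[OF Pm(4) D(1)]
   obtain p1 where p1: "cnum D L (X / Y) = enat p1" using fin cX by blast
   obtain \<epsilon> where \<epsilon>: "cnum D L Y = enat \<epsilon>" using fin[OF paramsD(6)[OF pL] D(2)] by blast
   show ?thesis
   proof (rule quadratic_step[where E = "mord S Y" and X' = "mord S (X / Y)" and tv = tv and \<epsilon> = \<epsilon> and p' = p1])
    show "(mord S Y)^2 + tv \<le> a * (mord S Y + mord S (X / Y))^2 + b * ((mord S Y + mord S (X / Y)) * mord S Y) + d * (mord S Y)^2"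
     using le unfolding vb(1) vb(2)[OF Pm(4) X0] .
    show "1 \<le> a + b + d" "e \<le> pY" by fact+
    show "\<epsilon> \<le> e" using ce(2) \<epsilon> unfolding e_def by simp
    show "e + p1 \<le> pX" using cX p1 n unfolding e_def by simp
    assume "tv \<le> (a + b + d - 1) * (mord S Y)^2 + (2 * a + b) * (mord S Y * mord S (X / Y)) + a * (mord S (X / Y))^2"
    thus "tm \<le> (a + b + d - 1) * \<epsilon>^2 + (2 * a + b) * (\<epsilon> * p1) + a * p1^2"
     unfolding tm_def tv_def S_def using Cons.IH[OF GL near pL D(2) _ \<epsilon> p1] cX by blast
   qed
  qed
  have le: "(vmin S R)^2 + tv \<le> a * (mord S X)^2 + b * (mord S X * mord S Y) + d * (mord S Y)^2"
   using Cons.prems(8) unfolding SS tv_def by simp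
  have goal: "e^2 + tm \<le> a * pX^2 + b * (pX * pY) + d * pY^2"
   using exceptional_direction[OF R L Cons.prems(3)]
  proof (elim disjE exE conjE)
   assume "L = blow R Y X"
   thus ?thesis using caseA[OF Cons.prems(3-7) le abd] epXY by blast
  next
   assume "L = blow R X Y"
   moreover have "(vmin S R)^2 + tv \<le> d * (mord S Y)^2 + b * (mord S Y * mord S X) + a * (mord S X)^2"
    using le by (simp add: ac_simps)
   moreover have "1 \<le> d + b + a" using abd by simp
   ultimately have "e^2 + tm \<le> d * pY^2 + b * (pY * pX) + a * pX^2"
    using caseA[OF params_commute[OF Cons.prems(3)] Cons.prems(5,4,7,6)] epXY(1) by blast
   thus ?thesis by (simp add: ac_simps)
  next
   \<comment> \<open>Now \<open>L\<close> lies on neither strict transform: both germs have the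
     value of the exceptional divisor, and the form collapses to a + b + d times its square. The
     next pair is the exceptional divisor with some germ not vanishing on the curve, which enters
     with coefficient 0.\<close>
   fix z w assume p: "params R z w" and Lb: "L = blow R z w"
    and u: "X / z \<in> L" "X / z \<notin> mx L" "Y / z \<in> L" "Y / z \<notin> mx L"
   note vb = vmin_blow[OF R p S(1) S(2)[unfolded Lb]]
   note ce = cnum_exceptional_le[OF G LE p Lb]
   note z = zw1[OF R p] and xy = zw1[OF R Cons.prems(3)]
   have LL: "loc_ring L" by (rule goodD(4)[OF GL])
   have "mord S (X / z) = 0" "mord S (Y / z) = 0" using mord_dominates[OF S(1) LL S(2)] u z(1) xy(1,2) by simp_all
   hence m: "mord S X = mord S z" "mord S Y = mord S z" using vb(2) xy by simp_all
   note pL = params_blow1[OF R p, folded Lb]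
   obtain k where k: "a + b + d = Suc k" using abd by (cases "a + b + d") auto
   have "(mord S z)^2 + tv \<le> (a + b + d) * (mord S z)^2"
    using le unfolding vb(1) m by (simp add: power2_eq_square algebra_simps)
   hence tv: "tv \<le> k * (mord S z)^2 + 0 * (mord S z * mord S v) + 0 * (mord S v)^2" for v unfolding k by simp
   have "\<exists>v. params L z v \<and> v \<notin> mx D"
   proof (cases "w / z \<in> mx D")
    case True
    \<comment> \<open>Subtracting \<open>z\<close>, which does not vanish on the curve, yields a
      second parameter that does not vanish on it either.\<close>
    have "params L z (w / z - K 1 * z)" using params_shear[OF params_commute[OF pL]] params_commute by blast
    moreover have "w / z - z \<notin> mx D"
    proof
     note D = local_domD[OF goodD(6)[OF G]]
     assume "w / z - z \<in> mx D"
     hence "w / z - (w / z - z) \<in> mx D" using submod_diff[OF D(2,1) True] by blast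
     thus False using ce(1) by simp
    qed
    ultimately show ?thesis by auto
   qed (use pL in blast)
   then obtain v where v: "params L z v" "v \<notin> mx D" by blast
   obtain \<epsilon> where \<epsilon>: "cnum D L z = enat \<epsilon>" using fin[OF paramsD(6)[OF pL] ce(1)] by blast
   obtain p1 where p1: "cnum D L v = enat p1" using fin[OF paramsD(7)[OF v(1)] v(2)] by blast
   have "tm \<le> k * \<epsilon>^2 + 0 * (\<epsilon> * p1) + 0 * p1^2"
    unfolding tm_def by (rule Cons.IH[OF GL near v(1) ce(1) v(2) \<epsilon> p1]) (use tv[of v] in \<open>simp only: tv_def S_def\<close>)
   also have "\<epsilon> \<le> e" using ce(2) \<epsilon> unfolding e_def by simp
   hence "k * \<epsilon>^2 + 0 * (\<epsilon> * p1) + 0 * p1^2 \<le> k * e^2" by simp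
   finally have "e^2 + tm \<le> (a + b + d) * e^2" unfolding k by simp
   also have "\<dots> = a * e^2 + b * (e * e) + d * e^2" by (simp add: power2_eq_square algebra_simps)
   also have "\<dots> \<le> a * pX^2 + b * (pX * pY) + d * pY^2" using epXY by (intro add_mono mult_mono power_mono) auto
   finally show ?thesis .
  qed
  thus ?thesis unfolding tm_def e_def by simp
 qed
qed

text \<open>The first blowup is treated separately. In 2 v_1 t + \<delta> t^2 the number v_1 would
  correspond to the intersection number with a second parameter \<open>Y\<close>, for which no bound
  by \<open>p\<close> is available; the multiplicity of the curve takes its place.\<close>

theorem tangent_chain_bound:
 fixes \<delta> p :: nat
 assumes G: "good D R" and near: "inf_near R (L # Ls)" and S_def: "S = last (R # L # Ls)"
  and H: "H \<in> mx R" "H \<notin> mpow R 2" "H \<notin> mx D" and p: "cnum D R H = enat p"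
  and t: "vmin S R < mord S H"
  and v: "(\<Sum>M\<leftarrow>R # L # Ls. (vmin S M)^2) \<le> 2 * (vmin S R * mord S H) + \<delta> * (mord S H)^2"
 shows "(\<Sum>M\<leftarrow>R # L # Ls. (mult_at D M)^2) \<le> (2 + \<delta>) * p^2"
proof -
 note R = goodD(1)[OF G]
 have L: "L \<in> exc R" and near': "inf_near L Ls" using near by auto
 note rL = reg_exceptional[OF R L]
 have SS: "S = last (L # Ls)" by (simp add: S_def)
 have S: "reg S" "dominates S L" using inf_near_last[OF rL near'] unfolding SS by auto
 define e where "e = mult_at D R"
 have ep: "e \<le> p" using cnum_ge_mult(1)[OF G H(1,3)] p unfolding e_def by simp
 show ?thesis
 proof (cases "L \<subseteq> D")
  case False
  have "e^2 \<le> p^2" using ep by (rule power_mono) simp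
  also have "\<dots> \<le> (2 + \<delta>) * p^2" by simp
  finally show ?thesis using inf_near_mult_zero[OF rL near' False]
   by (simp only: e_def list.map sum_list.Cons add_0_right)
 next
  case True
  hence LE: "L \<in> exc_on D R" unfolding exc_on_def using L by blast
  have GL: "good D L" using exc_onE[OF G LE] by blast
  obtain Y where pHY: "params R H Y" using params_extend[OF R H(1,2)] .
  have H0: "H \<noteq> 0" using zw1[OF R pHY] by blast
  \<comment> \<open>The other two kinds of direction would give \<open>H\<close> the minimal value
    v_1, contrary to \<open>t\<close>.\<close>
  have LYH: "L = blow R Y H" using exceptional_direction[OF R L pHY]
  proof (elim disjE exE conjE)
   assume "L = blow R H Y"
   hence "vmin S R = mord S H" using vmin_blow(1)[OF R pHY S(1)] S(2) by blast
   thus ?thesis using t by simp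
  next
   fix z w assume zw: "params R z w" "L = blow R z w" and u: "H / z \<in> L" "H / z \<notin> mx L"
   note vb = vmin_blow[OF R zw(1) S(1) S(2)[unfolded zw(2)]]
   have "mord S (H / z) = 0" using mord_dominates[OF S(1) goodD(4)[OF GL] S(2) u(1)] u(2) H0 zw1(1)[OF R zw(1)] by simp
   hence "vmin S R = mord S H" using vb(1) vb(2)[OF H(1) H0] by simp
   thus ?thesis using t by simp
  qed
  note p' = params_commute[OF pHY]
  note pL = params_blow1[OF R p', folded LYH]
  note vb = vmin_blow[OF R p' S(1) S(2)[unfolded LYH]]
  note ce = cnum_exceptional_le[OF G LE p' LYH]
  note cH = ce(3)[OF H(1,3)]
  obtain p1 where p1: "cnum D L (H / Y) = enat p1" using goodD(3)[OF GL] cH by blast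
  obtain \<epsilon> where \<epsilon>: "cnum D L Y = enat \<epsilon>" using goodD(3)[OF GL paramsD(6)[OF pL] ce(1)] by blast
  have "\<epsilon> \<le> e" using ce(2) \<epsilon> unfolding e_def by simp
  have ep1: "e + p1 \<le> p" using cH p1 p unfolding e_def by simp
  \<comment> \<open>Here x stands for v_1 and y for the value of the strict transform of
    \<open>H\<close>, so that t = x + y. What remains after removing x^2 is the form handed to the
    rest of the sequence.\<close>
  have id: "x^2 + ((1 + \<delta>) * x^2 + (2 + 2 * \<delta>) * (x * y) + \<delta> * y^2) = 2 * (x * (x + y)) + \<delta> * (x + y)^2" for x y :: nat
   by (simp add: power2_eq_square algebra_simps)
  have "(\<Sum>M\<leftarrow>L # Ls. (vmin S M)^2) \<le>
   (1 + \<delta>) * (mord S Y)^2 + (2 + 2 * \<delta>) * (mord S Y * mord S (H / Y)) + \<delta> * (mord S (H / Y))^2"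
  proof -
   have "(vmin S R)^2 + (\<Sum>M\<leftarrow>L # Ls. (vmin S M)^2) \<le> 2 * (vmin S R * mord S H) + \<delta> * (mord S H)^2"
    using v by (simp only: list.map sum_list.Cons)
   thus ?thesis using id[of "mord S Y" "mord S (H / Y)"] unfolding vb(1) vb(2)[OF H(1) H0] by linarith
  qed
  hence "(\<Sum>M\<leftarrow>L # Ls. (mult_at D M)^2) \<le> (1 + \<delta>) * \<epsilon>^2 + (2 + 2 * \<delta>) * (\<epsilon> * p1) + \<delta> * p1^2"
   using cH by (intro chain_bound[OF GL near' pL ce(1) _ \<epsilon> p1 SS]) auto
  also have "\<dots> \<le> (1 + \<delta>) * e^2 + (2 + 2 * \<delta>) * (e * p1) + \<delta> * p1^2"
   using \<open>\<epsilon> \<le> e\<close> by (intro add_mono mult_mono power_mono) auto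
  finally have "(\<Sum>M\<leftarrow>R # L # Ls. (mult_at D M)^2) \<le> 2 * (e * (e + p1)) + \<delta> * (e + p1)^2"
   using id[of e p1] by (simp add: e_def)
  also have "\<dots> \<le> 2 * (p * p) + \<delta> * p^2" using ep ep1 by (intro add_mono mult_mono power_mono) auto
  also have "\<dots> = (2 + \<delta>) * p^2" by (simp add: power2_eq_square algebra_simps)
  finally show ?thesis .
 qed
qed

end

section \<open>The divisorial valuation and its volume\<close>

context const_field
begin

definition word :: "'f set => 'f => int" where
 "word S q = (THE i. \<exists>a b. a \<in> S \<and> b \<in> S \<and> a \<noteq> 0 \<and> b \<noteq> 0 \<and> q = a / b \<and> i = int (mord S a) - int (mord S b))"

definition fracs :: "'f set => 'f set" where
 "fracs S = {a / b | a b. a \<in> S \<and> b \<in> S \<and> a \<noteq> 0 \<and> b \<noteq> 0}"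

lemma word_frac:
 assumes S: "reg S" and ab: "a \<in> S" "b \<in> S" "a \<noteq> 0" "b \<noteq> 0"
 shows "word S (a / b) = int (mord S a) - int (mord S b)"
 unfolding word_def
proof (rule the_equality)
 show "\<exists>a' b'. a' \<in> S \<and> b' \<in> S \<and> a' \<noteq> 0 \<and> b' \<noteq> 0 \<and> a / b = a' / b' \<and>
  int (mord S a) - int (mord S b) = int (mord S a') - int (mord S b')" using ab by blast
 fix i assume "\<exists>a' b'. a' \<in> S \<and> b' \<in> S \<and> a' \<noteq> 0 \<and> b' \<noteq> 0 \<and> a / b = a' / b' \<and>
  i = int (mord S a') - int (mord S b')"
 then obtain a' b' where *: "a' \<in> S" "b' \<in> S" "a' \<noteq> 0" "b' \<noteq> 0" "a / b = a' / b'"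
  "i = int (mord S a') - int (mord S b')" by blast
 have "a * b' = a' * b" using *(5) ab *(4) by (simp add: field_simps)
 hence "mord S a + mord S b' = mord S a' + mord S b"
  using mord_mult[OF S ab(1,3) *(2,4)] mord_mult[OF S *(1,3) ab(2,4)] by simp
 thus "i = int (mord S a) - int (mord S b)" using *(6) by linarith
qed

lemma word_self: "reg S ==> a \<in> S ==> a \<noteq> 0 ==> word S a = int (mord S a)"
 using word_frac[of S a 1] regD(2)[of S] ring_setD(2) mord_eq_0_iff[of S 1] one_notin_max_ideal[OF regD(1), of S]
 by auto

lemma fracsE: "q \<in> fracs S ==> (\<And>a b. a \<in> S ==> b \<in> S ==> a \<noteq> 0 ==> b \<noteq> 0 ==> q = a / b ==> P) ==> P"
 unfolding fracs_def by blast
lemma fracsI: "a \<in> S ==> b \<in> S ==> a \<noteq> 0 ==> b \<noteq> 0 ==> a / b \<in> fracs S"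
 unfolding fracs_def by blast

lemma fracs_nonzero: "q \<in> fracs S ==> q \<noteq> 0" by (auto elim: fracsE)

lemma fracs_self: "reg S ==> a \<in> S ==> a \<noteq> 0 ==> a \<in> fracs S"
 using fracsI[of a S 1] ring_setD(2)[OF regD(2)] by auto

lemma fracs_mult:
 assumes S: "reg S" and "q \<in> fracs S" "r \<in> fracs S"
 shows "q * r \<in> fracs S" "word S (q * r) = word S q + word S r"
proof -
 obtain a b where ab: "a \<in> S" "b \<in> S" "a \<noteq> 0" "b \<noteq> 0" "q = a / b" using assms(2) by (rule fracsE)
 obtain c d where cd: "c \<in> S" "d \<in> S" "c \<noteq> 0" "d \<noteq> 0" "r = c / d" using assms(3) by (rule fracsE)
 have qr: "q * r = (a * c) / (b * d)" using ab cd by simp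
 have m: "a * c \<in> S" "b * d \<in> S" using ring_setD(5)[OF regD(2)[OF S]] ab cd by auto
 show "q * r \<in> fracs S" unfolding qr using m ab cd by (intro fracsI) auto
 show "word S (q * r) = word S q + word S r" unfolding qr ab(5) cd(5) using ab cd m
  by (simp add: word_frac[OF S] mord_mult[OF S] del: times_divide_times_eq)
qed

lemma fracs_inverse:
 assumes S: "reg S" and "q \<in> fracs S" shows "inverse q \<in> fracs S" "word S (inverse q) = - word S q"
proof -
 obtain a b where ab: "a \<in> S" "b \<in> S" "a \<noteq> 0" "b \<noteq> 0" "q = a / b" using assms(2) by (rule fracsE)
 have qi: "inverse q = b / a" using ab by simp
 show "inverse q \<in> fracs S" unfolding qi using ab by (intro fracsI)
 show "word S (inverse q) = - word S q" unfolding qi unfolding ab(5) using ab by (simp add: word_frac[OF S])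
qed

lemma fracs_powi:
 assumes S: "reg S" and q: "q \<in> fracs S" shows "q powi n \<in> fracs S \<and> word S (q powi n) = n * word S q"
proof -
 have nat: "r ^ k \<in> fracs S \<and> word S (r ^ k) = int k * word S r" if r: "r \<in> fracs S" for r k
 proof (induction k)
  case 0
  have "1 \<in> S" using ring_setD(2)[OF regD(2)[OF S]] .
  thus ?case using fracs_self[OF S, of 1] word_self[OF S, of 1] mord_eq_0_iff[OF S, of 1]
    one_notin_max_ideal[OF regD(1)[OF S]] by simp
 next
  case (Suc k)
  thus ?case using fracs_mult[OF S r, of "r ^ k"] by (simp add: algebra_simps)
 qed
 show ?thesis using nat[OF q, of "nat n"] nat[OF fracs_inverse(1)[OF S q], of "nat (- n)"] fracs_inverse(2)[OF S q]
  unfolding power_int_def by auto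
qed

text \<open>A denominator of exact order n under a numerator of order at least n is what membership
  in the ring at the generic point asks for; so this ring is the valuation ring of the order at
  \<open>S\<close>.\<close>

lemma exceptional_ring_iff:
 assumes S: "reg S"
 shows "q \<in> ering S \<longleftrightarrow> q = 0 \<or> q \<in> fracs S \<and> word S q \<ge> 0"
proof
 note M0 = submodD(1)[OF submod_mpow(1)[OF regD(1)[OF S]]]
 assume "q \<in> ering S"
 then obtain a b n where ab: "a \<in> mpow S n" "b \<in> mpow S n" "b \<notin> mpow S (Suc n)" "q = a / b"
  unfolding exceptional_ring_def by blast
 note b = mord_eqI[OF S ab(2,3)]
 have aS: "a \<in> S" using ab(1) submod_mpow(2)[OF regD(1)[OF S]] by blast
 show "q = 0 \<or> q \<in> fracs S \<and> word S q \<ge> 0"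
 proof (cases "a = 0")
  case False
  hence "n \<le> mord S a" using mem_mpow_iff[OF S aS] ab(1) by blast
  thus ?thesis using fracsI[OF aS b(1) False b(2)] word_frac[OF S aS b(1) False b(2)] ab(4) b(3) by simp
 qed (use ab in simp)
next
 note M0 = submodD(1)[OF submod_mpow(1)[OF regD(1)[OF S]]]
 assume q: "q = 0 \<or> q \<in> fracs S \<and> word S q \<ge> 0"
 show "q \<in> ering S"
 proof (cases "q = 0")
  case True
  have "1 \<in> mpow S 0" "1 \<notin> mpow S (Suc 0)"
   using ring_setD(2)[OF regD(2)[OF S]] mem_mpow_iff[OF S, of 1] mord_eq_0_iff[OF S, of 1]
    one_notin_max_ideal[OF regD(1)[OF S]] by auto
  hence "0 / 1 \<in> ering S" using M0[of 0] unfolding exceptional_ring_def by blast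
  thus ?thesis using True by simp
 next
  case False
  then obtain a b where ab: "a \<in> S" "b \<in> S" "a \<noteq> 0" "b \<noteq> 0" "q = a / b" using q fracsE by metis
  hence "mord S b \<le> mord S a" using q False word_frac[OF S ab(1-4)] by simp
  hence "a \<in> mpow S (mord S b)" "b \<in> mpow S (mord S b)" "b \<notin> mpow S (Suc (mord S b))"
   using mem_mpow_iff[OF S] ab by auto
  thus ?thesis using ab(5) unfolding exceptional_ring_def by blast
 qed
qed

lemma max_ideal_exceptional_ring:
 assumes S: "reg S"
 shows "q \<in> mx (ering S) \<longleftrightarrow> q = 0 \<or> q \<in> fracs S \<and> word S q \<ge> 1"
 unfolding max_ideal_iff exceptional_ring_iff[OF S]
 using fracs_inverse[OF S, of q] fracs_inverse[OF S, of "inverse q"] by auto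

text \<open>A parameter of \<open>S\<close> has order 1 and is a uniformizer. Any other uniformizer
  divides it and so has order 1 as well, which makes the exponent unique.\<close>

lemma dvr_ord_exceptional_ring:
 assumes S: "reg S" and f: "f \<in> fracs S"
 shows "dvr_ord (ering S) f = word S f"
 unfolding dvr_ord_def cgenideal_ring_on Units_ring_on
proof (rule the_equality)
 note E = exceptional_ring_iff[OF S] and m = max_ideal_exceptional_ring[OF S]
 obtain x y where p: "params S x y" using regD(3)[OF S] by blast
 note z = zw1[OF S p]
 have x: "x \<in> fracs S" "word S x = 1" using fracs_self[OF S z(3,1)] word_self[OF S z(3,1)] mord_params(1)[OF S p] by auto
 have xD: "x *o ering S = mx (ering S)"
 proof
  show "x *o ering S \<subseteq> mx (ering S)"

  proof
   fix q assume "q \<in> x *o ering S"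
   then obtain d where d: "d \<in> ering S" "q = x * d" by (rule smulE)
   thus "q \<in> mx (ering S)" using fracs_mult[OF S x(1), of d] x(2) E[of d] m[of q] by auto
  qed
  show "mx (ering S) \<subseteq> x *o ering S"
  proof
   fix q assume q: "q \<in> mx (ering S)"
   have "inverse x * q \<in> ering S"
    using q fracs_mult[OF S fracs_inverse(1)[OF S x(1)], of q] fracs_inverse(2)[OF S x(1)] x(2)
     E[of "inverse x * q"] m[of q] by auto
   hence "x * (inverse x * q) \<in> x *o ering S" by (rule smulI)
   moreover have "x * (inverse x * q) = q" using z(1) by simp
   ultimately show "q \<in> x *o ering S" by (simp only:)
  qed
 qed
 let ?u = "f * inverse (x powi word S f)"
 have xp: "x powi word S f \<in> fracs S" "word S (x powi word S f) = word S f"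
  using fracs_powi[OF S x(1), of "word S f"] x(2) by auto
 have "?u \<in> fracs S" "word S ?u = 0"
  using fracs_mult[OF S f fracs_inverse(1)[OF S xp(1)]] fracs_inverse(2)[OF S xp(1)] xp(2) by auto
 hence "?u \<in> ering S \<and> ?u \<notin> mx (ering S)"
  using E[of ?u] m[of ?u] fracs_nonzero[of ?u S] by (metis not_one_le_zero order_refl)
 moreover have "f = ?u * x powi word S f" using fracs_nonzero[OF xp(1)] by simp
 moreover have "x \<in> ering S" using E[of x] x by simp
 ultimately show "\<exists>t u. t \<in> ering S \<and> t *o ering S = mx (ering S) \<and>
   (u \<in> ering S \<and> u \<notin> mx (ering S)) \<and> f = u * t powi word S f"
  using xD by metis
 fix n assume "\<exists>t u. t \<in> ering S \<and> t *o ering S = mx (ering S) \<and>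
   (u \<in> ering S \<and> u \<notin> mx (ering S)) \<and> f = u * t powi n"
 then obtain t u where t: "t \<in> ering S" "t *o ering S = mx (ering S)"
  and u: "u \<in> ering S" "u \<notin> mx (ering S)" and fu: "f = u * t powi n" by blast
 have u': "u \<in> fracs S" "word S u = 0" using u E[of u] m[of u] by auto
 have "x \<in> t *o ering S" using t(2) m[of x] x by simp
 then obtain d where d: "d \<in> ering S" "x = t * d" by (rule smulE)
 hence "t \<noteq> 0" "d \<noteq> 0" using z(1) by auto
 hence td: "t \<in> fracs S" "d \<in> fracs S" "word S d \<ge> 0" using t(1) d(1) E[of t] E[of d] by auto
 have "t * 1 \<in> mx (ering S)"
  unfolding t(2)[symmetric] using E[of 1] fracs_self[OF S] word_self[OF S] ring_setD(2,3)[OF regD(2)[OF S]]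
  by (intro smulI) simp
 hence "word S t \<ge> 1" using m[of t] \<open>t \<noteq> 0\<close> by simp
 moreover have "1 = word S t + word S d" using fracs_mult(2)[OF S td(1,2)] d(2) x(2) by simp
 ultimately have "word S t = 1" using td(3) by linarith
 thus "n = word S f" unfolding fu using fracs_mult(2)[OF S u'(1)] fracs_powi[OF S td(1), of n] u'(2) by simp
qed

lemma dvr_ord_eq_mord:
 assumes "reg S" "a \<in> S" "a \<noteq> 0" shows "dvr_ord (ering S) a = int (mord S a)"
 using dvr_ord_exceptional_ring[OF assms(1) fracs_self[OF assms]] word_self[OF assms] by simp

section \<open>Colength of the valuation ideals\<close>

definition tri :: "nat => nat" where "tri n = (\<Sum>i<n. Suc i)"

lemma tri_eq: "2 * tri n = n * n + n"
 by (induction n) (auto simp: tri_def)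

lemma dim_mpow:
 assumes "reg R" shows "dim R (mpow R n) = enat (tri n)"
proof (induction n)
 case (Suc n)
 obtain x y where p: "params R x y" using regD(3)[OF assms] by blast
 note M = submod_mpow[OF regD(1)[OF assms]]
 have "dim R (mpow R (Suc n)) = dim R (mpow R n) + dim (mpow R n) (mpow R (Suc n))"
  using M submod_self[OF regD(2)[OF assms]] mpow_antimono_Suc[OF p] submod_KK[OF regD(1)[OF assms]]
  by (intro len_add ring_set_KK) blast+
 thus ?case using Suc regD(4)[OF assms] by (simp add: tri_def)
qed (simp add: tri_def zero_enat_def[symmetric])

lemma mord_power:
 assumes S: "reg S" and z: "z \<in> S" "z \<noteq> 0" shows "mord S (z ^ n) = n * mord S z"
proof (induction n)
 case 0
 thus ?case using mord_eq_0_iff[OF S ring_setD(2)[OF regD(2)[OF S]]] one_notin_max_ideal[OF regD(1)[OF S]] by simp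
next
 case (Suc n)
 thus ?case using mord_mult[OF S z ring_setD(7)[OF regD(2)[OF S] z(1)], of n] z(2) by simp
qed

text \<open>Functions with virtual multiplicity c v_i at the i-th center. Each center costs at most
  \<open>tri (c * v_i)\<close> linear conditions, which may be dependent, and contributes c v_i
  times v_i to the value.\<close>

lemma multiplier_ideal:
 assumes "reg R" "inf_near R Ls" "S = last (R # Ls)"
 shows "\<exists>I. submod KK I \<and> I \<subseteq> R \<and> dim R I \<le> enat (\<Sum>L\<leftarrow>R # Ls. tri (c * vmin S L)) \<and>
  (\<forall>h\<in>I. h \<noteq> 0 --> c * (\<Sum>L\<leftarrow>R # Ls. (vmin S L)^2) \<le> mord S h)"
 using assms(1,2) unfolding assms(3)
proof (induction Ls arbitrary: R)
 case Nil
 note M = submod_mpow[OF regD(1)[OF Nil(1)]]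
 have "submod KK (mpow R c)" using M submod_KK[OF regD(1)[OF Nil(1)]] by blast
 moreover have "c \<le> mord R h" if "h \<in> mpow R c" "h \<noteq> 0" for h
  using mem_mpow_iff[OF Nil(1)] that M(2) by blast
 ultimately show ?case
  using M(2) dim_mpow[OF Nil(1), of c] by (intro exI[of _ "mpow R c"]) (auto simp: vmin_self[OF Nil(1)])
next
 case (Cons L Ls)
 note R = Cons.prems(1)
 have L: "L \<in> exc R" and near: "inf_near L Ls" using Cons.prems(2) by auto
 note rL = reg_exceptional[OF R L]
 define S where "S = last (L # Ls)"
 have SS: "last (R # L # Ls) = S" by (simp add: S_def)
 have S: "reg S" "dominates S L" using inf_near_last[OF rL near] unfolding S_def by auto
 obtain z w where zw: "params R z w" "L = blow R z w" using exceptional_pointsE[OF R L] .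
 note z = zw1[OF R zw(1)] and M = submod_mpow[OF regD(1)[OF R]]
 note vb = vmin_blow[OF R zw(1) S(1) S(2)[unfolded zw(2)]]
 define N where "N = c * vmin S R"
 obtain I where I: "submod KK I" "I \<subseteq> L" "dim L I \<le> enat (\<Sum>L\<leftarrow>L # Ls. tri (c * vmin S L))"
  "\<forall>h\<in>I. h \<noteq> 0 --> c * (\<Sum>L\<leftarrow>L # Ls. (vmin S L)^2) \<le> mord S h"
  using Cons.IH[OF rL near] unfolding S_def by blast
 \<comment> \<open>Multiplicity at least N at \<open>R\<close> and, after division by z^N, the
   conditions at the later centers.\<close>
 define J where "J = mpow R N \<inter> (z ^ N *o I)"
 have KM: "submod KK (mpow R N)" using M submod_KK[OF regD(1)[OF R]] by blast
 have KL: "submod KK L" using submod_subring[OF regD(2)[OF rL] loc_ringD(3)[OF regD(1)[OF rL]]] .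
 have KzI: "submod KK (z ^ N *o I)" by (rule submod_smul[OF I(1)])
 have J: "submod KK J" "J \<subseteq> R" unfolding J_def using submod_Int[OF KM KzI] M(2) by blast+
 have zN: "z ^ N \<noteq> 0" using z(1) by simp
 have "dim R J = dim R (mpow R N) + dim (mpow R N) J"
  using M(2) J(1) KM submod_subring[OF regD(2)[OF R] loc_ringD(3)[OF regD(1)[OF R]]]
  by (intro len_add ring_set_KK) (auto simp: J_def)
 also have "dim (mpow R N) J = dim (mpow R N +++ z ^ N *o I) (z ^ N *o I)"
  unfolding J_def using len_second_iso[OF ring_set_KK KM KzI] by simp
 also have "\<dots> \<le> dim (z ^ N *o L) (z ^ N *o I)"
 proof (rule len_mono1(1)[OF ring_set_KK submod_smul[OF KL] submod_add[OF KM KzI] KzI])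
  show "z ^ N *o I \<subseteq> mpow R N +++ z ^ N *o I" by (rule set_add_ub2[OF KM])
  have "mpow R N \<subseteq> z ^ N *o L"
  proof
   fix a assume "a \<in> mpow R N"
   hence "a / z ^ N \<in> L" using blow_divide_power[OF R zw(1)] zw(2) by blast
   hence "z ^ N * (a / z ^ N) \<in> z ^ N *o L" by (rule smulI)
   moreover have "z ^ N * (a / z ^ N) = a" using zN by (metis nonzero_mult_div_cancel_left times_divide_eq_right)
   ultimately show "a \<in> z ^ N *o L" by (simp only:)
  qed
  thus "mpow R N +++ z ^ N *o I \<subseteq> z ^ N *o L"
   using set_add_subset_iff[OF KM KzI submod_smul[OF KL]] smul_mono[OF I(2)] by blast
 qed
 also have "\<dots> = dim L I" by (rule len_smul[OF zN])
 finally have "dim R J \<le> enat (tri N) + enat (\<Sum>L\<leftarrow>L # Ls. tri (c * vmin S L))"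
  unfolding dim_mpow[OF R] using I(3) by (meson add_left_mono order_trans)
 hence d: "dim R J \<le> enat (\<Sum>L\<leftarrow>R # L # Ls. tri (c * vmin S L))" by (simp add: N_def)
 have "c * (\<Sum>L\<leftarrow>R # L # Ls. (vmin S L)^2) \<le> mord S h" if h: "h \<in> J" "h \<noteq> 0" for h
 proof -
  obtain g where g: "g \<in> I" "h = z ^ N * g" using h(1) unfolding J_def by (metis IntD2 smulE)
  have g0: "g \<noteq> 0" using h g by auto
  have gS: "g \<in> S" using g I(2) S(2) unfolding dominates_def by blast
  have "mord S h = N * mord S z + mord S g"
   using mord_power[OF S(1) vb(4) z(1), of N] mord_mult[OF S(1) ring_setD(7)[OF regD(2)[OF S(1)] vb(4), of N] zN gS g0] g by simp
  thus ?thesis using I(4) g g0 unfolding N_def vb(1) by (auto simp: power2_eq_square algebra_simps vb(1))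
 qed
 thus ?case unfolding SS using J d by blast
qed

text \<open>Strict transforms never have larger multiplicity than \<open>h\<close>, so each center
  adds at most v_i times the order of \<open>h\<close> at \<open>R\<close>. This linear bound is
  what makes the volume positive.\<close>

lemma mord_le_linear:
 assumes "reg R" "inf_near R Ls" "S = last (R # Ls)" "h \<in> R" "h \<noteq> 0"
 shows "mord S h \<le> (\<Sum>L\<leftarrow>R # Ls. vmin S L) * mord R h"
 using assms(1,2,4,5) unfolding assms(3)
proof (induction Ls arbitrary: R h)
 case Nil
 thus ?case by (simp add: vmin_self)
next
 case (Cons L Ls)
 note R = Cons.prems(1)
 have L: "L \<in> exc R" and near: "inf_near L Ls" using Cons.prems(2) by auto
 note rL = reg_exceptional[OF R L]
 define S where "S = last (L # Ls)"
 have SS: "last (R # L # Ls) = S" by (simp add: S_def)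
 have S: "reg S" "dominates S L" using inf_near_last[OF rL near] unfolding S_def by auto
 obtain z w where zw: "params R z w" "L = blow R z w" using exceptional_pointsE[OF R L] .
 note z = zw1[OF R zw(1)]
 note vb = vmin_blow[OF R zw(1) S(1) S(2)[unfolded zw(2)]]
 define e where "e = mord R h"
 have he: "h \<in> mpow R e" "h \<notin> mpow R (Suc e)" unfolding e_def using mem_mpow_iff[OF R Cons.prems(3,4)] by auto
 have hL: "h / z ^ e \<in> L" using blow_divide_power[OF R zw(1) he(1)] zw(2) by blast
 have h0: "h / z ^ e \<noteq> 0" using z(1) Cons.prems by simp
 have "h / z ^ e \<notin> mpow L (Suc e)" unfolding zw(2) by (rule strict_transform_order[OF R zw(1) refl refl he])
 hence le: "mord L (h / z ^ e) \<le> e" using mem_mpow_iff[OF rL hL h0] by auto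
 have "mord S (h / z ^ e) \<le> (\<Sum>L\<leftarrow>L # Ls. vmin S L) * mord L (h / z ^ e)"
  using Cons.IH[OF rL near hL h0] unfolding S_def .
 also have "\<dots> \<le> (\<Sum>L\<leftarrow>L # Ls. vmin S L) * e" using le by (rule mult_le_mono2)
 finally have 1: "mord S (h / z ^ e) \<le> (\<Sum>L\<leftarrow>L # Ls. vmin S L) * e" .
 have hS: "h / z ^ e \<in> S" using hL S(2) unfolding dominates_def by blast
 have "mord S h = e * mord S z + mord S (h / z ^ e)"
  using mord_mult[OF S(1) ring_setD(7)[OF regD(2)[OF S(1)] vb(4), of e] _ hS h0] z(1) mord_power[OF S(1) vb(4) z(1)] by simp
 hence "mord S h \<le> vmin S R * e + (\<Sum>L\<leftarrow>L # Ls. vmin S L) * e" using 1 vb(1) by (simp add: ac_simps)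
 thus ?case unfolding SS e_def[symmetric] by (simp add: algebra_simps)
qed

lemma vmin_pos:
 assumes "reg R" "inf_near R Ls" "S = last (R # Ls)" shows "1 \<le> vmin S R"
proof (cases Ls)
 case Nil
 thus ?thesis using assms vmin_self by simp
next
 case (Cons L Ls')
 have L: "L \<in> exc R" "inf_near L Ls'" using assms(2) Cons by auto
 have S: "reg S" "dominates S L" using inf_near_last[OF reg_exceptional[OF assms(1) L(1)] L(2)] assms(3) Cons by auto
 obtain z w where zw: "params R z w" "L = blow R z w" using exceptional_pointsE[OF assms(1) L(1)] .
 show ?thesis using vmin_blow(1,3)[OF assms(1) zw(1) S(1) S(2)[unfolded zw(2)]] by simp
qed

definition vset :: "'f set => 'f set => nat => 'f set" where
 "vset S R m = {h \<in> R. h = 0 \<or> m \<le> mord S h}"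

lemma submod_vset:
 assumes S: "reg S" and R: "loc_ring R" "R \<subseteq> S" shows "submod R (vset S R m)"
 unfolding submod_def
proof (intro conjI ballI)
 note r = ring_setD[OF loc_ringD(1)[OF R(1)]]
 show "0 \<in> vset S R m" unfolding vset_def using r by simp
 fix a b assume ab: "a \<in> vset S R m" "b \<in> vset S R m"
 thus "a + b \<in> vset S R m"
  unfolding vset_def using r(1,4) mord_add[OF S, of a b] R(2) by (cases "a = 0"; cases "b = 0"; cases "a + b = 0") (auto simp: subset_iff)
next
 note r = ring_setD[OF loc_ringD(1)[OF R(1)]]
 fix s a assume "s \<in> R" "a \<in> vset S R m"
 thus "s * a \<in> vset S R m"
  unfolding vset_def using r(1,5) mord_mult[OF S, of s a] R(2) by (cases "a = 0"; cases "s = 0") (auto simp: subset_iff)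
qed

lemma vset_dim_bounds:
 assumes R: "reg R" and near: "inf_near R Ls" and S_def: "S = last (R # Ls)"
  and \<Lambda>: "\<Lambda> = (\<Sum>L\<leftarrow>R # Ls. (vmin S L)^2)" and V: "V = (\<Sum>L\<leftarrow>R # Ls. vmin S L)"
 obtains n where "dim R (vset S R m) = enat n" "2 * n \<le> (m div \<Lambda> + 1)^2 * \<Lambda> + (m div \<Lambda> + 1) * V" "(m div V)^2 \<le> 2 * n"
proof -
 have S: "reg S" "R \<subseteq> S" using inf_near_last[OF R near] unfolding S_def dominates_def by auto
 have KR: "submod KK A" if "submod R A" for A using submod_KK[OF regD(1)[OF R] that] .
 have v: "submod KK (vset S R m)" "vset S R m \<subseteq> R"
  using KR[OF submod_vset[OF S(1) regD(1)[OF R] S(2)]] unfolding vset_def by auto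
 have self: "submod KK R" using KR submod_self[OF regD(2)[OF R]] by blast
 have v1: "1 \<le> vmin S R" by (rule vmin_pos[OF R near S_def])
 have "1 \<le> (vmin S R)^2" using v1 by (rule one_le_power)
 hence \<Lambda>1: "1 \<le> \<Lambda>" unfolding \<Lambda> by simp
 have V1: "1 \<le> V" unfolding V using v1 by simp
 \<comment> \<open>One more than the floor of m / \<Lambda>, so that c \<Lambda> exceeds m; the
   rounding is of lower order in m.\<close>
 define c where "c = m div \<Lambda> + 1"
 obtain I where I: "submod KK I" "I \<subseteq> R" "dim R I \<le> enat (\<Sum>L\<leftarrow>R # Ls. tri (c * vmin S L))"
  "\<forall>h\<in>I. h \<noteq> 0 --> c * \<Lambda> \<le> mord S h"
  using multiplier_ideal[OF R near S_def, of c] unfolding \<Lambda> by blast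
 have "m \<le> c * \<Lambda>" using \<Lambda>1 dividend_less_div_times[of \<Lambda> m] unfolding c_def by simp
 hence "I \<subseteq> vset S R m" using I(2,4) unfolding vset_def by (blast intro: order_trans)
 hence "dim R (vset S R m) \<le> dim R I" by (rule len_mono1(2)[OF ring_set_KK self v(1) I(1) _ v(2)])
 hence le: "dim R (vset S R m) \<le> enat (\<Sum>L\<leftarrow>R # Ls. tri (c * vmin S L))" using I(3) order_trans by blast
 then obtain n where n: "dim R (vset S R m) = enat n" by (metis enat_ile)
 have "2 * (\<Sum>L\<leftarrow>Ms. tri (c * vmin S L)) = c^2 * (\<Sum>L\<leftarrow>Ms. (vmin S L)^2) + c * (\<Sum>L\<leftarrow>Ms. vmin S L)" for Ms
  by (induction Ms) (auto simp: tri_eq power2_eq_square algebra_simps)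
 from this[of "R # Ls"] have up: "2 * n \<le> c^2 * \<Lambda> + c * V" using le n unfolding \<Lambda> V by simp
 \<comment> \<open>By the linear bound a value of at least m forces order at least m / V, so the
   valuation ideal lies in the k-th power of the maximal ideal.\<close>
 define k where "k = m div V"
 have "vset S R m \<subseteq> mpow R k"
 proof
  fix h assume h: "h \<in> vset S R m"
  show "h \<in> mpow R k"
  proof (cases "h = 0")
   case True
   thus ?thesis using submodD(1)[OF submod_mpow(1)[OF regD(1)[OF R]]] by simp
  next
   case False
   have hR: "h \<in> R" "m \<le> mord S h" using h False unfolding vset_def by auto
   have "m \<le> V * mord R h" using mord_le_linear[OF R near S_def hR(1) False] hR(2) unfolding V by linarith
   hence "k \<le> mord R h" unfolding k_def using V1 by (metis div_le_mono nonzero_mult_div_cancel_left not_one_le_zero)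
   thus ?thesis using mem_mpow_iff[OF R hR(1) False] by blast
  qed
 qed
 hence "dim R (mpow R k) \<le> dim R (vset S R m)"
  using submod_mpow[OF regD(1)[OF R]] KR by (intro len_mono1(2)[OF ring_set_KK self _ v(1)]) auto
 hence "tri k \<le> n" unfolding dim_mpow[OF R] n by simp
 hence "k^2 \<le> 2 * n" using tri_eq[of k] by (simp add: power2_eq_square)
 thus ?thesis using that n up unfolding c_def k_def by blast
qed

end

text \<open>After division by m^2 the sequence lies eventually between sequences tending to 1 / V^2
  and 1 / \<Lambda>. The upper bound excludes an infinite limit, which \<open>real_of_ereal\<close>
  would send to 0; the lower bound excludes the limit 0, whose inverse would be 0.\<close>

lemma limsup_quadratic_bounds:
 fixes n :: "nat => nat" and \<Lambda> V :: nat
 assumes "\<And>m. 2 * n m \<le> (m div \<Lambda> + 1)^2 * \<Lambda> + (m div \<Lambda> + 1) * V" "\<And>m. (m div V)^2 \<le> 2 * n m" "1 \<le> \<Lambda>" "1 \<le> V"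
 defines "v \<equiv> real_of_ereal (limsup (\<lambda>m. 2 * ereal_of_enat (enat (n m)) / ereal (real m ^ 2)))"
 shows "0 < v" "v \<le> 1 / real \<Lambda>"
proof -
 define g where "g m = real (2 * n m) / (real m)^2" for m
 define u where "u m = ((real m / \<Lambda> + 1)^2 * \<Lambda> + (real m / \<Lambda> + 1) * V) / (real m)^2" for m
 define l where "l m = (real m / V - 1)^2 / (real m)^2" for m
 have eq: "2 * ereal_of_enat (enat (n m)) / ereal (real m ^ 2) = ereal (g m)" if "m > 0" for m
  using that unfolding g_def by simp
 have gu: "g m \<le> u m" if "m > 0" for m
 proof -
  have d: "real (m div \<Lambda>) \<le> real m / real \<Lambda>" by (rule of_nat_div_le_of_nat)
  have "real (2 * n m) \<le> real ((m div \<Lambda> + 1)^2 * \<Lambda> + (m div \<Lambda> + 1) * V)" using assms(1) of_nat_mono by blast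
  also have "\<dots> = (real (m div \<Lambda>) + 1)^2 * \<Lambda> + (real (m div \<Lambda>) + 1) * V"
   by (simp add: algebra_simps)
  also have "\<dots> \<le> (real m / \<Lambda> + 1)^2 * \<Lambda> + (real m / \<Lambda> + 1) * V"
   using d by (intro add_mono mult_right_mono power_mono) auto
  finally show ?thesis unfolding g_def u_def by (rule divide_right_mono) simp
 qed
 have lg: "l m \<le> g m" if "m \<ge> V" for m
 proof -
  have "real m / V - 1 \<le> real (m div V)"
   using floor_divide_of_nat_eq[of m V, where 'a = real] floor_correct[of "real m / real V"] by simp
  moreover have "0 \<le> real m / V - 1" using that assms(4) by (simp add: field_simps)
  ultimately have "(real m / V - 1)^2 \<le> (real (m div V))^2" by (intro power_mono)
  also have "\<dots> \<le> real (2 * n m)" using assms(2)[of m] by (metis of_nat_mono of_nat_power)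
  finally show ?thesis unfolding l_def g_def by (rule divide_right_mono) simp
 qed
 have pos: "real \<Lambda> > 0" "real V > 0" using assms(3,4) by auto
 have "u \<longlonglongrightarrow> (inverse (real \<Lambda>))^2 * \<Lambda>" unfolding u_def using pos by real_asymp
 moreover have "(inverse (real \<Lambda>))^2 * \<Lambda> = 1 / \<Lambda>" using pos by (simp add: field_simps power2_eq_square)
 ultimately have ulim: "u \<longlonglongrightarrow> 1 / \<Lambda>" by simp
 have "l \<longlonglongrightarrow> (inverse (real V))^2" unfolding l_def using pos by real_asymp
 hence llim: "l \<longlonglongrightarrow> (1 / real V)^2" by (simp add: divide_inverse)
 let ?F = "\<lambda>m. 2 * ereal_of_enat (enat (n m)) / ereal (real m ^ 2)"
 have "limsup ?F \<le> limsup (\<lambda>m. ereal (u m))"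
  using eq gu by (intro Limsup_mono) (auto simp: eventually_sequentially intro!: exI[of _ 1])
 also have "\<dots> = ereal (1 / \<Lambda>)" using ulim by (intro lim_imp_Limsup) auto
 finally have up: "limsup ?F \<le> ereal (1 / \<Lambda>)" .
 have "ereal ((1 / real V)^2) = limsup (\<lambda>m. ereal (l m))" using llim by (intro lim_imp_Limsup[symmetric]) auto
 also have "\<dots> \<le> limsup ?F"
  using eq lg assms(4) by (intro Limsup_mono) (auto simp: eventually_sequentially intro!: exI[of _ V])
 finally have lo: "ereal ((1 / real V)^2) \<le> limsup ?F" .
 obtain r where r: "limsup ?F = ereal r" using up lo by (cases "limsup ?F") auto
 have "v = r" unfolding v_def r by simp
 moreover have "0 < (1 / real V)^2" using assms(4) by simp
 ultimately show "0 < v" "v \<le> 1 / real \<Lambda>" using up lo unfolding r ereal_less_eq by linarith+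
qed

section \<open>Ternary forms\<close>

definition cf :: "'k::zero poly poly poly => nat \<times> nat \<times> nat => 'k" where
 "cf F = (\<lambda>(i, j, l). pcoeff (pcoeff (pcoeff F i) j) l)"

definition mono3 :: "'k::zero => nat \<times> nat \<times> nat => 'k poly poly poly" where
 "mono3 c = (\<lambda>(i, j, l). monom (monom (monom c l) j) i)"

definition supp3 :: "'k::zero poly poly poly => (nat \<times> nat \<times> nat) set" where
 "supp3 F = {t. cf F t \<noteq> 0}"

fun deg3 :: "nat \<times> nat \<times> nat => nat" where "deg3 (i, j, l) = i + j + l"

lemma homogeneous_iff: "form d F \<longleftrightarrow> (\<forall>t\<in>supp3 F. deg3 t = d)"
 unfolding homogeneous_def supp3_def cf_def by auto

lemma hpoly_eqI: "(\<And>t. cf F t = cf G t) ==> F = G"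
 unfolding cf_def by (intro poly_eqI) (metis case_prod_conv)

lemma cf_0 [simp]: "cf 0 t = 0" by (simp add: cf_def split: prod.split)
lemma cf_add: "cf (F + G) t = cf F t + cf G t" by (simp add: cf_def split: prod.split)
lemma cf_sum: "cf (sum g I) t = (\<Sum>i\<in>I. cf (g i) t)"
 by (induction I rule: infinite_finite_induct) (auto simp: cf_add)
lemma cf_mono3: "cf (mono3 c s) t = (if s = t then c else 0)"
 by (auto simp: cf_def mono3_def split: prod.split)

lemma finite_supp3: "finite (supp3 F)"
proof -
 let ?A = "\<lambda>i. {j. pcoeff (pcoeff F i) j \<noteq> 0}"
 have fin: "finite {i. pcoeff p i \<noteq> 0}" for p :: "'x::zero poly"
  by (rule finite_subset[of _ "{..degree p}"]) (auto intro: le_degree)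
 have "supp3 F \<subseteq> (\<Union>i\<in>{i. pcoeff F i \<noteq> 0}. \<Union>j\<in>?A i.
  (\<lambda>l. (i, j, l)) ` {l. pcoeff (pcoeff (pcoeff F i) j) l \<noteq> 0})"
  unfolding supp3_def cf_def by (auto simp: image_iff intro!: exI)
 thus ?thesis by (rule finite_subset) (intro finite_UN_I finite_imageI fin)
qed

lemma hpoly_expand: "(\<Sum>t\<in>supp3 F. mono3 (cf F t) t) = (F :: 'k::comm_monoid_add poly poly poly)"
proof (rule hpoly_eqI)
 fix t
 have "cf (\<Sum>t\<in>supp3 F. mono3 (cf F t) t) t = (\<Sum>s\<in>supp3 F. if s = t then cf F s else 0)"
  by (simp add: cf_sum cf_mono3)
 also have "\<dots> = cf F t" by (subst sum.delta[OF finite_supp3]) (auto simp: supp3_def)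
 finally show "cf (\<Sum>t\<in>supp3 F. mono3 (cf F t) t) t = cf F t" .
qed

section \<open>Substitution into ternary polynomials\<close>

locale khom =
 fixes h :: "'k::comm_ring_1 => 'a::comm_ring_1"
 assumes h_add: "h (a + b) = h a + h b" and h_mult: "h (a * b) = h a * h b" and h_one: "h 1 = 1"
begin

lemma h_zero: "h 0 = 0" using h_add[of 0 0] by (metis add.right_neutral add_left_cancel)

definition evh :: "'a => 'k poly => 'a" where "evh s p = poly (map_poly h p) s"

lemma evh_0: "evh s 0 = 0" by (simp add: evh_def)
lemma evh_pCons: "evh s (pCons c p) = h c + s * evh s p"
 using h_zero by (cases "pCons c p = 0") (auto simp: evh_def map_poly_pCons)
lemma evh_add: "evh s (p + q) = evh s p + evh s q"
 by (induction p q rule: poly_induct2) (auto simp: evh_0 evh_pCons h_add algebra_simps)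
lemma evh_smult: "evh s (Polynomial.smult c p) = h c * evh s p"
 by (induction p) (auto simp: evh_0 evh_pCons h_mult algebra_simps)
lemma evh_mult: "evh s (p * q) = evh s p * evh s q"
 by (induction p) (auto simp: evh_0 evh_pCons evh_add evh_smult h_zero algebra_simps)

lemma khom_evh: "khom (evh s)"
proof
 show "evh s 1 = 1" using evh_pCons[of s 1 0] by (simp add: evh_0 h_one pCons_one)
qed (rule evh_add evh_mult)+

lemma evh_monom: "evh s (monom c n) = h c * s ^ n"
 by (induction n) (auto simp: monom_Suc monom_0 evh_pCons evh_0 h_zero algebra_simps)

end

text \<open>Three nested evaluations over an arbitrary homomorphism of coefficients. Values at
  points, restriction to a line and the splitting into homogeneous parts are all instances and share
  \<open>sub3_expand\<close>.\<close>

definition sub3 :: "('k::comm_ring_1 => 'a::comm_ring_1) => 'a => 'a => 'a => 'k poly poly poly => 'a" where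
 "sub3 h u v w = khom.evh (khom.evh (khom.evh h w) v) u"

context khom
begin

lemma khom_sub3: "khom (sub3 h u v w)"
 unfolding sub3_def by (intro khom.khom_evh khom_evh)

lemmas sub3_add = khom.h_add[OF khom_sub3]
 and sub3_mult = khom.h_mult[OF khom_sub3]
 and sub3_one = khom.h_one[OF khom_sub3]
 and sub3_zero = khom.h_zero[OF khom_sub3]

lemma sub3_sum: "sub3 h u v w (sum g I) = (\<Sum>i\<in>I. sub3 h u v w (g i))"
 by (induction I rule: infinite_finite_induct) (auto simp: sub3_zero sub3_add)

lemma sub3_mono3: "sub3 h u v w (mono3 c (i, j, l)) = h c * (u ^ i * v ^ j * w ^ l)"
 unfolding sub3_def mono3_def
 by (simp add: khom.evh_monom[OF khom.khom_evh[OF khom_evh]] khom.evh_monom[OF khom_evh] evh_monom mult_ac)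

lemma sub3_expand: "sub3 h u v w F = (\<Sum>(i, j, l)\<in>supp3 F. h (cf F (i, j, l)) * (u ^ i * v ^ j * w ^ l))"
 by (subst hpoly_expand[of F, symmetric], subst sub3_sum)
  (auto intro!: sum.cong simp: sub3_mono3)

lemma sub3_scale:
 assumes "\<forall>t\<in>supp3 F. deg3 t = d"
 shows "sub3 h (s * u) (s * v) (s * w) F = s ^ d * sub3 h u v w F"
 unfolding sub3_expand sum_distrib_left
proof (rule sum.cong[OF refl])
 fix t assume t: "t \<in> supp3 F"
 obtain i j l where tt: "t = (i, j, l)" using prod_cases3 by blast
 have "i + j + l = d" using assms t unfolding tt by auto
 thus "(case t of (i, j, l) => h (cf F (i, j, l)) * ((s * u) ^ i * (s * v) ^ j * (s * w) ^ l)) =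
   s ^ d * (case t of (i, j, l) => h (cf F (i, j, l)) * (u ^ i * v ^ j * w ^ l))"
  by (auto simp: tt power_mult_distrib power_add mult_ac)
qed

lemma sub3_congruent:
 assumes J0: "0 \<in> J" and Jadd: "\<And>a b. a \<in> J ==> b \<in> J ==> a + b \<in> J" and Jmul: "\<And>a b. a \<in> J ==> b * a \<in> J"
  and "u - u' \<in> J" "v - v' \<in> J" "w - w' \<in> J"
 shows "sub3 h u v w F - sub3 h u' v' w' F \<in> J"
proof -
 have Jsum: "sum g I \<in> J" if "\<And>i. i \<in> I ==> g i \<in> J" for g and I :: "(nat \<times> nat \<times> nat) set"
  using that by (induction I rule: infinite_finite_induct) (auto intro: J0 Jadd)
 have mul: "a * b - a' * b' \<in> J" if "a - a' \<in> J" "b - b' \<in> J" for a b a' b'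
 proof -
  have "a * b - a' * b' = b * (a - a') + a' * (b - b')" by (simp add: algebra_simps)
  thus ?thesis using Jadd Jmul that by metis
 qed
 have pw: "a ^ n - a' ^ n \<in> J" if "a - a' \<in> J" for a a' n by (induction n) (auto simp: J0 intro: mul that)
 show ?thesis unfolding sub3_expand sum_subtractf[symmetric]
 proof (rule Jsum)
  fix t assume "t \<in> supp3 F"
  obtain i j l where tt: "t = (i, j, l)" using prod_cases3 by blast
  have "h (cf F (i, j, l)) * (u ^ i * v ^ j * w ^ l) - h (cf F (i, j, l)) * (u' ^ i * v' ^ j * w' ^ l) \<in> J"
   by (intro mul pw assms) (simp add: J0)
  thus "(case t of (i, j, l) => h (cf F (i, j, l)) * (u ^ i * v ^ j * w ^ l)) -
    (case t of (i, j, l) => h (cf F (i, j, l)) * (u' ^ i * v' ^ j * w' ^ l)) \<in> J" by (simp add: tt)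
 qed
qed

end

abbreviation hX :: "'k::field poly poly poly" where "hX \<equiv> [:0, 1:]"
abbreviation hY :: "'k::field poly poly poly" where "hY \<equiv> [:[:0, 1:]:]"
abbreviation hZ :: "'k::field poly poly poly" where "hZ \<equiv> [:[:[:0, 1:]:]:]"
abbreviation hconst :: "'k::field => 'k poly poly poly" where "hconst c \<equiv> [:[:[:c:]:]:]"

lemma khom_id: "khom (\<lambda>x :: 'k::field. x)" by unfold_locales auto
lemma khom_const: "khom (\<lambda>c. [:c:] :: 'k::field poly)" by unfold_locales (auto simp: pCons_one)
lemma khom_hconst: "khom (hconst :: 'k::field => _)" by unfold_locales (auto simp: pCons_one)

lemma mono3_eq: "mono3 c (i, j, l) = hconst c * (hX ^ i * hY ^ j * hZ ^ l)"
proof -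
 have X: "hX ^ i = (monom 1 i :: 'a poly poly poly)" by (simp add: monom_altdef)
 have Y: "hY ^ j = ([:monom 1 j:] :: 'a poly poly poly)" by (simp add: monom_altdef poly_const_pow)
 have Z: "hZ ^ l = ([:[:monom 1 l:]:] :: 'a poly poly poly)" by (simp add: monom_altdef poly_const_pow)
 show ?thesis unfolding X Y Z mono3_def by (simp add: smult_monom)
qed

lemma sub3_variables: "sub3 hconst hX hY hZ F = F"
 unfolding khom.sub3_expand[OF khom_hconst]
 by (subst (2) hpoly_expand[symmetric]) (auto intro!: sum.cong simp: mono3_eq)

lemma heval_eq_sub3: "heval F (a, b, c) = sub3 (\<lambda>x. x) a b c F"
proof -
 have add: "heval (F + G) p = heval F p + heval G p" for F G :: "'a hpoly" and p
  by (simp add: heval_def split: prod.split)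
 have sum: "heval (sum g I) p = (\<Sum>i\<in>I. heval (g i) p)" for g :: "_ => 'a hpoly" and I :: "(nat \<times> nat \<times> nat) set" and p
  by (induction I rule: infinite_finite_induct) (auto simp: add, auto simp: heval_def split: prod.split)
 have "heval F (a, b, c) = (\<Sum>t\<in>supp3 F. heval (mono3 (cf F t) t) (a, b, c))"
  by (subst hpoly_expand[of F, symmetric], subst sum) simp
 also have "\<dots> = sub3 (\<lambda>x. x) a b c F" unfolding khom.sub3_expand[OF khom_id]
  by (intro sum.cong) (auto simp: mono3_def heval_def poly_monom poly_const_pow mult_ac)
 finally show ?thesis .
qed

lemma heval_simps [simp]:
 "heval (F + G) p = heval F p + heval G p" "heval (F * G) p = heval F p * heval G p"
 "heval (F - G) p = heval F p - heval G p" "heval 0 p = 0" "heval 1 p = 1" "heval (hconst c) p = c"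
 "heval hX p = fst p" "heval hY p = fst (snd p)" "heval hZ p = snd (snd p)"
 "heval (F ^ n) p = heval F p ^ n" by (auto simp: heval_def split: prod.split)

lemma heval_scale:
 "form d F ==> heval F (t * a, t * b, t * c) = t ^ d * heval F (a, b, c)"
 unfolding heval_eq_sub3 homogeneous_iff by (rule khom.sub3_scale[OF khom_id])

text \<open>The image of \<open>F\<close> under \<open>(X, Y, Z) \<mapsto> (XT, YT, ZT)\<close>, whose coefficients are the
 homogeneous components of \<open>F\<close>.\<close>
definition grade :: "'k::field poly poly poly => 'k poly poly poly poly" where
 "grade = sub3 (\<lambda>c. [:hconst c:]) (monom hX 1) (monom hY 1) (monom hZ 1)"

lemma khom_grade0: "khom (\<lambda>c. [:hconst c:] :: 'k::field poly poly poly poly)"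
 by unfold_locales (auto simp: pCons_one)

lemmas grade_mult = khom.sub3_mult[OF khom_grade0, of "monom hX 1" "monom hY 1" "monom hZ 1", folded grade_def]
 and grade_add = khom.sub3_add[OF khom_grade0, of "monom hX 1" "monom hY 1" "monom hZ 1", folded grade_def]

lemma grade_expand: "grade F = (\<Sum>t\<in>supp3 F. monom (mono3 (cf F t) t) (deg3 t))"
 unfolding grade_def khom.sub3_expand[OF khom_grade0]
 by (intro sum.cong) (auto simp: monom_power mult_monom smult_monom mono3_eq)

lemma coeff_grade: "pcoeff (grade F) n = (\<Sum>t | t \<in> supp3 F \<and> deg3 t = n. mono3 (cf F t) t)"
 unfolding grade_expand coeff_sum by (auto simp: sum.inter_filter[OF finite_supp3, symmetric] intro!: sum.cong)

lemma cf_coeff_grade: "cf (pcoeff (grade F) n) t = (if deg3 t = n then cf F t else 0)"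
proof -
 have "cf (pcoeff (grade F) n) t = (\<Sum>s | s \<in> supp3 F \<and> deg3 s = n. if s = t then cf F s else 0)"
  unfolding coeff_grade cf_sum by (simp add: cf_mono3)
 also have "\<dots> = (if t \<in> {s. s \<in> supp3 F \<and> deg3 s = n} then cf F t else 0)"
  by (rule sum.delta) (auto intro: finite_subset[OF _ finite_supp3])
 also have "\<dots> = (if deg3 t = n then cf F t else 0)" by (auto simp: supp3_def)
 finally show ?thesis .
qed

lemma homogeneous_coeff_grade: "form n (pcoeff (grade F) n)"
 unfolding homogeneous_iff supp3_def by (auto simp: cf_coeff_grade)

text \<open>In this form homogeneity is compatible with products and with factors, because
  \<open>grade\<close> is multiplicative and the factors of a nonzero monomial are
  monomials.\<close>

lemma homogeneous_iff_grade: "form d F \<longleftrightarrow> grade F = monom F d"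
proof
 assume hom: "form d F"
 have "pcoeff (grade F) n = pcoeff (monom F d) n" for n
  by (rule hpoly_eqI) (use hom in \<open>force simp: cf_coeff_grade homogeneous_iff supp3_def\<close>)
 thus "grade F = monom F d" by (rule poly_eqI)
next
 assume "grade F = monom F d"
 hence "form d (pcoeff (monom F d) d)" using homogeneous_coeff_grade[of d F] by simp
 thus "form d F" by simp
qed

lemma homogeneous_0 [simp]: "form d 0" by (simp add: homogeneous_iff supp3_def)

lemma homogeneous_add: "form d F ==> form d G ==> form d (F + G)"
 unfolding homogeneous_iff_grade by (simp add: grade_add add_monom)

lemma homogeneous_mult: "form d F ==> form e G ==> form (d + e) (F * G)"
 unfolding homogeneous_iff_grade by (simp add: grade_mult mult_monom)

lemma homogeneous_hconst [simp]: "form 0 (hconst c)"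
 unfolding homogeneous_def by (auto simp: coeff_pCons split: nat.splits)

lemma homogeneous_variables [simp]: "form (Suc 0) hX" "form (Suc 0) hY" "form (Suc 0) hZ"
 unfolding homogeneous_def by (auto simp: coeff_pCons split: nat.splits)

lemma homogeneous_1 [simp]: "form 0 1" using homogeneous_hconst[of 1] by (simp add: pCons_one)

lemma homogeneous_scalar: "form d F ==> form d (hconst c * F)"
 using homogeneous_mult[OF homogeneous_hconst] by fastforce

lemma homogeneous_uminus: "form d F ==> form d (- F)"
 unfolding homogeneous_def by simp

lemma homogeneous_diff: "form d F ==> form d G ==> form d (F - G)"
 using homogeneous_add[of d F "-G"] homogeneous_uminus[of d G] by simp

lemma homogeneous_power: "form d F ==> form (n * d) (F ^ n)"
 by (induction n) (auto intro: homogeneous_mult)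

lemma homogeneous_degree_unique: "form d F ==> form e F ==> F \<noteq> 0 ==> d = e"
 unfolding homogeneous_iff_grade by (metis degree_monom_eq)

text \<open>For a nonzero polynomial the order of vanishing at 0 is at most the degree. Both numbers
  add over products and agree for a monomial, so they agree for each factor.\<close>

lemma monom_factor:
 fixes P Q :: "'a::idom poly"
 assumes "P * Q = monom c d" "c \<noteq> 0"
 shows "\<exists>a n. P = monom a n"
proof -
 have nz: "P \<noteq> 0" "Q \<noteq> 0" using assms by (auto simp: monom_eq_0_iff)
 have "degree P + degree Q = d" using assms nz by (metis degree_monom_eq degree_mult_eq)
 moreover have "Polynomial.order 0 (monom c d) = d" using assms(2) by (simp add: order_0_monom)
 hence "Polynomial.order 0 P + Polynomial.order 0 Q = d" using assms nz order_mult[of P Q 0] by (metis mult_eq_0_iff)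
 moreover have "Polynomial.order 0 P \<le> degree P" "Polynomial.order 0 Q \<le> degree Q"
  using order_degree nz by blast+
 ultimately have o: "Polynomial.order 0 P = degree P" by linarith
 have "[:- 0, 1:] ^ degree P dvd P" using order_1[of 0 P] o by simp
 then obtain R where R: "P = [:0, 1:] ^ degree P * R" by (metis dvdE minus_zero)
 hence "degree R = 0" using nz by (metis add_cancel_right_right degree_linear_power degree_mult_eq mult_eq_0_iff)
 then obtain a where "R = [:a:]" by (metis degree_eq_zeroE)
 hence "P = monom a (degree P)" using R by (simp add: monom_altdef mult.commute)
 thus ?thesis by blast
qed

lemma homogeneous_factor:
 fixes F :: "'k::field poly poly poly"
 assumes "form d (F * G)" "F * G \<noteq> 0"
 obtains a b where "form a F" "form b G" "a + b = d"
proof -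
 have gr: "grade F * grade G = monom (F * G) d" using assms(1) unfolding homogeneous_iff_grade grade_mult .
 have comp: "\<exists>a. form a H" if H: "grade H = monom c n" for c n and H :: "'k poly poly poly"
 proof -
  have "deg3 t = n" if "t \<in> supp3 H" for t
  proof (rule ccontr)
   assume ne: "deg3 t \<noteq> n"
   hence "cf (pcoeff (grade H) (deg3 t)) t = 0" unfolding H by simp
   thus False using that unfolding cf_coeff_grade supp3_def by simp
  qed
  thus ?thesis unfolding homogeneous_iff by blast
 qed
 obtain a where a: "form a F" using monom_factor[OF gr assms(2)] comp by blast
 obtain b where b: "form b G" using monom_factor[of "grade G" "grade F", OF _ assms(2)] gr comp
  by (metis mult.commute)
 have "a + b = d" using homogeneous_degree_unique[OF homogeneous_mult[OF a b] assms] .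
 thus ?thesis using that a b by blast
qed

lemma homogeneous_quotient:
 fixes F :: "'k::field poly poly poly"
 assumes "form d (F * G)" "form a F" "F \<noteq> 0"
 shows "form (d - a) G"
proof (cases "G = 0")
 case False
 hence nz: "F * G \<noteq> 0" using assms by simp
 obtain a' b where ab: "form a' F" "form b G" "a' + b = d" using homogeneous_factor[OF assms(1) nz] .
 hence "a' = a" using homogeneous_degree_unique assms by blast
 thus ?thesis using ab by auto
qed simp

lemma homogeneous_0_const: "form 0 F ==> F = hconst (cf F (0, 0, 0))"
proof (rule hpoly_eqI)
 fix t assume "form 0 F"
 hence "cf F t = 0" if "t \<noteq> (0, 0, 0)" using that unfolding homogeneous_iff supp3_def by (cases t) auto
 thus "cf F t = cf (hconst (cf F (0, 0, 0))) t" by (cases t) (auto simp: cf_def coeff_pCons split: nat.splits)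
qed

section \<open>Linear forms, points and lines\<close>

type_synonym 'k vec3 = "'k \<times> 'k \<times> 'k"

definition lin :: "'k::field vec3 => 'k poly poly poly" where
 "lin = (\<lambda>(a, b, c). hconst a * hX + hconst b * hY + hconst c * hZ)"

text \<open>For the coefficient vectors of two lines this is their point of intersection; it is zero
  exactly when the two vectors are linearly dependent.\<close>

definition cross :: "'k::field vec3 => 'k vec3 => 'k vec3" where
 "cross = (\<lambda>(a, b, c) (a', b', c'). (b * c' - c * b', c * a' - a * c', a * b' - b * a'))"

lemma homogeneous_lin [simp]: "form (Suc 0) (lin a)"
 unfolding lin_def by (cases a) (simp only: prod.case, intro homogeneous_add homogeneous_scalar homogeneous_variables)

lemma cf_lin: "cf (lin (a, b, c)) t = (if t = (1, 0, 0) then a else if t = (0, 1, 0) then b else if t = (0, 0, 1) then c else 0)"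
 by (cases t) (auto simp: lin_def cf_def coeff_pCons split: nat.splits)

lemma lin_eq_0_iff: "lin a = 0 \<longleftrightarrow> a = (0, 0, 0)"
proof
 obtain x y z where a: "a = (x, y, z)" using prod_cases3 by blast
 assume "lin a = 0"
 hence "cf (lin (x, y, z)) t = 0" for t using a by simp
 from this[of "(1, 0, 0)"] this[of "(0, 1, 0)"] this[of "(0, 0, 1)"] show "a = (0, 0, 0)"
  unfolding cf_lin a by (simp add:)
qed (auto simp: lin_def)

lemma homogeneous_1_lin: "form (Suc 0) F ==> \<exists>a. F = lin a"
proof -
 assume F: "form (Suc 0) F"
 have "F = lin (cf F (1, 0, 0), cf F (0, 1, 0), cf F (0, 0, 1))"
 proof (rule hpoly_eqI)
  fix t
  have "cf F t = 0" if "deg3 t \<noteq> 1" using that F unfolding homogeneous_iff supp3_def by fastforce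
  thus "cf F t = cf (lin (cf F (1, 0, 0), cf F (0, 1, 0), cf F (0, 0, 1))) t" by (cases t) (auto simp: cf_lin)
 qed
 thus ?thesis by blast
qed

lemma heval_lin: "heval (lin (a, b, c)) (x, y, z) = a * x + b * y + c * z"
 by (simp add: lin_def heval_def algebra_simps)

lemma heval_lin_cross: "heval (lin a) (cross a b) = 0" "heval (lin b) (cross a b) = 0"
 by (cases a; cases b; simp add: heval_lin cross_def algebra_simps)+

text \<open>Modulo \<open>J\<close> each coordinate multiplied by \<sigma> equals p_i s, so
  homogeneity gives that \<sigma>^e F equals s^e F(p) = 0 modulo \<open>J\<close>, and \<sigma> is a
  nonzero constant.\<close>

lemma form_vanishing_aux:
 fixes F :: "'k::field hpoly"
 assumes F: "form e F" "heval F (p1, p2, p3) = 0"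
  and J: "J = {lin a * A + lin b * B | A B. True}" and \<sigma>: "\<sigma> \<noteq> 0"
  and s: "hconst \<sigma> * hX - hconst p1 * s \<in> J" "hconst \<sigma> * hY - hconst p2 * s \<in> J" "hconst \<sigma> * hZ - hconst p3 * s \<in> J"
 shows "F \<in> J"
proof -
 have J0: "0 \<in> J" unfolding J by (auto intro!: exI[of _ 0])
 have Jadd: "x + y \<in> J" if "x \<in> J" "y \<in> J" for x y
 proof -
  obtain A B where 1: "x = lin a * A + lin b * B" using \<open>x \<in> J\<close> unfolding J by blast
  obtain A' B' where 2: "y = lin a * A' + lin b * B'" using \<open>y \<in> J\<close> unfolding J by blast
  have "x + y = lin a * (A + A') + lin b * (B + B')" unfolding 1 2 by (simp add: algebra_simps)
  thus ?thesis unfolding J by blast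
 qed
 have Jmul: "y * x \<in> J" if "x \<in> J" for x y
 proof -
  obtain A B where "x = lin a * A + lin b * B" using \<open>x \<in> J\<close> unfolding J by blast
  hence "y * x = lin a * (y * A) + lin b * (y * B)" by (simp add: algebra_simps)
  thus ?thesis unfolding J by blast
 qed
 have const: "sub3 hconst (hconst p1) (hconst p2) (hconst p3) F = hconst (heval F (p1, p2, p3))"
 proof -
  have hs: "hconst (sum g I) = (\<Sum>i\<in>I. hconst (g i))" for g :: "_ => 'k" and I :: "(nat \<times> nat \<times> nat) set"
  proof -
   have add: "hconst (x + y) = hconst x + hconst y" for x y :: 'k by simp
   show ?thesis by (induction I rule: infinite_finite_induct) (simp_all only: sum.infinite sum.empty pCons_0_0 sum.insert add not_False_eq_True)
  qed
  show ?thesis unfolding heval_eq_sub3 khom.sub3_expand[OF khom_hconst] khom.sub3_expand[OF khom_id] hs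
   by (auto intro!: sum.cong simp: poly_const_pow)
 qed
 have "sub3 hconst (hconst \<sigma> * hX) (hconst \<sigma> * hY) (hconst \<sigma> * hZ) F -
   sub3 hconst (s * hconst p1) (s * hconst p2) (s * hconst p3) F \<in> J"
  using s by (intro khom.sub3_congruent[OF khom_hconst] J0 Jadd Jmul) (simp_all only: mult.commute[of s])
 hence "hconst \<sigma> ^ e * F - s ^ e * hconst 0 \<in> J"
  unfolding khom.sub3_scale[OF khom_hconst F(1)[unfolded homogeneous_iff]] sub3_variables const F(2) .
 hence "hconst \<sigma> ^ e * F \<in> J" by simp
 hence "hconst (inverse \<sigma>) ^ e * (hconst \<sigma> ^ e * F) \<in> J" by (rule Jmul)
 moreover have "hconst (inverse \<sigma>) ^ e * hconst \<sigma> ^ e = 1"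
  using \<sigma> by (simp add: power_mult_distrib[symmetric] pCons_one)
 ultimately show ?thesis by (simp only: mult.assoc[symmetric] mult_1)
qed

text \<open>The ideal of two lines contains the 2 by 2 minors of the coordinates against the
  intersection point, so modulo it every form is determined by its value there. Taking parts of
  degree e - 1 makes the cofactors homogeneous.\<close>

lemma form_vanishing:
 fixes F :: "'k::field hpoly"
 assumes F: "form e F" "heval F (cross a b) = 0" and nz: "cross a b \<noteq> (0, 0, 0)"
 obtains A B where "F = lin a * A + lin b * B" "form (e - 1) A" "form (e - 1) B"
proof -
 define J where "J = {lin a * A + lin b * B | A B. True}"
 obtain a1 a2 a3 where a: "a = (a1, a2, a3)" using prod_cases3 by blast
 obtain b1 b2 b3 where b: "b = (b1, b2, b3)" using prod_cases3 by blast
 define p1 p2 p3 where "p1 = a2 * b3 - a3 * b2" and "p2 = a3 * b1 - a1 * b3" and "p3 = a1 * b2 - a2 * b1"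
 have p: "cross a b = (p1, p2, p3)" unfolding a b cross_def p1_def p2_def p3_def by simp
 have JI: "lin a * hconst x + lin b * hconst y \<in> J" for x y unfolding J_def by blast
 have J0: "0 \<in> J" using JI[of 0 0] by simp
 have c: "hconst (x - y) = hconst x - hconst y" "hconst (x * y) = hconst x * hconst y" "hconst (- x) = - hconst x" for x y :: 'k
  by simp_all
 \<comment> \<open>One component of the expansion of an iterated cross product; cyclic permutations
   give all three minors.\<close>
 have cramer: "(u2 * w3 - u3 * w2) * y - (u3 * w1 - u1 * w3) * x = (u1 * x + u2 * y + u3 * z) * w3 + (w1 * x + w2 * y + w3 * z) * (- u3)"
  for u1 u2 u3 w1 w2 w3 x y z :: "'k hpoly" by (simp add: algebra_simps)
 have "hconst p1 * hY - hconst p2 * hX = lin a * hconst b3 + lin b * hconst (- a3)"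
  unfolding a b lin_def prod.case p1_def p2_def c by (rule cramer)
 hence 12: "hconst p1 * hY - hconst p2 * hX \<in> J" using JI by metis
 have "hconst p2 * hZ - hconst p3 * hY = lin a * hconst b1 + lin b * hconst (- a1)"
  unfolding a b lin_def prod.case p2_def p3_def c
  using cramer[of "hconst a3" "hconst b1" "hconst a1" "hconst b3" hZ "hconst b2" "hconst a2" hY hX] by (simp only: ac_simps)
 hence 23: "hconst p2 * hZ - hconst p3 * hY \<in> J" using JI by metis
 have "hconst p3 * hX - hconst p1 * hZ = lin a * hconst b2 + lin b * hconst (- a2)"
  unfolding a b lin_def prod.case p1_def p3_def c
  using cramer[of "hconst a1" "hconst b2" "hconst a2" "hconst b1" hX "hconst b3" "hconst a3" hZ hY] by (simp only: ac_simps)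
 hence 31: "hconst p3 * hX - hconst p1 * hZ \<in> J" using JI by metis
 have neg: "v - u \<in> J" if uv: "u - v \<in> J" for u v
 proof -
  obtain A B where "u - v = lin a * A + lin b * B" using uv unfolding J_def by blast
  hence "v - u = lin a * (- A) + lin b * (- B)" by (simp add: algebra_simps)
  thus ?thesis unfolding J_def by blast
 qed
 note 21 = neg[OF 12] and 32 = neg[OF 23] and 13 = neg[OF 31]
 note van = form_vanishing_aux[OF F(1) F(2)[unfolded p] J_def]
 have "F \<in> J"
 proof -
  \<comment> \<open>A nonzero coordinate of the point serves as \<sigma>, with the corresponding
    variable as \<open>s\<close>.\<close>
  consider "p1 \<noteq> 0" | "p2 \<noteq> 0" | "p3 \<noteq> 0" using nz unfolding p by auto
  thus ?thesis
  proof cases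
   case 1
   show ?thesis by (rule van[OF 1, of hX]) (use J0 12 13 in simp_all)
  next
   case 2
   show ?thesis by (rule van[OF 2, of hY]) (use J0 21 23 in simp_all)
  next
   case 3
   show ?thesis by (rule van[OF 3, of hZ]) (use J0 31 32 in simp_all)
  qed
 qed
 then obtain A B where AB: "F = lin a * A + lin b * B" unfolding J_def by blast
 show ?thesis
 proof (cases e)
  case 0
  have "F = hconst (cf F (0, 0, 0))" using homogeneous_0_const F(1) 0 by blast
  hence "F = 0" using F(2) by (metis heval_simps(6) pCons_0_0)
  thus ?thesis using that[of 0 0] by simp
 next
  case (Suc n)
  have g: "grade (lin c) = monom (lin c) (Suc 0)" for c :: "'k vec3"
   using homogeneous_lin homogeneous_iff_grade by blast
  have "monom F e = monom (lin a) (Suc 0) * grade A + monom (lin b) (Suc 0) * grade B"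
   using F(1) AB unfolding homogeneous_iff_grade by (metis grade_add grade_mult g)
  hence "pcoeff (monom F e) e =
    pcoeff (monom (lin a) (Suc 0) * grade A + monom (lin b) (Suc 0) * grade B) e" by simp
  hence "F = lin a * pcoeff (grade A) n + lin b * pcoeff (grade B) n"
   unfolding Suc coeff_add coeff_monom_mult by simp
  thus ?thesis using that[of "pcoeff (grade A) n" "pcoeff (grade B) n"]
    homogeneous_coeff_grade Suc by auto
 qed
qed

lemma irreducible_lin:
 fixes a :: "'k::field vec3"
 assumes "a \<noteq> (0, 0, 0)" shows "irreducible (lin a)"
proof (rule irreducibleI)
 show nz: "lin a \<noteq> 0" using assms lin_eq_0_iff by blast
 have const: "c dvd 1" if "form 0 c" "c \<noteq> 0" for c :: "'k poly poly poly"
 proof -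
  obtain k where k: "c = hconst k" using homogeneous_0_const[OF \<open>form 0 c\<close>] by blast
  hence "k \<noteq> 0" using that(2) by auto
  hence "c * hconst (inverse k) = 1" unfolding k by (simp add: pCons_one)
  thus ?thesis by (metis dvd_triv_left)
 qed
 show "\<not> lin a dvd 1"
 proof
  assume "lin a dvd 1"
  then obtain G where G: "lin a * G = 1" by (metis dvdE)
  obtain x y where "form x (lin a)" "form y G" "x + y = 0"
   using homogeneous_factor[of 0 "lin a" G] G by auto
  thus False using homogeneous_degree_unique[OF homogeneous_lin[of a] _ nz] by fastforce
 qed
 fix F G assume FG: "lin a = F * G"
 obtain x y where xy: "form x F" "form y G" "x + y = Suc 0"
  using homogeneous_factor[of "Suc 0" F G] FG homogeneous_lin[of a] nz by metis
 then consider "x = 0" | "y = 0" by linarith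
 thus "F dvd 1 \<or> G dvd 1" using const xy FG nz by cases auto
qed

lemma prime_elem_lin: "a \<noteq> (0, 0, 0) ==> prime_elem (lin a :: 'k::field hpoly)"
 using irreducible_lin[of a] by simp

lemma cross_exists:
 fixes p :: "'k::field vec3"
 assumes "p \<noteq> (0, 0, 0)" obtains a b where "cross a b = p"
proof -
 obtain x y z where p: "p = (x, y, z)" using prod_cases3 by blast
 consider "x \<noteq> 0" | "y \<noteq> 0" | "z \<noteq> 0" using assms unfolding p by auto
 thus ?thesis
 proof cases
  case 1
  hence "cross (- y, x, 0) (- z / x, 0, 1) = p" unfolding p cross_def by simp
  thus ?thesis by (rule that)
 next
  case 2
  hence "cross (0, - z, y) (1, - x / y, 0) = p" unfolding p cross_def by simp
  thus ?thesis by (rule that)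
 next
  case 3
  hence "cross (z, 0, - x) (0, 1, - y / z) = p" unfolding p cross_def by simp
  thus ?thesis by (rule that)
 qed
qed

lemma cross_solve:
 fixes b c :: "'k::field"
 assumes "b \<noteq> 0 \<or> c \<noteq> 0" "b * q2 + c * q3 = 0" shows "\<exists>m. cross (0, b, c) m = (q1, q2, q3)"
proof (cases "b = 0")
 case False
 have "c * (- q3 / b) = q2" using assms(2) False by (simp add: field_simps) (metis add.commute add_eq_0_iff2)
 hence "cross (0, b, c) (- q3 / b, 0, q1 / b) = (q1, q2, q3)" using False unfolding cross_def by simp
 thus ?thesis by blast
next
 case True
 hence "c \<noteq> 0" "q3 = 0" using assms by auto
 hence "cross (0, b, c) (q2 / c, - q1 / c, 0) = (q1, q2, q3)" using True unfolding cross_def by simp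
 thus ?thesis by blast
qed

lemma cross_zero_points:
 fixes a b p :: "'k::field vec3"
 assumes "heval (lin a) p = 0" "heval (lin b) p = 0" "cross a b \<noteq> (0, 0, 0)" "p \<noteq> (0, 0, 0)"
 obtains t x y z where "cross a b = (x, y, z)" "p = (t * x, t * y, t * z)" "t \<noteq> 0"
proof -
 obtain a1 a2 a3 where a: "a = (a1, a2, a3)" using prod_cases3 by blast
 obtain b1 b2 b3 where b: "b = (b1, b2, b3)" using prod_cases3 by blast
 obtain p1 p2 p3 where p: "p = (p1, p2, p3)" using prod_cases3 by blast
 define x y z where "x = a2 * b3 - a3 * b2" and "y = a3 * b1 - a1 * b3" and "z = a1 * b2 - a2 * b1"
 have c: "cross a b = (x, y, z)" unfolding a b cross_def x_def y_def z_def by simp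
 have e: "a1 * p1 + a2 * p2 + a3 * p3 = 0" "b1 * p1 + b2 * p2 + b3 * p3 = 0"
  using assms(1,2) unfolding a b p heval_lin by auto
 have m: "x * p2 = y * p1" "x * p3 = z * p1" "y * p3 = z * p2"
 proof -
  have "x * p2 - y * p1 = b3 * (a1 * p1 + a2 * p2 + a3 * p3) - a3 * (b1 * p1 + b2 * p2 + b3 * p3)"
   "x * p3 - z * p1 = a2 * (b1 * p1 + b2 * p2 + b3 * p3) - b2 * (a1 * p1 + a2 * p2 + a3 * p3)"
   "y * p3 - z * p2 = b1 * (a1 * p1 + a2 * p2 + a3 * p3) - a1 * (b1 * p1 + b2 * p2 + b3 * p3)"
   unfolding x_def y_def z_def by (simp_all add: algebra_simps)
  thus "x * p2 = y * p1" "x * p3 = z * p1" "y * p3 = z * p2" unfolding e by simp_all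
 qed
 consider "x \<noteq> 0" | "y \<noteq> 0" | "z \<noteq> 0" using assms(3) unfolding c by auto
 then obtain t where t: "p = (t * x, t * y, t * z)"
 proof cases
  case 1
  show ?thesis by (rule that[of "p1 / x"]) (use m 1 in \<open>auto simp: p field_simps\<close>)
 next
  case 2
  show ?thesis by (rule that[of "p2 / y"]) (use m 2 in \<open>auto simp: p field_simps\<close>)
 next
  case 3
  show ?thesis by (rule that[of "p3 / z"]) (use m 3 in \<open>auto simp: p field_simps\<close>)
 qed
 have "t \<noteq> 0" using t assms(4) by auto
 thus ?thesis using that c t by blast
qed

section \<open>The projective plane\<close>

abbreviation KP :: "'k::field => 'k hfrac" where "KP c \<equiv> Fract (hconst c) 1"

interpretation P: const_field "KP :: 'k::alg_closed_field => 'k hfrac"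
 by unfold_locales (simp_all add: One_fract_def pCons_one mult.commute)

definition lform :: "'k::field vec3 => 'k hpoly" where
 "lform p = (SOME l. form (Suc 0) l \<and> heval l p \<noteq> 0)"

lemma lform:
 assumes "p \<noteq> (0, 0, 0)"
 shows "form (Suc 0) (lform p)" "heval (lform p) p \<noteq> 0" "lform p \<noteq> 0"
proof -
 have "\<exists>l. form (Suc 0) l \<and> heval l p \<noteq> 0"
  using assms homogeneous_variables heval_simps(7-9)[of p] by (metis prod.collapse)
 thus *: "form (Suc 0) (lform p)" "heval (lform p) p \<noteq> 0"
  unfolding lform_def by (metis (mono_tags, lifting) someI_ex)+
 thus "lform p \<noteq> 0" by auto
qed

text \<open>The linear form \<open>lform p\<close> does not vanish at \<open>p\<close>.\<close>
definition germ :: "'k::field vec3 => nat => 'k hpoly => 'k hfrac" where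
 "germ p d F = Fract F (lform p ^ d)"

lemma prime_power_dvd:
 fixes t :: "'a::idom"
 assumes "prime_elem t" "\<not> t dvd b" shows "t ^ n dvd a * b ==> t ^ n dvd a"
proof (induction n arbitrary: a)
 case (Suc n)
 have "t dvd a * b" using Suc.prems unfolding power_Suc by (rule dvd_mult_left)
 from prime_elem_dvd_multD[OF assms(1) this] assms(2) have "t dvd a" by simp
 then obtain a' where a: "a = t * a'" by (rule dvdE)
 have "t \<noteq> 0" using assms(1) by auto
 hence "t ^ n dvd a' * b" using Suc.prems unfolding a power_Suc mult.assoc by simp
 from Suc.IH[OF this] show ?case unfolding a power_Suc by (rule mult_dvd_mono[OF dvd_refl])
qed simp

lemma heval_nz: "heval G p \<noteq> 0 ==> G \<noteq> 0" by auto

section \<open>Degree zero localization, for points (\<open>N\<close> is vanishing at p) and for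
  curves (\<open>N\<close> is divisibility by the equation)\<close>

context
 fixes N :: "'k::field hpoly => bool" and S
 assumes S: "S = {Fract F G | F G d. form d F \<and> form d G \<and> \<not> N G}"
  and N: "N 0" "\<not> N 1" "\<forall>F G. N F --> N G --> N (F + G)" "\<forall>F G. N (F * G) \<longleftrightarrow> N F \<or> N G"
begin

lemma hlocI: "form d F ==> form d G ==> \<not> N G ==> Fract F G \<in> S"
 unfolding S by blast

lemma hlocE:
 assumes "a \<in> S"
 obtains F G d where "a = Fract F G" "form d F" "form d G" "\<not> N G" "G \<noteq> 0"
 using assms N(1) unfolding S by blast

lemma ring_set_hloc: "ring_set S"
 unfolding ring_set_def
proof (intro conjI ballI)
 show "0 \<in> S" "1 \<in> S" unfolding Zero_fract_def One_fract_def using N(2) by (intro hlocI[of 0]; simp)+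
 fix a b assume ab: "a \<in> S" "b \<in> S"
 obtain F G d where 1: "a = Fract F G" "form d F" "form d G" "\<not> N G" "G \<noteq> 0"
  using hlocE[OF ab(1)] .
 obtain F' G' d' where 2: "b = Fract F' G'" "form d' F'" "form d' G'" "\<not> N G'" "G' \<noteq> 0"
  using hlocE[OF ab(2)] .
 show "- a \<in> S" unfolding 1(1) minus_fract by (rule hlocI[OF homogeneous_uminus[OF 1(2)] 1(3,4)])
 show "a * b \<in> S" unfolding 1(1) 2(1) mult_fract
  by (rule hlocI[OF homogeneous_mult[OF 1(2) 2(2)] homogeneous_mult[OF 1(3) 2(3)]]) (simp add: N 1 2)
 have "form (d + d') (F * G' + F' * G)"
  using homogeneous_add[OF homogeneous_mult[OF 1(2) 2(3)] homogeneous_mult[OF 2(2) 1(3), unfolded add.commute[of d']]] .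
 thus "a + b \<in> S" unfolding 1(1) 2(1) add_fract[OF 1(5) 2(5)]
  by (rule hlocI[OF _ homogeneous_mult[OF 1(3) 2(3)]]) (simp add: N 1 2)
qed

lemma hloc_max_iff:
 assumes "form d F" "form d G" "\<not> N G"
 shows "Fract F G \<in> mx S \<longleftrightarrow> N F"
proof -
 have G: "G \<noteq> 0" using assms(3) N(1) by auto
 have "N F" if "Fract G F \<notin> S" using that hlocI[OF assms(2,1)] by blast
 moreover have "Fract G F \<notin> S" if F: "F \<noteq> 0" "N F"
 proof
  assume "Fract G F \<in> S"
  then obtain A B where AB: "Fract G F = Fract A B" "\<not> N B" "B \<noteq> 0" by (auto elim: hlocE)
  hence "G * B = A * F" using F(1) by (simp add: eq_fract)
  thus False using N(4) F(2) AB(2) assms(3) by metis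
 qed
 moreover have "Fract F G = 0 \<longleftrightarrow> F = 0" using G by (simp add: Zero_fract_def eq_fract)
 ultimately show ?thesis unfolding max_ideal_iff inverse_fract using hlocI[OF assms] N(1) by (cases "F = 0") auto
qed

lemma submod_max_hloc: "submod S (mx S)"
 unfolding submod_def
proof (intro conjI ballI)
 show "0 \<in> mx S" using hloc_max_iff[of 0 0 1] N by (simp add: Zero_fract_def)
 fix a b assume b: "b \<in> mx S"
 hence "b \<in> S" unfolding max_ideal_def by blast
 then obtain F' G' d' where 2: "b = Fract F' G'" "form d' F'" "form d' G'" "\<not> N G'" "G' \<noteq> 0"
  using hlocE by blast
 hence "N F'" using hloc_max_iff b by blast
 show "a + b \<in> mx S" if a: "a \<in> mx S"
 proof -
  have "a \<in> S" using a unfolding max_ideal_def by blast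
  then obtain F G d where 1: "a = Fract F G" "form d F" "form d G" "\<not> N G" "G \<noteq> 0" using hlocE by blast
  have "form (d + d') (F * G' + F' * G)"
   using homogeneous_add[OF homogeneous_mult[OF 1(2) 2(3)] homogeneous_mult[OF 2(2) 1(3), unfolded add.commute[of d']]] .
  moreover have "N F" using hloc_max_iff 1 a by blast
  ultimately show ?thesis unfolding 1(1) 2(1) add_fract[OF 1(5) 2(5)]
   by (subst hloc_max_iff[OF _ homogeneous_mult[OF 1(3) 2(3)]]) (simp_all add: N 1 2 \<open>N F'\<close>)
 qed
 show "a * b \<in> mx S" if a: "a \<in> S"
 proof -
  obtain F G d where 1: "a = Fract F G" "form d F" "form d G" "\<not> N G" "G \<noteq> 0" using hlocE[OF a] .
  show ?thesis unfolding 1(1) 2(1) mult_fract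
   by (subst hloc_max_iff[OF homogeneous_mult[OF 1(2) 2(2)] homogeneous_mult[OF 1(3) 2(3)]])
    (simp_all add: N 1 2 \<open>N F'\<close>)
 qed
qed

end

text \<open>Coprimality in the form in which it is used: \<open>G\<close> is no zero divisor modulo
  \<open>F\<close>. No greatest common divisor is involved.\<close>

definition cop :: "'k::field hpoly => 'k hpoly => bool" where
 "cop F G \<longleftrightarrow> (\<forall>U. F dvd G * U --> F dvd U)"

lemma heval_prime:
 "heval (0 :: 'k::field hpoly) p = 0" "heval (1 :: 'k hpoly) p \<noteq> 0"
 "\<forall>F G :: 'k hpoly. heval F p = 0 --> heval G p = 0 --> heval (F + G) p = 0"
 "\<forall>F G :: 'k hpoly. heval (F * G) p = 0 \<longleftrightarrow> heval F p = 0 \<or> heval G p = 0" by simp_all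

lemmas local_ring_facts = local_ring_P2_def heval_prime
lemmas local_ringI = hlocI[where N = "\<lambda>F. heval F p = 0", OF local_ring_facts] for p
lemmas local_ringE = hlocE[where N = "\<lambda>F. heval F p = 0", OF local_ring_facts] for p
lemmas ring_set_local_ring = ring_set_hloc[where N = "\<lambda>F. heval F p = 0", OF local_ring_facts] for p
lemmas local_ring_max_iff = hloc_max_iff[where N = "\<lambda>F. heval F p = 0", OF local_ring_facts] for p
lemmas submod_max_local_ring = submod_max_hloc[where N = "\<lambda>F. heval F p = 0", OF local_ring_facts] for p

context
 fixes p :: "'k::alg_closed_field vec3"
 assumes p: "p \<noteq> (0, 0, 0)"
begin

lemma homogeneous_lform_power: "form d (lform p ^ d)"
 using homogeneous_power[OF lform(1)[OF p], of d] by simp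

lemma germ_in: "form d F ==> germ p d F \<in> \<O> p"
 unfolding germ_def by (rule local_ringI[OF _ homogeneous_lform_power]) (simp_all add: lform[OF p])

lemma germ_max_iff: "form d F ==> germ p d F \<in> mx (\<O> p) \<longleftrightarrow> heval F p = 0"
 unfolding germ_def by (rule local_ring_max_iff[OF _ homogeneous_lform_power]) (simp_all add: lform[OF p])

lemma germ_mult: "germ p (d + e) (F * G) = germ p d F * germ p e G"
 unfolding germ_def by (simp add: power_add)

lemma germ_add: "germ p d (F + G) = germ p d F + germ p d G"
 unfolding germ_def using lform(3)[OF p] by (simp add: eq_fract algebra_simps)

lemma germ_eq_0_iff: "germ p d F = 0 \<longleftrightarrow> F = 0"
 unfolding germ_def using lform(3)[OF p] by (simp add: Zero_fract_def eq_fract)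

lemma local_ring_mem_germ:
 assumes "form d F" "form e A" "form (d + e) G" "heval G p \<noteq> 0"
 shows "Fract (F * A) G \<in> germ p d F *o \<O> p"
proof -
 have "Fract (F * A) G = germ p d F * Fract (A * lform p ^ d) G"
  unfolding germ_def using lform(3)[OF p] heval_nz[OF assms(4)] by (simp add: eq_fract algebra_simps)
 moreover have "Fract (A * lform p ^ d) G \<in> \<O> p"
  using local_ringI[OF homogeneous_mult[OF assms(2) homogeneous_lform_power[of d]] _ assms(4)] assms(3)
  by (simp add: add.commute)
 ultimately show ?thesis using smulI by metis
qed

lemma loc_ring_local_ring: "P.loc_ring (\<O> p)"
 unfolding P.loc_ring_def
proof (intro conjI ballI ring_set_local_ring submod_max_local_ring)
 show "P.KK \<subseteq> \<O> p" using local_ringI[of 0 _ 1 p] by auto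
 fix a assume a: "a \<in> \<O> p"
 obtain F G d where 1: "a = Fract F G" "form d F" "form d G" "heval G p \<noteq> 0" "G \<noteq> 0"
  using local_ringE[OF a] .
 define c where "c = heval F p / heval G p"
 have "a - KP c = Fract (F - hconst c * G) G" unfolding 1(1) using 1(5) by (simp add: eq_fract)
 moreover have "heval (F - hconst c * G) p = 0" unfolding heval_simps c_def using 1(4) by simp
 ultimately have "a - KP c \<in> mx (\<O> p)"
  using local_ring_max_iff[OF homogeneous_diff[OF 1(2) homogeneous_scalar[OF 1(3)]] 1(3,4)] by metis
 thus "\<exists>c. a - KP c \<in> mx (\<O> p)" ..
qed

text \<open>A form vanishing at the point is a combination of the two lines; dividing by a
  denominator of the same degree turns it into a combination of the two germs.\<close>

lemma params_local_ring:
 assumes ab: "cross a b \<noteq> (0, 0, 0)" "heval (lin a) p = 0" "heval (lin b) p = 0"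
 shows "P.params (\<O> p) (germ p (Suc 0) (lin a)) (germ p (Suc 0) (lin b))"
 unfolding P.params_def
proof (intro conjI loc_ring_local_ring subset_antisym subsetI)
 let ?R = "\<O> p" and ?x = "germ p (Suc 0) (lin a)" and ?y = "germ p (Suc 0) (lin b)"
 note M = P.loc_ringD(4)[OF loc_ring_local_ring]
 have "?x \<in> mx ?R" "?y \<in> mx ?R" using germ_max_iff[OF homogeneous_lin] ab by blast+
 thus "r \<in> mx ?R" if "r \<in> ?x *o ?R +++ ?y *o ?R" for r
  using that submodD(2,4)[OF M] by (auto elim!: set_addE smulE simp: mult.commute)
 fix r assume r: "r \<in> mx ?R"
 hence "r \<in> ?R" unfolding max_ideal_def by blast
 then obtain F G d where 1: "r = Fract F G" "form d F" "form d G" "heval G p \<noteq> 0" "G \<noteq> 0"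
  by (rule local_ringE)
 obtain t x y z where t: "cross a b = (x, y, z)" "p = (t * x, t * y, t * z)" "t \<noteq> 0"
  using cross_zero_points[OF ab(2,3,1) p] .
 have "heval F p = 0" using r local_ring_max_iff[OF 1(2-4)] 1(1) by simp
 hence F0: "heval F (cross a b) = 0" using heval_scale[OF 1(2)] t by simp
 obtain A B where AB: "F = lin a * A + lin b * B" "form (d - 1) A" "form (d - 1) B"
  using form_vanishing[OF 1(2) F0 ab(1)] by blast
 show "r \<in> ?x *o ?R +++ ?y *o ?R"
 proof (cases d)
  case 0
  obtain c where "F = hconst c" using homogeneous_0_const 1(2) 0 by blast
  hence "F = 0" using F0 heval_simps(6)[of c "cross a b"] by auto
  hence "r = 0" using 1 by (simp add: Zero_fract_def eq_fract)
  thus ?thesis using submodD(1)[OF P.submod_two[OF ring_set_local_ring]] by blast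
 next
  case (Suc n)
  have "form (Suc 0 + n) G" using 1(3) Suc by simp
  note m = local_ring_mem_germ[OF homogeneous_lin _ this 1(4)]
  have "r = Fract (lin a * A) G + Fract (lin b * B) G"
   unfolding 1(1) AB(1) using 1(5) by (simp add: eq_fract algebra_simps)
  thus ?thesis using set_addI[OF m m] AB(2,3) Suc by simp
 qed
qed

text \<open>Cross-multiplying the denominators moves the relation to forms, where coprimality
  applies; the resulting cofactor is homogeneous as a quotient of forms and defines an element of
  the local ring.\<close>

lemma germ_cancel:
 assumes hom: "form d F" "form e G" "F \<noteq> 0" "cop F G"
  and u: "u \<in> \<O> p" "germ p e G * u \<in> germ p d F *o \<O> p"
 shows "u \<in> germ p d F *o \<O> p"
proof -
 let ?l = "lform p"
 obtain U B m where 1: "u = Fract U B" "form m U" "form m B" "heval B p \<noteq> 0" "B \<noteq> 0"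
  using local_ringE[OF u(1)] .
 obtain w where w: "w \<in> \<O> p" "germ p e G * u = germ p d F * w" using u(2) by (auto elim: smulE)
 obtain W B' n where 2: "w = Fract W B'" "form n W" "form n B'" "heval B' p \<noteq> 0" "B' \<noteq> 0"
  using local_ringE[OF w(1)] .
 have "Fract (G * U) (?l ^ e * B) = Fract (F * W) (?l ^ d * B')" using w(2) unfolding 1(1) 2(1) germ_def by simp
 hence "G * U * (?l ^ d * B') = F * W * (?l ^ e * B)" using 1(5) 2(5) lform(3)[OF p] by (simp add: eq_fract)
 hence "F dvd G * (U * (?l ^ d * B'))" unfolding mult.assoc by (rule dvdI)
 hence "F dvd U * (?l ^ d * B')" using hom(4) unfolding cop_def by blast
 then obtain W' where W': "U * (?l ^ d * B') = F * W'" by (rule dvdE)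
 have "form (m + (d + n)) (F * W')"
  unfolding W'[symmetric] by (intro homogeneous_mult 1 2 homogeneous_lform_power)
 from homogeneous_quotient[OF this hom(1,3)] have h: "form (m + n) W'" by simp
 have "u = Fract (F * W') (?l ^ d * B' * B)"
  unfolding W'[symmetric] 1(1) using 1(5) 2(5) lform(3)[OF p] by (simp add: eq_fract algebra_simps)
 moreover have "form (d + (m + n)) (?l ^ d * B' * B)"
  using homogeneous_mult[OF homogeneous_mult[OF homogeneous_lform_power 2(3)] 1(3)] by (simp add: ac_simps)
 ultimately show ?thesis using local_ring_mem_germ[OF hom(1) h] lform(2)[OF p] 1(4) 2(4) by simp
qed

text \<open>Restriction to the line from p to a point q with F(q) nonzero turns \<open>F\<close>
  into a nonzero polynomial, while elements of the n-th power of the maximal ideal restrict to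
  multiples of t^n. This replaces Krull's intersection theorem.\<close>

lemma local_ring_order_bounded:
 assumes F: "form d F" "form d G" "heval G p \<noteq> 0" "F \<noteq> 0" and q: "heval F q \<noteq> 0"
 shows "\<exists>n. Fract F G \<notin> mpow (\<O> p) n"
proof -
 obtain p1 p2 p3 where pp: "p = (p1, p2, p3)" using prod_cases3 by blast
 obtain q1 q2 q3 where qq: "q = (q1, q2, q3)" using prod_cases3 by blast
 define \<rho> where "\<rho> = sub3 (\<lambda>c::'k. [:c:]) [:p1, q1 - p1:] [:p2, q2 - p2:] [:p3, q3 - p3:]"
 note hom = khom.sub3_add[OF khom_const] khom.sub3_mult[OF khom_const]
 have rho: "\<rho> (A + B) = \<rho> A + \<rho> B" "\<rho> (A * B) = \<rho> A * \<rho> B" for A B unfolding \<rho>_def by (rule hom)+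
 have ev: "poly (\<rho> A) t = heval A (p1 + t * (q1 - p1), p2 + t * (q2 - p2), p3 + t * (q3 - p3))" for A t
  unfolding \<rho>_def heval_eq_sub3 khom.sub3_expand[OF khom_const] khom.sub3_expand[OF khom_id]
  by (auto simp: poly_sum intro!: sum.cong)
 let ?t = "[:0, 1:] :: 'k poly"
 have t0: "?t dvd P \<longleftrightarrow> poly P 0 = 0" for P using poly_eq_0_iff_dvd[of P 0] by simp
 have at0: "poly (\<rho> A) 0 = heval A p" for A unfolding ev pp by simp
 \<comment> \<open>Fractions whose numerator vanishes to order n along the line; this set will
   contain the n-th power of the maximal ideal.\<close>
 define E where "E n = {Fract A B | A B m. form m A \<and> form m B \<and> heval B p \<noteq> 0 \<and> ?t ^ n dvd \<rho> A}" for n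
 have Eadd: "r + s \<in> E n" if rs: "r \<in> E n" "s \<in> E n" for r s n
 proof -
  obtain A B m where 1: "r = Fract A B" "form m A" "form m B" "heval B p \<noteq> 0" "?t ^ n dvd \<rho> A"
   using rs(1) unfolding E_def by blast
  obtain A' B' m' where 2: "s = Fract A' B'" "form m' A'" "form m' B'" "heval B' p \<noteq> 0" "?t ^ n dvd \<rho> A'"
   using rs(2) unfolding E_def by blast
  have "r + s = Fract (A * B' + A' * B) (B * B')" unfolding 1(1) 2(1) using heval_nz[OF 1(4)] heval_nz[OF 2(4)] by simp
  moreover have "form (m + m') (A * B' + A' * B)"
   using homogeneous_add[OF homogeneous_mult[OF 1(2) 2(3)] homogeneous_mult[OF 2(2) 1(3), unfolded add.commute[of m']]] .
  moreover have "heval (B * B') p \<noteq> 0" using 1(4) 2(4) by simp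
  moreover have "?t ^ n dvd \<rho> (A * B' + A' * B)" unfolding rho by (intro dvd_add dvd_mult2 1 2)
  ultimately show ?thesis unfolding E_def using homogeneous_mult[OF 1(3) 2(3)] by blast
 qed
 have Emul: "r * s \<in> E (Suc n)" if rs: "r \<in> mx (\<O> p)" "s \<in> E n" for r s n
 proof -
  have "r \<in> \<O> p" using rs(1) unfolding max_ideal_def by blast
  then obtain A B m where 1: "r = Fract A B" "form m A" "form m B" "heval B p \<noteq> 0" "B \<noteq> 0"
   by (rule local_ringE)
  obtain A' B' m' where 2: "s = Fract A' B'" "form m' A'" "form m' B'" "heval B' p \<noteq> 0" "?t ^ n dvd \<rho> A'"
   using rs(2) unfolding E_def by blast
  have "?t dvd \<rho> A" unfolding t0 at0 using local_ring_max_iff[OF 1(2-4)] rs(1) 1(1) by simp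
  hence "?t ^ Suc n dvd \<rho> (A * A')" unfolding rho power_Suc by (rule mult_dvd_mono[OF _ 2(5)])
  moreover have "r * s = Fract (A * A') (B * B')" unfolding 1(1) 2(1) by simp
  moreover have "heval (B * B') p \<noteq> 0" using 1(4) 2(4) by simp
  ultimately show ?thesis unfolding E_def using homogeneous_mult[OF 1(3) 2(3)] homogeneous_mult[OF 1(2) 2(2)] by blast
 qed
 obtain a b where ab: "cross a b = p" using cross_exists[OF p] .
 note par = params_local_ring[of a b, unfolded ab, OF p heval_lin_cross[where a = a and b = b, unfolded ab]]
 have sub: "mpow (\<O> p) n \<subseteq> E n" for n
 proof (induction n)
  case 0 show ?case unfolding E_def local_ring_P2_def ideal_pow.simps(1) power_0 by (auto intro: one_dvd)
 next
  case (Suc n)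
  have "x *o mpow (\<O> p) n \<subseteq> E (Suc n)" if "x \<in> mx (\<O> p)" for x
   using Emul[OF that] Suc by (blast elim: smulE)
  from this[OF P.paramsD(4)[OF par]] this[OF P.paramsD(5)[OF par]]
  show ?case unfolding P.mpow_Suc[OF par] using Eadd by (blast elim: set_addE)
 qed
 have rF: "\<rho> F \<noteq> 0" using ev[of F 1] q unfolding qq by auto
 let ?n = "Suc (degree (\<rho> F))"
 have "Fract F G \<notin> E ?n"
 proof
  assume "Fract F G \<in> E ?n"
  then obtain A B m where 1: "Fract F G = Fract A B" "form m B" "heval B p \<noteq> 0" "?t ^ ?n dvd \<rho> A"
   unfolding E_def by blast
  have "F * B = A * G" using 1(1) heval_nz[OF 1(3)] heval_nz[OF F(3)] by (simp add: eq_fract)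
  hence "\<rho> F * \<rho> B = \<rho> A * \<rho> G" by (metis rho(2))
  hence A: "?t ^ ?n dvd \<rho> F * \<rho> B" using 1(4) by simp
  have B: "prime_elem ?t" using prime_elem_linear_field_poly[of 1 "0::'k"] by simp
  have C: "\<not> ?t dvd \<rho> B" unfolding t0 at0 using 1(3) .
  have "?t ^ ?n dvd \<rho> F" by (rule prime_power_dvd[OF B C A])
  hence "degree (?t ^ ?n) \<le> degree (\<rho> F)" using rF dvd_imp_degree_le by blast
  thus False using degree_linear_power[of "0::'k" ?n] by (simp del: power_Suc)
 qed
 thus ?thesis using sub by blast
qed

end

text \<open>The product of x - c over a finite field vanishes everywhere, but a nonzero polynomial
  over an algebraically closed field has a non-root.\<close>

lemma infinite_alg_closed: "infinite (UNIV :: 'k::alg_closed_field set)"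
proof
 assume fin: "finite (UNIV :: 'k set)"
 define p where "p = (\<Prod>c\<in>UNIV. [:- c, 1 :: 'k:])"
 have "p \<noteq> 0" unfolding p_def using fin by (simp add: prod_zero_iff)
 then obtain c where "poly p c \<noteq> 0" using P.poly_nonroot by blast
 thus False unfolding p_def poly_prod using fin by (simp add: prod_zero_iff)
qed

lemma form_nonzero_point:
 fixes F :: "'k::alg_closed_field hpoly"
 assumes "F \<noteq> 0" obtains q where "heval F q \<noteq> 0"
proof -
 have nr: "\<exists>x. poly Q (g x) \<noteq> 0" if "Q \<noteq> 0" "inj g" for Q :: "'b::idom poly" and g :: "'k => 'b"
 proof (rule ccontr)
  assume "\<not> (\<exists>x. poly Q (g x) \<noteq> 0)"
  hence "range g \<subseteq> {x. poly Q x = 0}" by auto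
  hence "finite (range g)" using poly_roots_finite[OF that(1)] finite_subset by blast
  thus False using finite_imageD[OF _ that(2)] infinite_alg_closed by blast
 qed
 obtain a where a: "poly F [:[:a:]:] \<noteq> 0" using nr[OF assms, of "\<lambda>a. [:[:a:]:]"] by (fastforce intro: injI)
 obtain b where b: "poly (poly F [:[:a:]:]) [:b:] \<noteq> 0" using nr[OF a, of "\<lambda>a. [:a:]"] by (fastforce intro: injI)
 obtain c where "poly (poly (poly F [:[:a:]:]) [:b:]) c \<noteq> 0" using nr[OF b, of "\<lambda>a. a"] by (fastforce intro: injI)
 hence "heval F (a, b, c) \<noteq> 0" by (simp add: heval_def)
 thus ?thesis by (rule that)
qed

lemma cop_prime: "prime_elem F ==> \<not> F dvd G ==> cop F G"
 unfolding cop_def by (simp add: prime_elem_dvd_mult_iff)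

lemma lin_not_dvd:
 assumes "cross a b \<noteq> (0, 0, 0)" shows "\<not> lin a dvd lin b" "a \<noteq> (0, 0, 0)" "b \<noteq> (0, 0, 0)"
proof -
 show nz: "a \<noteq> (0, 0, 0)" "b \<noteq> (0, 0, 0)" using assms by (auto simp: cross_def split: prod.splits)
 show "\<not> lin a dvd lin b"
 proof
  assume "lin a dvd lin b"
  then obtain U where U: "lin b = lin a * U" by (rule dvdE)
  have "form (Suc 0 - Suc 0) U"
   by (rule homogeneous_quotient[of _ "lin a"]) (use U nz lin_eq_0_iff in \<open>metis homogeneous_lin\<close>)+
  then obtain c where c: "U = hconst c" using homogeneous_0_const by fastforce
  obtain a1 a2 a3 where a: "a = (a1, a2, a3)" using prod_cases3 by blast
  obtain b1 b2 b3 where b: "b = (b1, b2, b3)" using prod_cases3 by blast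
  have "lin b = lin (c * a1, c * a2, c * a3)" unfolding U unfolding c a lin_def by simp
  hence "cf (lin b) t = cf (lin (c * a1, c * a2, c * a3)) t" for t by simp
  from this[of "(1, 0, 0)"] this[of "(0, 1, 0)"] this[of "(0, 0, 1)"]
  have "b1 = c * a1" "b2 = c * a2" "b3 = c * a3" unfolding b cf_lin by simp_all
  thus False using assms unfolding a b cross_def by simp
 qed
qed

lemma reg_local_ring:
 fixes p :: "'k::alg_closed_field vec3"
 assumes p: "p \<noteq> (0, 0, 0)"
 shows "P.reg (\<O> p)"
proof -
 obtain a b where ab: "cross a b = p" using cross_exists[OF p] .
 have nd: "\<not> lin a dvd lin b" "a \<noteq> (0, 0, 0)" using lin_not_dvd[of a b] ab p by auto
 show ?thesis
 proof (rule P.regI[OF params_local_ring[OF p, of a b, unfolded ab, OF p heval_lin_cross[where a = a and b = b, unfolded ab]]])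
  show "germ p (Suc 0) (lin a) \<noteq> 0" using germ_eq_0_iff[OF p] nd(2) lin_eq_0_iff by blast
  show "u \<in> germ p (Suc 0) (lin a) *o \<O> p"
   if "u \<in> \<O> p" "germ p (Suc 0) (lin b) * u \<in> germ p (Suc 0) (lin a) *o \<O> p" for u
   using germ_cancel[OF p homogeneous_lin homogeneous_lin _ cop_prime[OF prime_elem_lin[OF nd(2)] nd(1)] that] nd(2) lin_eq_0_iff by blast
  fix r assume r: "r \<in> \<O> p" "r \<noteq> 0"
  obtain F G d where 1: "r = Fract F G" "form d F" "form d G" "heval G p \<noteq> 0" "G \<noteq> 0"
   using local_ringE[OF r(1)] .
  have F: "F \<noteq> 0" using r(2) 1 by (auto simp: Zero_fract_def eq_fract)
  obtain q where "heval F q \<noteq> 0" using form_nonzero_point[OF F] .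
  thus "\<exists>n. r \<notin> mpow (\<O> p) n" unfolding 1(1)
   by (rule local_ring_order_bounded[OF p 1(2-4) F])
 qed
qed

lemma local_ring_scale:
 "(t :: 'k::field) \<noteq> 0 ==> \<O> (t * x, t * y, t * z) = \<O> (x, y, z)"
 unfolding local_ring_P2_def using heval_scale by (fastforce intro: Collect_cong)

text \<open>A linear form that vanishes at p and not at q, divided by one that avoids both, is in
  the maximal ideal at p and a unit at q; no ring can dominate both points.\<close>

lemma local_ring_distinct:
 fixes p q :: "'k::alg_closed_field vec3"
 assumes p: "p \<noteq> (0, 0, 0)" and q: "q \<noteq> (0, 0, 0)" and S: "ring_set S"
  and dom: "P.dominates S (\<O> p)" "P.dominates S (\<O> q)"
 shows "\<O> p = \<O> q"
proof (rule ccontr)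
 assume ne: "\<O> p \<noteq> \<O> q"
 obtain a b where ab: "cross a b = p" using cross_exists[OF p] .
 have "heval (lin a) q \<noteq> 0 \<or> heval (lin b) q \<noteq> 0"
 proof (rule ccontr)
  assume "\<not> ?thesis"
  then obtain t x y z where t: "cross a b = (x, y, z)" "q = (t * x, t * y, t * z)" "t \<noteq> 0"
   using cross_zero_points[of a q b] p q ab by metis
  thus False using ne local_ring_scale[OF t(3)] ab by simp
 qed
 then obtain w where w: "form (Suc 0) w" "heval w p = 0" "heval w q \<noteq> 0"
  using heval_lin_cross[where a = a and b = b] homogeneous_lin unfolding ab by blast
 have "\<exists>u. form (Suc 0) u \<and> heval u p \<noteq> 0 \<and> heval u q \<noteq> 0"
 proof -
  note l = lform(1,2)[OF p] lform(1,2)[OF q]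
  show ?thesis
  proof (cases "heval (lform p) q = 0 \<and> heval (lform q) p = 0")
   case True
   hence "heval (lform p + lform q) p \<noteq> 0" "heval (lform p + lform q) q \<noteq> 0" using l by simp_all
   thus ?thesis using homogeneous_add[OF l(1,3)] by blast
  qed (use l in blast)
 qed
 then obtain u where u: "form (Suc 0) u" "heval u p \<noteq> 0" "heval u q \<noteq> 0" by blast
 have "Fract w u \<in> mx S"
  using dom(1) local_ring_max_iff[OF w(1) u(1,2)] w(2) unfolding P.dominates_def by blast
 moreover have "inverse (Fract w u) \<in> S" using dom(2) local_ringI[OF u(1) w(1,3)] unfolding P.dominates_def by auto
 moreover have "Fract w u \<noteq> 0" using heval_nz[OF w(3)] heval_nz[OF u(3)] by (simp add: Zero_fract_def eq_fract)
 ultimately show False using max_ideal_iff by blast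
qed

section \<open>Bezout's theorem\<close>

text \<open>Finite support is part of the notion, because \<open>sum\<close> over an infinite set is
  0 by convention.\<close>

definition total :: "'a set => ('a => enat) => nat => bool" where
 "total A i n \<longleftrightarrow> finite {R \<in> A. i R \<noteq> 0} \<and> (\<Sum>R | R \<in> A \<and> i R \<noteq> 0. i R) = enat n"

lemma total_iff:
 assumes "finite S" "S \<subseteq> A" "\<And>R. R \<in> A ==> R \<notin> S ==> i R = 0"
 shows "total A i n \<longleftrightarrow> (\<Sum>R\<in>S. i R) = enat n"
proof -
 have sub: "{R \<in> A. i R \<noteq> 0} \<subseteq> S" using assms(3) by blast
 have "(\<Sum>R | R \<in> A \<and> i R \<noteq> 0. i R) = (\<Sum>R\<in>S. i R)"
  using assms(2) by (intro sum.mono_neutral_left[OF assms(1) sub]) auto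
 thus ?thesis unfolding total_def using finite_subset[OF sub assms(1)] by simp
qed

lemma total_support:
 assumes "total A i n" shows "\<exists>S. finite S \<and> S \<subseteq> A \<and> (\<forall>R\<in>A. R \<notin> S --> i R = 0)"
 using assms unfolding total_def by (intro exI[of _ "{R \<in> A. i R \<noteq> 0}"]) simp

lemma total_cong: "(\<And>R. R \<in> A ==> i R = j R) ==> total A i n \<longleftrightarrow> total A j n"
proof -
 assume eq: "\<And>R. R \<in> A ==> i R = j R"
 hence "{R \<in> A. i R \<noteq> 0} = {R \<in> A. j R \<noteq> 0}" by auto
 moreover have "(\<Sum>R | R \<in> A \<and> j R \<noteq> 0. i R) = (\<Sum>R | R \<in> A \<and> j R \<noteq> 0. j R)" using eq by (intro sum.cong) auto
 ultimately show ?thesis unfolding total_def by simp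
qed

lemma total_zero: "(\<And>R. R \<in> A ==> i R = 0) ==> total A i 0"
 using total_iff[of "{}" A i 0] by (simp add: zero_enat_def)

lemma total_add:
 assumes "total A i m" "total A j n" "\<And>R. R \<in> A ==> k R = i R + j R"
 shows "total A k (m + n)"
proof -
 obtain S where S: "finite S" "S \<subseteq> A" "\<forall>R\<in>A. R \<notin> S --> i R = 0" using total_support[OF assms(1)] by blast
 obtain T where T: "finite T" "T \<subseteq> A" "\<forall>R\<in>A. R \<notin> T --> j R = 0" using total_support[OF assms(2)] by blast
 have ST: "finite (S \<union> T)" "S \<union> T \<subseteq> A" using S T by auto
 have "(\<Sum>R\<in>S \<union> T. k R) = (\<Sum>R\<in>S \<union> T. i R) + (\<Sum>R\<in>S \<union> T. j R)"
  unfolding sum.distrib[symmetric] using ST(2) assms(3) by (intro sum.cong) auto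
 moreover have "(\<Sum>R\<in>S \<union> T. i R) = enat m" using total_iff[OF ST, of i] assms(1) S(3) by auto
 moreover have "(\<Sum>R\<in>S \<union> T. j R) = enat n" using total_iff[OF ST, of j] assms(2) T(3) by auto
 ultimately show ?thesis using total_iff[OF ST, of k] assms(3) S(3) T(3) by auto
qed

lemma total_cancel:
 assumes "total A k (m + n)" "total A i m" "\<And>R. R \<in> A ==> k R = i R + j R"
 shows "total A j n"
proof -
 obtain S where S: "finite S" "S \<subseteq> A" "\<forall>R\<in>A. R \<notin> S --> k R = 0" using total_support[OF assms(1)] by blast
 have 0: "i R = 0" "j R = 0" if "R \<in> A" "R \<notin> S" for R using S(3) that assms(3)[OF that(1)] by auto
 have "(\<Sum>R\<in>S. k R) = (\<Sum>R\<in>S. i R) + (\<Sum>R\<in>S. j R)"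
  unfolding sum.distrib[symmetric] using S(2) assms(3) by (intro sum.cong) auto
 moreover have "(\<Sum>R\<in>S. k R) = enat (m + n)" using total_iff[OF S(1,2), of k] S(3) assms(1) by blast
 moreover have "(\<Sum>R\<in>S. i R) = enat m" using total_iff[OF S(1,2), of i] assms(2) 0 by blast
 ultimately have "(\<Sum>R\<in>S. j R) = enat n" by (metis enat_add_left_cancel enat.distinct(1) plus_enat_simps(1))
 thus ?thesis using total_iff[OF S(1,2), of j] 0 by blast
qed

definition pt :: "'k::field hfrac set => 'k vec3" where
 "pt R = (SOME p. p \<noteq> (0, 0, 0) \<and> \<O> p = R)"

lemma pt:
 assumes "R \<in> PP2" shows "pt R \<noteq> (0, 0, 0)" "\<O> (pt R) = R"
proof -
 have "\<exists>p. p \<noteq> (0, 0, 0) \<and> \<O> p = R" using assms unfolding closed_points_P2_def by auto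
 thus "pt R \<noteq> (0, 0, 0)" "\<O> (pt R) = R" unfolding pt_def by (metis (mono_tags, lifting) someI_ex)+
qed

lemma reg_closed_point: "R \<in> PP2 ==> P.reg (R :: 'k::alg_closed_field hfrac set)"
 using reg_local_ring[OF pt(1)] pt(2) by metis

abbreviation gm :: "'k::field hfrac set => nat => 'k hpoly => 'k hfrac" where
 "gm R \<equiv> germ (pt R)"

text \<open>The degrees are arguments because the germ of a form depends on the power of the linear
  form by which it is divided.\<close>

definition fi :: "nat => 'k::alg_closed_field hpoly => nat => 'k hpoly => 'k hfrac set => enat" where
 "fi d F e G R = P.inum R (gm R d F) (gm R e G)"

context
 fixes R :: "'k::alg_closed_field hfrac set"
 assumes R: "R \<in> PP2"
begin

lemmas gm_in = germ_in[OF pt(1)[OF R], unfolded pt(2)[OF R]]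
 and gm_max_iff = germ_max_iff[OF pt(1)[OF R], unfolded pt(2)[OF R]]
 and gm_mult = germ_mult[OF pt(1)[OF R]]
 and gm_add = germ_add[OF pt(1)[OF R]]
 and gm_eq_0_iff = germ_eq_0_iff[OF pt(1)[OF R]]
 and gm_cancel = germ_cancel[OF pt(1)[OF R], unfolded pt(2)[OF R]]
 and loc_closed = loc_ring_local_ring[OF pt(1)[OF R], unfolded pt(2)[OF R]]
 and gm_params = params_local_ring[OF pt(1)[OF R], unfolded pt(2)[OF R]]

lemma fi_commute: "fi d F e G R = fi e G d F R"
 unfolding fi_def by (rule P.inum_commute)

lemma fi_nonvanishing: "form d F ==> form e G ==> heval G (pt R) \<noteq> 0 ==> fi d F e G R = 0"
 unfolding fi_def by (rule P.inum_unit[OF loc_closed gm_in gm_in]) (simp_all add: gm_max_iff)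

lemma fi_mult:
 assumes "form d F" "form e G" "form e' G'" "F \<noteq> 0" "G \<noteq> 0" "cop F G"
 shows "fi d F (e + e') (G * G') R = fi d F e G R + fi d F e' G' R"
 unfolding fi_def gm_mult by (rule P.inum_mult_gen[OF loc_closed]) (use gm_in gm_eq_0_iff gm_cancel assms in blast)+

lemma fi_mod:
 assumes "form d F" "form (d + e) G" "form e K"
 shows "fi d F (d + e) (G + F * K) R = fi d F (d + e) G R"
proof -
 let ?f = "gm R d F" and ?g = "gm R (d + e) G" and ?h = "gm R (d + e) (G + F * K)"
 note f = gm_in[OF assms(1)] and g = gm_in[OF assms(2)] and k = gm_in[OF assms(3)]
 have h: "?h = ?g + ?f * gm R e K" unfolding gm_add gm_mult ..
 note rr = ring_setD[OF P.loc_ringD(1)[OF loc_closed]]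
 have h1: "?h \<in> R" using gm_in[OF homogeneous_add[OF assms(2) homogeneous_mult[OF assms(1,3)]]] .
 have "?h \<in> ?f *o R +++ ?g *o R"
  using set_addI[OF smulI[OF k, of ?f] smulI[OF rr(2), of ?g]] unfolding h by (simp add: add.commute)
 moreover have "?g \<in> ?f *o R +++ ?h *o R"
  using set_addI[OF smulI[OF rr(3)[OF k], of ?f] smulI[OF rr(2), of ?h]] unfolding h by simp
 ultimately show ?thesis unfolding fi_def
  using P.inum_subset[OF loc_closed g f h1] P.inum_subset[OF loc_closed h1 f g] by simp
qed

lemma fi_lines:
 assumes "cross a b \<noteq> (0, 0, 0)" "heval (lin a) (pt R) = 0" "heval (lin b) (pt R) = 0"
 shows "fi (Suc 0) (lin a) (Suc 0) (lin b) R = 1"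
proof -
 note p = gm_params[OF assms]
 have "P.dim (mpow R 0) (mpow R (Suc 0)) = enat (Suc 0)" using reg_closed_point[OF R] unfolding P.reg_def by blast
 thus ?thesis unfolding fi_def P.inum_def P.paramsD(3)[OF p, symmetric] using P.mpow_1[OF p] by (simp add: one_enat_def)
qed

end

lemma local_ring_eq_zero:
 fixes p q :: "'k::alg_closed_field vec3"
 assumes p: "p \<noteq> (0, 0, 0)" "q \<noteq> (0, 0, 0)" "\<O> p = \<O> q"
  and F: "form d F" "heval F p = 0"
 shows "heval F q = 0"
proof -
 have l: "heval (lform p) q \<noteq> 0"
 proof
  assume z: "heval (lform p) q = 0"
  have "Fract (lform q) (lform p) \<in> \<O> q"
   using local_ringI[OF lform(1)[OF p(2)] lform(1,2)[OF p(1)]] p(3) by simp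
  moreover have "Fract (lform p) (lform q) \<in> mx (\<O> q)"
   using local_ring_max_iff[OF lform(1)[OF p(1)] lform(1,2)[OF p(2)]] z by simp
  moreover have "Fract (lform p) (lform q) \<noteq> 0" using lform(3)[OF p(1)] lform(3)[OF p(2)] by (simp add: Zero_fract_def eq_fract)
  ultimately show False using max_ideal_iff[of "Fract (lform p) (lform q)"] by simp
 qed
 show ?thesis using germ_max_iff[OF p(1) F(1)] F(2) p(3) l
   local_ring_max_iff[OF F(1) homogeneous_lform_power[OF p(1)], of q] unfolding germ_def by simp
qed

lemma closed_points_P2I: "p \<noteq> (0, 0, 0) ==> \<O> p \<in> PP2"
 unfolding closed_points_P2_def by blast

lemma total_lines:
 fixes a b :: "'k::alg_closed_field vec3"
 assumes ab: "cross a b \<noteq> (0, 0, 0)"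
 shows "total PP2 (fi (Suc 0) (lin a) (Suc 0) (lin b)) 1"
proof -
 let ?R = "\<O> (cross a b)"
 have R: "?R \<in> PP2" using closed_points_P2I[OF ab] .
 have z: "heval (lin a) (pt ?R) = 0" "heval (lin b) (pt ?R) = 0"
  using local_ring_eq_zero[OF ab pt(1)[OF R] pt(2)[OF R, symmetric] homogeneous_lin] heval_lin_cross by blast+
 have "fi (Suc 0) (lin a) (Suc 0) (lin b) S = 0" if S: "S \<in> PP2" "S \<noteq> ?R" for S
 proof -
  have "heval (lin a) (pt S) \<noteq> 0 \<or> heval (lin b) (pt S) \<noteq> 0"
  proof (rule ccontr)
   assume "\<not> ?thesis"
   then obtain t x y z where t: "cross a b = (x, y, z)" "pt S = (t * x, t * y, t * z)" "t \<noteq> 0"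
    using cross_zero_points[of a "pt S" b] pt(1)[OF S(1)] ab by metis
   thus False using local_ring_scale[OF t(3)] pt(2)[OF S(1)] S(2) by metis
  qed
  thus ?thesis using fi_nonvanishing[OF S(1) homogeneous_lin homogeneous_lin] fi_commute[OF S(1)] by metis
 qed
 thus ?thesis using total_iff[of "{?R}" PP2] R fi_lines[OF R ab z] by (auto simp: one_enat_def)
qed

section \<open>Intersection with a line\<close>

lemma coeff_linear_power:
 "degree Q \<le> n ==> degree ([:q, p:] ^ i * Q) \<le> i + n \<and>
   pcoeff ([:q, p:] ^ i * Q) (i + n) = p ^ i * pcoeff Q n" for p :: "'k::field"
proof (induction i)
 case (Suc i)
 let ?S = "[:q, p:] ^ i * Q"
 have e: "[:q, p:] ^ Suc i * Q = [:q, p:] * ?S" by (simp only: power_Suc mult.assoc)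
 have S: "degree ?S \<le> i + n" "pcoeff ?S (Suc (i + n)) = 0" using Suc by (auto intro: coeff_eq_0)
 have "degree ([:q, p:] * ?S) \<le> degree [:q, p:] + degree ?S" by (rule degree_mult_le)
 moreover have "degree [:q, p:] \<le> 1" by simp
 ultimately show ?case unfolding e using S Suc by (simp add: algebra_simps)
qed simp

text \<open>On the line through p and q the form becomes a polynomial in s whose coefficient at s^e
  is G(p). Either p is a zero, or this polynomial has positive degree and therefore a root.\<close>

lemma line_zero:
 fixes G :: "'k::alg_closed_field hpoly"
 assumes G: "form e G" "e > 0"
 obtains s t where "(s, t) \<noteq> (0, 0)" "heval G (s * p1 + t * q1, s * p2 + t * q2, s * p3 + t * q3) = 0"
proof -
 define g where "g = sub3 (\<lambda>c::'k. [:c:]) [:q1, p1:] [:q2, p2:] [:q3, p3:] G"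
 have ev: "poly g s = heval G (s * p1 + 1 * q1, s * p2 + 1 * q2, s * p3 + 1 * q3)" for s
  unfolding g_def heval_eq_sub3 khom.sub3_expand[OF khom_const] khom.sub3_expand[OF khom_id]
  by (auto simp: poly_sum add.commute intro!: sum.cong)
 show ?thesis
 proof (cases "heval G (p1, p2, p3) = 0")
  case True thus ?thesis using that[of 1 0] by simp
 next
  case False
  have "pcoeff g e = heval G (p1, p2, p3)"
   unfolding g_def heval_eq_sub3 khom.sub3_expand[OF khom_const] khom.sub3_expand[OF khom_id] coeff_sum
  proof (rule sum.cong[OF refl])
   fix x assume x: "x \<in> supp3 G"
   obtain i j l where x': "x = (i, j, l)" using prod_cases3 by blast
   have e: "e = i + (j + (l + 0))" using G(1) x unfolding homogeneous_iff x' by auto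
   have "degree (1 :: 'k poly) \<le> 0" by simp
   note c = coeff_linear_power[OF this, of q3 p3 l]
   note c = c coeff_linear_power[OF conjunct1[OF c], of q2 p2 j]
   note c = c coeff_linear_power[OF conjunct1[OF c(2)], of q1 p1 i]
   have "pcoeff ([:q1, p1:] ^ i * ([:q2, p2:] ^ j * ([:q3, p3:] ^ l * 1))) e = p1 ^ i * (p2 ^ j * (p3 ^ l * 1))"
    unfolding e c(3)[THEN conjunct2] c(2)[THEN conjunct2] c(1)[THEN conjunct2] by simp
   thus "pcoeff (case x of (i, j, l) => [:cf G (i, j, l):] * ([:q1, p1:] ^ i * [:q2, p2:] ^ j * [:q3, p3:] ^ l)) e =
    (case x of (i, j, l) => cf G (i, j, l) * (p1 ^ i * p2 ^ j * p3 ^ l))" by (simp add: x' mult.assoc)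
  qed
  hence "degree g \<ge> e" using False le_degree by metis
  then obtain s where "poly g s = 0" using alg_closed_imp_poly_has_root[of g] G(2) by auto
  thus ?thesis using that[of s 1] ev by simp
 qed
qed

text \<open>At a zero of \<open>G\<close> on the line, \<open>G\<close> is a combination of the line
  and a second line through that zero. Dropping the multiple of the first line changes no
  intersection number, and the second line splits off one point. Only lines through (1, 0, 0) are
  treated, the ones met when X is eliminated.\<close>

lemma total_line:
 fixes G :: "'k::alg_closed_field hpoly"
 assumes bc: "(b, c) \<noteq> (0, 0)"
 shows "form e G ==> \<not> lin (0, b, c) dvd G ==> total PP2 (fi (Suc 0) (lin (0, b, c)) e G) e"
proof (induction e arbitrary: G)
 case 0
 obtain k where k: "G = hconst k" using homogeneous_0_const 0(1) by blast
 have "k \<noteq> 0" using 0(2) k by auto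
 hence "fi (Suc 0) (lin (0, b, c)) 0 G R = 0" if "R \<in> PP2" for R
  using fi_nonvanishing[OF that homogeneous_lin 0(1)] heval_simps(6) k by metis
 thus ?case by (rule total_zero)
next
 case (Suc e)
 let ?L = "lin (0, b, c)"
 have nz: "(0, b, c) \<noteq> (0, 0, 0)" using bc by auto
 note pr = prime_elem_lin[OF nz]
 \<comment> \<open>The points (s, t c, - t b) are exactly those of the line with coefficients (0, b,
   c).\<close>
 obtain s t where st: "(s, t) \<noteq> (0, 0)" "heval G (s * 1 + t * 0, s * 0 + t * c, s * 0 + t * (- b)) = 0"
  using line_zero[OF Suc.prems(1)] by blast
 obtain m where m: "cross (0, b, c) m = (s, t * c, t * (- b))"
  using cross_solve[of b c "t * c" "t * (- b)" s] bc by (auto simp: algebra_simps)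
 have mz: "cross (0, b, c) m \<noteq> (0, 0, 0)" using m st(1) bc by auto
 have van: "heval G (cross (0, b, c) m) = 0" using st(2) m by simp
 obtain E G1 where G: "G = ?L * E + lin m * G1" "form (Suc e - 1) E" "form (Suc e - 1) G1"
  using form_vanishing[OF Suc.prems(1) van mz] .
 have nd: "\<not> ?L dvd lin m" "\<not> ?L dvd G1"
  using lin_not_dvd(1)[OF mz] Suc.prems(2) dvd_add[OF dvd_triv_left[of ?L E] dvd_mult[of ?L G1 "lin m"]]
  unfolding G(1) by blast+
 have L0: "?L \<noteq> 0" "lin m \<noteq> 0" using nz lin_not_dvd(3)[OF mz] by (simp_all only: lin_eq_0_iff not_False_eq_True)
 have "total PP2 (fi (Suc 0) ?L (Suc 0 + e) (lin m * G1)) (1 + e)"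
 proof (rule total_add[OF total_lines[OF mz] Suc.IH])
  show "form e G1" using G(3) by simp
  thus "fi (Suc 0) ?L (Suc 0 + e) (lin m * G1) R = fi (Suc 0) ?L (Suc 0) (lin m) R + fi (Suc 0) ?L e G1 R"
   if "R \<in> PP2" for R by (intro fi_mult[OF that] homogeneous_lin L0 cop_prime pr nd)
 qed (rule nd)
 moreover have "fi (Suc 0) ?L (Suc 0 + e) (lin m * G1) R = fi (Suc 0) ?L (Suc e) G R" if "R \<in> PP2" for R
  using fi_mod[OF that homogeneous_lin, of e "lin m * G1" E "(0, b, c)"] homogeneous_mult[OF homogeneous_lin, of e G1 m] G
  by (simp add: add.commute)
 ultimately show ?case
  using total_cong[of PP2 "fi (Suc 0) ?L (Suc 0 + e) (lin m * G1)" "fi (Suc 0) ?L (Suc e) G" "Suc e"] by simp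
qed

text \<open>A form free of X vanishes at some (0, s, t), so it lies in the ideal of X and t Y - s Z;
  comparing the parts free of X removes the first generator.\<close>

lemma binary_linear_factor:
 fixes F :: "'k::alg_closed_field hpoly"
 assumes F: "form d F" "degree F = 0" "d > 0"
 obtains b c where "(b, c) \<noteq> (0, 0)" "lin (0, b, c) dvd F"
proof -
 obtain s t where st: "(s, t) \<noteq> (0, 0)" "heval F (s * 0 + t * 0, s * 1 + t * 0, s * 0 + t * 1) = 0"
  using line_zero[OF F(1,3)] by blast
 have c: "cross (1, 0, 0) (0, t, - s) = (0, s, t)" by (simp add: cross_def)
 have van: "heval F (cross (1, 0, 0) (0, t, - s)) = 0" using st(2) c by simp
 have cz: "cross (1, 0, 0) (0, t, - s) \<noteq> (0, 0, 0)" using st(1) c by auto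
 obtain A B where AB: "F = lin (1, 0, 0) * A + lin (0, t, - s) * B" using form_vanishing[OF F(1) van cz] .
 obtain P where P: "F = [:P:]" using F(2) by (metis degree_eq_zeroE)
 have "pcoeff F 0 = pcoeff (lin (0, t, - s)) 0 * pcoeff B 0"
  unfolding AB by (simp add: lin_def coeff_mult)
 moreover have const_mult: "[:u:] * [:v:] = [:u * v:]" for u v :: "'k poly poly" by simp
 moreover have "lin (0, t, - s) = [:pcoeff (lin (0, t, - s)) 0:]" by (simp add: lin_def)
 ultimately have "F = lin (0, t, - s) * [:pcoeff B 0:]" unfolding P by (metis coeff_pCons_0 const_mult)
 hence "lin (0, t, - s) dvd F" by (rule dvdI)
 moreover have "(t, - s) \<noteq> (0, 0)" using st(1) by auto
 ultimately show ?thesis using that by blast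
qed

lemma cop_sym:
 assumes "cop F G" "F \<noteq> 0" shows "cop G F"
 unfolding cop_def
proof (intro allI impI)
 fix U assume "G dvd F * U"
 then obtain V where V: "F * U = G * V" by (rule dvdE)
 hence "F dvd V" using assms(1) unfolding cop_def by (metis dvd_triv_left)
 then obtain V' where "V = F * V'" by (rule dvdE)
 hence "F * U = F * (G * V')" using V by (simp add: mult_ac)
 thus "G dvd U" using assms(2) by simp
qed

text \<open>A binary form splits into linear factors; each of them is prime and does not divide
  \<open>F\<close>, so they are cancelled one by one.\<close>

lemma cop_binary:
 fixes F A :: "'k::alg_closed_field hpoly"
 assumes F: "\<And>b c. (b, c) \<noteq> (0, 0) ==> \<not> lin (0, b, c) dvd F"
 shows "form a A ==> degree A = 0 ==> A \<noteq> 0 ==> cop F A"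
proof (induction a arbitrary: A)
 case 0
 obtain k where k: "A = hconst k" using homogeneous_0_const 0(1) by blast
 hence "k \<noteq> 0" using 0(3) by auto
 hence i: "hconst (inverse k) * A = 1" unfolding k by (simp add: pCons_one)
 show ?case unfolding cop_def
 proof (intro allI impI)
  fix U assume "F dvd A * U"
  hence "F dvd hconst (inverse k) * (A * U)" by (rule dvd_mult)
  thus "F dvd U" unfolding mult.assoc[symmetric] i by simp
 qed
next
 case (Suc a)
 obtain b c where bc: "(b, c) \<noteq> (0, 0)" "lin (0, b, c) dvd A" using binary_linear_factor[OF Suc.prems(1,2)] by blast
 obtain A' where A: "A = lin (0, b, c) * A'" using bc(2) by (rule dvdE)
 have nz: "(0, b, c) \<noteq> (0, 0, 0)" using bc by auto
 note pr = prime_elem_lin[OF nz]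
 have l0: "lin (0, b, c) \<noteq> 0" using bc by (auto simp: lin_eq_0_iff)
 have "form (Suc a - Suc 0) A'"
  using homogeneous_quotient[OF _ homogeneous_lin l0] Suc.prems(1) unfolding A by blast
 moreover have "A' \<noteq> 0" using Suc.prems(3) A by auto
 moreover have "degree A' = 0" using Suc.prems(2) \<open>A' \<noteq> 0\<close> l0 unfolding A by (simp add: degree_mult_eq)
 ultimately have IH: "cop F A'" using Suc.IH by simp
 show ?case unfolding cop_def
 proof (intro allI impI)
  fix U assume "F dvd A * U"
  then obtain V where V: "lin (0, b, c) * (A' * U) = F * V" unfolding A mult.assoc by (rule dvdE)
  hence "lin (0, b, c) dvd F * V" by (metis dvd_triv_left)
  hence "lin (0, b, c) dvd V" using F[OF bc(1)] pr by (simp add: prime_elem_dvd_mult_iff)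
  then obtain V' where "V = lin (0, b, c) * V'" by (rule dvdE)
  hence "lin (0, b, c) * (A' * U) = lin (0, b, c) * (F * V')" using V by (simp only: mult_ac)
  hence "A' * U = F * V'" using l0 by simp
  thus "F dvd U" using IH unfolding cop_def by (metis dvd_triv_left)
 qed
qed

lemma homogeneous_outer_coeff:
 assumes "form d F" "pcoeff F i \<noteq> 0"
 shows "i \<le> d" "form (d - i) [:pcoeff F i:]"
proof -
 obtain j l where "pcoeff (pcoeff (pcoeff F i) j) l \<noteq> 0"
  using assms(2) by (metis leading_coeff_0_iff)
 thus "i \<le> d" using assms(1) unfolding homogeneous_def by fastforce
 show "form (d - i) [:pcoeff F i:]"
  using assms(1) unfolding homogeneous_def by (fastforce simp: coeff_pCons split: nat.splits)
qed

lemma degree_euclid_step: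
 fixes F G :: "'a::comm_ring_1 poly"
 assumes "degree F \<le> degree G" "0 < degree G"
 shows "degree ([:lead_coeff F:] * G - monom (lead_coeff G) (degree G - degree F) * F) < degree G"
proof -
 let ?H = "[:lead_coeff F:] * G - monom (lead_coeff G) (degree G - degree F) * F"
 have "degree (monom (lead_coeff G) (degree G - degree F) * F) \<le> degree G"
  using degree_mult_le[of "monom (lead_coeff G) (degree G - degree F)" F]
   degree_monom_le[of "lead_coeff G" "degree G - degree F"] assms(1) by linarith
 moreover have "degree ([:lead_coeff F:] * G) \<le> degree G" by (simp add: degree_smult_le)
 ultimately have "degree ?H \<le> degree G" by (rule degree_diff_le[rotated])
 moreover have "pcoeff ?H (degree G) = 0" using assms(1) by (simp add: coeff_monom_mult mult.commute[of "lead_coeff F"])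
 ultimately show ?thesis using assms(2) by (metis le_neq_implies_less leading_coeff_0_iff degree_0)
qed

text \<open>Elimination of X. A linear factor of \<open>F\<close> free of X is split off; if there
  is none, the leading coefficient \<open>A\<close> of \<open>F\<close> in X is coprime to
  \<open>F\<close>, and A G - K F is a pseudo-remainder of smaller degree in X. The order is
  lexicographic because the pseudo-remainder may raise the total degree, while splitting off a line
  keeps the degree in X.\<close>

theorem bezout_forms:
 fixes F G :: "'k::alg_closed_field hpoly"
 assumes "F \<noteq> 0" "G \<noteq> 0" "form d F" "form e G" "cop F G"
 shows "total PP2 (fi d F e G) (d * e)"
 using assms
proof (induction "(degree F + degree G, d + e)" arbitrary: d e F G rule: wf_induct_rule[OF wf_lex_prod[OF wf_less_than wf_less_than]])
 case (1 d e F G)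
 have IH: "total PP2 (fi d' F' e' G') (d' * e')"
  if "degree F' + degree G' < degree F + degree G \<or> degree F' + degree G' = degree F + degree G \<and> d' + e' < d + e"
   "F' \<noteq> 0" "G' \<noteq> 0" "form d' F'" "form e' G'" "cop F' G'" for d' e' and F' G' :: "'k hpoly"
  using 1(1)[OF _ that(2-6)] that(1) by simp
 \<comment> \<open>The case where \<open>F\<close> has degree in X at most that of \<open>G\<close>.
   The data \<open>F0\<close>, \<open>G0\<close>, \<open>d0\<close>, \<open>e0\<close> only fix the
   induction measure, so the other case can use this one with the forms exchanged.\<close>
 have main: "total PP2 (fi d F e G) (d * e)"
  if le: "degree F \<le> degree G" and dF: "degree F + degree G = degree F0 + degree G0" "d + e = d0 + e0"
   and IH: "\<And>d' e' (F' :: 'k hpoly) (G' :: 'k hpoly). degree F' + degree G' < degree F0 + degree G0 \<or>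
     degree F' + degree G' = degree F0 + degree G0 \<and> d' + e' < d0 + e0 ==>
    F' \<noteq> 0 ==> G' \<noteq> 0 ==> form d' F' ==> form e' G' ==> cop F' G' ==>
    total PP2 (fi d' F' e' G') (d' * e')"
   and FG: "F \<noteq> 0" "G \<noteq> 0" "form d F" "form e G" "cop F G"
  for d e d0 e0 :: nat and F G F0 G0 :: "'k hpoly"
 proof (cases "\<exists>b c. (b, c) \<noteq> (0, 0) \<and> lin (0, b, c) dvd F")
  case True
  then obtain b c where bc: "(b, c) \<noteq> (0, 0)" "lin (0, b, c) dvd F" by blast
  let ?L = "lin (0, b, c)"
  obtain F' where F: "F = ?L * F'" using bc(2) by (rule dvdE)
  have nz: "(0, b, c) \<noteq> (0, 0, 0)" using bc by auto
  note pr = prime_elem_lin[OF nz]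
  have l0: "?L \<noteq> 0" using bc by (auto simp: lin_eq_0_iff)
  have F'0: "F' \<noteq> 0" using FG(1) F by auto
  obtain x d' where x: "form x ?L" "form d' F'" "x + d' = d"
   using homogeneous_factor[of d ?L F'] FG(1,3) F by metis
  have d: "d = Suc 0 + d'" using homogeneous_degree_unique[OF x(1) homogeneous_lin l0] x(3) by simp
  have "degree ?L = 0" by (simp add: lin_def)
  hence "degree F = degree F'" unfolding F degree_mult_eq[OF l0 F'0] by simp
  moreover have c1: "cop F' G" unfolding cop_def
  proof (intro allI impI)
   fix U assume "F' dvd G * U"
   hence "?L * F' dvd ?L * (G * U)" by (rule mult_dvd_mono[OF dvd_refl])
   hence "F dvd G * (?L * U)" unfolding F by (simp only: mult.left_commute)
   hence "?L * F' dvd ?L * U" using FG(5) unfolding cop_def F[symmetric] by blast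
   thus "F' dvd U" using l0 by simp
  qed
  ultimately have t1: "total PP2 (fi d' F' e G) (d' * e)" using dF d F'0 FG x by (intro IH) auto
  have nd: "\<not> ?L dvd G"
  proof
   assume "?L dvd G"
   then obtain G' where "G = ?L * G'" by (rule dvdE)
   hence "G * F' = F * G'" unfolding F by (simp only: mult_ac)
   hence "F dvd G * F'" by (rule dvdI)
   hence "F dvd F'" using FG(5) unfolding cop_def by blast
   hence "?L * F' dvd 1 * F'" unfolding F[symmetric] mult_1 .
   hence "?L dvd 1" using F'0 dvd_mult_cancel_right[of ?L F' 1] by simp
   thus False using pr by (simp add: prime_elem_def)
  qed
  have t2: "total PP2 (fi (Suc 0) ?L e G) e" by (rule total_line[OF bc(1) FG(4) nd])
  have c2: "cop G ?L" using cop_sym[OF cop_prime[OF pr nd] l0] .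
  have "fi d F e G R = fi (Suc 0) ?L e G R + fi d' F' e G R" if R: "R \<in> PP2" for R
   unfolding fi_commute[OF R, of _ _ e G] F d by (rule fi_mult[OF R FG(4) homogeneous_lin x(2) FG(2) l0 c2])
  from total_add[OF t2 t1 this] show ?thesis unfolding d by simp
 next
  case False
  show ?thesis
  proof (cases "degree F = 0")
   case deg: True
   hence "d = 0" using False binary_linear_factor[OF FG(3)] by blast
   moreover obtain k where k: "F = hconst k" using homogeneous_0_const FG(3) \<open>d = 0\<close> by blast
   moreover have "k \<noteq> 0" using FG(1) k by auto
   ultimately have "fi d F e G R = 0" if "R \<in> PP2" for R
    using fi_nonvanishing[OF that FG(4,3)] heval_simps(6) fi_commute[OF that] by metis
   thus ?thesis using total_zero \<open>d = 0\<close> by (metis mult_0)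
  next
   case deg: False
   let ?m = "degree F" and ?n = "degree G"
   let ?A = "[:lead_coeff F:]" and ?K = "monom (lead_coeff G) (?n - ?m)"
   let ?H = "?A * G - ?K * F"
   have lc: "lead_coeff F \<noteq> 0" "lead_coeff G \<noteq> 0" using FG by auto
   note hF = homogeneous_outer_coeff[OF FG(3) lc(1)] and hG = homogeneous_outer_coeff[OF FG(4) lc(2)]
   have A0: "?A \<noteq> 0" using lc by simp
   have cA: "cop F ?A" by (rule cop_binary[OF _ hF(2)]) (use False A0 in auto)
   have K: "?K = [:lead_coeff G:] * hX ^ (?n - ?m)" by (simp add: monom_altdef)
   have hK: "form (e - ?n + (?n - ?m)) ?K"
    unfolding K using homogeneous_mult[OF hG(2) homogeneous_power[OF homogeneous_variables(1), of "?n - ?m"]] by simp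
   \<comment> \<open>The degree of \<open>K\<close> as a form; it gives K F and A G the common
     degree d + r.\<close>
   define r where "r = e - ?n + (?n - ?m)"
   have r: "d - ?m + e = d + r" using hF(1) hG(1) le unfolding r_def by simp
   have hAG: "form (d + r) (?A * G)" using homogeneous_mult[OF hF(2) FG(4)] unfolding r .
   have hH: "form (d + r) ?H"
    using homogeneous_diff[OF hAG homogeneous_mult[OF FG(3) hK[folded r_def]]] by (simp only: mult.commute[of F])
   have deg1: "degree ?H < ?n" using degree_euclid_step[OF le] deg le by simp
   have cAG: "cop F (?A * G)" using cA FG(5) unfolding cop_def mult.assoc by blast
   have cH: "cop F ?H" unfolding cop_def
   proof (intro allI impI)
    fix U assume "F dvd ?H * U"
    hence "F dvd ?H * U + F * (?K * U)" by simp
    hence "F dvd ?A * G * U" by (simp add: algebra_simps)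
    thus "F dvd U" using cAG unfolding cop_def by blast
   qed
   have H0: "?H \<noteq> 0"
   proof
    assume "?H = 0"
    hence "F dvd 1" using cH unfolding cop_def by simp
    thus False using deg FG(1) by (simp add: poly_dvd_1)
   qed
   have tH: "total PP2 (fi d F (d + r) ?H) (d * (d + r))" using deg1 dF H0 FG hH cH by (intro IH) auto
   have tA: "total PP2 (fi d F (d - ?m) ?A) (d * (d - ?m))"
    using deg le dF A0 FG hF(2) cA by (intro IH) auto
   have eq: "fi d F (d + r) ?H R = fi d F (d - ?m) ?A R + fi d F e G R" if R: "R \<in> PP2" for R
   proof -
    have "fi d F (d + r) ?H R = fi d F (d + r) (?H + F * ?K) R"
     using fi_mod[OF R FG(3) hH, of ?K] hK[folded r_def] by simp
    also have "?H + F * ?K = ?A * G" by (simp add: mult.commute)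
    also have "fi d F (d + r) (?A * G) R = fi d F (d - ?m) ?A R + fi d F e G R"
     unfolding r[symmetric] by (rule fi_mult[OF R FG(3) hF(2) FG(4,1) A0 cA])
    finally show ?thesis .
   qed
   \<comment> \<open>The pseudo-remainder meets \<open>F\<close> in the contribution of
     \<open>A\<close> plus that of \<open>G\<close>; the first and the total are known by induction,
     so the second follows by subtraction.\<close>
   have "d * (d + r) = d * (d - ?m) + d * e" unfolding r[symmetric] by (simp add: algebra_simps)
   thus ?thesis using total_cancel[OF _ tA eq, of "d * e"] tH by simp
  qed
 qed
 show ?case
 proof (cases "degree F \<le> degree G")
  case True show ?thesis by (rule main[OF True refl refl IH 1(2-6)])
 next
  case False
  have "total PP2 (fi e G d F) (e * d)"
   by (rule main[of G F F G e d d e]) (use False IH 1(2-6) cop_sym[OF 1(6,2)] in \<open>auto simp: add.commute\<close>)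
  thus ?thesis using total_cong[of PP2 "fi e G d F" "fi d F e G", OF fi_commute]
   by (simp add: mult.commute)
 qed
qed

section \<open>Plane curves\<close>

lemma total_restrict:
 assumes "total A i n" "B \<subseteq> A" "\<And>R. R \<in> A ==> R \<notin> B ==> i R = 0" shows "total B i n"
proof -
 have "{R \<in> B. i R \<noteq> 0} = {R \<in> A. i R \<noteq> 0}" using assms(2,3) by blast
 thus ?thesis using assms(1) unfolding total_def by simp
qed

lemma total_le:
 assumes "total A i n" "R \<in> A" shows "i R \<le> enat n"
proof (cases "i R = 0")
 case False
 hence "i R \<le> (\<Sum>R | R \<in> A \<and> i R \<noteq> 0. i R)"
  using assms unfolding total_def by (intro member_le_sum) auto
 thus ?thesis using assms(1) unfolding total_def by simp
qed simp

context
 fixes C :: "'k::alg_closed_field hpoly" and d :: nat and D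
 assumes C: "integral_plane_curve d C" and DC: "D = generic_ring C"
begin

lemma curve_hom: "form d C" and curve_prime_elem: "prime_elem C" and curve_nz: "C \<noteq> 0"
 using C unfolding integral_plane_curve_def by auto

lemma curve_degree_pos: "d > 0"
proof (rule ccontr)
 assume "\<not> d > 0"
 then obtain k where k: "C = hconst k" using homogeneous_0_const curve_hom by blast
 hence "C * hconst (inverse k) = 1" using curve_nz by (simp add: pCons_one)
 hence "C dvd 1" by (metis dvd_triv_left)
 thus False using prime_elem_not_unit[OF curve_prime_elem] by blast
qed

lemma not_dvd_mult: "\<not> C dvd A ==> \<not> C dvd B ==> \<not> C dvd A * B"
 using curve_prime_elem by (simp add: prime_elem_dvd_mult_iff)

lemma not_dvd_power: "\<not> C dvd A ==> \<not> C dvd A ^ n"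
 using curve_prime_elem by (meson prime_elem_dvd_power)

lemma dvd_prime:
 "C dvd 0" "\<not> C dvd 1" "\<forall>F G. C dvd F --> C dvd G --> C dvd F + G"
 "\<forall>F G. C dvd F * G \<longleftrightarrow> C dvd F \<or> C dvd G"
 using prime_elem_not_unit[OF curve_prime_elem] prime_elem_dvd_mult_iff[OF curve_prime_elem] by auto

lemmas genericI = hlocI[where N = "(dvd) C", OF generic_ring_def dvd_prime, folded DC]
 and genericE = hlocE[where N = "(dvd) C", OF generic_ring_def dvd_prime, folded DC]
 and ring_set_generic = ring_set_hloc[where N = "(dvd) C", OF generic_ring_def dvd_prime, folded DC]
 and generic_max_iff = hloc_max_iff[where N = "(dvd) C", OF generic_ring_def dvd_prime, folded DC]
 and submod_max_generic = submod_max_hloc[where N = "(dvd) C", OF generic_ring_def dvd_prime, folded DC]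

lemma local_dom_generic: "P.local_dom D"
 unfolding P.local_dom_def using ring_set_generic submod_max_generic by blast

lemma curve_dvd_line:
 assumes "C dvd lin a" "a \<noteq> (0, 0, 0)" shows "lin a dvd C"
proof -
 obtain U where U: "lin a = C * U" using assms(1) by (rule dvdE)
 have "U dvd 1" using irreducibleD[OF irreducible_lin[OF assms(2)] U] prime_elem_not_unit[OF curve_prime_elem] by blast
 hence "C * U dvd C * 1" by (rule mult_dvd_mono[OF dvd_refl])
 thus ?thesis unfolding U mult_1_right .
qed

lemma transversal_line:
 assumes "cross a b \<noteq> (0, 0, 0)" shows "\<not> C dvd lin a \<or> \<not> C dvd lin b"
 using curve_dvd_line[of a] lin_not_dvd[OF assms] dvd_trans by blast

lemma exists_transversal_line: "\<exists>a. \<not> C dvd lin a"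
 using transversal_line[of "(1, 0, 0)" "(0, 1, 0)"] by (auto simp: cross_def)

lemma local_ring_subset_iff:
 assumes p: "p \<noteq> (0, 0, 0)" shows "\<O> p \<subseteq> D \<longleftrightarrow> heval C p = 0"
proof
 assume z: "heval C p = 0"
 hence "\<not> C dvd G" if "heval G p \<noteq> 0" for G using that by (auto elim: dvdE)
 thus "\<O> p \<subseteq> D" using genericI by (auto elim!: local_ringE)
next
 assume sub: "\<O> p \<subseteq> D"
 show "heval C p = 0"
 proof (rule ccontr)
  assume nz: "heval C p \<noteq> 0"
  obtain a where a: "\<not> C dvd lin a" using exists_transversal_line by blast
  have h: "form d (lin a ^ d)" using homogeneous_power[OF homogeneous_lin, of d] by simp
  \<comment> \<open>If \<open>C\<close> did not vanish at p, the fraction l^d / C would be regular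
    at p although it has a pole along the curve.\<close>
  have "Fract (lin a ^ d) C \<in> D" using sub local_ringI[OF h curve_hom nz] by blast
  then obtain A B where "Fract (lin a ^ d) C = Fract A B" "\<not> C dvd B" "B \<noteq> 0" by (auto elim: genericE)
  hence "lin a ^ d * B = A * C" using curve_nz by (simp add: eq_fract)
  hence "C dvd lin a ^ d * B" by simp
  thus False using not_dvd_mult[OF not_dvd_power[OF a] \<open>\<not> C dvd B\<close>] by blast
 qed
qed

context
 fixes R assumes R: "R \<in> PP2" "R \<subseteq> D"
begin

lemma curve_vanishes: "heval C (pt R) = 0"
 using local_ring_subset_iff[OF pt(1)[OF R(1)]] pt(2)[OF R(1)] R(2) by simp

lemma not_dvd_at: "heval G (pt R) \<noteq> 0 ==> \<not> C dvd G"
 using curve_vanishes by (auto elim: dvdE)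

lemma gm_generic_iff: "form n A ==> gm R n A \<in> mx D \<longleftrightarrow> C dvd A"
 unfolding germ_def by (rule generic_max_iff[OF _ homogeneous_lform_power[OF pt(1)[OF R(1)]]])
  (auto intro!: not_dvd_at simp: lform(2)[OF pt(1)[OF R(1)]])

lemma curve_at_gm: "P.curve_at D R (gm R d C)"
 unfolding P.curve_at_def
proof (intro conjI local_dom_generic R(2) gm_in[OF R(1)] curve_hom subset_antisym subsetI IntI)
 show "gm R d C \<noteq> 0" using gm_eq_0_iff[OF R(1)] curve_nz by blast
 have gD: "gm R d C \<in> mx D" using gm_generic_iff[OF curve_hom] by simp
 show "a \<in> R" if "a \<in> gm R d C *o R" for a
  using that ring_setD(5)[OF P.loc_ringD(1)[OF loc_closed[OF R(1)]] gm_in[OF R(1) curve_hom]] by (auto elim: smulE)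
 show "a \<in> mx D" if "a \<in> gm R d C *o R" for a
  using that submodD(3)[OF P.local_domD(2)[OF local_dom_generic]] submodD(4)[OF P.local_domD(2)[OF local_dom_generic] _ gD] R(2)
  by (auto elim!: smulE simp: mult.commute)
 fix a assume a: "a \<in> R \<inter> mx D"
 hence "a \<in> \<O> (pt R)" using pt(2)[OF R(1)] by simp
 then obtain A B n where 1: "a = Fract A B" "form n A" "form n B" "heval B (pt R) \<noteq> 0" "B \<noteq> 0"
  by (rule local_ringE)
 have "C dvd A" using generic_max_iff[OF 1(2,3) not_dvd_at[OF 1(4)]] a 1(1) by blast
 then obtain A' where A: "A = C * A'" by (rule dvdE)
 show "a \<in> gm R d C *o R"
 proof (cases "A = 0")
  case True
  have "a = 0" using True 1 by (simp add: Zero_fract_def eq_fract)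
  hence "a = gm R d C * 0" by simp
  thus ?thesis using smulI[OF ring_setD(1)[OF P.loc_ringD(1)[OF loc_closed[OF R(1)]]]] by metis
 next
  case False
  obtain x y where xy: "form x C" "form y A'" "x + y = n"
   using homogeneous_factor[of n C A'] 1(2) False unfolding A by blast
  have "x = d" using homogeneous_degree_unique[OF xy(1) curve_hom curve_nz] .
  thus ?thesis
   using local_ring_mem_germ[OF pt(1)[OF R(1)] curve_hom xy(2) _ 1(4)] 1(3) xy(3) pt(2)[OF R(1)] unfolding 1(1) A by simp
 qed
qed

end

lemma total_cnum:
 assumes A: "form n A" "\<not> C dvd A"
 shows "total {R \<in> PP2. R \<subseteq> D} (\<lambda>R. P.cnum D R (gm R n A)) (d * n)"
proof -
 have A0: "A \<noteq> 0" using A(2) by auto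
 have t: "total PP2 (fi d C n A) (d * n)"
  by (rule bezout_forms[OF curve_nz A0 curve_hom A(1) cop_prime[OF curve_prime_elem A(2)]])
 have z: "fi d C n A R = 0" if R: "R \<in> PP2" "\<not> R \<subseteq> D" for R
 proof -
  have "heval C (pt R) \<noteq> 0" using local_ring_subset_iff[OF pt(1)[OF R(1)]] pt(2)[OF R(1)] R(2) by simp
  thus ?thesis using fi_nonvanishing[OF R(1) A(1) curve_hom] fi_commute[OF R(1), of d C n A] by simp
 qed
 have "total {R \<in> PP2. R \<subseteq> D} (fi d C n A) (d * n)"
  by (rule total_restrict[OF t]) (use z in auto)
 thus ?thesis
  using total_cong[of "{R \<in> PP2. R \<subseteq> D}" "fi d C n A" "\<lambda>R. P.cnum D R (gm R n A)"]
   P.cnum_eq_inum[OF curve_at_gm] unfolding fi_def by simp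
qed

text \<open>Local finiteness comes from the global theorem: a local intersection number is one term
  of a finite total.\<close>

lemma good_closed_point:
 assumes R: "R \<in> PP2" "R \<subseteq> D" shows "P.good D R"
 unfolding P.good_def
proof (intro conjI ballI impI reg_closed_point R exI[of _ "gm R d C"] curve_at_gm)
 fix g assume g: "g \<in> R" "g \<notin> mx D"
 hence "g \<in> \<O> (pt R)" using pt(2)[OF R(1)] by simp
 then obtain A B n where 1: "g = Fract A B" "form n A" "form n B" "heval B (pt R) \<noteq> 0" "B \<noteq> 0"
  by (rule local_ringE)
 note p = pt(1)[OF R(1)]
 have nd: "\<not> C dvd A" using generic_max_iff[OF 1(2,3) not_dvd_at[OF R 1(4)]] g(2) 1(1) by blast
 have u: "gm R n B \<in> R" "gm R n B \<notin> mx R" using gm_in[OF R(1) 1(3)] gm_max_iff[OF R(1) 1(3)] 1(4) by auto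
 have "gm R n A = gm R n B * g" unfolding 1(1) germ_def using 1(5) lform(3)[OF p] by (simp add: eq_fract mult.commute)
 hence "gm R n A \<in> g *o R" using smulI'[OF u(1)] by metis
 hence "P.cnum D R g \<le> P.cnum D R (gm R n A)" unfolding P.cnum_eq_inum[OF curve_at_gm[OF R]]
  by (intro P.inum_subset[OF loc_closed[OF R(1)] g(1) gm_in[OF R(1) curve_hom] gm_in[OF R(1) 1(2)]])
   (use set_add_ub2[OF submod_smul[OF submod_self[OF P.loc_ringD(1)[OF loc_closed[OF R(1)]]]]] in blast)
 also have "\<dots> \<le> enat (d * n)" using total_le[OF total_cnum[OF 1(2) nd]] R by simp
 finally show "P.cnum D R g \<noteq> \<infinity>" by (cases "P.cnum D R g") auto
qed

end

section \<open>Self-intersection on a blown up plane\<close>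

lemma sum_the_enat:
 assumes "finite S" "(\<Sum>L\<in>S. i L) = enat n" shows "(\<Sum>L\<in>S. int (the_enat (i L))) = int n"
 using assms
proof (induction S arbitrary: n rule: finite_induct)
 case (insert x S)
 then obtain a b where ab: "i x = enat a" "(\<Sum>L\<in>S. i L) = enat b" "a + b = n"
  by (cases "i x"; cases "\<Sum>L\<in>S. i L") auto
 thus ?case using insert.IH[OF ab(2)] insert.hyps by auto
qed (simp add: zero_enat_def)

context const_field
begin

lemma inf_near_psubset: "reg R ==> inf_near R Ls ==> Ls \<noteq> [] ==> R \<subset> last Ls"
proof (induction Ls arbitrary: R)
 case (Cons L Ls)
 hence L: "R \<subset> L" "reg L" "inf_near L Ls" using exceptional_psubset reg_exceptional by auto
 show ?case using Cons.IH[OF L(2,3)] L(1) by (cases "Ls = []") auto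
qed simp

lemma inf_near_unique:
 assumes "reg R" "inf_near R Ls" "inf_near R Ms" "last (R # Ls) = last (R # Ms)"
 shows "Ls = Ms"
 using assms
proof (induction Ls arbitrary: R Ms)
 case Nil
 thus ?case using inf_near_psubset[OF Nil(1,3)] by (cases "Ms = []") auto
next
 case (Cons L Ls)
 show ?case
 proof (cases Ms)
  case Nil
  thus ?thesis using inf_near_psubset[OF Cons.prems(1,2)] Cons.prems(4) by auto
 next
  case Ms: (Cons M Ms')
  let ?S = "last (L # Ls)"
  have L: "L \<in> exc R" "inf_near L Ls" "M \<in> exc R" "inf_near M Ms'" "?S = last (M # Ms')"
   using Cons.prems Ms by auto
  have rL: "reg L" "reg M" using reg_exceptional[OF Cons.prems(1)] L by auto
  have "dominates ?S L" "dominates ?S M" "ring_set ?S"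
   using inf_near_last[OF rL(1) L(2)] inf_near_last[OF rL(2) L(4)] L(5) regD(2) by auto
  hence "L = M" using exceptional_unique[OF Cons.prems(1) L(1,3)] by blast
  thus ?thesis using Cons.IH[OF rL(1) L(2), of Ms'] L(4,5) Ms by simp
 qed
qed

lemma local_equation:
 assumes G: "good D R" and C: "curve_at D R f"
 obtains w where "w \<in> R" "w \<notin> mx R" "local_equation D R = f * w" "curve_at D R (f * w)"
proof -
 note c = curve_atD[OF C] and r = goodD(5)[OF G]
 let ?g = "local_equation D R"
 have ci: "curve_ideal D R = f *o R" using c(2,6) unfolding curve_ideal_def by simp
 have "\<exists>g. g \<in> R \<and> PIdl\<^bsub>ring_on R\<^esub> g = curve_ideal D R" using c(3) unfolding ci cgenideal_ring_on by blast
 hence g: "?g \<in> R" "?g *o R = f *o R"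
  unfolding local_equation_def by (metis (mono_tags, lifting) someI_ex, metis (mono_tags, lifting) cgenideal_ring_on ci someI_ex)
 have "f * 1 \<in> ?g *o R" "?g * 1 \<in> f *o R" unfolding g(2) unfolding g(2)[symmetric] using smulI ring_setD(2)[OF r] by (metis g(2), blast)
 then obtain w w' where w: "w \<in> R" "w' \<in> R" "?g = f * w" "f = ?g * w'" by (auto elim!: smulE)
 have ww: "w * w' = 1" using w(3,4) c(4) by (metis mult.assoc mult_cancel_left1)
 hence "w \<noteq> 0" "inverse w = w'" by (auto intro: inverse_unique)
 hence "w \<notin> mx R" using w(2) max_ideal_iff by blast
 moreover have "curve_at D R ?g" using C g w(3) c(4) \<open>w \<noteq> 0\<close> unfolding curve_at_def by simp
 ultimately show ?thesis using that w by metis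
qed

text \<open>Two presentations of the same fraction satisfy a b' = a' b, so additivity of
  intersection numbers gives independence of the choice.\<close>

lemma local_intersection_eq:
 assumes G: "good D R" and C: "curve_at D R f" and ab: "a \<in> R" "b \<in> R" "a \<notin> mx D" "b \<notin> mx D"
 shows "local_intersection R f (a / b) = int (the_enat (cnum D R a)) - int (the_enat (cnum D R b))"
proof -
 note c = curve_atD[OF C] and r = goodD(5)[OF G]
 have mem: "x \<in> R - PIdl\<^bsub>ring_on R\<^esub> f \<longleftrightarrow> x \<in> R \<and> x \<notin> mx D" for x
  unfolding cgenideal_ring_on using c(5) by blast
 have num: "colength R (Idl\<^bsub>ring_on R\<^esub> {f, x}) = cnum D R x" if "x \<in> R" for x
  unfolding genideal2_ring_on[OF r c(3) that] cnum_def c(6)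
  by (rule colength_eq_dim[OF goodD(4)[OF G] submod_two[OF r] two_subset[OF r c(3) that]])
 have nz: "x \<noteq> 0" if "x \<notin> mx D" for x using submodD(1)[OF local_domD(2)[OF c(1)]] that by blast
 have fin: "cnum D R x = enat (the_enat (cnum D R x))" if "x \<in> R" "x \<notin> mx D" for x
  using goodD(3)[OF G that] by auto
 show ?thesis unfolding local_intersection_def mem
 proof (rule the_equality)
  show "\<exists>a' b'. (a' \<in> R \<and> a' \<notin> mx D) \<and> (b' \<in> R \<and> b' \<notin> mx D) \<and> a / b = a' / b' \<and>
   int (the_enat (cnum D R a)) - int (the_enat (cnum D R b)) =
   int (the_enat (colength R (Idl\<^bsub>ring_on R\<^esub> {f, a'}))) - int (the_enat (colength R (Idl\<^bsub>ring_on R\<^esub> {f, b'})))"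
   using ab num by (intro exI[of _ a] exI[of _ b]) simp
  fix n assume "\<exists>a' b'. (a' \<in> R \<and> a' \<notin> mx D) \<and> (b' \<in> R \<and> b' \<notin> mx D) \<and> a / b = a' / b' \<and>
   n = int (the_enat (colength R (Idl\<^bsub>ring_on R\<^esub> {f, a'}))) - int (the_enat (colength R (Idl\<^bsub>ring_on R\<^esub> {f, b'})))"
  then obtain a' b' where 1: "a' \<in> R" "a' \<notin> mx D" "b' \<in> R" "b' \<notin> mx D" "a / b = a' / b'"
   "n = int (the_enat (cnum D R a')) - int (the_enat (cnum D R b'))" using num by auto
  have "a * b' = a' * b" using 1(5) nz[OF 1(4)] nz[OF ab(4)] by (simp add: field_simps)
  hence "cnum D R a + cnum D R b' = cnum D R a' + cnum D R b"
   using cnum_mult[OF G ab(1) 1(3) ab(3)] cnum_mult[OF G 1(1) ab(2) 1(2)] by simp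
  hence "the_enat (cnum D R a) + the_enat (cnum D R b') = the_enat (cnum D R a') + the_enat (cnum D R b)"
   using fin[OF ab(1,3)] fin[OF ab(2,4)] fin[OF 1(1,2)] fin[OF 1(3,4)] by (metis enat.inject plus_enat_simps(1))
  thus "n = int (the_enat (cnum D R a)) - int (the_enat (cnum D R b))" unfolding 1(6) by linarith
 qed
qed

definition iv :: "'f set => 'f => 'f set => int" where
 "iv D \<phi> R = local_intersection R (local_equation D R) (local_equation D R / \<phi>)"

text \<open>A local presentation of a function with a simple zero along the curve. The divisor C -
  div \<phi> has the local equation c / b, so its contribution is the number for \<open>c\<close>
  minus the number for \<open>b\<close>.\<close>

definition rep :: "'f set => 'f => 'f set => 'f => 'f => 'f => bool" where
 "rep D \<phi> R f b c \<longleftrightarrow> good D R \<and> curve_at D R f \<and> b \<in> R \<and> c \<in> R \<and> b \<notin> mx D \<and> c \<notin> mx D \<and> \<phi> = f * b / c"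

lemma iv_eq:
 assumes "rep D \<phi> R f b c"
 shows "iv D \<phi> R = int (the_enat (cnum D R c)) - int (the_enat (cnum D R b))"
proof -
 have G: "good D R" and C: "curve_at D R f" and bc: "b \<in> R" "c \<in> R" "b \<notin> mx D" "c \<notin> mx D" "\<phi> = f * b / c"
  using assms unfolding rep_def by auto
 obtain w where w: "w \<in> R" "w \<notin> mx R" "local_equation D R = f * w" "curve_at D R (f * w)"
  using local_equation[OF G C] .
 have wD: "w \<notin> mx D" using unit_not_in_curve[OF G w(1,2)] .
 have nz: "x \<noteq> 0" if "x \<notin> mx D" for x
  using submodD(1)[OF local_domD(2)[OF goodD(6)[OF G]]] that by blast
 have "f * w / \<phi> = (w * c) / b" unfolding bc(5) using curve_atD(4)[OF C] nz[OF bc(3)] nz[OF bc(4)] by (simp add: field_simps)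
 moreover have "w * c \<in> R" "w * c \<notin> mx D"
  using ring_setD(5)[OF goodD(5)[OF G] w(1) bc(2)] local_domD(6)[OF goodD(6)[OF G] _ _ wD bc(4)] goodD(7)[OF G] w(1) bc(2) by auto
 ultimately show ?thesis
  unfolding iv_def w(3) using local_intersection_eq[OF G w(4) _ bc(1) _ bc(3), of "w * c"] cnum_unit_mult[OF G w(1,2) bc(2)] by simp
qed

text \<open>After the blowup the curve has equation f / x^m, so x^m joins the factor
  \<open>b\<close>. The totals for \<open>b\<close> and \<open>c\<close> are preserved, and x^m
  costs m times the total m of the exceptional divisor.\<close>

lemma iv_blowup:
 assumes rep: "rep D \<phi> R f b c"
 shows "finite (exc_on D R)" "L \<in> exc_on D R ==> \<exists>f' b' c'. rep D \<phi> L f' b' c'"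
  "(\<Sum>L\<in>exc_on D R. iv D \<phi> L) = iv D \<phi> R - int ((mult_at D R)^2)"
proof -
 have G: "good D R" and C: "curve_at D R f" and bc: "b \<in> R" "c \<in> R" "b \<notin> mx D" "c \<notin> mx D" "\<phi> = f * b / c"
  using rep unfolding rep_def by auto
 let ?m = "mult_at D R"
 obtain x where x: "x \<in> mx R" "x \<notin> mx D" "x \<noteq> 0"
  "finite (exc_on D R)" "\<And>L. L \<in> exc_on D R ==> good D L"
  "(\<Sum>L\<in>exc_on D R. cnum D L x) = enat ?m"
  "\<And>g. g \<in> R ==> g \<notin> mx D ==> (\<Sum>L\<in>exc_on D R. cnum D L g) = cnum D R g"
  "\<And>L f. L \<in> exc_on D R ==> curve_at D R f ==> curve_at D L (f / x ^ ?m)"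
  using blowup_intersection[OF G] by metis
 show fin: "finite (exc_on D R)" by (rule x(4))
 have xR: "x \<in> R" using x(1) loc_ringD(5)[OF goodD(4)[OF G]] by blast
 have RL: "R \<subseteq> L" if "L \<in> exc_on D R" for L
  using that exceptional_psubset[OF goodD(1)[OF G]] unfolding exc_on_def by blast
 have pw: "x ^ n \<in> L \<and> x ^ n \<notin> mx D \<and> (g \<in> L --> cnum D L (x ^ n * g) = of_nat n * cnum D L x + cnum D L g)"
  if L: "L \<in> exc_on D R" for L n g
 proof (induction n)
  case 0
  have "1 \<notin> mx D" using local_domD(5)[OF goodD(6)[OF G], of 1] ring_setD(2)[OF local_domD(1)[OF goodD(6)[OF G]]] by simp
  thus ?case using ring_setD(2)[OF goodD(5)[OF x(5)[OF L]]] by (simp add: zero_enat_def[symmetric])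
 next
  case (Suc n)
  have xL: "x \<in> L" using RL[OF L] xR by blast
  note g = x(5)[OF L] and r = ring_setD(5)[OF goodD(5)[OF x(5)[OF L]]]
  have "x * x ^ n \<notin> mx D" using local_domD(6)[OF goodD(6)[OF g] _ _ x(2)] Suc xL goodD(7)[OF g] by blast
  moreover have "cnum D L (x * (x ^ n * g)) = cnum D L x + cnum D L (x ^ n * g)" if "g \<in> L"
   using cnum_mult[OF g xL _ x(2)] r Suc that by blast
  ultimately show ?case using Suc r xL by (simp add: algebra_simps)
 qed
 have repL: "rep D \<phi> L (f / x ^ ?m) (x ^ ?m * b) c" if L: "L \<in> exc_on D R" for L
 proof -
  have l: "x ^ ?m \<in> L" "x ^ ?m \<notin> mx D" "b \<in> L" "c \<in> L" using pw[OF L] RL[OF L] bc by auto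
  note g = x(5)[OF L]
  have "x ^ ?m * b \<in> L" "x ^ ?m * b \<notin> mx D"
   using ring_setD(5)[OF goodD(5)[OF g]] local_domD(6)[OF goodD(6)[OF g] _ _ l(2) bc(3)] l goodD(7)[OF g] by blast+
  thus ?thesis unfolding rep_def using g x(8)[OF L C] bc l x(3) by simp
 qed
 thus "L \<in> exc_on D R ==> \<exists>f' b' c'. rep D \<phi> L f' b' c'" by blast
 have fin': "\<exists>n. cnum D L g = enat n" if "L \<in> exc_on D R" "g \<in> L" "g \<notin> mx D" for L g
  using goodD(3)[OF x(5)[OF that(1)] that(2,3)] by auto
 have "iv D \<phi> L = int (the_enat (cnum D L c)) - int (the_enat (cnum D L b)) - int ?m * int (the_enat (cnum D L x))"
  if L: "L \<in> exc_on D R" for L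
 proof -
  have l: "b \<in> L" "c \<in> L" "x \<in> L" using RL[OF L] bc xR by auto
  obtain p q where "cnum D L x = enat p" "cnum D L b = enat q" using fin'[OF L] l bc(3) x(2) by metis
  thus ?thesis unfolding iv_eq[OF repL[OF L]] using pw[OF L, of ?m b] l by (simp add: of_nat_eq_enat)
 qed
 hence "(\<Sum>L\<in>exc_on D R. iv D \<phi> L) = (\<Sum>L\<in>exc_on D R. int (the_enat (cnum D L c)))
   - (\<Sum>L\<in>exc_on D R. int (the_enat (cnum D L b))) - int ?m * (\<Sum>L\<in>exc_on D R. int (the_enat (cnum D L x)))"
  by (simp add: sum_subtractf sum_distrib_left)
 moreover have "(\<Sum>L\<in>exc_on D R. int (the_enat (cnum D L g))) = int (the_enat (cnum D R g))"
  if "g \<in> R" "g \<notin> mx D" for g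
 proof -
  obtain n where n: "cnum D R g = enat n" using goodD(3)[OF G \<open>g \<in> R\<close> \<open>g \<notin> mx D\<close>] by auto
  show ?thesis using sum_the_enat[OF fin, of "\<lambda>L. cnum D L g" n] x(7)[OF that] n by simp
 qed
 ultimately show "(\<Sum>L\<in>exc_on D R. iv D \<phi> L) = iv D \<phi> R - int (?m^2)"
  using sum_the_enat[OF fin x(6)] bc iv_eq[OF rep] by (simp add: power2_eq_square)
qed

end

section \<open>The points of an iterated blowup\<close>

definition tsum :: "'a set => ('a => int) => int => bool" where
 "tsum A i s \<longleftrightarrow> (\<exists>S. finite S \<and> S \<subseteq> A \<and> (\<forall>R\<in>A - S. i R = 0) \<and> sum i S = s)"

lemma tsum_replace:
 assumes "tsum A i s" "R \<in> A" "finite E" "E \<inter> A = {}"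
 shows "tsum (A - {R} \<union> E) i (s - i R + sum i E)"
proof -
 obtain S where S: "finite S" "S \<subseteq> A" "\<forall>R\<in>A - S. i R = 0" "sum i S = s" using assms(1) unfolding tsum_def by blast
 have "sum i (S - {R}) = s - i R" using S assms(2) by (cases "R \<in> S") (auto simp: sum_diff1)
 moreover have "sum i (S - {R} \<union> E) = sum i (S - {R}) + sum i E" using S assms by (intro sum.union_disjoint) auto
 ultimately show ?thesis unfolding tsum_def using S assms(3) by (intro exI[of _ "S - {R} \<union> E"]) auto
qed

lemma tsum_sum: "tsum A i s ==> (\<Sum>R | R \<in> A \<and> i R \<noteq> 0. i R) = s"
 unfolding tsum_def by (auto intro!: sum.mono_neutral_left)

lemma sbs_Cons:
 "sbs (R # Ls) \<longleftrightarrow> R \<in> PP2 \<and> P.inf_near (R :: 'k::alg_closed_field hfrac set) Ls"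
proof -
 have "(\<forall>i. Suc i < length (R # Ls) --> (R # Ls) ! Suc i \<in> exc ((R # Ls) ! i)) \<longleftrightarrow> P.inf_near R Ls"
 proof (induction Ls arbitrary: R)
  case (Cons L Ls)
  show ?case unfolding P.inf_near.simps Cons[of L, symmetric] by (auto simp: less_Suc_eq_0_disj All_less_Suc2 nth_Cons split: nat.splits)
 qed simp
 thus ?thesis unfolding simple_blowup_sequence_def by simp
qed

lemma sbs_prefix: "sbs (As @ Bs) ==> As \<noteq> [] ==> sbs As"
 unfolding simple_blowup_sequence_def
proof (elim conjE, intro conjI allI impI)
 fix i assume *: "\<forall>i. Suc i < length (As @ Bs) --> (As @ Bs) ! Suc i \<in> exc ((As @ Bs) ! i)" and i: "Suc i < length As"
 show "As ! Suc i \<in> exc (As ! i)" using *[rule_format, of i] i by (simp add: nth_append)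
qed simp_all

lemma sbs_snoc:
 "Rs \<noteq> [] ==> sbs (Rs @ [L]) \<longleftrightarrow> sbs Rs \<and> L \<in> exc (last Rs)"
 unfolding simple_blowup_sequence_def
 by (auto simp: nth_append last_conv_nth less_Suc_eq) (metis diff_Suc_Suc diff_zero)

text \<open>The last ring dominates all earlier ones, so two sequences with the same end have the
  same point of the plane as beginning and then agree step by step.\<close>

lemma sbs_unique:
 fixes Rs Ss :: "'k::alg_closed_field hfrac set list"
 assumes "sbs Rs" "sbs Ss" "last Rs = last Ss"
 shows "Rs = Ss"
proof -
 obtain R Ls where R: "Rs = R # Ls" using assms(1) unfolding simple_blowup_sequence_def by (cases Rs) auto
 obtain M Ms where M: "Ss = M # Ms" using assms(2) unfolding simple_blowup_sequence_def by (cases Ss) auto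
 have i: "R \<in> PP2" "P.inf_near R Ls" "M \<in> PP2" "P.inf_near M Ms"
  using assms unfolding R M sbs_Cons by auto
 note r = reg_closed_point[OF i(1)] reg_closed_point[OF i(3)]
 note l = P.inf_near_last[OF r(1) i(2)] P.inf_near_last[OF r(2) i(4)]
 have e: "last (R # Ls) = last (M # Ms)" using assms(3) R M by simp
 have "\<O> (pt R) = \<O> (pt M)"
  by (rule local_ring_distinct[OF pt(1)[OF i(1)] pt(1)[OF i(3)], of "last (R # Ls)"])
   (use l e P.regD(2) pt(2)[OF i(1)] pt(2)[OF i(3)] in auto)
 hence "R = M" using pt(2)[OF i(1)] pt(2)[OF i(3)] by simp
 thus ?thesis using P.inf_near_unique[OF r(1) i(2), of Ms] i(4) e R M by simp
qed

lemma sbs_reg: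
 fixes Rs :: "'k::alg_closed_field hfrac set list"
 shows "sbs Rs ==> P.reg (last Rs)"
 using P.inf_near_last reg_closed_point sbs_Cons by (metis simple_blowup_sequence_def neq_Nil_conv)

text \<open>Closure under predecessors, which allows the points to be blown up in some
  order.\<close>

definition pclosed :: "'k::alg_closed_field hfrac set set => bool" where
 "pclosed A \<longleftrightarrow> (\<forall>R\<in>A. \<exists>Rs. sbs Rs \<and> last Rs = R \<and> set Rs \<subseteq> A)"

lemma blown_up_surface_empty: "blown_up_surface {} = (PP2 :: 'k::alg_closed_field hfrac set set)"
proof -
 have "sbs Rs \<and> set (butlast Rs) \<subseteq> {} \<and> last Rs \<notin> {} \<longleftrightarrow> (\<exists>R\<in>PP2. Rs = [R])" for Rs :: "'k hfrac set list"
 proof (cases Rs)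
  case (Cons R Ls)
  thus ?thesis by (cases Ls) (auto simp: sbs_Cons)
 qed (simp add: simple_blowup_sequence_def)
 thus ?thesis unfolding blown_up_surface_def by (auto intro!: exI[of _ "[_]"])
qed

text \<open>\<open>A\<close> is closed and does not contain \<open>R\<close>, so no point of
  \<open>A\<close> lies over \<open>R\<close>; a sequence that runs through \<open>R\<close>
  therefore stops one step later.\<close>

lemma blown_up_surface_insert:
 fixes A :: "'k::alg_closed_field hfrac set set"
 assumes A: "pclosed A" and R: "R \<in> blown_up_surface A"
 shows "blown_up_surface (insert R A) = blown_up_surface A - {R} \<union> exc R"
  "exc R \<inter> blown_up_surface A = {}"
proof -
 obtain Rs where Rs: "sbs Rs" "set (butlast Rs) \<subseteq> A" "last Rs \<notin> A" "R = last Rs"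
  using R unfolding blown_up_surface_def by blast
 have ne: "Rs \<noteq> []" using Rs(1) unfolding simple_blowup_sequence_def by blast
 note reg = sbs_reg[OF Rs(1), folded Rs(4)]
 have RA: "R \<notin> A" using Rs(3,4) by simp
 have e: "sbs (Rs @ [L])" if "L \<in> exc R" for L
  using that Rs(1,4) sbs_snoc[OF ne] by blast
 have RRs: "R \<in> set Rs" using ne Rs(4) by simp
 have eA: "L \<notin> A" if L: "L \<in> exc R" for L
 proof
  assume "L \<in> A"
  then obtain Ss where "sbs Ss" "last Ss = L" "set Ss \<subseteq> A" using A unfolding pclosed_def by blast
  hence "set (Rs @ [L]) \<subseteq> A" using sbs_unique[OF e[OF L], of Ss] by simp
  thus False using RA RRs by auto
 qed
 show "exc R \<inter> blown_up_surface A = {}"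
 proof (rule ccontr)
  assume "\<not> ?thesis"
  then obtain L Ss where L: "L \<in> exc R" "sbs Ss" "set (butlast Ss) \<subseteq> A" "last Ss = L"
   unfolding blown_up_surface_def by blast
  hence "Ss = Rs @ [L]" using sbs_unique[OF L(2) e[OF L(1)]] by simp
  thus False using L(3) RA RRs by auto
 qed
 show "blown_up_surface (insert R A) = blown_up_surface A - {R} \<union> exc R"
 proof (intro subset_antisym subsetI)
  fix X assume "X \<in> blown_up_surface (insert R A)"
  then obtain Ss where S: "sbs Ss" "set (butlast Ss) \<subseteq> insert R A" "last Ss \<notin> insert R A" "X = last Ss"
   unfolding blown_up_surface_def by blast
  have neS: "Ss \<noteq> []" using S(1) unfolding simple_blowup_sequence_def by blast
  show "X \<in> blown_up_surface A - {R} \<union> exc R"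
  proof (cases "R \<in> set (butlast Ss)")
   case False
   thus ?thesis using S unfolding blown_up_surface_def by blast
  next
   case True
   then obtain Us Vs where UV: "butlast Ss = Us @ R # Vs" by (meson split_list)
   hence Ss: "Ss = (Us @ [R]) @ Vs @ [X]" using S(4) neS by (metis append.assoc append_Cons append_Nil append_butlast_last_id)
   obtain Y Ws where Y: "Vs @ [X] = Y # Ws" by (cases Vs) auto
   have seq: "sbs ((Us @ [R]) @ [Y])" using sbs_prefix[of "(Us @ [R]) @ [Y]" Ws] S(1) Ss Y by simp
   hence YE: "Y \<in> exc R" using sbs_snoc[of "Us @ [R]" Y] by simp
   show ?thesis
   proof (cases Vs)
    case Nil thus ?thesis using Y YE by simp
   next
    case (Cons V Vs')
    hence "Y \<in> insert R A" using Y UV S(2) by auto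
    moreover have "Y \<noteq> R" using P.exceptional_psubset[OF reg YE] by blast
    ultimately show ?thesis using eA[OF YE] by blast
   qed
  qed
 next
  fix X assume X: "X \<in> blown_up_surface A - {R} \<union> exc R"
  show "X \<in> blown_up_surface (insert R A)"
  proof (cases "X \<in> exc R")
   case True
   have "X \<noteq> R" using P.exceptional_psubset[OF reg True] by blast
   moreover have "set Rs \<subseteq> insert R A" using Rs(2,4) ne by (metis Un_insert_right append_butlast_last_id insert_mono list.simps(15) set_append sup_bot_right list.set(1))
   ultimately have "sbs (Rs @ [X]) \<and> set (butlast (Rs @ [X])) \<subseteq> insert R A \<and> last (Rs @ [X]) \<notin> insert R A"
    using e[OF True] eA[OF True] by simp
   thus ?thesis unfolding blown_up_surface_def by (metis (mono_tags, lifting) last_snoc mem_Collect_eq)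
  next
   case False
   hence "X \<in> blown_up_surface A" "X \<noteq> R" using X by auto
   thus ?thesis unfolding blown_up_surface_def by blast
  qed
 qed
qed

text \<open>A center whose sequence has maximal length has no other center above it.\<close>

lemma pclosed_remove:
 fixes A :: "'k::alg_closed_field hfrac set set"
 assumes A: "pclosed A" "finite A" "A \<noteq> {}"
 obtains R where "R \<in> A" "pclosed (A - {R})" "R \<in> blown_up_surface (A - {R})"
proof -
 define sq where "sq R = (SOME Rs. sbs Rs \<and> last Rs = R \<and> set Rs \<subseteq> A)" for R
 have sq: "sbs (sq R)" "last (sq R) = R" "set (sq R) \<subseteq> A" if "R \<in> A" for R
  using someI_ex[of "\<lambda>Rs. sbs Rs \<and> last Rs = R \<and> set Rs \<subseteq> A"] A(1) that
  unfolding sq_def pclosed_def by auto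
 let ?f = "\<lambda>R. length (sq R)"
 have "Max (?f ` A) \<in> ?f ` A" using A(2,3) by simp
 then obtain R where R0: "R \<in> A" "Max (?f ` A) = ?f R" by blast
 have R: "R \<in> A" "length (sq Y) \<le> length (sq R)" if "Y \<in> A" for Y
  using R0 Max_ge[of "?f ` A" "?f Y"] A(2) that by auto
 note R = R0(1) R(2)
 have pre: "sq R = As @ [R]" if "sbs (As @ R # Bs)" for As Bs
  using sbs_unique[OF sq(1)[OF R(1)], of "As @ [R]"] sbs_prefix[of "As @ [R]" Bs] that sq(2)[OF R(1)] by simp
 have "pclosed (A - {R})" unfolding pclosed_def
 proof
  fix Y assume Y: "Y \<in> A - {R}"
  have "R \<notin> set (sq Y)"
  proof
   assume "R \<in> set (sq Y)"
   then obtain As Bs where AB: "sq Y = As @ R # Bs" by (meson split_list)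
   hence "sq R = As @ [R]" using pre sq(1) Y by (metis DiffD1)
   hence "Bs = []" using R(2)[of Y] Y AB by simp
   thus False using AB sq(2)[of Y] Y by simp
  qed
  thus "\<exists>Rs. sbs Rs \<and> last Rs = Y \<and> set Rs \<subseteq> A - {R}" using sq Y by blast
 qed
 moreover have "R \<in> blown_up_surface (A - {R})"
 proof -
  have ne: "sq R \<noteq> []" using sq(1)[OF R(1)] unfolding simple_blowup_sequence_def by blast
  have "R \<notin> set (butlast (sq R))"
  proof
   assume "R \<in> set (butlast (sq R))"
   then obtain As Bs where AB: "butlast (sq R) = As @ R # Bs" by (meson split_list)
   hence e: "sq R = As @ R # (Bs @ [R])" using sq(2)[OF R(1)] ne by (metis append.assoc append_Cons append_butlast_last_id)
   hence "sq R = As @ [R]" using pre[of As "Bs @ [R]"] sq(1)[OF R(1)] by simp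
   thus False using e by simp
  qed
  hence "set (butlast (sq R)) \<subseteq> A - {R}" using sq(3)[OF R(1)] in_set_butlastD[of _ "sq R"] by auto
  thus ?thesis unfolding blown_up_surface_def using sq(1,2)[OF R(1)] by (intro CollectI exI[of _ "sq R"]) simp
 qed
 ultimately show ?thesis using that R(1) by blast
qed

lemma generic_uniformizer:
 assumes C: "integral_plane_curve d C" and DC: "D = generic_ring (C :: 'k::alg_closed_field hpoly)"
 obtains l where "form d l" "\<not> C dvd l" "l \<noteq> 0" "Fract C l \<in> D" "Fract C l *o D = mx D"
proof -
 obtain l where l: "\<not> C dvd lin l" using exists_transversal_line[OF C DC] by blast
 have n: "\<not> C dvd lin l ^ d" using not_dvd_power[OF C DC l] .
 have hl: "form d (lin l ^ d)" using homogeneous_power[OF homogeneous_lin, of d] by simp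
 note r = ring_set_generic[OF C DC] and g = generic_max_iff[OF C DC] and dom = local_dom_generic[OF C DC]
 have l0: "lin l ^ d \<noteq> 0" using n by (metis dvd_0_right)
 let ?c = "Fract C (lin l ^ d)"
 have c: "?c \<in> D" "?c \<in> mx D"
  using genericI[OF C DC curve_hom[OF C DC] hl n] g[OF curve_hom[OF C DC] hl n] by auto
 have "a \<in> ?c *o D" if a: "a \<in> mx D" for a
 proof -
  have aD: "a \<in> D" using a P.local_domD(3)[OF dom] by blast
  obtain N B m where 1: "a = Fract N B" "form m N" "form m B" "\<not> C dvd B" "B \<noteq> 0"
   using genericE[OF C DC aD] .
  have "C dvd N" using g[OF 1(2-4)] a 1(1) by blast
  then obtain A where A: "N = C * A" by (rule dvdE)
  show ?thesis
  proof (cases "N = 0")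
   case True
   hence "a = 0" using 1 by (simp add: Zero_fract_def eq_fract)
   hence "a = ?c * 0" by simp
   thus ?thesis using smulI[OF ring_setD(1)[OF r]] by metis
  next
   case False
   obtain x k where xk: "form x C" "form k A" "x + k = m"
    using homogeneous_factor[of m C A] 1(2) False unfolding A by blast
   have "x = d" using homogeneous_degree_unique[OF xk(1) curve_hom[OF C DC] curve_nz[OF C DC]] .
   hence "Fract (lin l ^ d * A) B \<in> D" using genericI[OF C DC homogeneous_mult[OF hl xk(2)] _ 1(4)] 1(3) xk(3) by simp
   moreover have "a = ?c * Fract (lin l ^ d * A) B" unfolding 1(1) A using 1(5) l0 by (simp add: eq_fract)
   ultimately show ?thesis using smulI by metis
  qed
 qed
 hence "?c *o D = mx D"
  using submodD(4)[OF P.local_domD(2)[OF dom] _ c(2)] by (auto elim!: smulE simp: mult.commute)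
 thus ?thesis using that hl n l0 c(1) by blast
qed

context
 fixes C :: "'k::alg_closed_field hpoly" and d :: nat and D \<phi>
 assumes C: "integral_plane_curve d C" and DC: "D = generic_ring C"
  and \<phi>: "\<phi> \<in> D" "\<phi> *o D = mx D"
begin

text \<open>\<phi> is C / l times a unit A / W of \<open>D\<close>, so at each point it is presented
  with b = A and c = l W. By Bezout's theorem the total is d (d + a) - d a.\<close>

lemma self_intersection_plane:
 "tsum {R \<in> PP2. R \<subseteq> D} (P.iv D \<phi>) (int (d^2))"
 "R \<in> PP2 ==> R \<subseteq> D ==> \<exists>f b c. P.rep D \<phi> R f b c"
proof -
 obtain l where l: "form d l" "\<not> C dvd l" "l \<noteq> 0" "Fract C l *o D = mx D"
  using generic_uniformizer[OF C DC] by metis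
 have one: "1 \<in> D" using ring_setD(2)[OF ring_set_generic[OF C DC]] .
 have \<phi>c: "\<phi> \<in> Fract C l *o D" and c\<phi>: "Fract C l \<in> \<phi> *o D"
  using smulI[OF one, of \<phi>] smulI[OF one, of "Fract C l"] l(4) \<phi>(2) by auto
 obtain u where u: "u \<in> D" "\<phi> = Fract C l * u" using \<phi>c by (rule smulE)
 obtain v where v: "v \<in> D" "Fract C l = \<phi> * v" using c\<phi> by (rule smulE)
 have "Fract C l \<noteq> 0" using l(3) curve_nz[OF C DC] by (simp add: Zero_fract_def eq_fract)
 moreover have "Fract C l * (u * v) = Fract C l * 1" unfolding mult.assoc[symmetric] u(2)[symmetric] v(2)[symmetric] by simp
 ultimately have "u * v = 1" using mult_left_cancel by blast
 hence "u \<noteq> 0" "inverse u = v" by (auto intro: inverse_unique)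
 hence uD: "u \<notin> mx D" using v(1) by (simp add: max_ideal_iff)
 obtain A W a where A: "u = Fract A W" "form a A" "form a W" "\<not> C dvd W" "W \<noteq> 0"
  using genericE[OF C DC u(1)] .
 have nA: "\<not> C dvd A" using generic_max_iff[OF C DC A(2-4)] uD A(1) by simp
 define B m where "B = l * W" and m: "m = d + a"
 have B: "form m B" "\<not> C dvd B" "B \<noteq> 0"
  unfolding B_def m using homogeneous_mult[OF l(1) A(3)] not_dvd_mult[OF C DC l(2) A(4)] l(3) A(5) by auto
 have rep: "P.rep D \<phi> R (gm R d C) (gm R a A) (gm R m B)" if R: "R \<in> PP2" "R \<subseteq> D" for R
  unfolding P.rep_def
 proof (intro conjI good_closed_point[OF C DC R] curve_at_gm[OF C DC R] gm_in[OF R(1)] curve_hom[OF C DC] A B)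
  show "gm R a A \<notin> mx D" "gm R m B \<notin> mx D"
   using gm_generic_iff[OF C DC R] A(2) nA B(1,2) by auto
  show "\<phi> = gm R d C * gm R a A / gm R m B"
   unfolding gm_mult[OF R(1), symmetric] m u(2) A(1) B_def germ_def using l(3) A(5) lform(3)[OF pt(1)[OF R(1)]]
   by (simp add: eq_fract divide_fract power_add)
 qed
 thus "R \<in> PP2 ==> R \<subseteq> D ==> \<exists>f b c. P.rep D \<phi> R f b c" by blast
 let ?A = "{R \<in> PP2. R \<subseteq> D}"
 note t = total_cnum[OF C DC B(1,2)] total_cnum[OF C DC A(2) nA]
 obtain S where S: "finite S" "S \<subseteq> ?A" "\<forall>R\<in>?A. R \<notin> S --> P.cnum D R (gm R m B) = 0" using total_support[OF t(1)] by blast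
 obtain T where T: "finite T" "T \<subseteq> ?A" "\<forall>R\<in>?A. R \<notin> T --> P.cnum D R (gm R a A) = 0" using total_support[OF t(2)] by blast
 have U: "finite (S \<union> T)" "S \<union> T \<subseteq> ?A" using S T by auto
 have "(\<Sum>R\<in>S \<union> T. P.cnum D R (gm R m B)) = enat (d * m)" "(\<Sum>R\<in>S \<union> T. P.cnum D R (gm R a A)) = enat (d * a)"
  using total_iff[OF U] t S(3) T(3) by (metis (no_types, lifting) Un_iff)+
 note s = sum_the_enat[OF U(1) this(1)] sum_the_enat[OF U(1) this(2)]
 have iv: "P.iv D \<phi> R = int (the_enat (P.cnum D R (gm R m B))) - int (the_enat (P.cnum D R (gm R a A)))" if "R \<in> ?A" for R
  using P.iv_eq[OF rep] that by simp
 have "sum (P.iv D \<phi>) (S \<union> T) = (\<Sum>R\<in>S \<union> T. int (the_enat (P.cnum D R (gm R m B))) - int (the_enat (P.cnum D R (gm R a A))))"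
  using iv U(2) by (intro sum.cong) auto
 also have "\<dots> = int (d^2)" unfolding sum_subtractf s by (simp add: m algebra_simps power2_eq_square)
 finally show "tsum ?A (P.iv D \<phi>) (int (d^2))"
  unfolding tsum_def using U iv S(3) T(3) by (intro exI[of _ "S \<union> T"]) (auto simp: zero_enat_def)
qed

text \<open>The second half of the claim, a presentation of \<phi> at every point of the curve, is
  what makes the next blowup computable.\<close>

lemma self_intersection_surface:
 assumes "finite A" "pclosed A"
 shows "tsum {R \<in> blown_up_surface A. R \<subseteq> D} (P.iv D \<phi>) (int (d^2) - (\<Sum>R\<in>A. int ((P.mult_at D R)^2)))
  \<and> (\<forall>R\<in>blown_up_surface A. R \<subseteq> D --> (\<exists>f b c. P.rep D \<phi> R f b c))"
 using assms
proof (induction "card A" arbitrary: A)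
 case 0
 hence "A = {}" by simp
 thus ?case using self_intersection_plane by (simp add: blown_up_surface_empty)
next
 case (Suc n)
 hence "A \<noteq> {}" by auto
 then obtain R where R: "R \<in> A" "pclosed (A - {R})" "R \<in> blown_up_surface (A - {R})"
  using pclosed_remove[OF Suc.prems(2,1)] by blast
 let ?B = "A - {R}" and ?X = "blown_up_surface (A - {R})"
 have IH: "tsum {R \<in> ?X. R \<subseteq> D} (P.iv D \<phi>) (int (d^2) - (\<Sum>R\<in>?B. int ((P.mult_at D R)^2)))"
  "\<forall>R\<in>?X. R \<subseteq> D --> (\<exists>f b c. P.rep D \<phi> R f b c)"
  using Suc.hyps(1)[of ?B] Suc.hyps(2) Suc.prems R by auto
 have insert: "insert R ?B = A" using R(1) by blast
 note bus = blown_up_surface_insert[OF R(2,3), unfolded insert]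
 have sum: "(\<Sum>R\<in>A. int ((P.mult_at D R)^2)) = int ((P.mult_at D R)^2) + (\<Sum>R\<in>?B. int ((P.mult_at D R)^2))"
  using R(1) Suc.prems(1) by (rule sum.remove[rotated])
 have set: "{R \<in> blown_up_surface A. R \<subseteq> D} = {R \<in> ?X. R \<subseteq> D} - {R} \<union> P.exc_on D R"
  unfolding bus(1) P.exc_on_def by blast
 show ?case
 proof (cases "R \<subseteq> D")
  case True
  then obtain f b c where rep: "P.rep D \<phi> R f b c" using IH(2) R(3) by blast
  note b = P.iv_blowup[OF rep]
  have "tsum ({R \<in> ?X. R \<subseteq> D} - {R} \<union> P.exc_on D R) (P.iv D \<phi>)
    ((int (d^2) - (\<Sum>R\<in>?B. int ((P.mult_at D R)^2))) - P.iv D \<phi> R + sum (P.iv D \<phi>) (P.exc_on D R))"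
   by (rule tsum_replace[OF IH(1)]) (use True R(3) b(1) bus(2) in \<open>auto simp: P.exc_on_def\<close>)
  hence "tsum {R \<in> blown_up_surface A. R \<subseteq> D} (P.iv D \<phi>) (int (d^2) - (\<Sum>R\<in>A. int ((P.mult_at D R)^2)))"
   unfolding set b(3) sum by (simp add: algebra_simps)
  moreover have "\<exists>f b c. P.rep D \<phi> Y f b c" if "Y \<in> blown_up_surface A" "Y \<subseteq> D" for Y
  proof -
   have "Y \<in> {R \<in> ?X. R \<subseteq> D} - {R} \<union> P.exc_on D R" using that unfolding set[symmetric] by blast
   thus ?thesis using IH(2) b(2)[of Y] by blast
  qed
  ultimately show ?thesis by blast
 next
  case False
  have reg: "P.reg R" using R(3) sbs_reg unfolding blown_up_surface_def by blast
  have "P.exc_on D R = {}" unfolding P.exc_on_def using P.exceptional_not_subset[OF reg _ False] by blast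
  hence eq: "{R \<in> blown_up_surface A. R \<subseteq> D} = {R \<in> ?X. R \<subseteq> D}" unfolding set using False by blast
  have "P.mult_at D R = 0" unfolding P.mult_at_def using False by simp
  thus ?thesis using IH eq unfolding sum by auto
 qed
qed

end

theorem self_intersection_eq:
 fixes C :: "'k::alg_closed_field hpoly"
 assumes C: "integral_plane_curve d C" and A: "finite A" "pclosed A"
 shows "self_intersection (blown_up_surface A) (generic_ring C)
   = int (d^2) - (\<Sum>R\<in>A. int ((P.mult_at (generic_ring C) R)^2))"
proof -
 let ?D = "generic_ring C"
 let ?\<phi> = "SOME \<phi>. \<phi> \<in> ?D \<and> PIdl\<^bsub>ring_on ?D\<^esub> \<phi> = mx ?D"
 have "\<exists>\<phi>. \<phi> \<in> ?D \<and> PIdl\<^bsub>ring_on ?D\<^esub> \<phi> = mx ?D"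
  unfolding cgenideal_ring_on using generic_uniformizer[OF C refl] by metis
 hence "?\<phi> \<in> ?D \<and> PIdl\<^bsub>ring_on ?D\<^esub> ?\<phi> = mx ?D" by (rule someI_ex)
 hence \<phi>: "?\<phi> \<in> ?D" "?\<phi> *o ?D = mx ?D" unfolding cgenideal_ring_on by auto
 have "self_intersection (blown_up_surface A) ?D =
   (\<Sum>R | R \<in> {R \<in> blown_up_surface A. R \<subseteq> ?D} \<and> P.iv ?D ?\<phi> R \<noteq> 0. P.iv ?D ?\<phi> R)"
  unfolding self_intersection_def Let_def P.iv_def by (simp add: conj_assoc)
 also have "\<dots> = int (d^2) - (\<Sum>R\<in>A. int ((P.mult_at ?D R)^2))"
  using tsum_sum self_intersection_surface[OF C refl \<phi> A] by blast
 finally show ?thesis .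
qed

section \<open>The bound\<close>

lemma sum_set_le_sum_list: "(\<Sum>x\<in>set xs. f x) \<le> (\<Sum>x\<leftarrow>xs. f x :: nat)"
 by (induction xs) (auto simp: insert_absorb sum.insert_if)

text \<open>Centers shared by several valuations are counted once on the left and repeatedly on the
  right, so on the surface they only help the bound.\<close>

lemma sum_UN_le:
 "finite V ==> (\<And>v. v \<in> V ==> finite (A v)) ==> (\<Sum>x\<in>(\<Union>v\<in>V. A v). f x) \<le> (\<Sum>v\<in>V. \<Sum>x\<in>A v. f x :: nat)"
proof (induction V rule: finite_induct)
 case (insert v V)
 have "(\<Sum>x\<in>A v \<union> (\<Union>v\<in>V. A v). f x) \<le> (\<Sum>x\<in>A v. f x) + (\<Sum>x\<in>(\<Union>v\<in>V. A v). f x)"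
  using insert by (subst sum_Un_nat) auto
 thus ?case using insert by simp
qed simp

lemma gm_scalar: "gm R d (hconst c * F) = KP c * gm R d F"
 unfolding germ_def by simp

text \<open>Two lines meeting in the point give parameters, and the germ is a combination of them
  with constant coefficients, not both zero; so it is itself part of a parameter pair.\<close>

lemma line_germ:
 fixes R :: "'k::alg_closed_field hfrac set"
 assumes R: "R \<in> PP2" and a: "a \<noteq> (0, 0, 0)" "heval (lin a) (pt R) = 0"
 shows "gm R (Suc 0) (lin a) \<notin> mpow R 2"
proof -
 let ?h = "gm R (Suc 0) (lin a)"
 obtain u v where uv: "cross u v = pt R" using cross_exists[OF pt(1)[OF R]] .
 have nz: "cross u v \<noteq> (0, 0, 0)" using uv pt(1)[OF R] by simp
 have p: "P.params R (gm R (Suc 0) (lin u)) (gm R (Suc 0) (lin v))"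
  using gm_params[OF R nz] heval_lin_cross[where a = u and b = v] uv by simp
 obtain A B where AB: "lin a = lin u * A + lin v * B" "form (Suc 0 - 1) A" "form (Suc 0 - 1) B"
  using form_vanishing[OF homogeneous_lin _ nz] a(2) uv by metis
 obtain c e where ce: "A = hconst c" "B = hconst e" using homogeneous_0_const AB(2,3) by fastforce
 have h: "?h = KP c * gm R (Suc 0) (lin u) + KP e * gm R (Suc 0) (lin v)"
  unfolding gm_scalar[symmetric] gm_add[OF R, symmetric] AB(1) ce by (simp add: mult.commute)
 have 0: "0 \<in> mpow R 2" using submodD(1)[OF P.submod_mpow(1)[OF loc_closed[OF R]]] .
 have reg: "P.reg R" using reg_closed_point[OF R] .
 show ?thesis
 proof (cases "e = 0")
  case True
  have "lin a \<noteq> 0" using a(1) lin_eq_0_iff[of a] by simp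
  hence "c \<noteq> 0" using True ce AB(1) by auto
  hence "P.params R ?h (gm R (Suc 0) (lin v))"
   using P.params_extend_aux[OF reg P.params_commute[OF p], of ?h e c] 0 h by (simp add: algebra_simps)
  thus ?thesis using P.params_nonzero(3)[OF reg] by blast
 next
  case False
  hence "P.params R ?h (gm R (Suc 0) (lin u))"
   using P.params_extend_aux[OF reg p, of ?h c e] 0 h by (simp add: algebra_simps)
  thus ?thesis using P.params_nonzero(3)[OF reg] by blast
 qed
qed

context
 fixes \<nu> :: "'k::alg_closed_field hfrac => int" and R S :: "'k hfrac set" and Ls
 assumes dv: "divisorial_valuation \<nu>" and seq: "blowup_sequence \<nu> = R # Ls" and S: "S = last (R # Ls)"
begin

lemma valuation_sequence: "sbs (R # Ls)" "\<nu> = dvr_ord (ering S)"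
 using dv someI_ex[of "\<lambda>Rs. sbs Rs \<and> \<nu> = dvr_ord (ering (last Rs))"] seq
 unfolding divisorial_valuation_def blowup_sequence_def[symmetric] S by auto

lemma center_point: "R \<in> PP2" "P.inf_near R Ls"
 using valuation_sequence(1) unfolding sbs_Cons by auto

lemmas center_reg = reg_closed_point[OF center_point(1)]

lemma last_reg: "P.reg S" "P.dominates S R" "R \<subseteq> S"
 using P.inf_near_last[OF center_reg center_point(2)] unfolding S P.dominates_def by auto

lemma valuation_eq_mord: "a \<in> S ==> a \<noteq> 0 ==> \<nu> a = int (P.mord S a)"
 unfolding valuation_sequence(2) by (rule P.dvr_ord_eq_mord[OF last_reg(1)])

lemma center_ring_eq: "center_ring \<nu> = R"
 unfolding center_ring_def seq by simp

lemma beta0_eq: "\<beta>0 \<nu> = int (P.vmin S R)"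
proof -
 have ex: "P.vmin S R \<in> P.mord S ` (mx R - {0})"
 proof -
  obtain x y where p: "P.params R x y" using P.regD(3)[OF center_reg] by blast
  have "P.mord S x \<in> P.mord S ` (mx R - {0})"
   using P.paramsD(4)[OF p] P.params_nonzero(1)[OF center_reg p] by blast
  thus ?thesis unfolding P.vmin_def by (rule LeastI)
 qed
 have val: "\<nu> a = int (P.mord S a)" if "a \<in> mx R - {0}" for a
  using that valuation_eq_mord last_reg(3) P.loc_ringD(5)[OF P.regD(1)[OF center_reg]] by blast
 show ?thesis unfolding \<beta>0_def center_ring_eq
 proof (rule Least_equality)
  show "int (P.vmin S R) \<in> \<nu> ` (mx R - {0})" using ex val by (auto simp: image_iff)
  fix v assume "v \<in> \<nu> ` (mx R - {0})"
  then obtain a where "a \<in> mx R - {0}" "v = int (P.mord S a)" using val by auto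
  thus "int (P.vmin S R) \<le> v" unfolding P.vmin_def by (auto intro: Least_le)
 qed
qed

lemma vmin_ge_1: "1 \<le> P.vmin S R"
 by (rule P.vmin_pos[OF center_reg center_point(2) S])

text \<open>The subspaces of prescribed multiplicity show that the volume is at most 1 / \<Lambda>.
  Taking inverses requires a positive volume, which the linear bound on values supplies.\<close>

lemma inverse_vol_ge: "real (\<Sum>M\<leftarrow>R # Ls. (P.vmin S M)^2) \<le> inverse (vol \<nu>)"
proof -
 define \<Lambda> where "\<Lambda> = (\<Sum>M\<leftarrow>R # Ls. (P.vmin S M)^2)"
 define V where "V = (\<Sum>M\<leftarrow>R # Ls. P.vmin S M)"
 have "1 \<le> (P.vmin S R)^2" using vmin_ge_1 by (rule one_le_power)
 hence pos: "1 \<le> \<Lambda>" "1 \<le> V"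
  using vmin_ge_1 unfolding \<Lambda>_def V_def list.map sum_list.Cons by linarith+
 have lr: "P.loc_ring R" using P.regD(1)[OF center_reg] .
 have val: "\<nu> x = int (P.mord S x)" if "x \<in> R" "x \<noteq> 0" for x using valuation_eq_mord last_reg(3) that by blast
 have "valuation_ideal \<nu> m = P.vset S R m" for m
  unfolding valuation_ideal_def P.vset_def center_ring_eq by (auto simp: val) (metis of_nat_le_iff val)+
 hence col: "colength (center_ring \<nu>) (valuation_ideal \<nu> m) = P.dim R (P.vset S R m)" for m
  using P.colength_eq_dim[OF lr P.submod_vset[OF last_reg(1) lr last_reg(3)], of m] center_ring_eq unfolding P.vset_def by auto
 have "\<exists>n. P.dim R (P.vset S R m) = enat n \<and> 2 * n \<le> (m div \<Lambda> + 1)^2 * \<Lambda> + (m div \<Lambda> + 1) * V \<and> (m div V)^2 \<le> 2 * n" for m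
  using P.vset_dim_bounds[OF center_reg center_point(2) S \<Lambda>_def V_def, of m] by metis
 then obtain n where n: "\<And>m. P.dim R (P.vset S R m) = enat (n m)"
  "\<And>m. 2 * n m \<le> (m div \<Lambda> + 1)^2 * \<Lambda> + (m div \<Lambda> + 1) * V" "\<And>m. (m div V)^2 \<le> 2 * n m" by metis
 have "0 < vol \<nu>" "vol \<nu> \<le> 1 / real \<Lambda>"
  using limsup_quadratic_bounds[OF n(2,3) pos] unfolding vol_def col n(1) by auto
 hence "inverse (1 / real \<Lambda>) \<le> inverse (vol \<nu>)" by (rule le_imp_inverse_le[rotated])
 thus ?thesis unfolding \<Lambda>_def[symmetric] using pos by simp
qed

text \<open>Through the center every local equation is a unit times the germ, and units have value
  0; off the center the local equation is itself a unit.\<close>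

lemma curve_value_line:
 assumes a: "a \<noteq> (0, 0, 0)"
 shows "curve_value \<nu> (lin a) = (if heval (lin a) (pt R) = 0 then int (P.mord S (gm R (Suc 0) (lin a))) else 0)"
proof -
 let ?E = "generic_ring (lin a)" and ?h = "gm R (Suc 0) (lin a)"
 have E: "integral_plane_curve (Suc 0) (lin a)" unfolding integral_plane_curve_def using irreducible_lin[OF a] by simp
 note lr = P.regD(1,2)[OF center_reg]
 have unit: "\<nu> w = 0" if "w \<in> R" "w \<notin> mx R" for w
 proof -
  have "w \<noteq> 0" using that(2) submodD(1)[OF P.loc_ringD(4)[OF lr(1)]] by blast
  thus ?thesis using P.mord_dominates[OF last_reg(1) lr(1) last_reg(2) that(1)] valuation_eq_mord[of w] last_reg(3) that by auto
 qed
 have iff: "R \<subseteq> ?E \<longleftrightarrow> heval (lin a) (pt R) = 0"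
  using local_ring_subset_iff[OF E refl pt(1)[OF center_point(1)]] pt(2)[OF center_point(1)] by simp
 show ?thesis
 proof (cases "heval (lin a) (pt R) = 0")
  case True
  hence RE: "R \<subseteq> ?E" using iff by simp
  obtain w where w: "w \<in> R" "w \<notin> mx R" "local_equation ?E R = ?h * w"
   using P.local_equation[OF good_closed_point[OF E refl center_point(1) RE] curve_at_gm[OF E refl center_point(1) RE]] by blast
  have "lin a \<noteq> 0" using a lin_eq_0_iff[of a] by simp
  hence h: "?h \<in> S" "?h \<noteq> 0" using gm_in[OF center_point(1) homogeneous_lin] gm_eq_0_iff[OF center_point(1)] last_reg(3) by blast+
  have w': "w \<in> S" "w \<noteq> 0" using w last_reg(3) submodD(1)[OF P.loc_ringD(4)[OF lr(1)]] by auto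
  have "\<nu> (?h * w) = int (P.mord S ?h)"
   using valuation_eq_mord[of "?h * w"] P.mord_mult[OF last_reg(1) h w'] unit[OF w(1,2)] valuation_eq_mord[OF w']
    ring_setD(5)[OF P.regD(2)[OF last_reg(1)] h(1) w'(1)] h(2) w'(2) by simp
  thus ?thesis unfolding curve_value_def center_ring_eq w(3) using True by simp
 next
  case False
  have ci: "curve_ideal ?E R = R" using iff False unfolding curve_ideal_def by simp
  let ?u = "local_equation ?E R"
  have "1 \<in> R \<and> PIdl\<^bsub>ring_on R\<^esub> 1 = curve_ideal ?E R"
   using ring_setD(2)[OF lr(2)] unfolding ci cgenideal_ring_on smul_def by simp
  hence "?u \<in> R \<and> PIdl\<^bsub>ring_on R\<^esub> ?u = curve_ideal ?E R" unfolding local_equation_def by (rule someI)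
  hence u: "?u \<in> R" "?u *o R = R" unfolding ci cgenideal_ring_on by auto
  then obtain v where v: "v \<in> R" "1 = ?u * v" using ring_setD(2)[OF lr(2)] by (metis smulE)
  hence "inverse ?u = v" "?u \<noteq> 0" by (auto intro: inverse_unique)
  hence "?u \<notin> mx R" using max_ideal_iff v(1) by blast
  thus ?thesis unfolding curve_value_def center_ring_eq using unit u(1) False by simp
 qed
qed

text \<open>At the second center the quotients of two coordinate germs x, y by \<open>z\<close> have
  residues c and e. The combination e x - c y has residue 0 there, so its value exceeds that of
  \<open>z\<close>, the minimal one.\<close>

lemma tangent_line_exists:
 assumes "Ls \<noteq> []" shows "\<exists>H. tangent_line \<nu> H"
proof -
 obtain L Ms where Ls: "Ls = L # Ms" using assms by (cases Ls) auto
 note Rp = center_point(1) and reg = center_reg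
 have L: "L \<in> exc R" "P.inf_near L Ms" using center_point(2) Ls by auto
 obtain z w where zw: "P.params R z w" "L = P.blow R z w" using P.exceptional_pointsE[OF reg L(1)] .
 have dom: "P.dominates S L" using P.inf_near_last[OF P.reg_exceptional[OF reg L(1)] L(2)] S Ls by simp
 note vb = P.vmin_blow[OF reg zw(1) last_reg(1) dom[unfolded zw(2)]]
 have LL: "P.loc_ring L" using P.regD(1)[OF P.reg_exceptional[OF reg L(1)]] .
 note mL = P.loc_ringD(4)[OF LL]
 obtain u v where uv: "cross u v = pt R" using cross_exists[OF pt(1)[OF Rp]] .
 have nz: "cross u v \<noteq> (0, 0, 0)" using uv pt(1)[OF Rp] by simp
 let ?x = "gm R (Suc 0) (lin u)" and ?y = "gm R (Suc 0) (lin v)"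
 have p: "P.params R ?x ?y" using gm_params[OF Rp nz] heval_lin_cross[where a = u and b = v] uv by simp
 have dv: "r / z \<in> L" if "r \<in> mx R" for r using P.blow_divide[OF reg zw(1) that] zw(2) by blast
 obtain c where c: "?x / z - KP c \<in> mx L" using P.loc_ringD(6)[OF LL dv[OF P.paramsD(4)[OF p]]] by blast
 obtain e where e: "?y / z - KP e \<in> mx L" using P.loc_ringD(6)[OF LL dv[OF P.paramsD(5)[OF p]]] by blast
 have main: "tangent_line \<nu> F" if F: "F = hconst s * lin u - hconst t * lin v" "s \<noteq> 0 \<or> t \<noteq> 0" "s * c = t * e" for F s t
 proof -
  have hF: "form (Suc 0) F" unfolding F(1) by (intro homogeneous_diff homogeneous_scalar homogeneous_lin)
  have "F \<noteq> 0"
  proof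
   assume "F = 0"
   hence eq: "lin u * hconst s = hconst t * lin v" unfolding F(1) by (simp only: right_minus_eq mult.commute)
   have "t = 0"
   proof (rule ccontr)
    assume "t \<noteq> 0"
    hence "lin v = hconst (inverse t) * (hconst t * lin v)" by simp
    hence "lin v = lin u * (hconst s * hconst (inverse t))" unfolding eq[symmetric] by (simp only: mult_ac)
    hence "lin u dvd lin v" by (rule dvdI)
    thus False using lin_not_dvd(1)[OF nz] by blast
   qed
   thus False using eq F(2) lin_not_dvd(2)[OF nz] lin_eq_0_iff[of u] by auto
  qed
  obtain a where a: "F = lin a" using homogeneous_1_lin[OF hF] by blast
  have a0: "a \<noteq> (0, 0, 0)" using \<open>F \<noteq> 0\<close> lin_eq_0_iff[of a] a by blast
  let ?h = "gm R (Suc 0) F"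
  have van: "heval F (pt R) = 0" unfolding F(1) heval_simps uv[symmetric] heval_lin_cross by simp
  have h: "?h = KP s * ?x - KP t * ?y"
   using gm_add[OF Rp, of "Suc 0" F "hconst t * lin v"] unfolding F(1) gm_scalar by (simp add: gm_scalar[symmetric])
  have hm: "?h \<in> mx R" "?h \<noteq> 0" using gm_max_iff[OF Rp hF] van gm_eq_0_iff[OF Rp] \<open>F \<noteq> 0\<close> by auto
  have "KP s * KP c = KP t * KP e" using F(3) P.K_mult by metis
  hence "?h / z = KP s * (?x / z - KP c) - KP t * (?y / z - KP e)"
   unfolding h diff_divide_distrib right_diff_distrib by simp
  hence "?h / z \<in> mx L"
   using submod_diff[OF mL P.loc_ringD(1)[OF LL]] submodD(3)[OF mL P.loc_ringD(2)[OF LL]] c e by metis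
  hence "P.mord S (?h / z) \<noteq> 0"
   using P.mord_dominates[OF last_reg(1) LL dom dv[OF hm(1)]] hm(2) P.zw1[OF reg zw(1)] by auto
  hence "P.vmin S R < P.mord S ?h" using vb(1) vb(2)[of ?h] hm by simp
  hence "curve_value \<nu> F > \<beta>0 \<nu>" unfolding beta0_eq a using curve_value_line[OF a0] van a by simp
  thus ?thesis unfolding tangent_line_def m_adic_def seq Ls using hF \<open>F \<noteq> 0\<close> by simp
 qed
 show ?thesis
 proof (cases "c = 0 \<and> e = 0")
  case True
  thus ?thesis using main[of _ 1 0] by auto
 next
  case False
  thus ?thesis using main[of _ e c] by (auto simp: mult.commute)
 qed
qed

context
 fixes C :: "'k hpoly" and d :: nat and D
 assumes C: "integral_plane_curve d C" and DC: "D = generic_ring C" and notan: "\<not> tangent_line \<nu> C"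
begin

text \<open>A line through the center of which the curve is not a component has intersection number
  at least the multiplicity there and at most d. This settles the m-adic case, where 2 + \<delta>0 =
  1.\<close>

lemma mult_le_degree: "P.mult_at D R \<le> d"
proof (cases "R \<subseteq> D")
 case True
 obtain u v where uv: "cross u v = pt R" using cross_exists[OF pt(1)[OF center_point(1)]] .
 have nz: "cross u v \<noteq> (0, 0, 0)" using uv pt(1)[OF center_point(1)] by simp
 obtain a where a: "heval (lin a) (pt R) = 0" "\<not> C dvd lin a"
  using transversal_line[OF C DC nz] heval_lin_cross[where a = u and b = v, unfolded uv] by blast
 let ?h = "gm R (Suc 0) (lin a)"
 have "?h \<in> mx R" "?h \<notin> mx D"
  using gm_max_iff[OF center_point(1) homogeneous_lin] gm_generic_iff[OF C DC center_point(1) True homogeneous_lin] a by auto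
 hence "enat (P.mult_at D R) \<le> P.cnum D R ?h"
  by (rule P.cnum_ge_mult(1)[OF good_closed_point[OF C DC center_point(1) True]])
 also have "\<dots> \<le> enat (d * Suc 0)" using total_le[OF total_cnum[OF C DC homogeneous_lin a(2)]] center_point(1) True by simp
 finally show ?thesis by simp
qed (simp add: P.mult_at_def)

lemma sum_multiplicities_le: "int (\<Sum>M\<in>centers \<nu>. (P.mult_at D M)^2) \<le> (2 + \<delta>0 \<nu>) * int (d^2)"
proof (cases Ls)
 case Nil
 hence "m_adic \<nu>" "centers \<nu> = {R}" unfolding m_adic_def centers_def seq by auto
 thus ?thesis unfolding \<delta>0_def using mult_le_degree power_mono[of "P.mult_at D R" d 2] by simp
next
 case (Cons L Ms)
 have nm: "\<not> m_adic \<nu>" unfolding m_adic_def seq Cons by simp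
 define H where "H = (SOME H. tangent_line \<nu> H)"
 have tH: "tangent_line \<nu> H" unfolding H_def by (rule someI_ex[OF tangent_line_exists]) (simp add: Cons)
 hence H: "form (Suc 0) H" "H \<noteq> 0" "curve_value \<nu> H > \<beta>0 \<nu>" unfolding tangent_line_def by auto
 obtain a where a: "H = lin a" using homogeneous_1_lin[OF H(1)] by blast
 have a0: "a \<noteq> (0, 0, 0)" using H(2) lin_eq_0_iff[of a] a by blast
 define h where "h = gm R (Suc 0) H"
 have van: "heval H (pt R) = 0" and t: "curve_value \<nu> H = int (P.mord S h)"
  using curve_value_line[OF a0] H(3) beta0_eq a unfolding h_def by (auto split: if_splits)
 define q where "q = (inverse (vol \<nu>) - 2 * real_of_int (\<beta>0 \<nu>) * real (P.mord S h)) / (real (P.mord S h))^2"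
 have \<delta>: "\<delta>0 \<nu> = ceiling_plus q"
  unfolding \<delta>0_def tangent_value_def q_def using nm t unfolding H_def by simp
 \<comment> \<open>By the cut-off at 0 the rounded number is a natural number and still at least
   \<open>q\<close>, as required of a coefficient of the quadratic form.\<close>
 have \<delta>0: "\<delta>0 \<nu> \<ge> 0" "q \<le> real_of_int (\<delta>0 \<nu>)" unfolding \<delta> ceiling_plus_def by auto
 define \<delta> where "\<delta> = nat (\<delta>0 \<nu>)"
 have gt: "P.vmin S R < P.mord S h" using H(3) unfolding t beta0_eq by simp
 have "inverse (vol \<nu>) = q * (real (P.mord S h))^2 + 2 * real (P.vmin S R) * real (P.mord S h)"
  unfolding q_def beta0_eq using gt by simp
 also have "\<dots> \<le> real \<delta> * (real (P.mord S h))^2 + 2 * real (P.vmin S R) * real (P.mord S h)"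
  using \<delta>0 unfolding \<delta>_def by (intro add_right_mono mult_right_mono) auto
 finally have "real (\<Sum>M\<leftarrow>R # Ls. (P.vmin S M)^2) \<le> real (2 * (P.vmin S R * P.mord S h) + \<delta> * (P.mord S h)^2)"
  using inverse_vol_ge by simp
 hence v: "(\<Sum>M\<leftarrow>R # L # Ms. (P.vmin S M)^2) \<le> 2 * (P.vmin S R * P.mord S h) + \<delta> * (P.mord S h)^2"
  unfolding Cons of_nat_le_iff .
 have "(\<Sum>M\<leftarrow>R # Ls. (P.mult_at D M)^2) \<le> (2 + \<delta>) * d^2"
 proof (cases "R \<subseteq> D")
  case True
  \<comment> \<open>If \<open>C\<close> divided \<open>H\<close>, the two forms would divide each
    other and define the same generic ring, so the curve would be the tangent line.\<close>
  have nd: "\<not> C dvd H"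
  proof
   assume "C dvd H"
   hence HC: "H dvd C" "C dvd H" using curve_dvd_line[OF C DC] a a0 by auto
   obtain U where U: "H = C * U" using HC(2) by (rule dvdE)
   obtain x y where xy: "form x C" "form y U" "x + y = Suc 0"
    using homogeneous_factor[of "Suc 0" C U] H(1,2) U by metis
   have "x = d" using homogeneous_degree_unique[OF xy(1) curve_hom[OF C DC] curve_nz[OF C DC]] .
   hence d1: "d = Suc 0" using xy(3) curve_degree_pos[OF C DC] by simp
   have "H dvd B \<longleftrightarrow> C dvd B" for B using HC dvd_trans by blast
   hence "generic_ring H = generic_ring C" unfolding generic_ring_def by simp
   hence "tangent_line \<nu> C"
    using tH curve_hom[OF C DC] curve_nz[OF C DC] d1 unfolding tangent_line_def curve_value_def by simp
   thus False using notan by blast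
  qed
  note Rp = center_point(1)
  have hh: "h \<in> mx R" "h \<notin> mpow R 2" "h \<notin> mx D"
   using gm_max_iff[OF Rp H(1)] van line_germ[OF Rp a0] gm_generic_iff[OF C DC Rp True H(1)] nd a unfolding h_def by auto
  have "P.cnum D R h \<le> enat (d * Suc 0)" using total_le[OF total_cnum[OF C DC H(1) nd]] Rp True unfolding h_def by simp
  then obtain p where p: "P.cnum D R h = enat p" "p \<le> d" by (cases "P.cnum D R h") auto
  have "(\<Sum>M\<leftarrow>R # L # Ms. (P.mult_at D M)^2) \<le> (2 + \<delta>) * p^2"
   by (rule P.tangent_chain_bound[OF good_closed_point[OF C DC Rp True] _ _ hh p(1) gt v]) (use center_point(2) S Cons in simp_all)
  also have "\<dots> \<le> (2 + \<delta>) * d^2" using p(2) by (intro mult_left_mono power_mono) auto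
  finally show ?thesis unfolding Cons .
 next
  case False
  show ?thesis unfolding P.inf_near_mult_zero[OF center_reg center_point(2) False] by simp
 qed
 moreover have "(\<Sum>M\<in>centers \<nu>. (P.mult_at D M)^2) \<le> (\<Sum>M\<leftarrow>R # Ls. (P.mult_at D M)^2)"
  unfolding centers_def seq by (rule sum_set_le_sum_list)
 ultimately have "int (\<Sum>M\<in>centers \<nu>. (P.mult_at D M)^2) \<le> int ((2 + \<delta>) * d^2)" by linarith
 thus ?thesis using \<delta>0(1) unfolding \<delta>_def by (simp add: distrib_right)
qed

end

end

theorem corollary4p2:
  fixes V :: "('k::alg_closed_field hfrac \<Rightarrow> int) set"
    and C :: "'k hpoly" and d :: nat
  assumes "finite V"
    and "\<forall>\<nu>\<in>V. divisorial_valuation \<nu>"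
    and "integral_plane_curve d C"
    and "\<forall>\<nu>\<in>V. \<not> tangent_line \<nu> C"
  shows "real_of_int (self_intersection (surface_of V) (generic_ring C)) / (real d)\<^sup>2
           \<ge> - real_of_int (\<Sum>\<nu>\<in>V. \<delta>0 \<nu>) - 2 * real (card V) + 1"
proof -
 let ?A = "\<Union>\<nu>\<in>V. centers \<nu>" and ?m = "\<lambda>M. (P.mult_at (generic_ring C) M)^2"
 have sbs: "sbs (blowup_sequence \<nu>)" if "\<nu> \<in> V" for \<nu>
  using assms(2) that someI_ex[of "\<lambda>Rs. sbs Rs \<and> \<nu> = dvr_ord (ering (last Rs))"]
  unfolding divisorial_valuation_def blowup_sequence_def[symmetric] by blast
 have fin: "finite ?A" "\<And>\<nu>. finite (centers \<nu>)" using assms(1) unfolding centers_def by auto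
 \<comment> \<open>The predecessors of a center are centers of the same valuation, by prefixes of
   its blowup sequence.\<close>
 have "pclosed ?A" unfolding pclosed_def
 proof
  fix R assume "R \<in> ?A"
  then obtain \<nu> where \<nu>: "\<nu> \<in> V" "R \<in> set (blowup_sequence \<nu>)" unfolding centers_def by blast
  then obtain As Bs where AB: "blowup_sequence \<nu> = (As @ [R]) @ Bs" by (metis append.assoc append_Cons append_Nil split_list)
  have "sbs (As @ [R])" by (rule sbs_prefix[of _ Bs]) (use sbs[OF \<nu>(1)] AB in simp_all)
  moreover have "set (As @ [R]) \<subseteq> ?A" using \<nu>(1) AB unfolding centers_def by fastforce
  ultimately show "\<exists>Rs. sbs Rs \<and> last Rs = R \<and> set Rs \<subseteq> ?A" by (metis last_snoc)
 qed
 hence si: "self_intersection (surface_of V) (generic_ring C) = int (d^2) - int (\<Sum>M\<in>?A. ?m M)"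
  unfolding surface_of_def self_intersection_eq[OF assms(3) fin(1) \<open>pclosed ?A\<close>] by simp
 have "int (\<Sum>M\<in>centers \<nu>. ?m M) \<le> (2 + \<delta>0 \<nu>) * int (d^2)" if \<nu>: "\<nu> \<in> V" for \<nu>
 proof -
  obtain R Ls where "blowup_sequence \<nu> = R # Ls" using sbs[OF \<nu>] unfolding simple_blowup_sequence_def by (cases "blowup_sequence \<nu>") auto
  thus ?thesis using sum_multiplicities_le[OF _ _ refl assms(3) refl] assms(2,4) \<nu> by blast
 qed
 hence "(\<Sum>\<nu>\<in>V. int (\<Sum>M\<in>centers \<nu>. ?m M)) \<le> (\<Sum>\<nu>\<in>V. (2 + \<delta>0 \<nu>) * int (d^2))" by (rule sum_mono)
 moreover have "int (\<Sum>M\<in>?A. ?m M) \<le> int (\<Sum>\<nu>\<in>V. \<Sum>M\<in>centers \<nu>. ?m M)"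
  unfolding of_nat_le_iff by (rule sum_UN_le[OF assms(1) fin(2)])
 ultimately have "int (\<Sum>M\<in>?A. ?m M) \<le> (2 * int (card V) + (\<Sum>\<nu>\<in>V. \<delta>0 \<nu>)) * int (d^2)"
  by (simp add: sum_distrib_right[symmetric] sum.distrib mult.commute[of _ 2])
 hence "(1 - 2 * int (card V) - (\<Sum>\<nu>\<in>V. \<delta>0 \<nu>)) * int (d^2) \<le> self_intersection (surface_of V) (generic_ring C)"
  unfolding si by (simp add: algebra_simps)
 hence "real_of_int ((1 - 2 * int (card V) - (\<Sum>\<nu>\<in>V. \<delta>0 \<nu>)) * int (d^2)) \<le> real_of_int (self_intersection (surface_of V) (generic_ring C))"
  by (simp only: of_int_le_iff)
 thus ?thesis using curve_degree_pos[OF assms(3) refl] by (simp add: field_simps)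
qed

end
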